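(* Suppose that for both $i\in\{0,1\}$ the following series converge for every $k\ge0$: $$\sum_{n=k}^\infty\rho_n^{(i)}\Lambda_n^{(i)}\kappa_{n,k}(\overrightarrow{\lambda^{(i)}+\mu^{(i)}}),\qquad \sum_{n=k}^\infty\left(c^{(i)}(n)+\mu_n^{(i)}\overline{R^{(i)}(n)}\right)\Lambda_n^{(i)}\kappa_{n,k}(\overrightarrow{\lambda^{(i)}+\mu^{(i)}}).$$ Then the process $X(t)=\mathbb L(t)+\mathbb J(t)$, $t\ge0$, is a martingale if and only if for both states $i\in\{0,1\}$ $$c^{(i)}(n)+\lambda_n^{(i)}\overline{r^{(i)}(n)}+\mu_n^{(i)}\overline{R^{(i)}(n)}=0\qquad\text{for all }n\ge0.$$
   Context: **Parameters.** For $i\in\{0,1\}$ let $\vec\lambda^{(i)}=\{\lambda_n^{(i)}\}_{n\ge0}$, $\vec\mu^{(i)}=\{\mu_n^{(i)}\}_{n\ge0}$ be sequences of positive numbers with $\sum_n1/\lambda_n^{(i)}=\infty$ and with the sums $\lambda_n^{(i)}+\mu_n^{(i)}$, $n\ge0$, distinct for each $i$; let $\{c^{(i)}(n)\}_{n\ge0}$ be real numbers (tendencies). Let $\varepsilon_m\in\{0,1\}$, $m\ge0$, be the alternating sequence ($\varepsilon_{m+1}=1-\varepsilon_m$) with initial value $\varepsilon_0=\varepsilon(0)$. **Driving processes.** $N_m=N_m(t)$, $m\ge0$, are independent counting processes; $N_m$ starts at $0$ and stays at $n$ for an exponential time with parameter $\lambda_n^{(\varepsilon_m)}$, the successive holding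 times being independent, before jumping to $n+1$. For $m\ge1$, $T_m>0$ has the Poisson-modulated exponential distribution driven by $N_{m-1}$: conditionally on $N_{m-1}$, $\mathbb P\{T_m>t\mid N_{m-1}\}=\exp\left(-\int_0^t\mu^{(\varepsilon_{m-1})}_{N_{m-1}(s)}\,\mathrm ds\right)$. The pairs $(N_{m-1},T_m)$, $m\ge1$, are independent. Put $T^{(+,0)}=0$, $T^{(+,m)}=T_1+\dots+T_m$, $M(t)=\max\{m:T^{(+,m)}\le t\}$, and $\varepsilon(t)=\varepsilon_m$ for $T^{(+,m)}\le t<T^{(+,m+1)}$. **Piecewise linear part.** $l_m(t)=\int_0^tc^{(\varepsilon_m)}(N_m(s))\,\mathrm ds$ and $$\mathbb L(t)=\sum_{m=1}^{M(t)}l_{m-1}(T_m)+l_{M(t)}\left(t-T^{(+,M(t))}\right).$$ **Jump part.** $\{r_m(n)\}$ and $\{R_m(n)\}$, $m,n\ge0$, are independent random variables, independent of all $N_m$, $T_m$; their distributions depend only on $n$ and on $i=\varepsilon_m$, and they have finite means $\overline{r^{(i)}(n)}=\mathbb E\{r_m(n)\}$, $\overline{R^{(i)}(n)}=\mathbb E\{R_m(n)\}$ when $\varepsilon_m=i$. Set $j_m(t)=\sum_{n=1}^{N_m(t)}r_m(n-1)$ and $$\mathbb J(t)=\sum_{m=1}^{M(t)}\left[R_{m-1}(N_{m-1}(T_m))+j_{m-1}(T_m)\right]+j_{M(t)}\left(t-T^{(+,M(t))}\right).$$ The expectations of $X(t)=\mathbb L(t)+\mathbb J(t)$ given $\varepsilon(0)=i$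 are assumed to exist. **Martingale property.** It is understood under $\mathbb P\{\cdot\mid\varepsilon(0)=i\}$ for both initial states $i\in\{0,1\}$, with respect to the filtration $\mathcal F_t$ generated up to time $t$ by $X(s)$, $\varepsilon(s)$, $M(s)$ and the current shock count $N_{M(s)}(s-T^{(+,M(s))})$, $s\le t$. **Notation.** $\Lambda_0^{(i)}=1$, $\Lambda_n^{(i)}=\prod_{k=0}^{n-1}\lambda_k^{(i)}$; $\rho_0^{(i)}=0$, $\rho_n^{(i)}=\sum_{k=0}^{n-1}\overline{r^{(i)}(k)}$ for $n\ge1$. For a sequence $\vec\theta$ of distinct numbers, $\kappa_{0,0}(\vec\theta)=1$, $\kappa_{n,k}(\vec\theta)=\prod_{0\le j\le n,\,j\ne k}(\theta_j-\theta_k)^{-1}$, $0\le k\le n$; $\overrightarrow{\lambda^{(i)}+\mu^{(i)}}=\{\lambda_n^{(i)}+\mu_n^{(i)}\}_{n\ge0}$. *)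

theory Defs
  imports "HOL-Probability.Probability"
begin

section \<open>Paths of the process\<close>

text \<open>
  The states are the numbers 0 and 1.  Conditioning on the initial state is rendered by a family of
  probability measures \<open>P i\<close>, where \<open>P i\<close> plays the role of the conditional probability given that
  the initial state is \<open>i\<close>.  Thus the sequence of states is deterministic under \<open>P i\<close>, and the
  objects below that depend on it take \<open>i\<close> as an argument.

  The random input consists of the holding times \<open>H m n\<close> of the counting processes, the switching
  gaps \<open>T m\<close> (only \<open>m \<ge> 1\<close> is used), and the jump sizes \<open>r m n\<close> and \<open>R m n\<close>.  The gaps take
  values in \<open>[0, \<infinity>]\<close>: if the integral of the switching rate along the driving process can stay
  bounded, then a gap is infinite with positive probability.
\<close>

definition eps :: "nat \<Rightarrow> nat \<Rightarrow> nat" where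
  "eps i m = (i + m) mod 2"

text \<open>
  The maxima in the next definition and in \<open>switch_count\<close> are taken over finite sets off a null set
  (no explosion); on that null set the values are immaterial.
\<close>

definition shock_count ::
  "(nat \<Rightarrow> nat \<Rightarrow> 'a \<Rightarrow> real) \<Rightarrow> nat \<Rightarrow> real \<Rightarrow> 'a \<Rightarrow> nat" where
  "shock_count H m t \<omega> = Max {n. (\<Sum>k<n. H m k \<omega>) \<le> t}"

definition switch_time :: "(nat \<Rightarrow> 'a \<Rightarrow> ennreal) \<Rightarrow> nat \<Rightarrow> 'a \<Rightarrow> ennreal" where
  "switch_time T m \<omega> = (\<Sum>k=1..m. T k \<omega>)"

definition switch_count :: "(nat \<Rightarrow> 'a \<Rightarrow> ennreal) \<Rightarrow> real \<Rightarrow> 'a \<Rightarrow> nat" where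
  "switch_count T t \<omega> = Max {m. switch_time T m \<omega> \<le> ennreal t}"

definition state :: "nat \<Rightarrow> (nat \<Rightarrow> 'a \<Rightarrow> ennreal) \<Rightarrow> real \<Rightarrow> 'a \<Rightarrow> nat" where
  "state i T t \<omega> = eps i (switch_count T t \<omega>)"

definition elapsed :: "(nat \<Rightarrow> 'a \<Rightarrow> ennreal) \<Rightarrow> real \<Rightarrow> 'a \<Rightarrow> real" where
  "elapsed T t \<omega> = t - enn2real (switch_time T (switch_count T t \<omega>) \<omega>)"

definition phase_drift ::
  "nat \<Rightarrow> (nat \<Rightarrow> nat \<Rightarrow> real) \<Rightarrow> (nat \<Rightarrow> nat \<Rightarrow> 'a \<Rightarrow> real) \<Rightarrow> nat \<Rightarrow> real \<Rightarrow> 'a \<Rightarrow> real" where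
  "phase_drift i c H m t \<omega> = (LBINT s:{0..t}. c (eps i m) (shock_count H m s \<omega>))"

definition linear_part ::
  "nat \<Rightarrow> (nat \<Rightarrow> nat \<Rightarrow> real) \<Rightarrow> (nat \<Rightarrow> nat \<Rightarrow> 'a \<Rightarrow> real) \<Rightarrow> (nat \<Rightarrow> 'a \<Rightarrow> ennreal)
    \<Rightarrow> real \<Rightarrow> 'a \<Rightarrow> real" where
  "linear_part i c H T t \<omega> =
     (\<Sum>m=1..switch_count T t \<omega>. phase_drift i c H (m - 1) (enn2real (T m \<omega>)) \<omega>)
     + phase_drift i c H (switch_count T t \<omega>) (elapsed T t \<omega>) \<omega>"

definition phase_jumps ::
  "(nat \<Rightarrow> nat \<Rightarrow> 'a \<Rightarrow> real) \<Rightarrow> (nat \<Rightarrow> nat \<Rightarrow> 'a \<Rightarrow> real) \<Rightarrow> nat \<Rightarrow> real \<Rightarrow> 'a \<Rightarrow> real" where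
  "phase_jumps H r m t \<omega> = (\<Sum>n=1..shock_count H m t \<omega>. r m (n - 1) \<omega>)"

definition jump_part ::
  "(nat \<Rightarrow> nat \<Rightarrow> 'a \<Rightarrow> real) \<Rightarrow> (nat \<Rightarrow> 'a \<Rightarrow> ennreal) \<Rightarrow> (nat \<Rightarrow> nat \<Rightarrow> 'a \<Rightarrow> real)
    \<Rightarrow> (nat \<Rightarrow> nat \<Rightarrow> 'a \<Rightarrow> real) \<Rightarrow> real \<Rightarrow> 'a \<Rightarrow> real" where
  "jump_part H T r R t \<omega> =
     (\<Sum>m=1..switch_count T t \<omega>.
        R (m - 1) (shock_count H (m - 1) (enn2real (T m \<omega>)) \<omega>) \<omega>
        + phase_jumps H r (m - 1) (enn2real (T m \<omega>)) \<omega>)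
     + phase_jumps H r (switch_count T t \<omega>) (elapsed T t \<omega>) \<omega>"

definition process ::
  "nat \<Rightarrow> (nat \<Rightarrow> nat \<Rightarrow> real) \<Rightarrow> (nat \<Rightarrow> nat \<Rightarrow> 'a \<Rightarrow> real) \<Rightarrow> (nat \<Rightarrow> 'a \<Rightarrow> ennreal)
    \<Rightarrow> (nat \<Rightarrow> nat \<Rightarrow> 'a \<Rightarrow> real) \<Rightarrow> (nat \<Rightarrow> nat \<Rightarrow> 'a \<Rightarrow> real) \<Rightarrow> real \<Rightarrow> 'a \<Rightarrow> real" where
  "process i c H T r R t \<omega> = linear_part i c H T t \<omega> + jump_part H T r R t \<omega>"


section \<open>Generated sigma-algebras and martingales\<close>

definition gen_sigma ::
  "'a set \<Rightarrow> ('s \<Rightarrow> 'a \<Rightarrow> 'b :: topological_space) \<Rightarrow> 's set \<Rightarrow> 'a measure" where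
  "gen_sigma \<Omega> Y I = sigma \<Omega> (\<Union>s\<in>I. {Y s -` A \<inter> \<Omega> | A. A \<in> sets borel})"

definition martingale ::
  "'a measure \<Rightarrow> (real \<Rightarrow> 'a measure) \<Rightarrow> (real \<Rightarrow> 'a \<Rightarrow> real) \<Rightarrow> bool" where
  "martingale P F X \<longleftrightarrow>
     (\<forall>t\<ge>0. subalgebra P (F t)) \<and>
     (\<forall>s t. 0 \<le> s \<longrightarrow> s \<le> t \<longrightarrow> sets (F s) \<subseteq> sets (F t)) \<and>
     (\<forall>t\<ge>0. X t \<in> borel_measurable (F t)) \<and>
     (\<forall>t\<ge>0. integrable P (X t)) \<and>
     (\<forall>s t. 0 \<le> s \<longrightarrow> s \<le> t \<longrightarrow> (AE \<omega> in P. real_cond_exp P (F s) (X t) \<omega> = X s \<omega>))"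

definition observation ::
  "nat \<Rightarrow> (nat \<Rightarrow> nat \<Rightarrow> real) \<Rightarrow> (nat \<Rightarrow> nat \<Rightarrow> 'a \<Rightarrow> real) \<Rightarrow> (nat \<Rightarrow> 'a \<Rightarrow> ennreal)
    \<Rightarrow> (nat \<Rightarrow> nat \<Rightarrow> 'a \<Rightarrow> real) \<Rightarrow> (nat \<Rightarrow> nat \<Rightarrow> 'a \<Rightarrow> real) \<Rightarrow> real \<Rightarrow> 'a
    \<Rightarrow> real \<times> nat \<times> nat \<times> nat" where
  "observation i c H T r R s \<omega> =
     (process i c H T r R s \<omega>, state i T s \<omega>, switch_count T s \<omega>,
      shock_count H (switch_count T s \<omega>) (elapsed T s \<omega>) \<omega>)"

definition history ::
  "'a set \<Rightarrow> nat \<Rightarrow> (nat \<Rightarrow> nat \<Rightarrow> real) \<Rightarrow> (nat \<Rightarrow> nat \<Rightarrow> 'a \<Rightarrow> real) \<Rightarrow> (nat \<Rightarrow> 'a \<Rightarrow> ennreal)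
    \<Rightarrow> (nat \<Rightarrow> nat \<Rightarrow> 'a \<Rightarrow> real) \<Rightarrow> (nat \<Rightarrow> nat \<Rightarrow> 'a \<Rightarrow> real) \<Rightarrow> real \<Rightarrow> 'a measure" where
  "history \<Omega> i c H T r R t = gen_sigma \<Omega> (observation i c H T r R) {0..t}"


section \<open>Probabilistic assumptions\<close>

locale switching_parameters =
  fixes lam mu :: "nat \<Rightarrow> nat \<Rightarrow> real"
    and Dr DR :: "nat \<Rightarrow> nat \<Rightarrow> real measure"
  assumes lam_pos: "\<And>i n. i \<in> {0, 1} \<Longrightarrow> 0 < lam i n"
    and mu_pos: "\<And>i n. i \<in> {0, 1} \<Longrightarrow> 0 < mu i n"
    and lam_non_explosive: "\<And>i. i \<in> {0, 1} \<Longrightarrow> \<not> summable (\<lambda>n. 1 / lam i n)"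
    and rates_distinct: "\<And>i. i \<in> {0, 1} \<Longrightarrow> inj (\<lambda>n. lam i n + mu i n)"
    and r_mean_finite: "\<And>i n. i \<in> {0, 1} \<Longrightarrow> integrable (Dr i n) (\<lambda>x. x)"
    and R_mean_finite: "\<And>i n. i \<in> {0, 1} \<Longrightarrow> integrable (DR i n) (\<lambda>x. x)"

datatype source = Driver nat | Small_Jump nat nat | Big_Jump nat nat

text \<open>The information carried by the pair of the \<open>m\<close>-th counting process and the gap it drives, or
  by a single jump size.\<close>

fun source_events ::
  "'a set \<Rightarrow> (nat \<Rightarrow> nat \<Rightarrow> 'a \<Rightarrow> real) \<Rightarrow> (nat \<Rightarrow> 'a \<Rightarrow> ennreal) \<Rightarrow> (nat \<Rightarrow> nat \<Rightarrow> 'a \<Rightarrow> real)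
    \<Rightarrow> (nat \<Rightarrow> nat \<Rightarrow> 'a \<Rightarrow> real) \<Rightarrow> source \<Rightarrow> 'a set set" where
  "source_events \<Omega> H T r R (Driver m) =
     sets (gen_sigma \<Omega> (\<lambda>t \<omega>. (shock_count H m t \<omega>, T (Suc m) \<omega>)) {0..})"
| "source_events \<Omega> H T r R (Small_Jump m n) = sets (vimage_algebra \<Omega> (r m n) borel)"
| "source_events \<Omega> H T r R (Big_Jump m n) = sets (vimage_algebra \<Omega> (R m n) borel)"

text \<open>The law of the random input under the initial state \<open>i\<close>.\<close>

locale switching_model = prob_space P + switching_parameters lam mu Dr DR
  for P :: "'a measure" and i :: nat
    and lam mu :: "nat \<Rightarrow> nat \<Rightarrow> real" and Dr DR :: "nat \<Rightarrow> nat \<Rightarrow> real measure"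
    and H :: "nat \<Rightarrow> nat \<Rightarrow> 'a \<Rightarrow> real" and T :: "nat \<Rightarrow> 'a \<Rightarrow> ennreal"
    and r R :: "nat \<Rightarrow> nat \<Rightarrow> 'a \<Rightarrow> real" +
  assumes H_exponential:
      "\<And>m n. distributed P lborel (H m n) (exponential_density (lam (eps i m) n))"
    and H_indep: "\<And>m. indep_vars (\<lambda>_. borel) (H m) UNIV"
    and T_measurable: "\<And>m. random_variable borel (T (Suc m))"
    and T_pos: "\<And>m. AE \<omega> in P. 0 < T (Suc m) \<omega>"
    and T_conditional_law: "\<And>m t. 0 \<le> t \<Longrightarrow>
      AE \<omega> in P.
        real_cond_exp P (gen_sigma (space P) (shock_count H m) {0..})
          (indicator {\<omega> \<in> space P. ennreal t < T (Suc m) \<omega>}) \<omega>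
        = exp (- (LBINT s:{0..t}. mu (eps i m) (shock_count H m s \<omega>)))"
    and r_measurable: "\<And>m n. random_variable borel (r m n)"
    and r_law: "\<And>m n. distr P borel (r m n) = Dr (eps i m) n"
    and R_measurable: "\<And>m n. random_variable borel (R m n)"
    and R_law: "\<And>m n. distr P borel (R m n) = DR (eps i m) n"
    and sources_indep: "indep_sets (source_events (space P) H T r R) UNIV"


section \<open>Notation for the series\<close>

definition mean :: "real measure \<Rightarrow> real" where
  "mean D = (\<integral>x. x \<partial>D)"

definition Lam :: "(nat \<Rightarrow> real) \<Rightarrow> nat \<Rightarrow> real" where
  "Lam l n = (\<Prod>k<n. l k)"

definition rho :: "(nat \<Rightarrow> real measure) \<Rightarrow> nat \<Rightarrow> real" where
  "rho D n = (\<Sum>k<n. mean (D k))"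

definition kappa :: "(nat \<Rightarrow> real) \<Rightarrow> nat \<Rightarrow> nat \<Rightarrow> real" where
  "kappa \<theta> n k = (\<Prod>j\<in>{0..n} - {k}. inverse (\<theta> j - \<theta> k))"

end

theory Submission
 imports Defs
begin

text \<open>
 The process is followed through its successive cells: being in the cell \<open>(m, n)\<close> means that the
 current phase has number \<open>m\<close> and has seen \<open>n\<close> shocks. The holding times are
 exponential and the switching rate is constant between shocks, so in a cell a shock occurs at rate
 \<open>lam\<close> and a switching at rate \<open>mu\<close>, both without memory. Hence the increment of the
 process after a time \<open>s\<close>, given the observed history, depends on the current cell only, and its
 law solves a renewal equation that is obtained by conditioning on the next event
 (\<open>increment_law_history\<close>). The martingale property therefore says that the means \<open>a i n
 u\<close> of these laws, over all durations \<open>u\<close>, vanish; here every cell counts, because each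
 cell of the first phase is occupied at time 1 with positive probability (\<open>cell_positive\<close>).

 Integrating the renewal equation gives an equation for the means whose inhomogeneous term is the balance
 \<open>g = c + lam * r + mu * R\<close> (with the mean jumps \<open>r\<close> and \<open>R\<close>) times a
 positive factor. If all means vanish, then so does \<open>g\<close> (\<open>means_zero_imp_balance\<close>).

 The converse is a uniqueness statement for the homogeneous equation, and it is not automatic, since a phase
 passes through infinitely many cells whose rates are unbounded. Following one phase through its first
 \<open>n\<close> shocks expresses \<open>a i 0\<close> by the means at the start of the next phase and a
 remainder carried by the paths that reach the \<open>n\<close>-th shock without a switching. The next phase
 contributes at most \<open>theta / (1 + theta)\<close> times the norm of \<open>a (Suc i) 0\<close>, in an L1
 norm with an exponential weight. The remainder is small along a subsequence: its part that comes from the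
 paths alive at \<open>n\<close> is the tail of a convergent series, and the rest is the mean displacement at
 the \<open>n\<close>-th shock. That displacement is controlled by the integrability of the process; if
 \<open>1 / theta\<close> is summable, this is not enough, and the convergence of the drift series supplies
 the missing estimate (\<open>arrival_frequently_small\<close>). Two applications of the contraction give
 \<open>a i 0 = 0\<close>, and the equation carries this on to all \<open>n\<close>
 (\<open>balance_imp_means_zero\<close>).
\<close>

section \<open>The renewal kernel\<close>

text \<open>
 The states carry all natural numbers as indices, with period two. Thus a switching is the step from
 \<open>i\<close> to \<open>Suc i\<close>, and the phase with number \<open>m\<close> of the process started
 in \<open>i\<close> has index \<open>i + m\<close>.
\<close>

locale switching_kernel =
 fixes lam mu c :: "nat \<Rightarrow> nat \<Rightarrow> real" and Dr DR :: "nat \<Rightarrow> nat \<Rightarrow> real measure"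
 assumes lam_pos: "\<And>i n. 0 < lam i n"
  and mu_pos: "\<And>i n. 0 < mu i n"
  and Dr_prob: "\<And>i n. prob_space (Dr i n)"
  and DR_prob: "\<And>i n. prob_space (DR i n)"
  and sets_Dr [measurable_cong]: "\<And>i n. sets (Dr i n) = sets borel"
  and sets_DR [measurable_cong]: "\<And>i n. sets (DR i n) = sets borel"
  and Dr_mean: "\<And>i n. integrable (Dr i n) (\<lambda>x. x)"
  and DR_mean: "\<And>i n. integrable (DR i n) (\<lambda>x. x)"
  and lam_per: "\<And>i. lam (Suc (Suc i)) = lam i"
  and mu_per: "\<And>i. mu (Suc (Suc i)) = mu i"
  and c_per: "\<And>i. c (Suc (Suc i)) = c i"
  and Dr_per: "\<And>i. Dr (Suc (Suc i)) = Dr i"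
  and DR_per: "\<And>i. DR (Suc (Suc i)) = DR i"
begin

sublocale Dr: prob_space "Dr i n" for i n by (rule Dr_prob)
sublocale DR: prob_space "DR i n" for i n by (rule DR_prob)

abbreviation theta :: "nat \<Rightarrow> nat \<Rightarrow> real" where
 "theta i n \<equiv> lam i n + mu i n"

lemma theta_pos: "0 < theta i n"
 using lam_pos[of i n] mu_pos[of i n] by simp

text \<open>
 The expectation of \<open>\<phi>\<close> at the position after time \<open>u\<close>, restricted to exactly
 \<open>j\<close> further shocks and switchings, for a process at position \<open>x\<close> in the state
 \<open>i\<close> after \<open>n\<close> shocks. The position moves with slope \<open>c i n\<close> until the
 next event, whose time \<open>w\<close> and kind are decided by two independent exponential clocks.
\<close>

primrec U :: "nat \<Rightarrow> (real \<Rightarrow> ennreal) \<Rightarrow> nat \<Rightarrow> nat \<Rightarrow> real \<Rightarrow> real \<Rightarrow> ennreal" where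
 "U 0 \<phi> i n x u = ennreal (exp (- (theta i n * u))) * \<phi> (x + c i n * u)"
| "U (Suc j) \<phi> i n x u = (\<integral>\<^sup>+w. indicator {0<..u} w * ennreal (exp (- (theta i n * w))) *
   (ennreal (lam i n) * (\<integral>\<^sup>+y. U j \<phi> i (Suc n) (x + c i n * w + y) (u - w) \<partial>Dr i n)
   + ennreal (mu i n) * (\<integral>\<^sup>+y. U j \<phi> (Suc i) 0 (x + c i n * w + y) (u - w) \<partial>DR i n)) \<partial>lborel)"

definition V :: "(real \<Rightarrow> ennreal) \<Rightarrow> nat \<Rightarrow> nat \<Rightarrow> real \<Rightarrow> real \<Rightarrow> ennreal" where
 "V \<phi> i n x u = (\<Sum>j. U j \<phi> i n x u)"

lemma measurable_U_aux:
 assumes [measurable]: "\<phi> \<in> borel_measurable borel"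
 shows "(\<lambda>z. U j \<phi> i n (fst z) (snd z)) \<in> borel_measurable (borel \<Otimes>\<^sub>M borel)"
proof (induction j arbitrary: i n)
 case 0 then show ?case by simp
next
 case (Suc j)
 define B :: "((real \<times> real) \<times> real) measure" where "B = (borel \<Otimes>\<^sub>M borel) \<Otimes>\<^sub>M borel"
 have inner: "(\<lambda>p. U j \<phi> k l (fst (fst (fst p)) + c i n * snd (fst p) + snd p)
    (snd (fst (fst p)) - snd (fst p))) \<in> borel_measurable (B \<Otimes>\<^sub>M borel)" for k l
  unfolding B_def
  by (rule measurable_compose[OF measurable_Pair Suc[of k l], unfolded fst_conv snd_conv]; measurable)
 have Dr: "(\<lambda>p. \<integral>\<^sup>+y. U j \<phi> k l (fst (fst p) + c i n * snd p + y) (snd (fst p) - snd p) \<partial>Dr i n)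
   \<in> borel_measurable B" for k l
  using Dr.borel_measurable_nn_integral[of "\<lambda>p y. U j \<phi> k l (fst (fst p) + c i n * snd p + y) (snd (fst p) - snd p)" B i n]
   inner[of k l] by (simp add: split_beta' cong: measurable_cong_sets sets_pair_measure_cong add: sets_Dr)
 have DR: "(\<lambda>p. \<integral>\<^sup>+y. U j \<phi> k l (fst (fst p) + c i n * snd p + y) (snd (fst p) - snd p) \<partial>DR i n)
   \<in> borel_measurable B" for k l
  using DR.borel_measurable_nn_integral[of "\<lambda>p y. U j \<phi> k l (fst (fst p) + c i n * snd p + y) (snd (fst p) - snd p)" B i n]
   inner[of k l] by (simp add: split_beta' cong: measurable_cong_sets sets_pair_measure_cong add: sets_DR)
 have [measurable]: "(\<lambda>p. indicator {0<..snd (fst p)} (snd p) :: ennreal) \<in> borel_measurable B"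
  unfolding B_def indicator_def greaterThanAtMost_iff by measurable
 have [measurable]: "(\<lambda>p. ennreal (exp (- (theta i n * snd p)))) \<in> borel_measurable B"
  unfolding B_def by measurable
 show ?case
  unfolding U.simps
  apply (rule lborel.borel_measurable_nn_integral)
  apply (simp only: split_beta')
  apply (subst measurable_cong_sets[where M' = B and N' = borel])
  subgoal unfolding B_def by (intro sets_pair_measure_cong; simp)
  subgoal by simp
  by (intro borel_measurable_times_ennreal borel_measurable_add borel_measurable_const Dr DR; measurable)
qed

lemma measurable_U [measurable (raw)]:
 assumes "\<phi> \<in> borel_measurable borel" "f \<in> borel_measurable M" "g \<in> borel_measurable M"
 shows "(\<lambda>z. U j \<phi> i n (f z) (g z)) \<in> borel_measurable M"
 using measurable_compose[OF measurable_Pair[OF assms(2,3)] measurable_U_aux[OF assms(1)]] by simp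

lemma measurable_V [measurable (raw)]:
 assumes [measurable]: "\<phi> \<in> borel_measurable borel" "f \<in> borel_measurable M" "g \<in> borel_measurable M"
 shows "(\<lambda>z. V \<phi> i n (f z) (g z)) \<in> borel_measurable M"
 unfolding V_def by measurable

lemma V_first_step:
 assumes [measurable]: "\<phi> \<in> borel_measurable borel"
 shows "V \<phi> i n x u = ennreal (exp (- (theta i n * u))) * \<phi> (x + c i n * u) +
  (\<integral>\<^sup>+w. indicator {0<..u} w * ennreal (exp (- (theta i n * w))) *
   (ennreal (lam i n) * (\<integral>\<^sup>+y. V \<phi> i (Suc n) (x + c i n * w + y) (u - w) \<partial>Dr i n)
   + ennreal (mu i n) * (\<integral>\<^sup>+y. V \<phi> (Suc i) 0 (x + c i n * w + y) (u - w) \<partial>DR i n)) \<partial>lborel)"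
proof -
 have "V \<phi> i n x u = U 0 \<phi> i n x u + (\<Sum>j. U (Suc j) \<phi> i n x u)"
  unfolding V_def using suminf_offset[of "\<lambda>j. U j \<phi> i n x u" 1] by simp
 also have "(\<Sum>j. U (Suc j) \<phi> i n x u) = (\<integral>\<^sup>+w. indicator {0<..u} w * ennreal (exp (- (theta i n * w))) *
   (ennreal (lam i n) * (\<integral>\<^sup>+y. V \<phi> i (Suc n) (x + c i n * w + y) (u - w) \<partial>Dr i n)
   + ennreal (mu i n) * (\<integral>\<^sup>+y. V \<phi> (Suc i) 0 (x + c i n * w + y) (u - w) \<partial>DR i n)) \<partial>lborel)"
 proof -
  define A B where "A j w = (\<integral>\<^sup>+y. U j \<phi> i (Suc n) (x + c i n * w + y) (u - w) \<partial>Dr i n)"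
   and "B j w = (\<integral>\<^sup>+y. U j \<phi> (Suc i) 0 (x + c i n * w + y) (u - w) \<partial>DR i n)" for j w
  have [measurable]: "A j \<in> borel_measurable borel" "B j \<in> borel_measurable borel" for j
   unfolding A_def B_def by measurable
  have *: "(\<integral>\<^sup>+y. V \<phi> i (Suc n) (x + c i n * w + y) (u - w) \<partial>Dr i n) = (\<Sum>j. A j w)"
   "(\<integral>\<^sup>+y. V \<phi> (Suc i) 0 (x + c i n * w + y) (u - w) \<partial>DR i n) = (\<Sum>j. B j w)" for w
   unfolding V_def A_def B_def by (rule nn_integral_suminf; measurable)+
  show ?thesis
   unfolding * U.simps A_def[symmetric] B_def[symmetric]
   by (subst nn_integral_suminf[symmetric]) (measurable, simp add: suminf_add[symmetric])
 qed
 finally show ?thesis by simp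
qed

lemma U_translate: "U j (\<lambda>y. \<phi> (x + y)) i n z u = U j \<phi> i n (x + z) u"
 by (induction j arbitrary: i n z u) (simp_all add: add.assoc)

lemma V_translate: "V (\<lambda>y. \<phi> (x + y)) i n z u = V \<phi> i n (x + z) u"
 by (simp add: V_def U_translate)

lemma U_periodic: "U j \<phi> (Suc (Suc i)) n x u = U j \<phi> i n x u"
 by (induction j arbitrary: i n x u) (simp_all add: lam_per mu_per c_per Dr_per DR_per)

lemma V_periodic: "V \<phi> (Suc (Suc i)) n x u = V \<phi> i n x u"
 by (simp add: V_def U_periodic)

end

section \<open>Mean increments and the first-step equation\<close>

lemma enn2real_nn_integral_diff:
 assumes [measurable]: "F \<in> borel_measurable M" "G \<in> borel_measurable M"
  and F: "(\<integral>\<^sup>+x. F x \<partial>M) < \<infinity>" and G: "(\<integral>\<^sup>+x. G x \<partial>M) < \<infinity>"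
 shows "integrable M (\<lambda>x. enn2real (F x) - enn2real (G x))"
  and "enn2real (\<integral>\<^sup>+x. F x \<partial>M) - enn2real (\<integral>\<^sup>+x. G x \<partial>M) = (\<integral>x. enn2real (F x) - enn2real (G x) \<partial>M)"
proof -
 have *: "integrable M (\<lambda>x. enn2real (H x)) \<and> (\<integral>x. enn2real (H x) \<partial>M) = enn2real (\<integral>\<^sup>+x. H x \<partial>M)"
  if [measurable]: "H \<in> borel_measurable M" and fin: "(\<integral>\<^sup>+x. H x \<partial>M) < \<infinity>" for H
 proof -
  have "AE x in M. H x \<noteq> \<infinity>"
   by (rule nn_integral_noteq_infinite) (use fin in auto)
  then have "AE x in M. ennreal (enn2real (H x)) = H x"
   by eventually_elim (simp add: ennreal_enn2real_if)
  then have eq: "(\<integral>\<^sup>+x. ennreal (enn2real (H x)) \<partial>M) = (\<integral>\<^sup>+x. H x \<partial>M)"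
   by (rule nn_integral_cong_AE)
  have "integrable M (\<lambda>x. enn2real (H x))"
   by (rule integrableI_nonneg) (use eq fin in auto)
  moreover have "(\<integral>x. enn2real (H x) \<partial>M) = enn2real (\<integral>\<^sup>+x. H x \<partial>M)"
   by (subst integral_eq_nn_integral) (use eq in auto)
  ultimately show ?thesis by simp
 qed
 show "integrable M (\<lambda>x. enn2real (F x) - enn2real (G x))"
  using *[of F] *[of G] F G by auto
 show "enn2real (\<integral>\<^sup>+x. F x \<partial>M) - enn2real (\<integral>\<^sup>+x. G x \<partial>M) = (\<integral>x. enn2real (F x) - enn2real (G x) \<partial>M)"
  using *[of F] *[of G] F G by auto
qed

text \<open>
 The measures \<open>Q\<close> are the laws of the increments. Their existence as probability measures says
 that the events do not accumulate, and will come from the paths of the process, not from the kernel.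
\<close>

locale integrable_kernel = switching_kernel +
 fixes Q :: "nat \<Rightarrow> nat \<Rightarrow> real \<Rightarrow> real measure"
 assumes Q_prob: "\<And>i n u. 0 \<le> u \<Longrightarrow> prob_space (Q i n u)"
  and sets_Q [measurable_cong]: "\<And>i n u. sets (Q i n u) = sets borel"
  and Q_law: "\<And>i n u \<phi>. 0 \<le> u \<Longrightarrow> \<phi> \<in> borel_measurable borel \<Longrightarrow>
   (\<integral>\<^sup>+y. \<phi> y \<partial>Q i n u) = V \<phi> i n 0 u"
  and V_abs_finite: "\<And>i n u. 0 \<le> u \<Longrightarrow> V (\<lambda>y. ennreal \<bar>y\<bar>) i n 0 u < \<infinity>"
begin

abbreviation Vabs :: "nat \<Rightarrow> nat \<Rightarrow> real \<Rightarrow> real \<Rightarrow> ennreal" where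
 "Vabs \<equiv> V (\<lambda>y. ennreal \<bar>y\<bar>)"

text \<open>
 The mean of \<open>Q i n u\<close>, see \<open>a_eq\<close>. The form through \<open>V\<close> makes it
 measurable in \<open>u\<close>.
\<close>

definition a :: "nat \<Rightarrow> nat \<Rightarrow> real \<Rightarrow> real" where
 "a i n u = enn2real (V (\<lambda>y. ennreal y) i n 0 u) - enn2real (V (\<lambda>y. ennreal (- y)) i n 0 u)"

text \<open>
 The balance of drift and mean jumps: the infinitesimal mean displacement in the cell.
\<close>

definition g :: "nat \<Rightarrow> nat \<Rightarrow> real" where
 "g i n = c i n + lam i n * mean (Dr i n) + mu i n * mean (DR i n)"

lemma measurable_a [measurable]: "a i n \<in> borel_measurable borel"
 unfolding a_def by measurable

lemma V_eq_Q:
 assumes "0 \<le> u" and [measurable]: "\<phi> \<in> borel_measurable borel"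
 shows "V \<phi> i n x u = (\<integral>\<^sup>+y. \<phi> (x + y) \<partial>Q i n u)"
 using Q_law[OF assms(1), of "\<lambda>y. \<phi> (x + y)" i n] V_translate[of \<phi> x i n 0 u] by simp

lemma Q_integrable: "0 \<le> u \<Longrightarrow> integrable (Q i n u) (\<lambda>y. y)"
 using V_abs_finite[of u i n] V_eq_Q[of u "\<lambda>y. ennreal \<bar>y\<bar>" i n 0]
 by (intro integrableI_bounded) auto

lemma a_eq: "0 \<le> u \<Longrightarrow> a i n u = (\<integral>y. y \<partial>Q i n u)"
 using V_eq_Q[of u "\<lambda>y. ennreal y" i n 0] V_eq_Q[of u "\<lambda>y. ennreal (- y)" i n 0]
  real_lebesgue_integral_def[OF Q_integrable, of u i n]
 by (simp add: a_def)

lemma Vabs_triangle: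
 assumes "0 \<le> u" shows "Vabs i n x u \<le> ennreal \<bar>x - z\<bar> + Vabs i n z u"
proof -
 interpret Q: prob_space "Q i n u" by (rule Q_prob[OF assms])
 have "(\<integral>\<^sup>+y. ennreal \<bar>x + y\<bar> \<partial>Q i n u) \<le> (\<integral>\<^sup>+y. ennreal \<bar>x - z\<bar> + ennreal \<bar>z + y\<bar> \<partial>Q i n u)"
  by (intro nn_integral_mono) (auto simp: ennreal_plus[symmetric] simp del: ennreal_plus intro!: ennreal_leI)
 then show ?thesis
  by (simp add: V_eq_Q[OF assms] nn_integral_add Q.emeasure_space_1)
qed

lemma abs_le_Vabs:
 assumes "0 \<le> u" shows "ennreal \<bar>x\<bar> \<le> Vabs i n x u + Vabs i n 0 u"
proof -
 interpret Q: prob_space "Q i n u" by (rule Q_prob[OF assms])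
 have "(\<integral>\<^sup>+y. ennreal \<bar>x\<bar> \<partial>Q i n u) \<le> (\<integral>\<^sup>+y. ennreal \<bar>x + y\<bar> + ennreal \<bar>0 + y\<bar> \<partial>Q i n u)"
  by (intro nn_integral_mono) (auto simp: ennreal_plus[symmetric] simp del: ennreal_plus intro!: ennreal_leI)
 then show ?thesis
  by (simp add: V_eq_Q[OF assms] nn_integral_add Q.emeasure_space_1)
qed

lemma Vabs_finite: "0 \<le> u \<Longrightarrow> Vabs i n x u < \<infinity>"
 using Vabs_triangle[of u i n x 0] V_abs_finite[of u i n]
 by (auto simp: ennreal_add_eq_top less_top[symmetric] top_unique)

lemma V_mean:
 assumes "0 \<le> u"
 shows "V (\<lambda>y. ennreal y) i n x u < \<infinity>" "V (\<lambda>y. ennreal (- y)) i n x u < \<infinity>"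
  and "enn2real (V (\<lambda>y. ennreal y) i n x u) - enn2real (V (\<lambda>y. ennreal (- y)) i n x u) = x + a i n u"
  and "ennreal \<bar>x + a i n u\<bar> \<le> Vabs i n x u"
proof -
 interpret Q: prob_space "Q i n u" by (rule Q_prob[OF assms])
 have int: "integrable (Q i n u) (\<lambda>y. x + y)"
  using Q_integrable[OF assms] by simp
 have "V (\<lambda>y. ennreal y) i n x u \<le> Vabs i n x u" "V (\<lambda>y. ennreal (- y)) i n x u \<le> Vabs i n x u"
  unfolding V_eq_Q[OF assms measurable_ennreal] V_eq_Q[OF assms, of "\<lambda>y. ennreal (- y)", simplified]
   V_eq_Q[OF assms, of "\<lambda>y. ennreal \<bar>y\<bar>", simplified]
  by (auto intro!: nn_integral_mono ennreal_leI)
 then show "V (\<lambda>y. ennreal y) i n x u < \<infinity>" "V (\<lambda>y. ennreal (- y)) i n x u < \<infinity>"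
  using Vabs_finite[OF assms, of i n x] by (auto intro: le_less_trans)
 have E: "(\<integral>y. x + y \<partial>Q i n u) = x + a i n u"
  using Q_integrable[OF assms] by (simp add: a_eq[OF assms] Q.prob_space)
 show "enn2real (V (\<lambda>y. ennreal y) i n x u) - enn2real (V (\<lambda>y. ennreal (- y)) i n x u) = x + a i n u"
  using real_lebesgue_integral_def[OF int] E
   V_eq_Q[OF assms, of "\<lambda>y. ennreal y" i n x] V_eq_Q[OF assms, of "\<lambda>y. ennreal (- y)" i n x]
  by simp
 have "ennreal \<bar>x + a i n u\<bar> \<le> (\<integral>\<^sup>+y. ennreal (norm (x + y)) \<partial>Q i n u)"
  unfolding E[symmetric] using integral_norm_bound_ennreal[OF int] by simp
 then show "ennreal \<bar>x + a i n u\<bar> \<le> Vabs i n x u"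
  using V_eq_Q[OF assms, of "\<lambda>y. ennreal \<bar>y\<bar>" i n x] by simp
qed

text \<open>
 Integration of the mean over the jump that leads into the cell.
\<close>

lemma V_mean_jump:
 assumes "0 \<le> u" and D: "prob_space D" "integrable D (\<lambda>y. y)" and [measurable_cong]: "sets D = sets borel"
 shows "(\<integral>\<^sup>+y. V (\<lambda>y. ennreal y) i n (x + y) u \<partial>D) < \<infinity>"
  and "(\<integral>\<^sup>+y. V (\<lambda>y. ennreal (- y)) i n (x + y) u \<partial>D) < \<infinity>"
  and "enn2real (\<integral>\<^sup>+y. V (\<lambda>y. ennreal y) i n (x + y) u \<partial>D)
    - enn2real (\<integral>\<^sup>+y. V (\<lambda>y. ennreal (- y)) i n (x + y) u \<partial>D) = x + mean D + a i n u"
proof -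
 interpret D: prob_space D by fact
 have "(\<integral>\<^sup>+y. Vabs i n (x + y) u \<partial>D) \<le> (\<integral>\<^sup>+y. ennreal \<bar>y\<bar> + Vabs i n x u \<partial>D)"
  by (intro nn_integral_mono order_trans[OF Vabs_triangle[OF assms(1), where z = x]]) simp
 also have "\<dots> = (\<integral>\<^sup>+y. ennreal \<bar>y\<bar> \<partial>D) + Vabs i n x u"
  by (simp add: nn_integral_add D.emeasure_space_1)
 also have "\<dots> < \<infinity>"
  using D(2) Vabs_finite[OF assms(1), of i n x]
  by (auto simp: integrable_iff_bounded)
 finally have fin: "(\<integral>\<^sup>+y. Vabs i n (x + y) u \<partial>D) < \<infinity>" .
 have le: "V (\<lambda>y. ennreal y) i n z u \<le> Vabs i n z u" "V (\<lambda>y. ennreal (- y)) i n z u \<le> Vabs i n z u" for z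
  unfolding V_eq_Q[OF assms(1) measurable_ennreal] V_eq_Q[OF assms(1), of "\<lambda>y. ennreal (- y)", simplified]
   V_eq_Q[OF assms(1), of "\<lambda>y. ennreal \<bar>y\<bar>", simplified]
  by (auto intro!: nn_integral_mono ennreal_leI)
 show *: "(\<integral>\<^sup>+y. V (\<lambda>y. ennreal y) i n (x + y) u \<partial>D) < \<infinity>"
  "(\<integral>\<^sup>+y. V (\<lambda>y. ennreal (- y)) i n (x + y) u \<partial>D) < \<infinity>"
  using fin by (auto intro!: le_less_trans[OF nn_integral_mono[OF le(1)]] le_less_trans[OF nn_integral_mono[OF le(2)]])
 show "enn2real (\<integral>\<^sup>+y. V (\<lambda>y. ennreal y) i n (x + y) u \<partial>D)
    - enn2real (\<integral>\<^sup>+y. V (\<lambda>y. ennreal (- y)) i n (x + y) u \<partial>D) = x + mean D + a i n u"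
 proof -
  have "enn2real (\<integral>\<^sup>+y. V (\<lambda>y. ennreal y) i n (x + y) u \<partial>D)
    - enn2real (\<integral>\<^sup>+y. V (\<lambda>y. ennreal (- y)) i n (x + y) u \<partial>D)
    = (\<integral>y. enn2real (V (\<lambda>y. ennreal y) i n (x + y) u) - enn2real (V (\<lambda>y. ennreal (- y)) i n (x + y) u) \<partial>D)"
   by (rule enn2real_nn_integral_diff(2)[OF _ _ *]; measurable)
  also have "\<dots> = (\<integral>y. x + y + a i n u \<partial>D)"
   by (simp only: V_mean(3)[OF assms(1)])
  also have "\<dots> = x + mean D + a i n u"
   using D(2) by (simp add: mean_def D.prob_space)
  finally show ?thesis .
 qed
qed

lemma mean_first_step_raw:
 fixes i n :: nat and u :: real
 assumes "0 \<le> u"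
 defines "h \<equiv> (\<lambda>w::real. indicator {0<..u} w * (exp (- (theta i n * w)) *
   (lam i n * (c i n * w + mean (Dr i n) + a i (Suc n) (u - w))
    + mu i n * (c i n * w + mean (DR i n) + a (Suc i) 0 (u - w)))))"
 shows "integrable lborel h" and "a i n u = exp (- (theta i n * u)) * (c i n * u) + (\<integral>w. h w \<partial>lborel)"
proof -
 define F where "F \<phi> w = indicator {0<..u} w * ennreal (exp (- (theta i n * w))) *
   (ennreal (lam i n) * (\<integral>\<^sup>+y. V \<phi> i (Suc n) (c i n * w + y) (u - w) \<partial>Dr i n)
   + ennreal (mu i n) * (\<integral>\<^sup>+y. V \<phi> (Suc i) 0 (c i n * w + y) (u - w) \<partial>DR i n))" for \<phi> w
 have [measurable]: "F \<phi> \<in> borel_measurable borel" if [measurable]: "\<phi> \<in> borel_measurable borel" for \<phi>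
  unfolding F_def[abs_def] by measurable
 let ?p = "\<lambda>y::real. ennreal y" and ?m = "\<lambda>y::real. ennreal (- y)"
 have step: "V \<phi> i n 0 u = ennreal (exp (- (theta i n * u))) * \<phi> (c i n * u) + (\<integral>\<^sup>+w. F \<phi> w \<partial>lborel)"
  if "\<phi> \<in> borel_measurable borel" for \<phi>
  using V_first_step[OF that, of i n 0 u] by (simp add: F_def)
 have fin: "(\<integral>\<^sup>+w. F ?p w \<partial>lborel) < \<infinity>" "(\<integral>\<^sup>+w. F ?m w \<partial>lborel) < \<infinity>"
  using V_mean(1,2)[OF assms(1), of i n 0] step[of ?p] step[of ?m] by auto
 have h: "enn2real (F ?p w) - enn2real (F ?m w) = h w" for w
 proof (cases "w \<in> {0<..u}")
  case True
  then have u: "0 \<le> u - w" by simp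
  note A = V_mean_jump[where D = "Dr i n" and i = i and n = "Suc n" and x = "c i n * w", OF u Dr_prob Dr_mean sets_Dr]
  note B = V_mean_jump[where D = "DR i n" and i = "Suc i" and n = 0 and x = "c i n * w", OF u DR_prob DR_mean sets_DR]
  have E: "enn2real (indicator {0<..u} w * ennreal (exp (- (theta i n * w))) * (ennreal (lam i n) * X + ennreal (mu i n) * Y))
    = exp (- (theta i n * w)) * (lam i n * enn2real X + mu i n * enn2real Y)" if "X < \<infinity>" "Y < \<infinity>" for X Y
   using True that lam_pos[of i n] mu_pos[of i n]
   by (simp add: enn2real_mult enn2real_plus ennreal_mult_less_top)
  show ?thesis
   unfolding F_def h_def E[OF A(1) B(1)] E[OF A(2) B(2)] A(3)[symmetric] B(3)[symmetric]
   using True by (simp add: algebra_simps)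
 qed (simp add: F_def h_def)
 note D = enn2real_nn_integral_diff[OF _ _ fin, unfolded h]
 show "integrable lborel h" using D(1) by simp
 have "a i n u = (exp (- (theta i n * u)) * enn2real (?p (c i n * u)) + enn2real (\<integral>\<^sup>+w. F ?p w \<partial>lborel))
   - (exp (- (theta i n * u)) * enn2real (?m (c i n * u)) + enn2real (\<integral>\<^sup>+w. F ?m w \<partial>lborel))"
  unfolding a_def step[OF measurable_ennreal] step[of ?m, simplified] using fin
  by (simp add: enn2real_plus enn2real_mult ennreal_mult_less_top)
 also have "\<dots> = exp (- (theta i n * u)) * (c i n * u) + (\<integral>w. h w \<partial>lborel)"
 proof -
  have "z = enn2real (?p z) - enn2real (?m z)" for z :: real
   by (cases "0 \<le> z") (simp_all add: ennreal_neg)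
  note cu = this[of "c i n * u"]
  have *: "(e * p + A) - (e * m + B) = e * (p - m) + (A - B)" for e p m A B :: real
   by (simp add: right_diff_distrib)
  show ?thesis
   unfolding * cu[symmetric] using D(2) by simp
 qed
 finally show "a i n u = exp (- (theta i n * u)) * (c i n * u) + (\<integral>w. h w \<partial>lborel)" .
qed

text \<open>
 Integration by parts turns the drift up to the next event into a term with the constant rate
 \<open>g\<close>.
\<close>

lemma drift_integral:
 fixes i n :: nat and u :: real
 assumes "0 \<le> u"
 defines "k \<equiv> (\<lambda>w::real. indicator {0<..u} w * (exp (- (theta i n * w)) *
   (theta i n * c i n * w + lam i n * mean (Dr i n) + mu i n * mean (DR i n))))"
 shows "integrable lborel k"
  and "(\<integral>w. k w \<partial>lborel) = g i n * (1 - exp (- (theta i n * u))) / theta i n - exp (- (theta i n * u)) * (c i n * u)"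
proof -
 define f where "f w = exp (- (theta i n * w)) *
   (theta i n * c i n * w + lam i n * mean (Dr i n) + mu i n * mean (DR i n))" for w
 define G where "G w = - (c i n * w * exp (- (theta i n * w))) - g i n / theta i n * exp (- (theta i n * w))" for w
 have th: "theta i n \<noteq> 0" using theta_pos[of i n] by simp
 have G: "(G has_vector_derivative f w) (at w within {0..u})" for w
 proof -
  have "(G has_real_derivative f w) (at w)"
   unfolding G_def[abs_def] f_def g_def
   by (rule derivative_eq_intros refl | simp)+ (use th in \<open>simp add: field_simps\<close>)
  then show ?thesis
   by (simp add: has_real_derivative_iff_has_vector_derivative has_vector_derivative_at_within)
 qed
 have cont: "continuous_on {0..u} f" unfolding f_def by (intro continuous_intros)
 have eq: "AE w in lborel. indicator {0..u} w *\<^sub>R f w = k w"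
  using AE_lborel_singleton[of 0] by eventually_elim (auto simp: k_def f_def indicator_def)
 have [measurable]: "f \<in> borel_measurable borel" unfolding f_def by measurable
 have [measurable]: "k \<in> borel_measurable borel" unfolding k_def by measurable
 have "set_integrable lborel {0..u} f"
  unfolding set_integrable_def by (rule borel_integrable_compact) (use cont in auto)
 then show "integrable lborel k"
  unfolding set_integrable_def using eq by (subst (asm) integrable_cong_AE) auto
 have "(\<integral>w. indicator {0..u} w *\<^sub>R f w \<partial>lborel) = G u - G 0"
  by (rule integral_FTC_Icc) (use assms G cont in auto)
 moreover have "(\<integral>w. indicator {0..u} w *\<^sub>R f w \<partial>lborel) = (\<integral>w. k w \<partial>lborel)"
  by (rule integral_cong_AE) (use eq in auto)
 moreover have "G u - G 0 = g i n * (1 - exp (- (theta i n * u))) / theta i n - exp (- (theta i n * u)) * (c i n * u)"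
  unfolding G_def by (simp add: right_diff_distrib diff_divide_distrib)
 ultimately show "(\<integral>w. k w \<partial>lborel) = g i n * (1 - exp (- (theta i n * u))) / theta i n - exp (- (theta i n * u)) * (c i n * u)"
  by simp
qed

text \<open>
 The boundary term of the drift cancels the mean on the event that nothing happens, so that only
 \<open>g\<close> remains besides the means after the first event.
\<close>

lemma mean_first_step:
 fixes i n :: nat and u :: real
 assumes "0 \<le> u"
 defines "h \<equiv> (\<lambda>w::real. indicator {0<..u} w * (exp (- (theta i n * w)) *
   (lam i n * a i (Suc n) (u - w) + mu i n * a (Suc i) 0 (u - w))))"
 shows "integrable lborel h"
  and "a i n u = g i n * (1 - exp (- (theta i n * u))) / theta i n + (\<integral>w. h w \<partial>lborel)"
proof -
 note raw = mean_first_step_raw[OF assms(1), of i n] and dr = drift_integral[OF assms(1), of i n]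
 have eq: "h = (\<lambda>w. (indicator {0<..u} w * (exp (- (theta i n * w)) *
   (lam i n * (c i n * w + mean (Dr i n) + a i (Suc n) (u - w))
    + mu i n * (c i n * w + mean (DR i n) + a (Suc i) 0 (u - w)))))
   - indicator {0<..u} w * (exp (- (theta i n * w)) *
   (theta i n * c i n * w + lam i n * mean (Dr i n) + mu i n * mean (DR i n))))"
  by (auto simp: h_def algebra_simps)
 show "integrable lborel h" unfolding eq using raw(1) dr(1) by (rule Bochner_Integration.integrable_diff)
 show "a i n u = g i n * (1 - exp (- (theta i n * u))) / theta i n + (\<integral>w. h w \<partial>lborel)"
  unfolding eq Bochner_Integration.integral_diff[OF raw(1) dr(1)] dr(2) raw(2) by simp
qed

text \<open>
 The first-step equation for duration 1 reduces to its inhomogeneous term.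
\<close>

lemma means_zero_imp_balance:
 assumes "\<And>i n u. 0 \<le> u \<Longrightarrow> a i n u = 0"
 shows "g i n = 0"
proof -
 have h: "(\<lambda>w::real. indicator {0<..1} w * (exp (- (theta i n * w)) *
   (lam i n * a i (Suc n) (1 - w) + mu i n * a (Suc i) 0 (1 - w)))) = (\<lambda>w. 0)"
  using assms by (auto simp: indicator_def)
 have "g i n * (1 - exp (- theta i n)) / theta i n = 0"
  using mean_first_step(2)[of 1 i n] assms[of 1 i n] unfolding h by simp
 then show ?thesis using theta_pos[of i n] by auto
qed

end

section \<open>Local integrability of the means\<close>

text \<open>
 The positive and the negative part of \<open>f\<close> define finite measures on a bounded interval that
 agree on all half-lines, hence they are equal.
\<close>

lemma AE_zero_of_initial_integrals:
 fixes f :: "real \<Rightarrow> real"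
 assumes [measurable]: "f \<in> borel_measurable borel"
  and int: "\<And>u. 0 \<le> u \<Longrightarrow> integrable lborel (\<lambda>v. indicator {0..<u} v * f v)"
  and zero: "AE u in lborel. 0 \<le> u \<longrightarrow> (\<integral>v. indicator {0..<u} v * f v \<partial>lborel) = 0"
 shows "AE v in lborel. 0 \<le> v \<longrightarrow> f v = 0"
proof -
 have all: "(\<integral>v. indicator {0..<u} v * f v \<partial>lborel) = 0" for u
 proof (cases "0 < u")
  case True
  have "\<exists>w. 0 \<le> w \<and> w < u \<and> u - 1 / Suc k < w \<and> (\<integral>v. indicator {0..<w} v * f v \<partial>lborel) = 0" for k :: nat
  proof (rule ccontr)
   assume none: "\<not> ?thesis"
   define b where "b = max 0 (u - 1 / Suc k)"
   have "b < u" "0 \<le> b" using True by (auto simp: b_def)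
   have "AE w in lborel. w \<notin> {b<..<u}"
    using zero by eventually_elim (use none in \<open>force simp: b_def\<close>)
   then have "emeasure lborel {b<..<u} = 0"
    by (subst (asm) AE_iff_measurable[of "{b<..<u}"]) auto
   then show False using \<open>b < u\<close> by simp
  qed
  then obtain w where w: "\<And>k. 0 \<le> w k" "\<And>k. w k < u" "\<And>k::nat. u - 1 / Suc k < w k"
   "\<And>k. (\<integral>v. indicator {0..<w k} v * f v \<partial>lborel) = 0" by metis
  have lim: "w \<longlonglongrightarrow> u"
  proof (rule tendsto_sandwich)
   show "(\<lambda>k. u - 1 / real (Suc k)) \<longlonglongrightarrow> u"
    using tendsto_diff[OF tendsto_const LIMSEQ_Suc[OF lim_1_over_n], of u] by simp
   show "\<forall>\<^sub>F k in sequentially. u - 1 / real (Suc k) \<le> w k"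
    by (intro always_eventually allI less_imp_le w(3))
   show "\<forall>\<^sub>F k in sequentially. w k \<le> u"
    by (intro always_eventually allI less_imp_le w(2))
  qed auto
  have "(\<lambda>k. \<integral>v. indicator {0..<w k} v * f v \<partial>lborel) \<longlonglongrightarrow> (\<integral>v. indicator {0..<u} v * f v \<partial>lborel)"
  proof (rule integral_dominated_convergence[where w = "\<lambda>v. \<bar>indicator {0..<u} v * f v\<bar>"])
   show "integrable lborel (\<lambda>v. \<bar>indicator {0..<u} v * f v\<bar>)"
    using int[of u] True by (intro integrable_abs) simp
   show "AE v in lborel. (\<lambda>k. indicator {0..<w k} v * f v) \<longlonglongrightarrow> indicator {0..<u} v * f v"
   proof (intro AE_I2)
    fix v :: real
    show "(\<lambda>k. indicator {0..<w k} v * f v) \<longlonglongrightarrow> indicator {0..<u} v * f v"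
    proof (cases "0 \<le> v \<and> v < u")
     case True
     have "\<forall>\<^sub>F k in sequentially. v < w k"
      using order_tendstoD(1)[OF lim] True by auto
     then have "\<forall>\<^sub>F k in sequentially. indicator {0..<w k} v * f v = indicator {0..<u} v * f v"
      by eventually_elim (use True in \<open>auto simp: indicator_def\<close>)
     then show ?thesis by (rule tendsto_eventually)
    next
     case False
     then have "indicator {0..<w k} v * f v = indicator {0..<u} v * f v" for k
      using w(2)[of k] by (auto simp: indicator_def)
     then show ?thesis by (simp only: tendsto_const)
    qed
   qed
   show "AE v in lborel. norm (indicator {0..<w k} v * f v) \<le> \<bar>indicator {0..<u} v * f v\<bar>" for k
    using w(2)[of k] by (intro AE_I2) (auto simp: indicator_def)
  qed measurable
  then show ?thesis using w(4) by (simp add: LIMSEQ_const_iff)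
 qed simp
 have "AE v in lborel. indicator {0..<real N} v * f v = 0" for N :: nat
 proof -
  define h where "h v = indicator {0..<real N} v * f v" for v
  have [measurable]: "h \<in> borel_measurable borel" unfolding h_def by measurable
  have inth: "integrable lborel h" unfolding h_def using int[of "real N"] by simp
  have fin: "(\<integral>\<^sup>+v. ennreal \<bar>h v\<bar> \<partial>lborel) < \<infinity>"
   using inth by (auto simp: integrable_iff_bounded)
  have zero_tail: "(\<integral>v. indicator {x<..} v * h v \<partial>lborel) = 0" for x
  proof (cases "x < 0 \<or> real N \<le> x")
   case True
   then have "(\<lambda>v. indicator {x<..} v * h v) = (\<lambda>v. indicator {0..<real N} v * f v) \<or> (\<lambda>v. indicator {x<..} v * h v) = (\<lambda>v. 0)"
    by (auto simp: h_def indicator_def fun_eq_iff)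
   then show ?thesis using all[of "real N"] by (elim disjE) simp_all
  next
   case False
   have "(\<integral>v. indicator {x<..} v * h v \<partial>lborel)
     = (\<integral>v. indicator {0..<real N} v * f v - indicator {0..<x} v * f v \<partial>lborel)"
   proof (intro integral_cong_AE)
    show "AE v in lborel. indicator {x<..} v * h v = indicator {0..<real N} v * f v - indicator {0..<x} v * f v"
     using AE_lborel_singleton[of x] by eventually_elim (use False in \<open>auto simp: h_def indicator_def\<close>)
   qed measurable
   also have "\<dots> = 0" using int[of "real N"] int[of x] False all by simp
   finally show ?thesis .
  qed
  have "density lborel (\<lambda>v. ennreal (h v)) = density lborel (\<lambda>v. ennreal (- h v))"
  proof (rule measure_eqI_lessThan)
   fix x :: real
   have eq: "emeasure (density lborel (\<lambda>v. ennreal (k v))) {x<..} = (\<integral>\<^sup>+v. ennreal (indicator {x<..} v * k v) \<partial>lborel)"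
    if [measurable]: "k \<in> borel_measurable borel" for k
    by (subst emeasure_density) (auto intro!: nn_integral_cong simp: indicator_def)
   have "emeasure (density lborel (\<lambda>v. ennreal (h v))) {x<..} \<le> (\<integral>\<^sup>+v. ennreal \<bar>h v\<bar> \<partial>lborel)"
    by (subst eq) (auto intro!: nn_integral_mono ennreal_leI simp: indicator_def)
   then show finx: "emeasure (density lborel (\<lambda>v. ennreal (h v))) {x<..} < \<infinity>"
    using fin by (rule le_less_trans)
   have "emeasure (density lborel (\<lambda>v. ennreal (- h v))) {x<..} \<le> (\<integral>\<^sup>+v. ennreal \<bar>h v\<bar> \<partial>lborel)"
    by (subst eq) (auto intro!: nn_integral_mono ennreal_leI simp: indicator_def)
   then have finm: "emeasure (density lborel (\<lambda>v. ennreal (- h v))) {x<..} < \<infinity>"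
    using fin by (rule le_less_trans)
   have "integrable lborel (\<lambda>v. indicator {x<..} v * h v)"
    using inth by (rule Bochner_Integration.integrable_bound) (auto simp: indicator_def)
   from real_lebesgue_integral_def[OF this]
   have eq0: "enn2real (\<integral>\<^sup>+v. ennreal (indicator {x<..} v * h v) \<partial>lborel)
     = enn2real (\<integral>\<^sup>+v. ennreal (- (indicator {x<..} v * h v)) \<partial>lborel)"
    unfolding zero_tail by linarith
   have em: "emeasure (density lborel (\<lambda>v. ennreal (- h v))) {x<..} = (\<integral>\<^sup>+v. ennreal (- (indicator {x<..} v * h v)) \<partial>lborel)"
    by (subst eq) simp_all
   show "emeasure (density lborel (\<lambda>v. ennreal (h v))) {x<..} = emeasure (density lborel (\<lambda>v. ennreal (- h v))) {x<..}"
    using eq0 finx finm unfolding em eq[of h, OF \<open>h \<in> borel_measurable borel\<close>]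
    by (metis ennreal_enn2real infinity_ennreal_def)
  qed auto
  then have "AE v in lborel. ennreal (h v) = ennreal (- h v)"
   by (subst (asm) sigma_finite_measure.density_unique_iff[OF sigma_finite_lborel]) auto
  then show ?thesis
   unfolding h_def[symmetric]
   by eventually_elim (metis ennreal_neg ennreal_eq_0_iff linorder_le_cases neg_le_0_iff_le order_antisym)
 qed
 then have "AE v in lborel. \<forall>N::nat. indicator {0..<real N} v * f v = 0"
  by (subst AE_all_countable) blast
 then show ?thesis
 proof eventually_elim
  case (elim v)
  obtain N :: nat where "v < real N" using reals_Archimedean2 by blast
  with elim show ?case by (auto simp: indicator_def split: if_splits)
 qed
qed

lemma integral_reflect:
 fixes k :: "real \<Rightarrow> real"
 shows "integrable lborel (\<lambda>w. indicator {0<..u} w * k (u - w)) \<longleftrightarrow> integrable lborel (\<lambda>v. indicator {0..<u} v * k v)"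
  and "(\<integral>w. indicator {0<..u} w * k (u - w) \<partial>lborel) = (\<integral>v. indicator {0..<u} v * k v \<partial>lborel)"
proof -
 have eq: "(\<lambda>w. indicator {0..<u} (u + - 1 * w) * k (u + - 1 * w)) = (\<lambda>w. indicator {0<..u} w * k (u - w))"
  by (auto simp: fun_eq_iff indicator_def)
 show "integrable lborel (\<lambda>w. indicator {0<..u} w * k (u - w)) \<longleftrightarrow> integrable lborel (\<lambda>v. indicator {0..<u} v * k v)"
  using lborel_integrable_real_affine_iff[of "-1" "\<lambda>v. indicator {0..<u} v * k v" u] unfolding eq by simp
 show "(\<integral>w. indicator {0<..u} w * k (u - w) \<partial>lborel) = (\<integral>v. indicator {0..<u} v * k v \<partial>lborel)"
  using lborel_integral_real_affine[of "-1" "\<lambda>v. indicator {0..<u} v * k v" u] unfolding eq by simp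
qed

lemma nn_integral_reflect:
 fixes k :: "real \<Rightarrow> ennreal"
 assumes [measurable]: "k \<in> borel_measurable borel"
 shows "(\<integral>\<^sup>+w. indicator {0<..u} w * k (u - w) \<partial>lborel) = (\<integral>\<^sup>+v. indicator {0..<u} v * k v \<partial>lborel)"
proof -
 have eq: "(\<lambda>w. indicator {0..<u} (u + - 1 * w) * k (u + - 1 * w)) = (\<lambda>w. indicator {0<..u} w * k (u - w))"
  by (auto simp: fun_eq_iff indicator_def)
 show ?thesis
  using nn_integral_real_affine[of "\<lambda>v. indicator {0..<u} v * k v" "-1" u] unfolding eq by simp
qed

context integrable_kernel
begin

text \<open>
 By the triangle inequality the displacement before and during the jump can be removed at the cost of a finite
 constant.
\<close>

lemma locally_integrable_aux:
 assumes "prob_space D" "integrable D (\<lambda>y. y)" and [measurable_cong]: "sets D = sets borel"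
  and u: "0 \<le> u" and K: "0 < K"
  and fin: "(\<integral>\<^sup>+w. indicator {0<..u} w * (ennreal K * (\<integral>\<^sup>+y. Vabs i n (b * w + y) (u - w) \<partial>D)) \<partial>lborel) < \<infinity>"
 shows "(\<integral>\<^sup>+v. indicator {0..<u} v * Vabs i n 0 v \<partial>lborel) < \<infinity>"
proof -
 interpret D: prob_space D by fact
 define C where "C = ennreal (\<bar>b\<bar> * u) + (\<integral>\<^sup>+y. ennreal \<bar>y\<bar> \<partial>D)"
 have C: "C < \<infinity>"
  using assms(2) by (auto simp: C_def integrable_iff_bounded)
 have le: "Vabs i n 0 (u - w) \<le> (\<integral>\<^sup>+y. Vabs i n (b * w + y) (u - w) \<partial>D) + C" if w: "0 < w" "w \<le> u" for w
 proof -
  have "(\<integral>\<^sup>+y. Vabs i n 0 (u - w) \<partial>D) \<le> (\<integral>\<^sup>+y. Vabs i n (b * w + y) (u - w) + (ennreal (\<bar>b\<bar> * u) + ennreal \<bar>y\<bar>) \<partial>D)"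
  proof (intro nn_integral_mono)
   fix y
   have le: "\<bar>b * w + y\<bar> \<le> \<bar>b\<bar> * u + \<bar>y\<bar>"
    using w abs_triangle_ineq[of "b * w" y] mult_left_mono[of w u "\<bar>b\<bar>"] by (auto simp: abs_mult)
   have "ennreal \<bar>0 - (b * w + y)\<bar> \<le> ennreal (\<bar>b\<bar> * u) + ennreal \<bar>y\<bar>"
    using ennreal_leI[OF le] u by (simp only: diff_0 abs_minus_cancel) simp
   then show "Vabs i n 0 (u - w) \<le> Vabs i n (b * w + y) (u - w) + (ennreal (\<bar>b\<bar> * u) + ennreal \<bar>y\<bar>)"
    using order_trans[OF Vabs_triangle[of "u - w" i n 0 "b * w + y"] add_right_mono] w
    by (subst add.commute) simp
  qed
  also have "\<dots> = (\<integral>\<^sup>+y. Vabs i n (b * w + y) (u - w) \<partial>D) + C"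
   unfolding C_def by (simp add: nn_integral_add D.emeasure_space_1)
  finally show ?thesis by (simp add: D.emeasure_space_1)
 qed
 have "ennreal K * (\<integral>\<^sup>+v. indicator {0..<u} v * Vabs i n 0 v \<partial>lborel)
   = (\<integral>\<^sup>+w. indicator {0<..u} w * (ennreal K * Vabs i n 0 (u - w)) \<partial>lborel)"
  by (subst nn_integral_reflect[symmetric]) (auto simp: nn_integral_cmult[symmetric] mult_ac)
 also have "\<dots> \<le> (\<integral>\<^sup>+w. indicator {0<..u} w * (ennreal K * (\<integral>\<^sup>+y. Vabs i n (b * w + y) (u - w) \<partial>D))
   + indicator {0<..u} w * (ennreal K * C) \<partial>lborel)"
  by (intro nn_integral_mono) (auto simp: indicator_def distrib_left[symmetric] intro!: mult_left_mono le)
 also have "\<dots> = (\<integral>\<^sup>+w. indicator {0<..u} w * (ennreal K * (\<integral>\<^sup>+y. Vabs i n (b * w + y) (u - w) \<partial>D)) \<partial>lborel)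
   + ennreal K * C * ennreal u"
 proof -
  have "(\<integral>\<^sup>+w. indicator {0<..u} w * (ennreal K * C) \<partial>lborel) = ennreal K * C * ennreal u"
   using u by (subst nn_integral_multc) (auto simp: mult.commute)
  then show ?thesis by (subst nn_integral_add) auto
 qed
 also have "\<dots> < \<infinity>"
  using fin C by (auto simp: ennreal_mult_less_top)
 finally show ?thesis
  using K by (auto simp: ennreal_mult_less_top)
qed

text \<open>
 A cell is entered through an event, and the first-step formula of the preceding cell integrates over the time
 of that event. Periodicity provides a preceding phase for \<open>n = 0\<close>.
\<close>

lemma Vabs_locally_integrable:
 assumes u: "0 \<le> u"
 shows "(\<integral>\<^sup>+v. indicator {0..<u} v * Vabs i n 0 v \<partial>lborel) < \<infinity>"
proof -
 have shock: "(\<integral>\<^sup>+v. indicator {0..<u} v * Vabs i (Suc n) 0 v \<partial>lborel) < \<infinity>"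
  and switch: "(\<integral>\<^sup>+v. indicator {0..<u} v * Vabs (Suc i) 0 0 v \<partial>lborel) < \<infinity>" for i n
 proof -
  define E where "E = exp (- (theta i n * u))"
  have E: "E \<le> exp (- (theta i n * w))" if "w \<le> u" for w
   using that theta_pos[of i n] by (simp add: E_def mult_left_mono)
  define I J where "I w = (\<integral>\<^sup>+y. Vabs i (Suc n) (c i n * w + y) (u - w) \<partial>Dr i n)"
   and "J w = (\<integral>\<^sup>+y. Vabs (Suc i) 0 (c i n * w + y) (u - w) \<partial>DR i n)" for w
  have T: "(\<integral>\<^sup>+w. indicator {0<..u} w * ennreal (exp (- (theta i n * w))) *
    (ennreal (lam i n) * I w + ennreal (mu i n) * J w) \<partial>lborel) < \<infinity>"
   using V_first_step[of "\<lambda>y. ennreal \<bar>y\<bar>" i n 0 u] V_abs_finite[OF u, of i n]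
   unfolding I_def J_def by (auto simp: less_top)
  have "indicator {0<..u} w * (ennreal (E * lam i n) * I w) \<le> indicator {0<..u} w * ennreal (exp (- (theta i n * w))) *
    (ennreal (lam i n) * I w + ennreal (mu i n) * J w)" for w
   using E[of w] lam_pos[of i n]
   by (auto simp: indicator_def ennreal_mult E_def mult.assoc intro!: mult_mono)
  then have "(\<integral>\<^sup>+w. indicator {0<..u} w * (ennreal (E * lam i n) * I w) \<partial>lborel) < \<infinity>"
   by (intro le_less_trans[OF nn_integral_mono T])
  from locally_integrable_aux[OF Dr_prob Dr_mean sets_Dr u _ this[unfolded I_def]]
  show "(\<integral>\<^sup>+v. indicator {0..<u} v * Vabs i (Suc n) 0 v \<partial>lborel) < \<infinity>"
   using lam_pos[of i n] by (simp add: E_def)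
  have "indicator {0<..u} w * (ennreal (E * mu i n) * J w) \<le> indicator {0<..u} w * ennreal (exp (- (theta i n * w))) *
    (ennreal (lam i n) * I w + ennreal (mu i n) * J w)" for w
   using E[of w] mu_pos[of i n]
   by (auto simp: indicator_def ennreal_mult E_def mult.assoc intro!: mult_mono)
  then have "(\<integral>\<^sup>+w. indicator {0<..u} w * (ennreal (E * mu i n) * J w) \<partial>lborel) < \<infinity>"
   by (intro le_less_trans[OF nn_integral_mono T])
  from locally_integrable_aux[OF DR_prob DR_mean sets_DR u _ this[unfolded J_def]]
  show "(\<integral>\<^sup>+v. indicator {0..<u} v * Vabs (Suc i) 0 0 v \<partial>lborel) < \<infinity>"
   using mu_pos[of i n] by (simp add: E_def)
 qed
 show ?thesis
 proof (cases n)
  case 0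
  then show ?thesis using switch[of "Suc i"] by (simp add: V_periodic)
 next
  case (Suc k)
  then show ?thesis using shock[of i k] by simp
 qed
qed

lemma abs_a_le_Vabs: "0 \<le> u \<Longrightarrow> ennreal \<bar>a i n u\<bar> \<le> Vabs i n 0 u"
 using V_mean(4)[where u = u and i = i and n = n and x = 0] by simp

lemma a_locally_integrable:
 assumes "0 \<le> u" shows "integrable lborel (\<lambda>v. indicator {0..<u} v * a i n v)"
proof (rule integrableI_bounded)
 have "(\<integral>\<^sup>+v. ennreal (norm (indicator {0..<u} v * a i n v)) \<partial>lborel) \<le> (\<integral>\<^sup>+v. indicator {0..<u} v * Vabs i n 0 v \<partial>lborel)"
  by (intro nn_integral_mono) (auto simp: indicator_def intro: abs_a_le_Vabs)
 then show "(\<integral>\<^sup>+v. ennreal (norm (indicator {0..<u} v * a i n v)) \<partial>lborel) < \<infinity>"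
  using Vabs_locally_integrable[OF assms, of i n] by (rule le_less_trans)
qed measurable

text \<open>
 Without balance term and without contribution of the next phase, the first-step equation at \<open>n\<close>
 says that all integrals over initial intervals of the mean at \<open>Suc n\<close> vanish if the mean at
 \<open>n\<close> does.
\<close>

lemma means_propagate:
 assumes g: "\<And>n. g i n = 0"
  and F: "AE u in lborel. 0 \<le> u \<longrightarrow> a (Suc i) 0 u = 0"
  and F0: "AE u in lborel. 0 \<le> u \<longrightarrow> a i 0 u = 0"
  and "0 \<le> u"
 shows "a i n u = 0"
proof -
 define f where "f n v = exp (theta i n * v) * (lam i n * a i (Suc n) v + mu i n * a (Suc i) 0 v)" for n v
 have [measurable]: "f n \<in> borel_measurable borel" for n unfolding f_def[abs_def] by measurable
 have f_int: "integrable lborel (\<lambda>v. indicator {0..<u} v * f n v)"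
  and f_eq: "a i n u = exp (- (theta i n * u)) * (\<integral>v. indicator {0..<u} v * f n v \<partial>lborel)"
  if u: "0 \<le> u" for n u
 proof -
  have eq: "(\<lambda>w::real. indicator {0<..u} w * (exp (- (theta i n * w)) *
   (lam i n * a i (Suc n) (u - w) + mu i n * a (Suc i) 0 (u - w))))
   = (\<lambda>w. indicator {0<..u} w * (exp (- (theta i n * u)) * f n (u - w)))"
  proof -
   have "exp (- (theta i n * u)) * (exp (theta i n * (u - w)) * z) = exp (- (theta i n * w)) * z" for w z
    unfolding mult.assoc[symmetric] exp_add[symmetric] by (simp add: right_diff_distrib)
   then show ?thesis by (simp only: f_def)
  qed
  have "integrable lborel (\<lambda>v. indicator {0..<u} v * (exp (- (theta i n * u)) * f n v))"
   using mean_first_step(1)[OF u, of i n] unfolding eq integral_reflect(1)[where k = "\<lambda>v. exp (- (theta i n * u)) * f n v"] .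
  then have "integrable lborel (\<lambda>v. exp (theta i n * u) * (indicator {0..<u} v * (exp (- (theta i n * u)) * f n v)))"
   by (rule integrable_mult_right)
  moreover have "exp (theta i n * u) * (indicator {0..<u} v * (exp (- (theta i n * u)) * f n v)) = indicator {0..<u} v * f n v" for v
   by (simp add: exp_minus)
  ultimately show "integrable lborel (\<lambda>v. indicator {0..<u} v * f n v)" by simp
  show "a i n u = exp (- (theta i n * u)) * (\<integral>v. indicator {0..<u} v * f n v \<partial>lborel)"
  proof -
   have "a i n u = (\<integral>v. indicator {0..<u} v * (exp (- (theta i n * u)) * f n v) \<partial>lborel)"
    using mean_first_step(2)[OF u, of i n]
    unfolding eq integral_reflect(2)[where k = "\<lambda>v. exp (- (theta i n * u)) * f n v"] g by simp
   also have "\<dots> = (\<integral>v. exp (- (theta i n * u)) * (indicator {0..<u} v * f n v) \<partial>lborel)"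
    by (simp only: mult.left_commute)
   finally show ?thesis by (simp only: integral_mult_right_zero)
  qed
 qed
 have AE0: "AE u in lborel. 0 \<le> u \<longrightarrow> a i n u = 0" for n
 proof (induction n)
  case 0 show ?case by (rule F0)
 next
  case (Suc n)
  have "AE v in lborel. 0 \<le> v \<longrightarrow> f n v = 0"
  proof (rule AE_zero_of_initial_integrals)
   show "AE u in lborel. 0 \<le> u \<longrightarrow> (\<integral>v. indicator {0..<u} v * f n v \<partial>lborel) = 0"
    using Suc by eventually_elim (use f_eq in auto)
  qed (use f_int in auto)
  with F show ?case
   by eventually_elim (use lam_pos[of i n] in \<open>auto simp: f_def\<close>)
 qed
 have "AE v in lborel. indicator {0..<u} v * f n v = 0"
  using AE0[of "Suc n"] F by eventually_elim (auto simp: f_def indicator_def)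
 then have "(\<integral>v. indicator {0..<u} v * f n v \<partial>lborel) = 0"
  by (intro integral_eq_zero_AE)
 then show ?thesis using f_eq[OF \<open>0 \<le> u\<close>, of n] by simp
qed

end

section \<open>The arrival of the n-th shock in a phase\<close>

lemma measurable_indicator_Ioc [measurable (raw)]:
 assumes [measurable]: "f \<in> borel_measurable M" "g \<in> borel_measurable M"
 shows "(\<lambda>x. indicator {0<..g x} (f x :: real) :: ennreal) \<in> borel_measurable M"
 unfolding indicator_def greaterThanAtMost_iff by measurable

definition Ex :: "real \<Rightarrow> real measure" where
 "Ex b = density lborel (\<lambda>w. indicator {0<..} w * ennreal (b * exp (- (b * w))))"

lemma sets_Ex [measurable_cong, simp]: "sets (Ex b) = sets borel"
 by (simp add: Ex_def)

lemma nn_integral_Ex: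
 assumes [measurable]: "f \<in> borel_measurable borel"
 shows "(\<integral>\<^sup>+w. f w \<partial>Ex b) = (\<integral>\<^sup>+w. indicator {0<..} w * ennreal (b * exp (- (b * w))) * f w \<partial>lborel)"
 unfolding Ex_def by (rule nn_integral_density) measurable

lemma nn_integral_Ex_erlang:
 assumes [measurable]: "f \<in> borel_measurable borel"
 shows "(\<integral>\<^sup>+w. f w \<partial>Ex b) = (\<integral>\<^sup>+w. ennreal (erlang_density 0 b w) * f w \<partial>lborel)"
 unfolding nn_integral_Ex[OF assms]
 by (intro nn_integral_cong_AE, use AE_lborel_singleton[of 0] in eventually_elim)
  (auto simp: erlang_density_def indicator_def mult.commute)

lemma prob_space_Ex: "0 < b \<Longrightarrow> prob_space (Ex b)"
 using nn_integral_Ex_erlang[of "\<lambda>_. 1" b] nn_integral_erlang_ith_moment[of b 0 0]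
 by (intro prob_spaceI) simp

lemma nn_integral_Ex_mean: "0 < b \<Longrightarrow> (\<integral>\<^sup>+w. ennreal w \<partial>Ex b) = ennreal (1 / b)"
 using nn_integral_Ex_erlang[of "\<lambda>w. ennreal w" b] nn_integral_erlang_ith_moment[of b 0 1]
 by (simp add: ennreal_mult'[symmetric])

lemma nn_integral_exp_tail:
 assumes "0 < b"
 shows "(\<integral>\<^sup>+w. indicator {0<..} w * ennreal (exp (- (b * w))) \<partial>lborel) = ennreal (1 / b)"
proof -
 interpret prob_space "Ex b" using assms by (rule prob_space_Ex)
 have "ennreal b * (\<integral>\<^sup>+w. indicator {0<..} w * ennreal (exp (- (b * w))) \<partial>lborel) = (\<integral>\<^sup>+w. 1 \<partial>Ex b)"
  using assms by (subst nn_integral_Ex) (auto simp: nn_integral_cmult[symmetric] ennreal_mult mult_ac)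
 also have "\<dots> = 1" using emeasure_space_1 by simp
 finally have eq: "ennreal b * (\<integral>\<^sup>+w. indicator {0<..} w * ennreal (exp (- (b * w))) \<partial>lborel) = 1" .
 have "(\<integral>\<^sup>+w. indicator {0<..} w * ennreal (exp (- (b * w))) \<partial>lborel)
   = ennreal (1 / b) * (ennreal b * (\<integral>\<^sup>+w. indicator {0<..} w * ennreal (exp (- (b * w))) \<partial>lborel))"
  using assms by (simp add: mult.assoc[symmetric] ennreal_mult[symmetric])
 then show ?thesis unfolding eq by simp
qed

context switching_kernel
begin

text \<open>
 The joint law of the time and the displacement at the \<open>n\<close>-th shock of a phase, conditioned on no
 switching before. Under this condition the waiting times are exponential with the total rates
 \<open>theta\<close>.
\<close>

primrec nu :: "nat \<Rightarrow> nat \<Rightarrow> (real \<times> real) measure" where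
 "nu i 0 = return (borel \<Otimes>\<^sub>M borel) (0, 0)"
| "nu i (Suc n) = distr ((nu i n \<Otimes>\<^sub>M Ex (theta i n)) \<Otimes>\<^sub>M Dr i n) (borel \<Otimes>\<^sub>M borel)
   (\<lambda>p. (fst (fst (fst p)) + snd (fst p), snd (fst (fst p)) + c i n * snd (fst p) + snd p))"

text \<open>
 The probability that the first \<open>n\<close> events of a phase are shocks.
\<close>

definition q :: "nat \<Rightarrow> nat \<Rightarrow> real" where
 "q i n = (\<Prod>k<n. lam i k / theta i k)"

lemma q_pos: "0 < q i n"
 unfolding q_def using lam_pos theta_pos by (intro prod_pos) auto

lemma q_Suc: "q i (Suc n) = q i n * (lam i n / theta i n)"
 by (simp add: q_def)

lemma sets_nu [measurable_cong, simp]: "sets (nu i n) = sets (borel \<Otimes>\<^sub>M borel)"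
 by (cases n) auto

lemma measurable_nu_step:
 "(\<lambda>p. (fst (fst (fst p)) + snd (fst p), snd (fst (fst p)) + c i n * snd (fst p) + snd p))
  \<in> (nu i n \<Otimes>\<^sub>M Ex (theta i n)) \<Otimes>\<^sub>M Dr i n \<rightarrow>\<^sub>M borel \<Otimes>\<^sub>M borel"
 by measurable

lemma prob_space_nu: "prob_space (nu i n)"
proof (induction n)
 case 0 show ?case by (simp add: prob_space_return space_pair_measure)
next
 case (Suc n)
 interpret N: prob_space "nu i n" by (rule Suc)
 interpret X: prob_space "Ex (theta i n)" using theta_pos by (rule prob_space_Ex)
 interpret NX: pair_prob_space "nu i n" "Ex (theta i n)" ..
 interpret NXD: pair_prob_space "nu i n \<Otimes>\<^sub>M Ex (theta i n)" "Dr i n" ..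
 show ?case unfolding nu.simps by (rule NXD.prob_space_distr[OF measurable_nu_step])
qed

sublocale nu: prob_space "nu i n" for i n by (rule prob_space_nu)

lemma nn_integral_nu_Suc:
 assumes [measurable]: "f \<in> borel_measurable (borel \<Otimes>\<^sub>M borel)"
 shows "(\<integral>\<^sup>+z. f z \<partial>nu i (Suc n)) = (\<integral>\<^sup>+z. (\<integral>\<^sup>+w. (\<integral>\<^sup>+y. f (fst z + w, snd z + c i n * w + y) \<partial>Dr i n)
   \<partial>Ex (theta i n)) \<partial>nu i n)"
proof -
 interpret X: prob_space "Ex (theta i n)" using theta_pos by (rule prob_space_Ex)
 define h where "h p = f (fst (fst (fst p)) + snd (fst p), snd (fst (fst p)) + c i n * snd (fst p) + snd p)" for p
 have h: "h \<in> borel_measurable ((nu i n \<Otimes>\<^sub>M Ex (theta i n)) \<Otimes>\<^sub>M Dr i n)"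
  unfolding h_def by measurable
 have h2: "(\<lambda>x. \<integral>\<^sup>+y. h (x, y) \<partial>Dr i n) \<in> borel_measurable (nu i n \<Otimes>\<^sub>M Ex (theta i n))"
  by (rule Dr.borel_measurable_nn_integral_fst[OF h])
 have "(\<integral>\<^sup>+z. f z \<partial>nu i (Suc n)) = (\<integral>\<^sup>+p. h p \<partial>((nu i n \<Otimes>\<^sub>M Ex (theta i n)) \<Otimes>\<^sub>M Dr i n))"
  unfolding nu.simps h_def by (subst nn_integral_distr[OF measurable_nu_step]) (simp_all add: assms)
 also have "\<dots> = (\<integral>\<^sup>+x. (\<integral>\<^sup>+y. h (x, y) \<partial>Dr i n) \<partial>(nu i n \<Otimes>\<^sub>M Ex (theta i n)))"
  by (rule Dr.nn_integral_fst[OF h, symmetric])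
 also have "\<dots> = (\<integral>\<^sup>+z. (\<integral>\<^sup>+w. (\<integral>\<^sup>+y. h ((z, w), y) \<partial>Dr i n) \<partial>Ex (theta i n)) \<partial>nu i n)"
  by (rule X.nn_integral_fst[OF h2, symmetric])
 finally show ?thesis by (simp add: h_def)
qed

lemma nu_nonneg: "AE z in nu i n. 0 \<le> fst z"
proof -
 have "(\<integral>\<^sup>+z. indicator {..<0} (fst z) \<partial>nu i n) = 0"
 proof (induction n)
  case 0 then show ?case by (simp add: nn_integral_return space_pair_measure)
 next
  case (Suc n)
  have "(\<integral>\<^sup>+w. indicator {..<0} (s + w) \<partial>Ex (theta i n)) \<le> indicator {..<0::real} s" for s
  proof (cases "0 \<le> s")
   case True
   have "(\<integral>\<^sup>+w. indicator {..<0} (s + w) \<partial>Ex (theta i n)) = (\<integral>\<^sup>+w. indicator {0<..} w *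
     ennreal (theta i n * exp (- (theta i n * w))) * indicator {..<0} (s + w) \<partial>lborel)"
    by (rule nn_integral_Ex) measurable
   also have "\<dots> = (\<integral>\<^sup>+w. 0 \<partial>(lborel :: real measure))"
    using True by (intro nn_integral_cong) (auto simp: indicator_def)
   finally show ?thesis by simp
  next
   case False
   interpret X: prob_space "Ex (theta i n)" using theta_pos by (rule prob_space_Ex)
   have "(\<integral>\<^sup>+w. indicator {..<0} (s + w) \<partial>Ex (theta i n)) \<le> (\<integral>\<^sup>+w. 1 \<partial>Ex (theta i n))"
    by (intro nn_integral_mono) (auto simp: indicator_def)
   then show ?thesis using False X.emeasure_space_1 by simp
  qed
  then have "(\<integral>\<^sup>+z. indicator {..<0} (fst z) \<partial>nu i (Suc n)) \<le> (\<integral>\<^sup>+z. indicator {..<0} (fst z) \<partial>nu i n)"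
   by (subst nn_integral_nu_Suc) (auto simp: Dr.emeasure_space_1 intro!: nn_integral_mono)
  with Suc show ?case by simp
 qed
 then have "AE z in nu i n. indicator {..<0} (fst z) = (0::ennreal)"
  by (subst (asm) nn_integral_0_iff_AE) auto
 then show ?thesis by eventually_elim (auto simp: indicator_def split: if_splits)
qed

text \<open>
 Rate \<open>lam\<close> times the survival factor is the density of the total clock times the probability
 \<open>lam / theta\<close> that the event is a shock.
\<close>

lemma shock_transport:
 assumes [measurable]: "h \<in> borel_measurable (borel \<Otimes>\<^sub>M borel)"
 shows "ennreal (q i n) * (\<integral>\<^sup>+z. indicator {..u} (fst z) * (\<integral>\<^sup>+w. indicator {0<..u - fst z} w * ennreal (exp (- (theta i n * w))) *
   (ennreal (lam i n) * (\<integral>\<^sup>+y. h (fst z + w, snd z + c i n * w + y) \<partial>Dr i n)) \<partial>lborel) \<partial>nu i n)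
  = ennreal (q i (Suc n)) * (\<integral>\<^sup>+z. indicator {..u} (fst z) * h z \<partial>nu i (Suc n))"
proof -
 define J where "J z w = (\<integral>\<^sup>+y. h (fst z + w, snd z + c i n * w + y) \<partial>Dr i n)" for z :: "real \<times> real" and w
 have J [measurable]: "(\<lambda>p. J (fst p) (snd p)) \<in> borel_measurable ((borel \<Otimes>\<^sub>M borel) \<Otimes>\<^sub>M borel)"
  unfolding J_def by measurable
 have [measurable]: "J z \<in> borel_measurable borel" for z
  unfolding J_def by measurable
 have "ennreal (q i (Suc n)) * (\<integral>\<^sup>+z. indicator {..u} (fst z) * h z \<partial>nu i (Suc n))
   = ennreal (q i (Suc n)) * (\<integral>\<^sup>+z. (\<integral>\<^sup>+w. indicator {..u} (fst z + w) * J z w \<partial>Ex (theta i n)) \<partial>nu i n)"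
  unfolding J_def by (subst nn_integral_nu_Suc) (auto simp: nn_integral_cmult)
 also have "\<dots> = ennreal (q i (Suc n)) * (\<integral>\<^sup>+z. (\<integral>\<^sup>+w. indicator {0<..} w * ennreal (theta i n * exp (- (theta i n * w)))
   * (indicator {..u} (fst z + w) * J z w) \<partial>lborel) \<partial>nu i n)"
  by (subst nn_integral_Ex) auto
 also have "\<dots> = ennreal (q i n * lam i n) * (\<integral>\<^sup>+z. (\<integral>\<^sup>+w. indicator {0<..} w * ennreal (exp (- (theta i n * w)))
   * (indicator {..u} (fst z + w) * J z w) \<partial>lborel) \<partial>nu i n)"
 proof -
  have "ennreal (q i (Suc n)) * (\<integral>\<^sup>+z. (\<integral>\<^sup>+w. indicator {0<..} w * ennreal (theta i n * exp (- (theta i n * w)))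
    * (indicator {..u} (fst z + w) * J z w) \<partial>lborel) \<partial>nu i n)
   = ennreal (q i (Suc n)) * (\<integral>\<^sup>+z. ennreal (theta i n) * (\<integral>\<^sup>+w. indicator {0<..} w * ennreal (exp (- (theta i n * w)))
    * (indicator {..u} (fst z + w) * J z w) \<partial>lborel) \<partial>nu i n)"
   using theta_pos[of i n] by (subst nn_integral_cmult[symmetric]) (auto simp: ennreal_mult mult_ac)
  also have "\<dots> = ennreal (q i (Suc n)) * (ennreal (theta i n) * (\<integral>\<^sup>+z. (\<integral>\<^sup>+w. indicator {0<..} w * ennreal (exp (- (theta i n * w)))
    * (indicator {..u} (fst z + w) * J z w) \<partial>lborel) \<partial>nu i n))"
   by (subst nn_integral_cmult) auto
  also have "\<dots> = ennreal (q i n * lam i n) * (\<integral>\<^sup>+z. (\<integral>\<^sup>+w. indicator {0<..} w * ennreal (exp (- (theta i n * w)))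
    * (indicator {..u} (fst z + w) * J z w) \<partial>lborel) \<partial>nu i n)"
   using theta_pos[of i n] q_pos[of i "Suc n"] q_pos[of i n]
   by (simp add: mult.assoc[symmetric] ennreal_mult[symmetric] q_Suc)
  finally show ?thesis .
 qed
 also have "\<dots> = ennreal (q i n) * (\<integral>\<^sup>+z. ennreal (lam i n) * (\<integral>\<^sup>+w. indicator {0<..} w * ennreal (exp (- (theta i n * w)))
    * (indicator {..u} (fst z + w) * J z w) \<partial>lborel) \<partial>nu i n)"
  using q_pos[of i n] lam_pos[of i n] by (subst nn_integral_cmult) (auto simp: ennreal_mult mult.assoc)
 also have "\<dots> = ennreal (q i n) * (\<integral>\<^sup>+z. indicator {..u} (fst z) * (\<integral>\<^sup>+w. indicator {0<..u - fst z} w * ennreal (exp (- (theta i n * w))) *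
   (ennreal (lam i n) * J z w) \<partial>lborel) \<partial>nu i n)"
 proof -
  have "ennreal (lam i n) * (\<integral>\<^sup>+w. indicator {0<..} w * ennreal (exp (- (theta i n * w)))
    * (indicator {..u} (fst z + w) * J z w) \<partial>lborel)
   = indicator {..u} (fst z) * (\<integral>\<^sup>+w. indicator {0<..u - fst z} w * ennreal (exp (- (theta i n * w))) *
   (ennreal (lam i n) * J z w) \<partial>lborel)" (is "?L = ?R") for z
  proof -
   have "?L = (\<integral>\<^sup>+w. ennreal (lam i n) * (indicator {0<..} w * ennreal (exp (- (theta i n * w)))
    * (indicator {..u} (fst z + w) * J z w)) \<partial>lborel)"
    by (rule nn_integral_cmult[symmetric]) measurable
   also have "\<dots> = (\<integral>\<^sup>+w. indicator {..u} (fst z) * (indicator {0<..u - fst z} w * ennreal (exp (- (theta i n * w))) *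
   (ennreal (lam i n) * J z w)) \<partial>lborel)"
    by (intro nn_integral_cong) (auto simp: indicator_def mult_ac)
   also have "\<dots> = ?R"
    by (rule nn_integral_cmult) measurable
   finally show ?thesis .
  qed
  then show ?thesis by simp
 qed
 finally show ?thesis unfolding J_def by simp
qed

text \<open>
 The three contributions to \<open>V \<phi> i 0 0 u\<close> that are attached to the \<open>n\<close>-th shock
 of the first phase: paths that reach it before \<open>u\<close>; paths that also are still waiting for the
 next event at \<open>u\<close> (\<open>stay\<close>); paths whose next event is a switching before
 \<open>u\<close> (\<open>leave\<close>).
\<close>

definition reach :: "(real \<Rightarrow> ennreal) \<Rightarrow> nat \<Rightarrow> nat \<Rightarrow> real \<Rightarrow> ennreal" where
 "reach \<phi> i n u = ennreal (q i n) * (\<integral>\<^sup>+z. indicator {..u} (fst z) * V \<phi> i n (snd z) (u - fst z) \<partial>nu i n)"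

definition stay :: "(real \<Rightarrow> ennreal) \<Rightarrow> nat \<Rightarrow> nat \<Rightarrow> real \<Rightarrow> ennreal" where
 "stay \<phi> i n u = ennreal (q i n) * (\<integral>\<^sup>+z. indicator {..u} (fst z) *
   (ennreal (exp (- (theta i n * (u - fst z)))) * \<phi> (snd z + c i n * (u - fst z))) \<partial>nu i n)"

definition leave :: "(real \<Rightarrow> ennreal) \<Rightarrow> nat \<Rightarrow> nat \<Rightarrow> real \<Rightarrow> ennreal" where
 "leave \<phi> i n u = ennreal (q i n) * (\<integral>\<^sup>+z. indicator {..u} (fst z) * (\<integral>\<^sup>+w. indicator {0<..u - fst z} w *
   ennreal (exp (- (theta i n * w))) * (ennreal (mu i n) *
    (\<integral>\<^sup>+y. V \<phi> (Suc i) 0 (snd z + c i n * w + y) (u - fst z - w) \<partial>DR i n)) \<partial>lborel) \<partial>nu i n)"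

lemma reach_step:
 assumes [measurable]: "\<phi> \<in> borel_measurable borel"
 shows "reach \<phi> i n u = stay \<phi> i n u + leave \<phi> i n u + reach \<phi> i (Suc n) u"
proof -
 define A where "A z w = (\<integral>\<^sup>+y. V \<phi> i (Suc n) (snd z + c i n * w + y) (u - fst z - w) \<partial>Dr i n)" for z :: "real \<times> real" and w
 define B where "B z w = (\<integral>\<^sup>+y. V \<phi> (Suc i) 0 (snd z + c i n * w + y) (u - fst z - w) \<partial>DR i n)" for z :: "real \<times> real" and w
 have [measurable]: "(\<lambda>p. A (fst p) (snd p)) \<in> borel_measurable ((borel \<Otimes>\<^sub>M borel) \<Otimes>\<^sub>M borel)"
  "(\<lambda>p. B (fst p) (snd p)) \<in> borel_measurable ((borel \<Otimes>\<^sub>M borel) \<Otimes>\<^sub>M borel)"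
  unfolding A_def B_def by measurable
 have [measurable]: "A z \<in> borel_measurable borel" "B z \<in> borel_measurable borel" for z
  unfolding A_def B_def by measurable
 define K where "K z w = indicator {0<..u - fst z} w * ennreal (exp (- (theta i n * w)))" for z :: "real \<times> real" and w
 have [measurable]: "(\<lambda>p. K (fst p) (snd p)) \<in> borel_measurable ((borel \<Otimes>\<^sub>M borel) \<Otimes>\<^sub>M borel)"
  unfolding K_def by measurable
 have [measurable]: "K z \<in> borel_measurable borel" for z
  unfolding K_def by measurable
 have V: "V \<phi> i n (snd z) (u - fst z) = ennreal (exp (- (theta i n * (u - fst z)))) * \<phi> (snd z + c i n * (u - fst z))
   + ((\<integral>\<^sup>+w. K z w * (ennreal (mu i n) * B z w) \<partial>lborel) + (\<integral>\<^sup>+w. K z w * (ennreal (lam i n) * A z w) \<partial>lborel))" for z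
  unfolding A_def B_def K_def V_first_step[OF assms, of i n "snd z" "u - fst z"]
  by (subst nn_integral_add[symmetric]) (auto simp: distrib_left add.commute)
 have "reach \<phi> i n u = stay \<phi> i n u + (leave \<phi> i n u + ennreal (q i n) * (\<integral>\<^sup>+z. indicator {..u} (fst z) *
   (\<integral>\<^sup>+w. K z w * (ennreal (lam i n) * A z w) \<partial>lborel) \<partial>nu i n))"
  unfolding reach_def V stay_def leave_def B_def[symmetric] K_def[symmetric]
  unfolding distrib_left[symmetric]
  by (subst (1 2) nn_integral_add[symmetric]) (auto simp: distrib_left[symmetric])
 also have "ennreal (q i n) * (\<integral>\<^sup>+z. indicator {..u} (fst z) *
   (\<integral>\<^sup>+w. K z w * (ennreal (lam i n) * A z w) \<partial>lborel) \<partial>nu i n) = reach \<phi> i (Suc n) u"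
  using shock_transport[of "\<lambda>z. V \<phi> i (Suc n) (snd z) (u - fst z)" i n u]
  unfolding reach_def A_def K_def by (simp add: diff_diff_eq)
 finally show ?thesis by (simp add: add.assoc)
qed

lemma V_decomposition:
 assumes [measurable]: "\<phi> \<in> borel_measurable borel" and "0 \<le> u"
 shows "V \<phi> i 0 0 u = (\<Sum>k<N. stay \<phi> i k u + leave \<phi> i k u) + reach \<phi> i N u"
proof (induction N)
 case 0
 then show ?case using assms(2) by (simp add: reach_def q_def nn_integral_return space_pair_measure)
next
 case (Suc N) then show ?case using reach_step[OF assms(1), of i N u] by (simp add: add.assoc)
qed

text \<open>
 A path that reaches the \<open>N\<close>-th shock has at least \<open>N\<close> events, so
 \<open>reach\<close> is a tail of a convergent series whenever \<open>V\<close> is finite.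
\<close>

lemma reach_le_tail:
 assumes [measurable]: "\<phi> \<in> borel_measurable borel" and "0 \<le> u"
 shows "reach \<phi> i N u \<le> (\<Sum>j. U (N + j) \<phi> i 0 0 u)"
proof -
 define R where "R n j = ennreal (q i n) * (\<integral>\<^sup>+z. indicator {..u} (fst z) * U j \<phi> i n (snd z) (u - fst z) \<partial>nu i n)" for n j
 have R: "R n j \<le> U (n + j) \<phi> i 0 0 u" for n j
 proof (induction n arbitrary: j)
  case 0 then show ?case using assms(2) by (simp add: R_def q_def nn_integral_return space_pair_measure)
 next
  case (Suc n)
  have "R (Suc n) j \<le> R n (Suc j)"
   unfolding R_def
   using shock_transport[of "\<lambda>z. U j \<phi> i (Suc n) (snd z) (u - fst z)" i n u, symmetric]
   by (auto simp: diff_diff_eq intro!: mult_left_mono nn_integral_mono)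
  also have "\<dots> \<le> U (Suc n + j) \<phi> i 0 0 u" using Suc[of "Suc j"] by simp
  finally show ?case .
 qed
 have "reach \<phi> i N u = (\<Sum>j. R N j)"
 proof -
  have "(\<integral>\<^sup>+z. indicator {..u} (fst z) * V \<phi> i N (snd z) (u - fst z) \<partial>nu i N)
    = (\<integral>\<^sup>+z. (\<Sum>j. indicator {..u} (fst z) * U j \<phi> i N (snd z) (u - fst z)) \<partial>nu i N)"
   unfolding V_def by (simp only: ennreal_suminf_cmult)
  also have "\<dots> = (\<Sum>j. \<integral>\<^sup>+z. indicator {..u} (fst z) * U j \<phi> i N (snd z) (u - fst z) \<partial>nu i N)"
   by (rule nn_integral_suminf) measurable
  finally show ?thesis unfolding reach_def R_def by (simp only: ennreal_suminf_cmult)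
 qed
 also have "\<dots> \<le> (\<Sum>j. U (N + j) \<phi> i 0 0 u)"
  by (intro suminf_le R summableI)
 finally show ?thesis .
qed

end

section \<open>A weighted norm and the contribution of the next phase\<close>

lemma measurable_indicator_Iic [measurable (raw)]:
 assumes [measurable]: "f \<in> borel_measurable M" "g \<in> borel_measurable M"
 shows "(\<lambda>x. indicator {..g x} (f x :: real) :: ennreal) \<in> borel_measurable M"
 unfolding indicator_def atMost_iff by measurable

lemma nn_integral_shift:
 fixes f :: "real \<Rightarrow> ennreal"
 assumes [measurable]: "f \<in> borel_measurable borel"
 shows "(\<integral>\<^sup>+u. f u \<partial>lborel) = (\<integral>\<^sup>+w. f (s + w) \<partial>lborel)"
 using nn_integral_real_affine[of f 1 s] by simp

lemma nn_integral_exp_tail_mult: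
 assumes "0 < b"
 shows "(\<integral>\<^sup>+w. indicator {0<..} w * ennreal (exp (- (b * w))) * C \<partial>lborel) = ennreal (1 / b) * C"
 unfolding nn_integral_exp_tail[OF assms, symmetric] by (rule nn_integral_multc) measurable

text \<open>
 The intervals \<open>(0, h)\<close> and \<open>(h, 2 h)\<close> together make up the right-hand side up to a
 point.
\<close>

lemma two_point_bound:
 fixes f :: "real \<Rightarrow> ennreal"
 assumes [measurable]: "f \<in> borel_measurable borel" and "0 < h"
  and K: "\<And>w. 0 < w \<Longrightarrow> w < h \<Longrightarrow> K \<le> f w + f (w + h)"
 shows "K * ennreal h \<le> 2 * (\<integral>\<^sup>+w. indicator {0<..<2 * h} w * f w \<partial>lborel)"
proof -
 have "K * ennreal h = (\<integral>\<^sup>+w. K * indicator {0<..<h} w \<partial>lborel)"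
  using \<open>0 < h\<close> by (subst nn_integral_cmult_indicator) auto
 also have "\<dots> \<le> (\<integral>\<^sup>+w. indicator {0<..<h} w * f w + indicator {0<..<h} w * f (w + h) \<partial>lborel)"
  using K by (intro nn_integral_mono) (auto simp: indicator_def)
 also have "\<dots> = (\<integral>\<^sup>+w. indicator {0<..<h} w * f w \<partial>lborel) + (\<integral>\<^sup>+w. indicator {0<..<h} w * f (w + h) \<partial>lborel)"
  by (rule nn_integral_add) measurable
 also have "(\<integral>\<^sup>+w. indicator {0<..<h} w * f (w + h) \<partial>lborel) = (\<integral>\<^sup>+w. indicator {h<..<2*h} w * f w \<partial>lborel)"
  by (subst nn_integral_shift[of "\<lambda>w. indicator {h<..<2*h} w * f w" h])
   (auto intro!: nn_integral_cong simp: indicator_def add.commute)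
 also have "(\<integral>\<^sup>+w. indicator {0<..<h} w * f w \<partial>lborel) + \<dots> \<le>
   (\<integral>\<^sup>+w. indicator {0<..<2 * h} w * f w \<partial>lborel) + (\<integral>\<^sup>+w. indicator {0<..<2 * h} w * f w \<partial>lborel)"
  using \<open>0 < h\<close> by (intro add_mono nn_integral_mono) (auto simp: indicator_def)
 finally show ?thesis by (simp only: mult_2)
qed

text \<open>
 An affine function cannot be small on most of an interval: with \<open>t = b * w\<close>,
 \<open>\<bar>y\<bar> \<le> 2 * \<bar>y + t\<bar> + \<bar>y + 2 * t\<bar>\<close>, and the last term is
 integrated by scaling.
\<close>

lemma affine_integral_bound:
 assumes "0 < d"
 shows "ennreal (\<bar>y\<bar> * d) \<le> 5 * (\<integral>\<^sup>+w. indicator {0<..<d} w * ennreal \<bar>y + b * w\<bar> \<partial>lborel)"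
proof -
 define f where "f w = indicator {0<..<d} w * ennreal \<bar>y + b * w\<bar>" for w
 have [measurable]: "f \<in> borel_measurable borel" unfolding f_def by measurable
 define I J where "I = (\<integral>\<^sup>+w. f w \<partial>lborel)" and "J = (\<integral>\<^sup>+w. f (0 + 2 * w) \<partial>lborel)"
 have J: "2 * J = I"
  unfolding I_def J_def using nn_integral_real_affine[of f 2 0] by simp
 have "ennreal \<bar>y\<bar> * ennreal (d/2) = (\<integral>\<^sup>+w. ennreal \<bar>y\<bar> * indicator {0<..<d/2} w \<partial>lborel)"
  using assms by (subst nn_integral_cmult_indicator) auto
 also have "\<dots> \<le> (\<integral>\<^sup>+w. 2 * f w + f (0 + 2 * w) \<partial>lborel)"
 proof (intro nn_integral_mono)
  fix w :: real
  have "\<bar>y\<bar> \<le> 2 * \<bar>y + t\<bar> + \<bar>y + 2 * t\<bar>" for t by (auto simp: abs_if)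
  from this[of "b * w"] have "\<bar>y\<bar> \<le> 2 * \<bar>y + b * w\<bar> + \<bar>y + b * (0 + 2 * w)\<bar>"
   by (simp add: mult.left_commute)
  then have "ennreal \<bar>y\<bar> \<le> ennreal (2 * \<bar>y + b * w\<bar> + \<bar>y + b * (0 + 2 * w)\<bar>)" by (rule ennreal_leI)
  also have "\<dots> = 2 * ennreal \<bar>y + b * w\<bar> + ennreal \<bar>y + b * (0 + 2 * w)\<bar>"
   by (subst ennreal_plus) (auto simp: ennreal_mult)
  finally show "ennreal \<bar>y\<bar> * indicator {0<..<d/2} w \<le> 2 * f w + f (0 + 2 * w)"
   unfolding f_def by (auto simp: indicator_def)
 qed
 also have "\<dots> = 2 * I + J"
  unfolding I_def J_def by (subst nn_integral_add) (auto simp: nn_integral_cmult)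
 finally have "2 * (ennreal \<bar>y\<bar> * ennreal (d/2)) \<le> 2 * (2 * I + J)"
  by (rule mult_left_mono) simp
 also have "\<dots> = 5 * I"
 proof -
  have "5 * I = (2 * 2 + 1) * I" by simp
  then show ?thesis unfolding distrib_left J by (simp only: distrib_right mult.assoc mult_1_left)
 qed
 also have "2 * (ennreal \<bar>y\<bar> * ennreal (d/2)) = ennreal (\<bar>y\<bar> * d)"
 proof -
  have "ennreal 2 * (ennreal \<bar>y\<bar> * ennreal (d/2)) = ennreal (2 * (\<bar>y\<bar> * (d/2)))"
   using assms by (simp only: ennreal_mult'[symmetric] ennreal_mult''[symmetric])
  then show ?thesis by simp
 qed
 finally show ?thesis unfolding I_def f_def .
qed

lemma ennreal_tail_tendsto_0:
 fixes b :: "nat \<Rightarrow> ennreal"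
 assumes "(\<Sum>j. b j) < \<infinity>"
 shows "(\<lambda>N. \<Sum>j. b (N + j)) \<longlonglongrightarrow> 0"
proof -
 have fin: "b j < \<infinity>" for j
  using assms by (metis ennreal_suminf_lessD infinity_ennreal_def)
 define r where "r j = enn2real (b j)" for j
 have b: "b j = ennreal (r j)" for j using fin[of j] by (simp add: r_def)
 have r0: "0 \<le> r j" for j by (simp add: r_def)
 have sm: "summable r"
  by (rule summable_suminf_not_top) (use r0 assms in \<open>auto simp: b\<close>)
 have "(\<lambda>N. ennreal (\<Sum>j. r (j + N))) \<longlonglongrightarrow> ennreal 0"
 proof (rule tendsto_ennrealI)
  have "(\<lambda>N. suminf r - (\<Sum>j<N. r j)) \<longlonglongrightarrow> suminf r - suminf r"
   by (intro tendsto_intros summable_LIMSEQ sm)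
  then show "(\<lambda>N. \<Sum>j. r (j + N)) \<longlonglongrightarrow> 0"
   using suminf_minus_initial_segment[OF sm] by simp
 qed
 moreover have "(\<Sum>j. b (N + j)) = ennreal (\<Sum>j. r (j + N))" for N
  unfolding b add.commute[of N] using r0 sm by (intro suminf_ennreal2) (auto simp: summable_iff_shift)
 ultimately show ?thesis by simp
qed

lemma ennreal_summable_tendsto_0:
 fixes b :: "nat \<Rightarrow> ennreal"
 assumes "(\<Sum>j. b j) < \<infinity>"
 shows "b \<longlonglongrightarrow> 0"
proof (rule tendsto_sandwich[OF _ _ tendsto_const ennreal_tail_tendsto_0[OF assms]])
 show "\<forall>\<^sub>F N in sequentially. b N \<le> (\<Sum>j. b (N + j))"
 proof (intro always_eventually allI)
  fix N
  have "(\<Sum>j<1. b (N + j)) \<le> (\<Sum>j. b (N + j))" by (rule sum_le_suminf) auto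
  then show "b N \<le> (\<Sum>j. b (N + j))" by simp
 qed
qed simp

text \<open>
 The weight \<open>exp (- u)\<close> plays the part of an independent exponential deadline; it yields a
 contraction factor below 1 that does not depend on the horizon \<open>v\<close>.
\<close>

definition nrm :: "real \<Rightarrow> (real \<Rightarrow> real) \<Rightarrow> ennreal" where
 "nrm v f = (\<integral>\<^sup>+u. indicator {0..<v} u * ennreal (exp (- u) * \<bar>f u\<bar>) \<partial>lborel)"

lemma nrm_triangle:
 assumes [measurable]: "f \<in> borel_measurable borel" "h \<in> borel_measurable borel"
  and le: "\<And>u. 0 \<le> u \<Longrightarrow> u < v \<Longrightarrow> \<bar>k u\<bar> \<le> \<bar>f u\<bar> + \<bar>h u\<bar>"
 shows "nrm v k \<le> nrm v f + nrm v h"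
proof -
 have "nrm v k \<le> (\<integral>\<^sup>+u. indicator {0..<v} u * ennreal (exp (- u) * \<bar>f u\<bar>) + indicator {0..<v} u * ennreal (exp (- u) * \<bar>h u\<bar>) \<partial>lborel)"
  unfolding nrm_def
 proof (intro nn_integral_mono)
  fix u :: real
  show "indicator {0..<v} u * ennreal (exp (- u) * \<bar>k u\<bar>) \<le> indicator {0..<v} u * ennreal (exp (- u) * \<bar>f u\<bar>) + indicator {0..<v} u * ennreal (exp (- u) * \<bar>h u\<bar>)"
  proof (cases "u \<in> {0..<v}")
   case True
   then have "exp (- u) * \<bar>k u\<bar> \<le> exp (- u) * \<bar>f u\<bar> + exp (- u) * \<bar>h u\<bar>"
    unfolding distrib_left[symmetric] using le[of u] by (intro mult_left_mono) auto
   then show ?thesis using True by (simp add: ennreal_plus[symmetric] ennreal_leI del: ennreal_plus)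
  qed simp
 qed
 also have "\<dots> = nrm v f + nrm v h"
  unfolding nrm_def by (rule nn_integral_add) measurable
 finally show ?thesis .
qed

lemma nrm_le:
 assumes "\<And>u. 0 \<le> u \<Longrightarrow> u < v \<Longrightarrow> ennreal \<bar>f u\<bar> \<le> G u"
 shows "nrm v f \<le> (\<integral>\<^sup>+u. indicator {0..<v} u * G u \<partial>lborel)"
 unfolding nrm_def
proof (intro nn_integral_mono)
 fix u :: real
 show "indicator {0..<v} u * ennreal (exp (- u) * \<bar>f u\<bar>) \<le> indicator {0..<v} u * G u"
 proof (cases "u \<in> {0..<v}")
  case True
  then have "exp (- u) * \<bar>f u\<bar> \<le> 1 * \<bar>f u\<bar>" by (intro mult_right_mono) auto
  then show ?thesis using True assms[of u] by (auto intro: order_trans[OF ennreal_leI])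
 qed simp
qed

context switching_kernel
begin

lemma swap_lborel_nu:
 fixes f :: "real \<Rightarrow> real \<times> real \<Rightarrow> ennreal"
 assumes "(\<lambda>p. f (fst p) (snd p)) \<in> borel_measurable (borel \<Otimes>\<^sub>M (borel \<Otimes>\<^sub>M borel))"
 shows "(\<integral>\<^sup>+u. (\<integral>\<^sup>+z. f u z \<partial>nu i n) \<partial>lborel) = (\<integral>\<^sup>+z. (\<integral>\<^sup>+u. f u z \<partial>lborel) \<partial>nu i n)"
proof -
 interpret pair_sigma_finite "nu i n" "lborel :: real measure" ..
 have "(\<lambda>p. f (snd p) (fst p)) \<in> borel_measurable ((borel \<Otimes>\<^sub>M borel) \<Otimes>\<^sub>M borel)"
  using measurable_compose[OF measurable_pair_swap' assms] by (simp add: split_beta')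
 then show ?thesis
  by (intro Fubini'[of "\<lambda>z u. f u z"]) (simp add: split_beta' cong: measurable_cong_sets sets_pair_measure_cong)
qed

text \<open>
 The switching that follows the \<open>n\<close>-th shock, with a function \<open>G\<close> of the remaining
 time only.
\<close>

definition drive :: "(real \<Rightarrow> ennreal) \<Rightarrow> nat \<Rightarrow> nat \<Rightarrow> real \<Rightarrow> ennreal" where
 "drive G i n u = ennreal (q i n) * (\<integral>\<^sup>+z. indicator {..u} (fst z) * (\<integral>\<^sup>+w. indicator {0<..u - fst z} w *
   ennreal (exp (- (theta i n * w))) * (ennreal (mu i n) * G (u - fst z - w)) \<partial>lborel) \<partial>nu i n)"

text \<open>
 By Tonelli the time arguments separate: the remaining time, the waiting time of the switching and the time of
 the \<open>n\<close>-th shock each contribute a factor. The cases \<open>b = 1\<close> (the weighted norm)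
 and \<open>b = 0\<close> (the plain integral) are used.
\<close>

lemma drive_bound:
 assumes [measurable]: "G \<in> borel_measurable borel" and b: "0 \<le> b"
 shows "(\<integral>\<^sup>+u. indicator {0..<v} u * (ennreal (exp (- (b * u))) * drive G i n u) \<partial>lborel)
  \<le> ennreal (q i n * (mu i n / (b + theta i n))) * (\<integral>\<^sup>+z. ennreal (exp (- (b * fst z))) \<partial>nu i n)
   * (\<integral>\<^sup>+t. indicator {0..<v} t * (ennreal (exp (- (b * t))) * G t) \<partial>lborel)"
proof -
 define N where "N = (\<integral>\<^sup>+t. indicator {0..<v} t * (ennreal (exp (- (b * t))) * G t) \<partial>lborel)"
 have pos: "0 < b + theta i n" using b theta_pos[of i n] by linarith
 define K where "K u z w = indicator {0..<v} u * (ennreal (exp (- (b * u))) * (indicator {..u} (fst z) * (indicator {0<..u - fst z} w *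
   ennreal (exp (- (theta i n * w))) * (ennreal (mu i n) * G (u - fst z - w)))))" for u w :: real and z :: "real \<times> real"
 have K3 [measurable]: "(\<lambda>p. K (fst (fst p)) (snd (fst p)) (snd p)) \<in> borel_measurable ((borel \<Otimes>\<^sub>M (borel \<Otimes>\<^sub>M borel)) \<Otimes>\<^sub>M borel)"
  unfolding K_def by measurable
 have K2: "(\<lambda>p. K (snd p) z (fst p)) \<in> borel_measurable (borel \<Otimes>\<^sub>M borel)" for z
  unfolding K_def by measurable
 have [measurable]: "K u z \<in> borel_measurable borel" "(\<lambda>u. K u z w) \<in> borel_measurable borel" for u z w
  unfolding K_def by measurable
 have Kw: "(\<lambda>p. \<integral>\<^sup>+w. K (fst p) (snd p) w \<partial>lborel) \<in> borel_measurable (borel \<Otimes>\<^sub>M (borel \<Otimes>\<^sub>M borel))"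
 proof -
  have "(\<lambda>p. K (fst (fst p)) (snd (fst p)) (snd p)) \<in> borel_measurable ((borel \<Otimes>\<^sub>M (borel \<Otimes>\<^sub>M borel)) \<Otimes>\<^sub>M lborel)"
   using K3 by (simp cong: measurable_cong_sets sets_pair_measure_cong)
  from lborel.borel_measurable_nn_integral_fst[OF this] show ?thesis by simp
 qed
 have Kwz: "(\<lambda>u. \<integral>\<^sup>+z. (\<integral>\<^sup>+w. K u z w \<partial>lborel) \<partial>nu i n) \<in> borel_measurable lborel"
 proof -
  have "(\<lambda>p. \<integral>\<^sup>+w. K (fst p) (snd p) w \<partial>lborel) \<in> borel_measurable (lborel \<Otimes>\<^sub>M nu i n)"
   using Kw by (simp cong: measurable_cong_sets sets_pair_measure_cong)
  from nu.borel_measurable_nn_integral_fst[OF this] show ?thesis by simp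
 qed
 have inner: "(\<integral>\<^sup>+u. K u z w \<partial>lborel) \<le> indicator {0<..} w * ennreal (exp (- ((b + theta i n) * w))) * (ennreal (mu i n) * (ennreal (exp (- (b * fst z))) * N))"
  if z: "0 \<le> fst z" for z w
 proof (cases "0 < w")
  case True
  have "(\<integral>\<^sup>+u. K u z w \<partial>lborel) = (\<integral>\<^sup>+t. K (fst z + w + t) z w \<partial>lborel)"
   by (rule nn_integral_shift) measurable
  also have "\<dots> \<le> (\<integral>\<^sup>+t. ennreal (exp (- (theta i n * w)) * exp (- (b * w)) * exp (- (b * fst z))) * ennreal (mu i n) * (indicator {0..<v} t * (ennreal (exp (- (b * t))) * G t)) \<partial>lborel)"
  proof (intro nn_integral_mono)
   fix t :: real
   have "exp (- (b * (fst z + w + t))) = exp (- (b * w)) * exp (- (b * fst z)) * exp (- (b * t))"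
    unfolding exp_add[symmetric] by (simp add: algebra_simps)
   then show "K (fst z + w + t) z w \<le> ennreal (exp (- (theta i n * w)) * exp (- (b * w)) * exp (- (b * fst z))) * ennreal (mu i n) * (indicator {0..<v} t * (ennreal (exp (- (b * t))) * G t))"
    using True z unfolding K_def by (auto simp: indicator_def ennreal_mult mult_ac)
  qed
  also have "\<dots> = ennreal (exp (- (theta i n * w)) * exp (- (b * w)) * exp (- (b * fst z))) * ennreal (mu i n) * N"
   unfolding N_def by (rule nn_integral_cmult) measurable
  also have "exp (- (theta i n * w)) * exp (- (b * w)) * exp (- (b * fst z)) = exp (- ((b + theta i n) * w)) * exp (- (b * fst z))"
   by (simp add: exp_add[symmetric] algebra_simps)
  finally show ?thesis using True by (simp add: ennreal_mult mult_ac)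
 next
  case False then show ?thesis by (simp add: K_def)
 qed
 have "(\<integral>\<^sup>+u. indicator {0..<v} u * (ennreal (exp (- (b * u))) * drive G i n u) \<partial>lborel)
   = (\<integral>\<^sup>+u. ennreal (q i n) * (\<integral>\<^sup>+z. (\<integral>\<^sup>+w. K u z w \<partial>lborel) \<partial>nu i n) \<partial>lborel)"
 proof (intro nn_integral_cong)
  fix u :: real
  have "(\<integral>\<^sup>+w. K u z w \<partial>lborel) = indicator {0..<v} u * (ennreal (exp (- (b * u))) * (indicator {..u} (fst z) * (\<integral>\<^sup>+w. indicator {0<..u - fst z} w *
    ennreal (exp (- (theta i n * w))) * (ennreal (mu i n) * G (u - fst z - w)) \<partial>lborel)))" for z
   unfolding K_def by (simp add: nn_integral_cmult)
  then have "(\<integral>\<^sup>+z. (\<integral>\<^sup>+w. K u z w \<partial>lborel) \<partial>nu i n) = indicator {0..<v} u * (ennreal (exp (- (b * u))) * (\<integral>\<^sup>+z. indicator {..u} (fst z) * (\<integral>\<^sup>+w. indicator {0<..u - fst z} w *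
    ennreal (exp (- (theta i n * w))) * (ennreal (mu i n) * G (u - fst z - w)) \<partial>lborel) \<partial>nu i n))"
   by (simp add: nn_integral_cmult)
  then show "indicator {0..<v} u * (ennreal (exp (- (b * u))) * drive G i n u) = ennreal (q i n) * (\<integral>\<^sup>+z. (\<integral>\<^sup>+w. K u z w \<partial>lborel) \<partial>nu i n)"
   unfolding drive_def by (simp add: mult_ac)
 qed
 also have "\<dots> = ennreal (q i n) * (\<integral>\<^sup>+u. (\<integral>\<^sup>+z. (\<integral>\<^sup>+w. K u z w \<partial>lborel) \<partial>nu i n) \<partial>lborel)"
  by (rule nn_integral_cmult) (rule Kwz)
 also have "(\<integral>\<^sup>+u. (\<integral>\<^sup>+z. (\<integral>\<^sup>+w. K u z w \<partial>lborel) \<partial>nu i n) \<partial>lborel) = (\<integral>\<^sup>+z. (\<integral>\<^sup>+u. (\<integral>\<^sup>+w. K u z w \<partial>lborel) \<partial>lborel) \<partial>nu i n)"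
  by (rule swap_lborel_nu) (rule Kw)
 also have "\<dots> = (\<integral>\<^sup>+z. (\<integral>\<^sup>+w. (\<integral>\<^sup>+u. K u z w \<partial>lborel) \<partial>lborel) \<partial>nu i n)"
 proof (rule nn_integral_cong)
  fix z :: "real \<times> real"
  show "(\<integral>\<^sup>+u. (\<integral>\<^sup>+w. K u z w \<partial>lborel) \<partial>lborel) = (\<integral>\<^sup>+w. (\<integral>\<^sup>+u. K u z w \<partial>lborel) \<partial>lborel)"
   using K2[of z] by (intro lborel_pair.Fubini'[of "\<lambda>w u. K u z w"]) (simp add: split_beta' cong: measurable_cong_sets sets_pair_measure_cong)
 qed
 finally have eq: "(\<integral>\<^sup>+u. indicator {0..<v} u * (ennreal (exp (- (b * u))) * drive G i n u) \<partial>lborel)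
  = ennreal (q i n) * (\<integral>\<^sup>+z. (\<integral>\<^sup>+w. (\<integral>\<^sup>+u. K u z w \<partial>lborel) \<partial>lborel) \<partial>nu i n)" .
 have le: "(\<integral>\<^sup>+z. (\<integral>\<^sup>+w. (\<integral>\<^sup>+u. K u z w \<partial>lborel) \<partial>lborel) \<partial>nu i n)
  \<le> (\<integral>\<^sup>+z. ennreal (mu i n / (b + theta i n)) * N * ennreal (exp (- (b * fst z))) \<partial>nu i n)"
 proof (rule nn_integral_mono_AE)
  show "AE z in nu i n. (\<integral>\<^sup>+w. (\<integral>\<^sup>+u. K u z w \<partial>lborel) \<partial>lborel)
   \<le> ennreal (mu i n / (b + theta i n)) * N * ennreal (exp (- (b * fst z)))"
   using nu_nonneg[of i n]
  proof eventually_elim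
   case (elim z)
   have "(\<integral>\<^sup>+w. (\<integral>\<^sup>+u. K u z w \<partial>lborel) \<partial>lborel)
    \<le> ennreal (1 / (b + theta i n)) * (ennreal (mu i n) * (ennreal (exp (- (b * fst z))) * N))"
    unfolding nn_integral_exp_tail_mult[OF pos, symmetric] by (rule nn_integral_mono, rule inner[OF elim])
   moreover have e: "ennreal (mu i n / (b + theta i n)) = ennreal (1 / (b + theta i n)) * ennreal (mu i n)"
    using mu_pos[of i n] pos by (simp add: ennreal_mult[symmetric])
   ultimately show ?case unfolding e by (simp add: mult_ac)
  qed
 qed
 have m: "(\<lambda>z. ennreal (exp (- (b * fst z)))) \<in> borel_measurable (nu i n)" by measurable
 have "(\<integral>\<^sup>+z. ennreal (mu i n / (b + theta i n)) * N * ennreal (exp (- (b * fst z))) \<partial>nu i n)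
   = ennreal (mu i n / (b + theta i n)) * N * (\<integral>\<^sup>+z. ennreal (exp (- (b * fst z))) \<partial>nu i n)"
  by (rule nn_integral_cmult[OF m])
 with le have le': "(\<integral>\<^sup>+z. (\<integral>\<^sup>+w. (\<integral>\<^sup>+u. K u z w \<partial>lborel) \<partial>lborel) \<partial>nu i n)
  \<le> ennreal (mu i n / (b + theta i n)) * N * (\<integral>\<^sup>+z. ennreal (exp (- (b * fst z))) \<partial>nu i n)" by (simp only:)
 have "ennreal (q i n * (mu i n / (b + theta i n))) = ennreal (q i n) * ennreal (mu i n / (b + theta i n))"
  using q_pos[of i n] mu_pos[of i n] pos by (intro ennreal_mult) auto
 with mult_left_mono[OF le', of "ennreal (q i n)"] show ?thesis
  unfolding eq N_def[symmetric] by (simp add: mult_ac)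
qed

lemma nn_integral_nu_exp:
 "(\<integral>\<^sup>+z. ennreal (exp (- fst z)) \<partial>nu i n) = ennreal (\<Prod>k<n. theta i k / (1 + theta i k))"
proof (induction n)
 case 0 then show ?case by (simp add: nn_integral_return space_pair_measure)
next
 case (Suc n)
 have "(\<integral>\<^sup>+w. ennreal (exp (- w)) \<partial>Ex (theta i n)) = (\<integral>\<^sup>+w. ennreal (theta i n) * (indicator {0<..} w * ennreal (exp (- ((1 + theta i n) * w)))) \<partial>lborel)"
 proof -
  have "exp (- ((1 + theta i n) * w)) = exp (- (theta i n * w)) * exp (- w)" for w
   unfolding exp_add[symmetric] by (simp add: distrib_right)
  then show ?thesis
   using theta_pos[of i n]
   by (subst nn_integral_Ex) (auto intro!: nn_integral_cong simp: indicator_def ennreal_mult mult.assoc)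
 qed
 also have "\<dots> = ennreal (theta i n) * ennreal (1 / (1 + theta i n))"
  using nn_integral_exp_tail[of "1 + theta i n"] theta_pos[of i n] by (subst nn_integral_cmult) auto
 also have "\<dots> = ennreal (theta i n / (1 + theta i n))"
  using theta_pos[of i n] by (simp add: ennreal_mult[symmetric])
 finally have E: "(\<integral>\<^sup>+w. ennreal (exp (- w)) \<partial>Ex (theta i n)) = ennreal (theta i n / (1 + theta i n))" .
 have "(\<integral>\<^sup>+z. ennreal (exp (- fst z)) \<partial>nu i (Suc n)) = (\<integral>\<^sup>+z. (\<integral>\<^sup>+w. ennreal (exp (- fst z)) * ennreal (exp (- w)) \<partial>Ex (theta i n)) \<partial>nu i n)"
  by (subst nn_integral_nu_Suc) (auto simp: Dr.emeasure_space_1 ennreal_mult[symmetric] exp_add[symmetric])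
 also have "\<dots> = (\<integral>\<^sup>+z. ennreal (exp (- fst z)) \<partial>nu i n) * ennreal (theta i n / (1 + theta i n))"
  by (simp add: nn_integral_cmult nn_integral_multc E)
 also have "\<dots> = ennreal (\<Prod>k<Suc n. theta i k / (1 + theta i k))"
  unfolding Suc using theta_pos by (subst ennreal_mult[symmetric]) (auto intro!: prod_nonneg divide_nonneg_pos simp: add_pos_pos less_imp_le)
 finally show ?case .
qed

text \<open>
 The probability that the phase ends with a switching after exactly \<open>n\<close> shocks, all before an
 independent exponential deadline of rate 1.
\<close>

definition beta :: "nat \<Rightarrow> nat \<Rightarrow> real" where
 "beta i n = (\<Prod>k<n. lam i k / (1 + theta i k)) * (mu i n / (1 + theta i n))"

lemma beta_nonneg: "0 \<le> beta i n"
 unfolding beta_def using lam_pos mu_pos theta_pos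
 by (intro mult_nonneg_nonneg prod_nonneg divide_nonneg_pos) (auto simp: less_imp_le add_pos_pos)

text \<open>
 The events described by \<open>beta\<close> are disjoint and require that the first event of the phase
 precedes the deadline. The inequality with the remainder \<open>b n\<close> is kept through the induction.
\<close>

lemma sum_beta: "(\<Sum>k<n. beta i k) \<le> theta i 0 / (1 + theta i 0)"
proof -
 define b where "b n = (\<Prod>k<n. lam i k / (1 + theta i k))" for n
 have b0: "0 \<le> b n" for n
  unfolding b_def using lam_pos mu_pos theta_pos
  by (intro prod_nonneg divide_nonneg_pos) (auto simp: less_imp_le add_pos_pos)
 have "(\<Sum>k<n. beta i k) + b n \<le> theta i 0 / (1 + theta i 0)" if "0 < n" for n
  using that
 proof (induction n)
  case (Suc n)
  have pos: "0 < 1 + theta i n" using theta_pos[of i n] by simp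
  have step: "beta i n + b (Suc n) = b n * (theta i n / (1 + theta i n))"
  proof -
   have "b (Suc n) = b n * (lam i n / (1 + theta i n))" by (simp add: b_def)
   then show ?thesis
    unfolding beta_def b_def[symmetric] by (simp add: distrib_left[symmetric] add_divide_distrib[symmetric] add.commute)
  qed
  have le: "b n * (theta i n / (1 + theta i n)) \<le> b n"
   using b0[of n] pos theta_pos[of i n] by (intro mult_right_le_one_le) auto
  show ?case
  proof (cases "n = 0")
   case True then show ?thesis using step by (simp add: b_def)
  next
   case False then show ?thesis using step le Suc.IH by simp
  qed
 qed simp
 from this[of n] b0[of n] show ?thesis
  using theta_pos[of i 0] by (cases "n = 0") auto
qed

lemma drive_nrm:
 assumes [measurable]: "f \<in> borel_measurable borel"
 shows "(\<integral>\<^sup>+u. indicator {0..<v} u * (ennreal (exp (- u)) * drive (\<lambda>t. ennreal \<bar>f t\<bar>) i n u) \<partial>lborel)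
  \<le> ennreal (beta i n) * nrm v f"
proof -
 have "q i n * (mu i n / (1 + theta i n)) * (\<Prod>k<n. theta i k / (1 + theta i k)) = beta i n"
 proof -
  have "q i n * (\<Prod>k<n. theta i k / (1 + theta i k)) = (\<Prod>k<n. lam i k / (1 + theta i k))"
   unfolding q_def prod.distrib[symmetric] using theta_pos
   by (intro prod.cong) (auto simp: less_imp_neq[symmetric])
  then show ?thesis by (simp add: beta_def mult_ac)
 qed
 moreover have "ennreal (q i n * (mu i n / (1 + theta i n))) * ennreal (\<Prod>k<n. theta i k / (1 + theta i k))
  = ennreal (q i n * (mu i n / (1 + theta i n)) * (\<Prod>k<n. theta i k / (1 + theta i k)))"
  using q_pos[of i n] mu_pos[of i n] theta_pos
  by (intro ennreal_mult[symmetric]) (auto intro!: prod_nonneg divide_nonneg_pos mult_nonneg_nonneg simp: add_pos_pos less_imp_le)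
 ultimately show ?thesis
  using drive_bound[of "\<lambda>t. ennreal \<bar>f t\<bar>" 1 v i n]
  by (simp add: nn_integral_nu_exp nrm_def ennreal_mult)
qed

end

section \<open>Bounds from the integrability of the process\<close>

lemma ennreal_abs_triangle: "ennreal \<bar>x + y\<bar> \<le> ennreal \<bar>x\<bar> + ennreal \<bar>y\<bar>"
proof -
 have "ennreal \<bar>x + y\<bar> \<le> ennreal (\<bar>x\<bar> + \<bar>y\<bar>)" by (rule ennreal_leI) (rule abs_triangle_ineq)
 then show ?thesis by simp
qed

context switching_kernel
begin

lemma nu_abs_finite: "(\<integral>\<^sup>+z. ennreal \<bar>snd z\<bar> \<partial>nu i n) < \<infinity>"
proof (induction n)
 case 0 show ?case by (simp add: nn_integral_return space_pair_measure)
next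
 case (Suc n)
 interpret X: prob_space "Ex (theta i n)" using theta_pos by (rule prob_space_Ex)
 define D where "D = (\<integral>\<^sup>+y. ennreal \<bar>y\<bar> \<partial>Dr i n)"
 have D: "D < \<infinity>" using Dr_mean[of i n] by (simp add: D_def integrable_iff_bounded)
 have 1: "(\<integral>\<^sup>+y. ennreal \<bar>x + c i n * w + y\<bar> \<partial>Dr i n) \<le> ennreal \<bar>x\<bar> + ennreal \<bar>c i n\<bar> * ennreal \<bar>w\<bar> + D" for x w
 proof -
  have "ennreal \<bar>x + c i n * w + y\<bar> \<le> ennreal (\<bar>x\<bar> + \<bar>c i n\<bar> * \<bar>w\<bar>) + ennreal \<bar>y\<bar>" for y
   using order_trans[OF ennreal_abs_triangle[of "x + c i n * w" y] add_right_mono[OF ennreal_abs_triangle[of x "c i n * w"]]]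
   by (simp add: abs_mult)
  then have "(\<integral>\<^sup>+y. ennreal \<bar>x + c i n * w + y\<bar> \<partial>Dr i n) \<le> (\<integral>\<^sup>+y. ennreal (\<bar>x\<bar> + \<bar>c i n\<bar> * \<bar>w\<bar>) + ennreal \<bar>y\<bar> \<partial>Dr i n)"
   by (rule nn_integral_mono)
  then show ?thesis by (simp add: nn_integral_add Dr.emeasure_space_1 D_def ennreal_mult)
 qed
 have w: "(\<integral>\<^sup>+w. ennreal \<bar>w\<bar> \<partial>Ex (theta i n)) = ennreal (1 / theta i n)"
 proof -
  have "(\<integral>\<^sup>+w. ennreal \<bar>w\<bar> \<partial>Ex (theta i n)) = (\<integral>\<^sup>+w. ennreal w \<partial>Ex (theta i n))"
   by (simp add: nn_integral_Ex) (auto intro!: nn_integral_cong simp: indicator_def)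
  then show ?thesis using nn_integral_Ex_mean[OF theta_pos] by simp
 qed
 have wc: "(\<integral>\<^sup>+w. ennreal \<bar>c i n\<bar> * ennreal \<bar>w\<bar> \<partial>Ex (theta i n)) = ennreal (\<bar>c i n\<bar> * (1 / theta i n))"
  using theta_pos[of i n] by (subst nn_integral_cmult) (auto simp: w ennreal_mult[symmetric])
 have 2: "(\<integral>\<^sup>+w. ennreal \<bar>x\<bar> + ennreal \<bar>c i n\<bar> * ennreal \<bar>w\<bar> + D \<partial>Ex (theta i n)) = ennreal \<bar>x\<bar> + (ennreal (\<bar>c i n\<bar> * (1 / theta i n)) + D)" for x
  by (subst nn_integral_add, simp, simp, subst nn_integral_add, simp, simp) (simp only: wc nn_integral_const X.emeasure_space_1 mult_1_right add.assoc)
 have "(\<integral>\<^sup>+z. ennreal \<bar>snd z\<bar> \<partial>nu i (Suc n)) = (\<integral>\<^sup>+z. (\<integral>\<^sup>+w. (\<integral>\<^sup>+y. ennreal \<bar>snd z + c i n * w + y\<bar> \<partial>Dr i n) \<partial>Ex (theta i n)) \<partial>nu i n)"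
  by (subst nn_integral_nu_Suc) auto
 moreover have "(\<integral>\<^sup>+z. (\<integral>\<^sup>+w. (\<integral>\<^sup>+y. ennreal \<bar>snd z + c i n * w + y\<bar> \<partial>Dr i n) \<partial>Ex (theta i n)) \<partial>nu i n)
  \<le> (\<integral>\<^sup>+z. ennreal \<bar>snd z\<bar> + (ennreal (\<bar>c i n\<bar> * (1 / theta i n)) + D) \<partial>nu i n)"
  unfolding 2[symmetric] by (intro nn_integral_mono 1)
 moreover have "(\<integral>\<^sup>+z. ennreal \<bar>snd z\<bar> + (ennreal (\<bar>c i n\<bar> * (1 / theta i n)) + D) \<partial>nu i n) =
   (\<integral>\<^sup>+z. ennreal \<bar>snd z\<bar> \<partial>nu i n) + (ennreal (\<bar>c i n\<bar> * (1 / theta i n)) + D)"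
  by (simp add: nn_integral_add nu.emeasure_space_1)
 ultimately show ?case using Suc D by (auto simp: less_top[symmetric] top_unique)
qed

text \<open>
 The mean absolute displacement at the \<open>n\<close>-th shock; the quantity to be shown small.
\<close>

definition arrival :: "nat \<Rightarrow> nat \<Rightarrow> real \<Rightarrow> ennreal" where
 "arrival i n v = (\<integral>\<^sup>+z. indicator {..v} (fst z) * ennreal \<bar>snd z\<bar> \<partial>nu i n)"

lemma stay_leave_sum_le:
 assumes "\<phi> \<in> borel_measurable borel" "0 \<le> u"
 shows "(\<Sum>k. stay \<phi> i k u + leave \<phi> i k u) \<le> V \<phi> i 0 0 u"
proof (rule suminf_le_const[OF summableI])
 fix n
 show "(\<Sum>k<n. stay \<phi> i k u + leave \<phi> i k u) \<le> V \<phi> i 0 0 u"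
  unfolding V_decomposition[OF assms, of i n] by (rule add_increasing2) auto
qed

lemma measurable_stay [measurable]:
 assumes [measurable]: "\<phi> \<in> borel_measurable borel"
 shows "stay \<phi> i n \<in> borel_measurable borel"
 unfolding stay_def[abs_def] by measurable

lemma measurable_leave [measurable]:
 assumes [measurable]: "\<phi> \<in> borel_measurable borel"
 shows "leave \<phi> i n \<in> borel_measurable borel"
 unfolding leave_def[abs_def] by measurable

lemma measurable_reach [measurable]:
 assumes [measurable]: "\<phi> \<in> borel_measurable borel"
 shows "reach \<phi> i n \<in> borel_measurable borel"
 unfolding reach_def[abs_def] by measurable

lemma measurable_drive [measurable]:
 assumes [measurable]: "G \<in> borel_measurable borel"
 shows "drive G i n \<in> borel_measurable borel"
 unfolding drive_def[abs_def] by measurable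

text \<open>
 During the waiting time after the \<open>n\<close>-th shock the position moves along a line, so
 \<open>affine_integral_bound\<close> applies on an interval of length \<open>min (1 / theta) v\<close>, on
 which the survival factor is at least \<open>exp (- 1)\<close>.
\<close>

lemma arrival_le_stay:
 assumes "0 < v"
 shows "ennreal (q i n * min (1 / theta i n) v) * arrival i n v
  \<le> ennreal (5 * exp 1) * (\<integral>\<^sup>+u. indicator {0..<2 * v} u * stay (\<lambda>y. ennreal \<bar>y\<bar>) i n u \<partial>lborel)"
proof -
 define d where "d = min (1 / theta i n) v"
 have d: "0 < d" "d \<le> v" "theta i n * d \<le> 1"
  using assms theta_pos[of i n] by (auto simp: d_def min_def field_simps)
 define H where "H u z = indicator {0..<2 * v} u * (indicator {..u} (fst z) *
   (ennreal (exp (- (theta i n * (u - fst z)))) * ennreal \<bar>snd z + c i n * (u - fst z)\<bar>))" for u and z :: "real \<times> real"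
 have H [measurable]: "(\<lambda>p. H (fst p) (snd p)) \<in> borel_measurable (borel \<Otimes>\<^sub>M (borel \<Otimes>\<^sub>M borel))"
  unfolding H_def by measurable
 have [measurable]: "(\<lambda>p. H (snd p) (fst p)) \<in> borel_measurable ((borel \<Otimes>\<^sub>M borel) \<Otimes>\<^sub>M borel)"
  unfolding H_def by measurable
 have [measurable]: "(\<lambda>u. H u z) \<in> borel_measurable borel" "H u \<in> borel_measurable (borel \<Otimes>\<^sub>M borel)" for z u
  unfolding H_def by measurable
 have pt: "indicator {..v} (fst z) * ennreal \<bar>snd z\<bar> * ennreal d \<le> ennreal (5 * exp 1) * (\<integral>\<^sup>+u. H u z \<partial>lborel)"
  if z: "0 \<le> fst z" for z
 proof (cases "fst z \<le> v")
  case True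
  define I where "I = (\<integral>\<^sup>+w. indicator {0<..<d} w * ennreal \<bar>snd z + c i n * w\<bar> \<partial>lborel)"
  have "ennreal (exp (- 1)) * I = (\<integral>\<^sup>+w. ennreal (exp (- 1)) * (indicator {0<..<d} w * ennreal \<bar>snd z + c i n * w\<bar>) \<partial>lborel)"
   unfolding I_def by (subst nn_integral_cmult) auto
  also have "\<dots> \<le> (\<integral>\<^sup>+w. H (fst z + w) z \<partial>lborel)"
  proof (rule nn_integral_mono)
   fix w :: real
   show "ennreal (exp (- 1)) * (indicator {0<..<d} w * ennreal \<bar>snd z + c i n * w\<bar>) \<le> H (fst z + w) z"
   proof (cases "0 < w \<and> w < d")
    case True
    have "theta i n * w \<le> theta i n * d" using True theta_pos[of i n] by (intro mult_left_mono) auto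
    then have "exp (- 1) \<le> exp (- (theta i n * w))" using d by simp
    moreover have "fst z + w \<in> {0..<2 * v}" using True d z \<open>fst z \<le> v\<close> by auto
    ultimately show ?thesis using True by (auto simp: H_def intro!: mult_right_mono ennreal_leI)
   qed auto
  qed
  also have "\<dots> = (\<integral>\<^sup>+u. H u z \<partial>lborel)"
   by (rule nn_integral_shift[symmetric]) measurable
  finally have 1: "ennreal (exp (- 1)) * I \<le> (\<integral>\<^sup>+u. H u z \<partial>lborel)" .
  have "indicator {..v} (fst z) * ennreal \<bar>snd z\<bar> * ennreal d \<le> 5 * I"
   using affine_integral_bound[OF d(1), of "snd z" "c i n"] True d by (simp add: I_def ennreal_mult)
  also have "5 * I = ennreal (5 * exp 1) * (ennreal (exp (- 1)) * I)"
  proof -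
   have e: "5 * exp 1 * exp (- 1) = (5::real)" by (simp add: exp_minus)
   have "ennreal (5 * exp 1) * ennreal (exp (- 1)) = ennreal (5 * exp 1 * exp (- 1))"
    by (rule ennreal_mult[symmetric]) simp_all
   then have "ennreal (5 * exp 1) * ennreal (exp (- 1)) = 5" unfolding e by simp
   then show ?thesis by (simp only: mult.assoc[symmetric])
  qed
  finally show ?thesis using mult_left_mono[OF 1, of "ennreal (5 * exp 1)"] by (rule order_trans) simp
 qed simp
 have e1: "ennreal (q i n * d) * arrival i n v = ennreal (q i n) * (\<integral>\<^sup>+z. indicator {..v} (fst z) * ennreal \<bar>snd z\<bar> * ennreal d \<partial>nu i n)"
  unfolding arrival_def using q_pos[of i n] d by (subst nn_integral_multc) (auto simp: ennreal_mult mult_ac)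
 have e2: "(\<integral>\<^sup>+z. indicator {..v} (fst z) * ennreal \<bar>snd z\<bar> * ennreal d \<partial>nu i n)
   \<le> (\<integral>\<^sup>+z. ennreal (5 * exp 1) * (\<integral>\<^sup>+u. H u z \<partial>lborel) \<partial>nu i n)"
 proof (rule nn_integral_mono_AE)
  show "AE z in nu i n. indicator {..v} (fst z) * ennreal \<bar>snd z\<bar> * ennreal d \<le> ennreal (5 * exp 1) * (\<integral>\<^sup>+u. H u z \<partial>lborel)"
   using nu_nonneg[of i n] by eventually_elim (rule pt)
 qed
 have e3: "(\<integral>\<^sup>+z. ennreal (5 * exp 1) * (\<integral>\<^sup>+u. H u z \<partial>lborel) \<partial>nu i n) = ennreal (5 * exp 1) * (\<integral>\<^sup>+z. (\<integral>\<^sup>+u. H u z \<partial>lborel) \<partial>nu i n)"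
  by (rule nn_integral_cmult) measurable
 have e4: "(\<integral>\<^sup>+z. (\<integral>\<^sup>+u. H u z \<partial>lborel) \<partial>nu i n) = (\<integral>\<^sup>+u. (\<integral>\<^sup>+z. H u z \<partial>nu i n) \<partial>lborel)"
  by (rule swap_lborel_nu[symmetric]) (rule H)
 have e5: "ennreal (q i n) * (\<integral>\<^sup>+u. (\<integral>\<^sup>+z. H u z \<partial>nu i n) \<partial>lborel) = (\<integral>\<^sup>+u. indicator {0..<2 * v} u * stay (\<lambda>y. ennreal \<bar>y\<bar>) i n u \<partial>lborel)"
 proof -
  have "(\<integral>\<^sup>+z. H u z \<partial>nu i n) = indicator {0..<2 * v} u * (\<integral>\<^sup>+z. (indicator {..u} (fst z) *
   (ennreal (exp (- (theta i n * (u - fst z)))) * ennreal \<bar>snd z + c i n * (u - fst z)\<bar>)) \<partial>nu i n)" for u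
   unfolding H_def by (rule nn_integral_cmult) measurable
  then have "indicator {0..<2 * v} u * stay (\<lambda>y. ennreal \<bar>y\<bar>) i n u = ennreal (q i n) * (\<integral>\<^sup>+z. H u z \<partial>nu i n)" for u
   unfolding stay_def by (simp add: mult_ac)
  then show ?thesis by (simp add: nn_integral_cmult)
 qed
 show ?thesis
  using mult_left_mono[OF e2, of "ennreal (q i n)"]
  unfolding d_def[symmetric] e1 e3 e4 e5[symmetric] mult.left_commute[of "ennreal (5 * exp 1)" "ennreal (q i n)"]
  by (simp only: zero_le)
qed

end

context integrable_kernel
begin

lemma stay_leave_integrals_finite:
 assumes "0 \<le> v"
 shows "(\<Sum>k. \<integral>\<^sup>+u. indicator {0..<v} u * stay (\<lambda>y. ennreal \<bar>y\<bar>) i k u \<partial>lborel) < \<infinity>"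
  and "(\<Sum>k. \<integral>\<^sup>+u. indicator {0..<v} u * leave (\<lambda>y. ennreal \<bar>y\<bar>) i k u \<partial>lborel) < \<infinity>"
proof -
 have *: "(\<Sum>k. \<integral>\<^sup>+u. indicator {0..<v} u * f k u \<partial>lborel) < \<infinity>"
  if [measurable]: "\<And>k. f k \<in> borel_measurable borel"
   and le: "\<And>k u. f k u \<le> stay (\<lambda>y. ennreal \<bar>y\<bar>) i k u + leave (\<lambda>y. ennreal \<bar>y\<bar>) i k u" for f
 proof -
  have "(\<Sum>k. \<integral>\<^sup>+u. indicator {0..<v} u * f k u \<partial>lborel) = (\<integral>\<^sup>+u. (\<Sum>k. indicator {0..<v} u * f k u) \<partial>lborel)"
   by (rule nn_integral_suminf[symmetric]) measurable
  moreover have "(\<integral>\<^sup>+u. (\<Sum>k. indicator {0..<v} u * f k u) \<partial>lborel) \<le> (\<integral>\<^sup>+u. indicator {0..<v} u * Vabs i 0 0 u \<partial>lborel)"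
  proof (rule nn_integral_mono)
   fix u :: real
   show "(\<Sum>k. indicator {0..<v} u * f k u) \<le> indicator {0..<v} u * Vabs i 0 0 u"
   proof (cases "u \<in> {0..<v}")
    case True
    have "(\<Sum>k. f k u) \<le> (\<Sum>k. stay (\<lambda>y. ennreal \<bar>y\<bar>) i k u + leave (\<lambda>y. ennreal \<bar>y\<bar>) i k u)"
     by (intro suminf_le le summableI)
    also have "\<dots> \<le> Vabs i 0 0 u"
     using True by (intro stay_leave_sum_le) auto
    finally show ?thesis using True by simp
   qed simp
  qed
  ultimately show ?thesis using Vabs_locally_integrable[OF assms, of i 0] by (simp add: order.strict_trans1)
 qed
 show "(\<Sum>k. \<integral>\<^sup>+u. indicator {0..<v} u * stay (\<lambda>y. ennreal \<bar>y\<bar>) i k u \<partial>lborel) < \<infinity>"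
  by (rule *) (auto simp: add_increasing2)
 show "(\<Sum>k. \<integral>\<^sup>+u. indicator {0..<v} u * leave (\<lambda>y. ennreal \<bar>y\<bar>) i k u \<partial>lborel) < \<infinity>"
  by (rule *) (auto simp: add_increasing)
qed

text \<open>
 The sum of the \<open>stay\<close> terms is bounded by the mean absolute displacement of the whole process.
\<close>

lemma arrival_sum_finite:
 assumes "0 < v"
 shows "(\<Sum>k. ennreal (q i k * min (1 / theta i k) v) * arrival i k v) < \<infinity>"
proof -
 have "(\<Sum>k. ennreal (q i k * min (1 / theta i k) v) * arrival i k v)
  \<le> (\<Sum>k. ennreal (5 * exp 1) * (\<integral>\<^sup>+u. indicator {0..<2 * v} u * stay (\<lambda>y. ennreal \<bar>y\<bar>) i k u \<partial>lborel))"
  by (intro suminf_le arrival_le_stay assms summableI)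
 also have "\<dots> < \<infinity>"
  using stay_leave_integrals_finite(1)[of "2 * v" i] assms
  by (simp add: ennreal_suminf_cmult ennreal_mult_less_top)
 finally show ?thesis .
qed

text \<open>
 The mean absolute displacement just after a switching that follows the \<open>n\<close>-th shock.
\<close>

definition jumpout :: "nat \<Rightarrow> nat \<Rightarrow> real \<Rightarrow> ennreal" where
 "jumpout i n v = ennreal (q i n) * (\<integral>\<^sup>+z. indicator {..v} (fst z) * (\<integral>\<^sup>+w. indicator {0<..<v} w *
   ennreal (exp (- (theta i n * w))) * (ennreal (mu i n) * (\<integral>\<^sup>+y. ennreal \<bar>snd z + c i n * w + y\<bar> \<partial>DR i n)) \<partial>lborel) \<partial>nu i n)"

text \<open>
 The displacement after the switching is the final displacement minus what the later phases add; the latter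
 has a mean that is bounded by \<open>drive\<close>.
\<close>

lemma jumpout_le:
 assumes u: "2 * v \<le> u" "0 < v"
 shows "jumpout i n v \<le> leave (\<lambda>y. ennreal \<bar>y\<bar>) i n u + drive (Vabs (Suc i) 0 0) i n u"
proof -
 define B where "B z w = (\<integral>\<^sup>+y. Vabs (Suc i) 0 (snd z + c i n * w + y) (u - fst z - w) \<partial>DR i n)" for z :: "real \<times> real" and w
 define G where "G z w = Vabs (Suc i) 0 0 (u - fst z - w)" for z :: "real \<times> real" and w
 define K where "K z w = indicator {0<..u - fst z} w * ennreal (exp (- (theta i n * w)))" for z :: "real \<times> real" and w
 have [measurable]: "(\<lambda>p. B (fst p) (snd p)) \<in> borel_measurable ((borel \<Otimes>\<^sub>M borel) \<Otimes>\<^sub>M borel)"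
  "(\<lambda>p. G (fst p) (snd p)) \<in> borel_measurable ((borel \<Otimes>\<^sub>M borel) \<Otimes>\<^sub>M borel)"
  "(\<lambda>p. K (fst p) (snd p)) \<in> borel_measurable ((borel \<Otimes>\<^sub>M borel) \<Otimes>\<^sub>M borel)"
  unfolding B_def G_def K_def by measurable
 have [measurable]: "B z \<in> borel_measurable borel" "G z \<in> borel_measurable borel" "K z \<in> borel_measurable borel" for z
  unfolding B_def G_def K_def by measurable
 have pt: "(\<integral>\<^sup>+y. ennreal \<bar>x + y\<bar> \<partial>DR i n) \<le> (\<integral>\<^sup>+y. Vabs (Suc i) 0 (x + y) t \<partial>DR i n) + Vabs (Suc i) 0 0 t" if "0 \<le> t" for x t
 proof -
  have "(\<integral>\<^sup>+y. ennreal \<bar>x + y\<bar> \<partial>DR i n) \<le> (\<integral>\<^sup>+y. Vabs (Suc i) 0 (x + y) t + Vabs (Suc i) 0 0 t \<partial>DR i n)"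
   by (intro nn_integral_mono abs_le_Vabs that)
  then show ?thesis by (simp add: nn_integral_add DR.emeasure_space_1)
 qed
 have "jumpout i n v \<le> ennreal (q i n) * (\<integral>\<^sup>+z. indicator {..u} (fst z) * (\<integral>\<^sup>+w. K z w * (ennreal (mu i n) * B z w)
    + K z w * (ennreal (mu i n) * G z w) \<partial>lborel) \<partial>nu i n)"
  unfolding jumpout_def
 proof (intro mult_left_mono nn_integral_mono)
  fix z :: "real \<times> real"
  show "indicator {..v} (fst z) * (\<integral>\<^sup>+w. indicator {0<..<v} w *
   ennreal (exp (- (theta i n * w))) * (ennreal (mu i n) * (\<integral>\<^sup>+y. ennreal \<bar>snd z + c i n * w + y\<bar> \<partial>DR i n)) \<partial>lborel)
   \<le> indicator {..u} (fst z) * (\<integral>\<^sup>+w. K z w * (ennreal (mu i n) * B z w) + K z w * (ennreal (mu i n) * G z w) \<partial>lborel)"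
  proof (cases "fst z \<le> v")
   case True
   have "(\<integral>\<^sup>+w. indicator {0<..<v} w * ennreal (exp (- (theta i n * w))) * (ennreal (mu i n) * (\<integral>\<^sup>+y. ennreal \<bar>snd z + c i n * w + y\<bar> \<partial>DR i n)) \<partial>lborel)
    \<le> (\<integral>\<^sup>+w. K z w * (ennreal (mu i n) * B z w) + K z w * (ennreal (mu i n) * G z w) \<partial>lborel)"
   proof (rule nn_integral_mono)
    fix w :: real
    show "indicator {0<..<v} w * ennreal (exp (- (theta i n * w))) * (ennreal (mu i n) * (\<integral>\<^sup>+y. ennreal \<bar>snd z + c i n * w + y\<bar> \<partial>DR i n))
     \<le> K z w * (ennreal (mu i n) * B z w) + K z w * (ennreal (mu i n) * G z w)"
     unfolding distrib_left[symmetric] K_def B_def G_def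
     using True u pt[of "u - fst z - w" "snd z + c i n * w"]
     by (cases "w \<in> {0<..<v}") (auto intro!: mult_left_mono)
   qed
   then show ?thesis using True u by simp
  qed simp
 qed simp
 also have "\<dots> = leave (\<lambda>y. ennreal \<bar>y\<bar>) i n u + drive (Vabs (Suc i) 0 0) i n u"
 proof -
  have "(\<integral>\<^sup>+w. K z w * (ennreal (mu i n) * B z w) + K z w * (ennreal (mu i n) * G z w) \<partial>lborel)
   = (\<integral>\<^sup>+w. K z w * (ennreal (mu i n) * B z w) \<partial>lborel) + (\<integral>\<^sup>+w. K z w * (ennreal (mu i n) * G z w) \<partial>lborel)" for z
   by (rule nn_integral_add) measurable
  moreover have "(\<integral>\<^sup>+z. indicator {..u} (fst z) * (\<integral>\<^sup>+w. K z w * (ennreal (mu i n) * B z w) \<partial>lborel)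
     + indicator {..u} (fst z) * (\<integral>\<^sup>+w. K z w * (ennreal (mu i n) * G z w) \<partial>lborel) \<partial>nu i n)
    = (\<integral>\<^sup>+z. indicator {..u} (fst z) * (\<integral>\<^sup>+w. K z w * (ennreal (mu i n) * B z w) \<partial>lborel) \<partial>nu i n)
     + (\<integral>\<^sup>+z. indicator {..u} (fst z) * (\<integral>\<^sup>+w. K z w * (ennreal (mu i n) * G z w) \<partial>lborel) \<partial>nu i n)"
   by (rule nn_integral_add) measurable
  ultimately show ?thesis
   unfolding leave_def drive_def K_def[symmetric] B_def[symmetric] G_def[symmetric] by (simp only: distrib_left)
 qed
 finally show ?thesis .
qed

lemma qp_summable: "(\<Sum>k. ennreal (q i k * (mu i k / theta i k))) < \<infinity>"
proof -
 have eq: "q i k * (mu i k / theta i k) = q i k - q i (Suc k)" for k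
  using theta_pos[of i k] by (simp add: q_Suc field_simps)
 have "(\<Sum>k. ennreal (q i k * (mu i k / theta i k))) \<le> 1"
 proof (rule suminf_le_const[OF summableI])
  fix n
  have nn: "0 \<le> q i k * (mu i k / theta i k)" for k
   using q_pos[of i k] mu_pos[of i k] theta_pos[of i k] by simp
  have "(\<Sum>k<n. ennreal (q i k * (mu i k / theta i k))) = ennreal (\<Sum>k<n. q i k - q i (Suc k))"
   unfolding eq[symmetric] using nn by (rule sum_ennreal)
  also have "(\<Sum>k<n. q i k - q i (Suc k)) = 1 - q i n"
   unfolding sum_lessThan_telescope' by (simp add: q_def)
  also have "ennreal (1 - q i n) \<le> ennreal 1"
   using q_pos[of i n] by (intro ennreal_leI) auto
  finally show "(\<Sum>k<n. ennreal (q i k * (mu i k / theta i k))) \<le> 1" by simp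
 qed
 then show ?thesis by (rule le_less_trans) simp
qed

text \<open>
 Both bounds in \<open>jumpout_le\<close> are summable after integration over the final time.
\<close>

lemma jumpout_tendsto_0:
 assumes v: "0 < v" shows "(\<lambda>n. jumpout i n v) \<longlonglongrightarrow> 0"
proof -
 define L where "L n = (\<integral>\<^sup>+u. indicator {0..<3 * v} u * leave (\<lambda>y. ennreal \<bar>y\<bar>) i n u \<partial>lborel)" for n
 define S where "S = (\<integral>\<^sup>+u. indicator {0..<3 * v} u * Vabs (Suc i) 0 0 u \<partial>lborel)"
 have S: "S < \<infinity>" unfolding S_def using v by (intro Vabs_locally_integrable) auto
 have le: "jumpout i n v \<le> ennreal (1 / v) * (L n + ennreal (q i n * (mu i n / theta i n)) * S)" for n
 proof -
  have "ennreal v * jumpout i n v = (\<integral>\<^sup>+u. jumpout i n v * indicator {2 * v..<3 * v} u \<partial>lborel)"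
   using v by (subst nn_integral_cmult_indicator) (auto simp: mult.commute)
  also have "\<dots> \<le> (\<integral>\<^sup>+u. indicator {0..<3 * v} u * leave (\<lambda>y. ennreal \<bar>y\<bar>) i n u + indicator {0..<3 * v} u * drive (Vabs (Suc i) 0 0) i n u \<partial>lborel)"
   using v jumpout_le[of v _ i n] by (intro nn_integral_mono) (auto simp: indicator_def)
  also have "\<dots> = L n + (\<integral>\<^sup>+u. indicator {0..<3 * v} u * drive (Vabs (Suc i) 0 0) i n u \<partial>lborel)"
   unfolding L_def by (rule nn_integral_add) measurable
  also have "\<dots> \<le> L n + ennreal (q i n * (mu i n / theta i n)) * S"
   using drive_bound[of "Vabs (Suc i) 0 0" 0 "3 * v" i n]
   by (intro add_left_mono) (simp add: S_def nu.emeasure_space_1)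
  finally have "ennreal (1 / v) * (ennreal v * jumpout i n v) \<le> ennreal (1 / v) * (L n + ennreal (q i n * (mu i n / theta i n)) * S)"
   by (rule mult_left_mono) simp
  then show ?thesis using v by (simp add: mult.assoc[symmetric] ennreal_mult[symmetric])
 qed
 have "L \<longlonglongrightarrow> 0"
  using stay_leave_integrals_finite(2)[of "3 * v" i] v unfolding L_def by (intro ennreal_summable_tendsto_0) auto
 moreover have "(\<lambda>n. ennreal (q i n * (mu i n / theta i n))) \<longlonglongrightarrow> 0"
  by (intro ennreal_summable_tendsto_0 qp_summable)
 ultimately have "(\<lambda>n. ennreal (1 / v) * (L n + ennreal (q i n * (mu i n / theta i n)) * S)) \<longlonglongrightarrow> ennreal (1 / v) * (0 + 0 * S)"
  using S by (intro ennreal_tendsto_cmult tendsto_add tendsto_mult_ennreal tendsto_const) auto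
 then have lim: "(\<lambda>n. ennreal (1 / v) * (L n + ennreal (q i n * (mu i n / theta i n)) * S)) \<longlonglongrightarrow> 0" by simp
 show ?thesis
  by (rule tendsto_sandwich[OF _ _ tendsto_const lim]) (simp, intro always_eventually allI le)
qed

text \<open>
 Averaging over the jump leaves an affine function of the waiting time; its value at the shock and its slope
 can both be read off from its integral.
\<close>

lemma jumpout_ge:
 fixes i n :: nat and v :: real
 assumes v: "0 < v"
 defines "d \<equiv> min (1 / theta i n) v"
 shows "ennreal (q i n * mu i n * d) * (\<integral>\<^sup>+z. indicator {..v} (fst z) * ennreal \<bar>snd z + mean (DR i n)\<bar> \<partial>nu i n)
   \<le> ennreal (5 * exp 1) * jumpout i n v"
  and "ennreal (q i n * mu i n * d\<^sup>2 * \<bar>c i n\<bar>) * (\<integral>\<^sup>+z. indicator {..v} (fst z) \<partial>nu i n)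
   \<le> ennreal (8 * exp 1) * jumpout i n v"
proof -
 have d: "0 < d" "d \<le> v" "theta i n * d \<le> 1"
  using v theta_pos[of i n] by (auto simp: d_def min_def field_simps)
 define f where "f x w = (\<integral>\<^sup>+y. ennreal \<bar>x + c i n * w + y\<bar> \<partial>DR i n)" for x w :: real
 have [measurable]: "(\<lambda>p. f (fst p) (snd p)) \<in> borel_measurable (borel \<Otimes>\<^sub>M borel)"
  unfolding f_def by measurable
 have [measurable]: "f x \<in> borel_measurable borel" for x
  unfolding f_def by measurable
 have fm [measurable]: "(\<lambda>p. f (snd (fst p)) (snd p)) \<in> borel_measurable ((borel \<Otimes>\<^sub>M borel) \<Otimes>\<^sub>M borel)"
  unfolding f_def by measurable
 define I where "I x = (\<integral>\<^sup>+w. indicator {0<..<d} w * f x w \<partial>lborel)" for x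
 define W where "W x = (\<integral>\<^sup>+w. indicator {0<..<v} w * ennreal (exp (- (theta i n * w))) * (ennreal (mu i n) * f x w) \<partial>lborel)" for x
 have W: "ennreal (mu i n) * I x \<le> ennreal (exp 1) * W x" for x
 proof -
  have "ennreal (mu i n) * I x = (\<integral>\<^sup>+w. ennreal (mu i n) * (indicator {0<..<d} w * f x w) \<partial>lborel)"
   unfolding I_def by (rule nn_integral_cmult[symmetric]) measurable
  also have "\<dots> \<le> (\<integral>\<^sup>+w. ennreal (exp 1) * (indicator {0<..<v} w * ennreal (exp (- (theta i n * w))) * (ennreal (mu i n) * f x w)) \<partial>lborel)"
  proof (rule nn_integral_mono)
   fix w :: real
   show "ennreal (mu i n) * (indicator {0<..<d} w * f x w) \<le> ennreal (exp 1) * (indicator {0<..<v} w * ennreal (exp (- (theta i n * w))) * (ennreal (mu i n) * f x w))"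
   proof (cases "0 < w \<and> w < d")
    case True
    have "theta i n * w \<le> theta i n * d" using True theta_pos[of i n] by (intro mult_left_mono) auto
    then have "1 \<le> exp (1 - theta i n * w)" using d by simp
    also have "exp (1 - theta i n * w) = exp 1 * exp (- (theta i n * w))" by (simp add: exp_add[symmetric])
    finally have "ennreal 1 \<le> ennreal (exp 1) * ennreal (exp (- (theta i n * w)))"
     by (subst ennreal_mult[symmetric]) (auto intro: ennreal_leI)
    from mult_right_mono[OF this, of "ennreal (mu i n) * f x w"]
    show ?thesis using True d by (simp add: mult.assoc)
   qed auto
  qed
  also have "\<dots> = ennreal (exp 1) * W x"
   unfolding W_def by (rule nn_integral_cmult) measurable
  finally show ?thesis .
 qed
 have jump: "jumpout i n v = ennreal (q i n) * (\<integral>\<^sup>+z. indicator {..v} (fst z) * W (snd z) \<partial>nu i n)"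
  unfolding jumpout_def W_def f_def ..
 have Wm [measurable]: "(\<lambda>z. W (snd z)) \<in> borel_measurable (borel \<Otimes>\<^sub>M borel)"
  unfolding W_def by measurable
 have general: "ennreal (q i n * mu i n) * (\<integral>\<^sup>+z. indicator {..v} (fst z) * G (snd z) \<partial>nu i n) \<le> ennreal (K * exp 1) * jumpout i n v"
  if G: "\<And>x. G x \<le> ennreal K * I x" and "0 \<le> K" and [measurable]: "G \<in> borel_measurable borel" for G K
 proof -
  have "ennreal (q i n * mu i n) * (\<integral>\<^sup>+z. indicator {..v} (fst z) * G (snd z) \<partial>nu i n)
   = ennreal (q i n) * (\<integral>\<^sup>+z. ennreal (mu i n) * (indicator {..v} (fst z) * G (snd z)) \<partial>nu i n)"
   using q_pos[of i n] mu_pos[of i n] by (subst nn_integral_cmult) (auto simp: ennreal_mult mult.assoc)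
  also have "\<dots> \<le> ennreal (q i n) * (\<integral>\<^sup>+z. ennreal (K * exp 1) * (indicator {..v} (fst z) * W (snd z)) \<partial>nu i n)"
  proof (intro mult_left_mono nn_integral_mono)
   fix z :: "real \<times> real"
   have "ennreal (mu i n) * G (snd z) \<le> ennreal K * (ennreal (mu i n) * I (snd z))"
    using mult_left_mono[OF G[of "snd z"], of "ennreal (mu i n)"] by (simp add: mult_ac)
   also have "\<dots> \<le> ennreal K * (ennreal (exp 1) * W (snd z))"
    by (intro mult_left_mono W) auto
   finally have "ennreal (mu i n) * G (snd z) \<le> ennreal (K * exp 1) * W (snd z)"
    using \<open>0 \<le> K\<close> by (simp add: ennreal_mult mult.assoc)
   then show "ennreal (mu i n) * (indicator {..v} (fst z) * G (snd z)) \<le> ennreal (K * exp 1) * (indicator {..v} (fst z) * W (snd z))"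
    by (auto simp: indicator_def)
  qed simp
  also have "\<dots> = ennreal (K * exp 1) * jumpout i n v"
   unfolding jump by (subst nn_integral_cmult) (auto simp: mult_ac)
  finally show ?thesis .
 qed
 have "ennreal \<bar>x + mean (DR i n)\<bar> * ennreal d \<le> ennreal 5 * I x" for x
 proof -
  have "ennreal \<bar>x + mean (DR i n) + c i n * w\<bar> \<le> f x w" for w
  proof -
   have int: "integrable (DR i n) (\<lambda>y. x + c i n * w + y)" using DR_mean[of i n] by simp
   have "(\<integral>y. x + c i n * w + y \<partial>DR i n) = x + c i n * w + mean (DR i n)"
    using DR_mean[of i n] by (simp add: mean_def DR.prob_space)
   with integral_norm_bound_ennreal[OF int] show ?thesis
    unfolding f_def by (simp add: add_ac)
  qed
  then have "(\<integral>\<^sup>+w. indicator {0<..<d} w * ennreal \<bar>x + mean (DR i n) + c i n * w\<bar> \<partial>lborel) \<le> I x"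
   unfolding I_def by (intro nn_integral_mono mult_left_mono) auto
  from mult_left_mono[OF this, of 5] order_trans[OF affine_integral_bound[OF d(1), of "x + mean (DR i n)" "c i n"]]
  show ?thesis using d by (simp add: ennreal_mult)
 qed
 note g1 = general[of "\<lambda>x. ennreal \<bar>x + mean (DR i n)\<bar> * ennreal d" 5, OF this]
 have "(\<integral>\<^sup>+z. indicator {..v} (fst z) * (ennreal \<bar>snd z + mean (DR i n)\<bar> * ennreal d) \<partial>nu i n)
   = (\<integral>\<^sup>+z. indicator {..v} (fst z) * ennreal \<bar>snd z + mean (DR i n)\<bar> \<partial>nu i n) * ennreal d"
  unfolding mult.assoc[symmetric] by (rule nn_integral_multc) measurable
 moreover have "ennreal (q i n * mu i n * d) = ennreal (q i n * mu i n) * ennreal d"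
  using d q_pos[of i n] mu_pos[of i n] by (intro ennreal_mult) auto
 ultimately show "ennreal (q i n * mu i n * d) * (\<integral>\<^sup>+z. indicator {..v} (fst z) * ennreal \<bar>snd z + mean (DR i n)\<bar> \<partial>nu i n)
   \<le> ennreal (5 * exp 1) * jumpout i n v"
  using g1 by (simp add: mult.assoc mult.commute[of "ennreal d"])
 have "ennreal (\<bar>c i n\<bar> * d\<^sup>2) \<le> ennreal 8 * I x" for x
 proof -
  have "ennreal (\<bar>c i n\<bar> * (d/2)) \<le> f x w + f x (w + d/2)" for w
  proof -
   have "(\<integral>\<^sup>+y. ennreal (\<bar>c i n\<bar> * (d/2)) \<partial>DR i n) \<le> (\<integral>\<^sup>+y. ennreal \<bar>x + c i n * w + y\<bar> + ennreal \<bar>x + c i n * (w + d/2) + y\<bar> \<partial>DR i n)"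
   proof (rule nn_integral_mono)
    fix y
    have "\<bar>c i n\<bar> * (d/2) = \<bar>(x + c i n * (w + d/2) + y) - (x + c i n * w + y)\<bar>"
     using d by (simp add: abs_mult distrib_left)
    also have "\<dots> \<le> \<bar>x + c i n * w + y\<bar> + \<bar>x + c i n * (w + d/2) + y\<bar>" by simp
    finally show "ennreal (\<bar>c i n\<bar> * (d/2)) \<le> ennreal \<bar>x + c i n * w + y\<bar> + ennreal \<bar>x + c i n * (w + d/2) + y\<bar>"
     using ennreal_leI by (simp add: ennreal_plus[symmetric] del: ennreal_plus)
   qed
   then show ?thesis unfolding f_def by (simp add: nn_integral_add DR.emeasure_space_1)
  qed
  from two_point_bound[of "f x" "d/2", OF _ _ this]
  have "ennreal (\<bar>c i n\<bar> * (d/2)) * ennreal (d/2) \<le> 2 * I x" using d by (simp add: I_def)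
  from mult_left_mono[OF this, of 4]
  have "ennreal 4 * (ennreal (\<bar>c i n\<bar> * (d/2)) * ennreal (d/2)) \<le> ennreal 8 * I x" by (simp add: mult.assoc[symmetric])
  also have "ennreal 4 * (ennreal (\<bar>c i n\<bar> * (d/2)) * ennreal (d/2)) = ennreal (4 * (\<bar>c i n\<bar> * (d/2) * (d/2)))"
  proof -
   have "ennreal (\<bar>c i n\<bar> * (d/2)) * ennreal (d/2) = ennreal (\<bar>c i n\<bar> * (d/2) * (d/2))"
    by (rule ennreal_mult[symmetric]) (use d in auto)
   moreover have "ennreal 4 * ennreal (\<bar>c i n\<bar> * (d/2) * (d/2)) = ennreal (4 * (\<bar>c i n\<bar> * (d/2) * (d/2)))"
    by (rule ennreal_mult[symmetric]) (use d in auto)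
   ultimately show ?thesis by (simp only:)
  qed
  also have "4 * (\<bar>c i n\<bar> * (d/2) * (d/2)) = \<bar>c i n\<bar> * d\<^sup>2" by (simp add: power2_eq_square)
  finally show ?thesis .
 qed
 note g2 = general[of "\<lambda>x. ennreal (\<bar>c i n\<bar> * d\<^sup>2)" 8, OF this]
 have "(\<integral>\<^sup>+z. indicator {..v} (fst z) * ennreal (\<bar>c i n\<bar> * d\<^sup>2) \<partial>nu i n)
   = (\<integral>\<^sup>+z. indicator {..v} (fst z) \<partial>nu i n) * ennreal (\<bar>c i n\<bar> * d\<^sup>2)"
  by (rule nn_integral_multc) measurable
 moreover have "ennreal (q i n * mu i n * d\<^sup>2 * \<bar>c i n\<bar>) = ennreal (q i n * mu i n) * ennreal (\<bar>c i n\<bar> * d\<^sup>2)"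
  using d q_pos[of i n] mu_pos[of i n] by (subst ennreal_mult[symmetric]) (auto simp: mult_ac)
 ultimately show "ennreal (q i n * mu i n * d\<^sup>2 * \<bar>c i n\<bar>) * (\<integral>\<^sup>+z. indicator {..v} (fst z) \<partial>nu i n)
   \<le> ennreal (8 * exp 1) * jumpout i n v"
  using g2 by (simp add: mult.assoc mult.commute[of "ennreal (\<bar>c i n\<bar> * d\<^sup>2)"])
qed

end

section \<open>Vanishing of the means under the balance condition\<close>

lemma measurable_indicator_Iic_real [measurable (raw)]:
 assumes [measurable]: "f \<in> borel_measurable M" "g \<in> borel_measurable M"
 shows "(\<lambda>x. indicator {..g x} (f x :: real) :: real) \<in> borel_measurable M"
 unfolding indicator_def atMost_iff by measurable

context integrable_kernel
begin

text \<open>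
 The factors of \<open>1 / kappa\<close> are at most \<open>theta i k * (1 + theta i 0 / theta i k)\<close>,
 and the product of the second factors is bounded if \<open>1 / theta\<close> is summable.
\<close>

lemma series_term_bound:
 assumes sm: "summable (\<lambda>n. 1 / theta i n)" and inj: "inj (theta i)"
 obtains C where "\<And>n x. \<bar>x\<bar> * (q i n / theta i n) \<le> C * \<bar>x * Lam (lam i) n * kappa (theta i) n 0\<bar>"
proof -
 define E where "E = exp (theta i 0 * (\<Sum>n. 1 / theta i n))"
 have le: "\<bar>x\<bar> * (q i n / theta i n) \<le> E / theta i 0 * \<bar>x * Lam (lam i) n * kappa (theta i) n 0\<bar>" for n x
 proof -
  let ?J = "{0..n} - {0}"
  have "1 \<le> E * \<bar>kappa (theta i) n 0\<bar> * (\<Prod>j\<in>?J. theta i j)"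
  proof -
   have "(\<Prod>j\<in>?J. \<bar>theta i j - theta i 0\<bar>) \<le> (\<Prod>j\<in>?J. theta i j * exp (theta i 0 * (1 / theta i j)))"
   proof (rule prod_mono, intro conjI abs_ge_zero)
    fix j
    have "\<bar>theta i j - theta i 0\<bar> \<le> theta i j * (1 + theta i 0 * (1 / theta i j))"
    proof -
     have "x * (1 + y * (1 / x)) = x + y" if "0 < x" for x y :: real
      using that by (simp add: distrib_left)
     from this[OF theta_pos[of i j], of "theta i 0"] show ?thesis using theta_pos[of i j] theta_pos[of i 0] by linarith
    qed
    also have "\<dots> \<le> theta i j * exp (theta i 0 * (1 / theta i j))"
     using theta_pos[of i j] by (intro mult_left_mono exp_ge_add_one_self) auto
    finally show "\<bar>theta i j - theta i 0\<bar> \<le> theta i j * exp (theta i 0 * (1 / theta i j))" .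
   qed
   also have "\<dots> = (\<Prod>j\<in>?J. theta i j) * exp (theta i 0 * (\<Sum>j\<in>?J. 1 / theta i j))"
    by (simp only: prod.distrib exp_sum sum_distrib_left finite_Diff finite_atLeastAtMost)
   also have "\<dots> \<le> (\<Prod>j\<in>?J. theta i j) * E"
   proof (intro mult_left_mono prod_nonneg)
    have "(\<Sum>j\<in>?J. 1 / theta i j) \<le> (\<Sum>n. 1 / theta i n)"
     by (rule sum_le_suminf[OF sm]) (auto simp: less_imp_le[OF theta_pos])
    then show "exp (theta i 0 * (\<Sum>j\<in>?J. 1 / theta i j)) \<le> E"
     unfolding E_def using theta_pos[of i 0] by (simp add: mult_left_mono)
   qed (use theta_pos in \<open>auto intro: less_imp_le\<close>)
   finally have le: "(\<Prod>j\<in>?J. \<bar>theta i j - theta i 0\<bar>) \<le> (\<Prod>j\<in>?J. theta i j) * E" .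
   have pos: "0 < (\<Prod>j\<in>?J. \<bar>theta i j - theta i 0\<bar>)"
    using inj by (intro prod_pos) (auto dest: injD)
   have kap: "\<bar>kappa (theta i) n 0\<bar> = inverse (\<Prod>j\<in>?J. \<bar>theta i j - theta i 0\<bar>)"
    unfolding kappa_def by (simp only: abs_prod abs_inverse prod_inversef[symmetric] o_def)
   from le pos show ?thesis unfolding kap by (simp add: field_simps)
  qed
  then have "1 / (\<Prod>j\<in>?J. theta i j) \<le> E * \<bar>kappa (theta i) n 0\<bar>"
   using prod_pos[of ?J "theta i"] theta_pos by (simp add: field_simps)
  from mult_left_mono[OF this, of "\<bar>x\<bar> * Lam (lam i) n / theta i 0"]
  have "\<bar>x\<bar> * Lam (lam i) n / theta i 0 * (1 / (\<Prod>j\<in>?J. theta i j))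
    \<le> \<bar>x\<bar> * Lam (lam i) n / theta i 0 * (E * \<bar>kappa (theta i) n 0\<bar>)"
   using lam_pos theta_pos[of i 0] by (simp add: Lam_def prod_nonneg less_imp_le)
  moreover have "q i n / theta i n = Lam (lam i) n / theta i 0 * (1 / (\<Prod>j\<in>?J. theta i j))"
  proof -
   have "(\<Prod>k<n. theta i k) * theta i n = (\<Prod>k\<le>n. theta i k)" by (simp add: lessThan_Suc_atMost[symmetric])
   also have "\<dots> = theta i 0 * (\<Prod>j\<in>?J. theta i j)"
    by (subst prod.remove[of "{..n}" 0]) (auto simp: atLeast0AtMost)
   finally show ?thesis by (simp add: q_def Lam_def prod_dividef divide_divide_eq_left)
  qed
  moreover have "0 \<le> Lam (lam i) n" using lam_pos by (simp add: Lam_def prod_nonneg less_imp_le)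
  ultimately show ?thesis by (simp add: abs_mult mult_ac)
 qed
 show thesis by (rule that[OF le])
qed

text \<open>
 If \<open>1 / theta\<close> is not summable, neither is \<open>min (1 / theta) v\<close>, and
 \<open>arrival_sum_finite\<close> forces small values. If it is summable, then \<open>lam \<le> mu\<close>
 infinitely often, as otherwise \<open>1 / lam\<close> would be summable. For such \<open>n\<close> a
 switching is at least as likely as a shock, so \<open>jumpout_ge\<close> bounds the displacement shifted by
 the mean \<open>R\<close> jump and the drift \<open>c / theta\<close>; the drift series bounds the
 combination of this mean with the drift, and hence the mean itself.
\<close>

lemma arrival_frequently_small:
 assumes nonexp: "\<not> summable (\<lambda>n. 1 / lam i n)" and inj: "inj (theta i)"
  and lim: "(\<lambda>n. (c i n + mu i n * mean (DR i n)) * Lam (lam i) n * kappa (theta i) n 0) \<longlonglongrightarrow> 0"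
  and v: "0 < v" and e: "0 < (e::ennreal)"
 shows "\<exists>\<^sub>F n in sequentially. ennreal (q i n) * arrival i n v < e"
proof (cases "summable (\<lambda>n. 1 / theta i n)")
 case True
 obtain C where C: "\<And>n x. \<bar>x\<bar> * (q i n / theta i n) \<le> C * \<bar>x * Lam (lam i) n * kappa (theta i) n 0\<bar>"
  using series_term_bound[OF True inj] by blast
 define t where "t n = (c i n + mu i n * mean (DR i n)) * Lam (lam i) n * kappa (theta i) n 0" for n
 \<comment> \<open>The constant is \<open>2 * (5 + 16)\<close>: the constants of \<open>jumpout_ge\<close>, where the drift enters twice and \<open>mu / theta \<ge> 1 / 2\<close> is divided out.\<close>
 define G where "G n = ennreal (42 * exp 1) * jumpout i n v + ennreal (2 * (C * \<bar>t n\<bar>))" for n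
 have G0: "G \<longlonglongrightarrow> 0"
 proof -
  have "(\<lambda>n. ennreal (2 * (C * \<bar>t n\<bar>))) \<longlonglongrightarrow> ennreal (2 * (C * \<bar>0\<bar>))"
   using lim unfolding t_def[symmetric] by (intro tendsto_intros)
  moreover have "(\<lambda>n. ennreal (42 * exp 1) * jumpout i n v) \<longlonglongrightarrow> ennreal (42 * exp 1) * 0"
   using jumpout_tendsto_0[OF v] by (intro ennreal_tendsto_cmult) auto
  ultimately show ?thesis unfolding G_def using tendsto_add by fastforce
 qed
 have bound: "ennreal (q i n) * arrival i n v \<le> G n" if \<mu>: "lam i n \<le> mu i n" and d: "1 / theta i n \<le> v" for n
 proof -
  have dd: "min (1 / theta i n) v = 1 / theta i n" using d by simp
  define m where "m = mean (DR i n)"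
  define B where "B = (\<integral>\<^sup>+z. indicator {..v} (fst z) * ennreal \<bar>snd z + m\<bar> \<partial>nu i n)"
  define P where "P = (\<integral>\<^sup>+z. indicator {..v} (fst z) \<partial>nu i n)"
  have P1: "P \<le> 1"
  proof -
   have "P \<le> (\<integral>\<^sup>+z. 1 \<partial>nu i n)" unfolding P_def by (intro nn_integral_mono) (auto simp: indicator_def)
   then show ?thesis by (simp add: nu.emeasure_space_1)
  qed
  have arr: "arrival i n v \<le> B + ennreal \<bar>m\<bar> * P"
  proof -
   have "arrival i n v \<le> (\<integral>\<^sup>+z. indicator {..v} (fst z) * ennreal \<bar>snd z + m\<bar> + ennreal \<bar>m\<bar> * indicator {..v} (fst z) \<partial>nu i n)"
    unfolding arrival_def
   proof (rule nn_integral_mono)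
    fix z :: "real \<times> real"
    show "indicator {..v} (fst z) * ennreal \<bar>snd z\<bar> \<le> indicator {..v} (fst z) * ennreal \<bar>snd z + m\<bar> + ennreal \<bar>m\<bar> * indicator {..v} (fst z)"
     using ennreal_abs_triangle[of "snd z + m" "- m"] by (cases "fst z \<le> v") auto
   qed
   also have "\<dots> = B + ennreal \<bar>m\<bar> * P"
    unfolding B_def P_def by (subst nn_integral_add) (auto simp: nn_integral_cmult)
   finally show ?thesis .
  qed
  define p where "p = mu i n / theta i n"
  have p: "1 / 2 \<le> p" using \<mu> theta_pos[of i n] by (simp add: p_def field_simps)
  have q0: "0 < q i n" by (rule q_pos)
  have J1: "ennreal (q i n * p) * B \<le> ennreal (5 * exp 1) * jumpout i n v"
   using jumpout_ge(1)[OF v, of i n] unfolding dd B_def m_def p_def by simp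
  have J2: "ennreal (q i n * p * (\<bar>c i n\<bar> / theta i n)) * P \<le> ennreal (8 * exp 1) * jumpout i n v"
  proof -
   have "q i n * mu i n * (1 / theta i n)\<^sup>2 * \<bar>c i n\<bar> = q i n * p * (\<bar>c i n\<bar> / theta i n)"
    by (simp add: p_def power2_eq_square)
   then show ?thesis using jumpout_ge(2)[OF v, of i n] unfolding dd P_def by simp
  qed
  have J3: "ennreal (q i n * p * \<bar>m\<bar>) * P \<le> ennreal (C * \<bar>t n\<bar>) + ennreal (16 * exp 1) * jumpout i n v"
  proof -
   have "q i n * p * \<bar>m\<bar> \<le> C * \<bar>t n\<bar> + 2 * (q i n * p * (\<bar>c i n\<bar> / theta i n))"
   proof -
    have "mu i n * \<bar>m\<bar> \<le> \<bar>c i n + mu i n * m\<bar> + \<bar>c i n\<bar>"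
     using mu_pos[of i n] abs_triangle_ineq4[of "c i n + mu i n * m" "c i n"] by (simp add: abs_mult)
    then have "mu i n * \<bar>m\<bar> * (q i n / theta i n) \<le> (\<bar>c i n + mu i n * m\<bar> + \<bar>c i n\<bar>) * (q i n / theta i n)"
     using q0 theta_pos[of i n] by (intro mult_right_mono) auto
    moreover have "\<bar>c i n + mu i n * m\<bar> * (q i n / theta i n) \<le> C * \<bar>t n\<bar>"
     using C[of "c i n + mu i n * m" n] unfolding t_def m_def .
    moreover have "1 * (\<bar>c i n\<bar> * (q i n / theta i n)) \<le> (2 * p) * (\<bar>c i n\<bar> * (q i n / theta i n))"
     using p q0 theta_pos[of i n] by (intro mult_right_mono) auto
    moreover have "q i n * p * \<bar>m\<bar> = mu i n * \<bar>m\<bar> * (q i n / theta i n)"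
     "2 * (q i n * p * (\<bar>c i n\<bar> / theta i n)) = (2 * p) * (\<bar>c i n\<bar> * (q i n / theta i n))"
     by (simp_all add: p_def)
    ultimately show ?thesis unfolding distrib_right by linarith
   qed
   then have "ennreal (q i n * p * \<bar>m\<bar>) * P \<le> ennreal (C * \<bar>t n\<bar> + 2 * (q i n * p * (\<bar>c i n\<bar> / theta i n))) * P"
    by (intro mult_right_mono ennreal_leI) auto
   also have "\<dots> \<le> (ennreal (C * \<bar>t n\<bar>) + 2 * ennreal (q i n * p * (\<bar>c i n\<bar> / theta i n))) * P"
   proof (intro mult_right_mono)
    have C0: "0 \<le> C * \<bar>t n\<bar>"
     unfolding t_def
     by (rule order_trans[OF _ C[of "c i n + mu i n * mean (DR i n)" n]]) (use q0 theta_pos[of i n] in auto)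
    have "ennreal (2 * (q i n * p * (\<bar>c i n\<bar> / theta i n))) = 2 * ennreal (q i n * p * (\<bar>c i n\<bar> / theta i n))"
     using p q0 theta_pos[of i n] by (subst ennreal_mult) auto
    then show "ennreal (C * \<bar>t n\<bar> + 2 * (q i n * p * (\<bar>c i n\<bar> / theta i n))) \<le> ennreal (C * \<bar>t n\<bar>) + 2 * ennreal (q i n * p * (\<bar>c i n\<bar> / theta i n))"
     using C0 p q0 theta_pos[of i n] by (subst ennreal_plus) auto
   qed simp
   also have "\<dots> = ennreal (C * \<bar>t n\<bar>) * P + 2 * (ennreal (q i n * p * (\<bar>c i n\<bar> / theta i n)) * P)"
    by (simp only: distrib_right mult.assoc)
   also have "\<dots> \<le> ennreal (C * \<bar>t n\<bar>) * 1 + 2 * (ennreal (8 * exp 1) * jumpout i n v)"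
    by (intro add_mono mult_left_mono P1 J2) auto
   also have "2 * (ennreal (8 * exp 1) * jumpout i n v) = ennreal (16 * exp 1) * jumpout i n v"
   proof -
    have "ennreal (16 * exp 1) = ennreal 2 * ennreal (8 * exp 1)" by (subst ennreal_mult[symmetric]) auto
    then show ?thesis by (simp add: mult.assoc)
   qed
   finally show ?thesis by simp
  qed
  have "ennreal (q i n) * arrival i n v \<le> ennreal (2 * (q i n * p)) * (B + ennreal \<bar>m\<bar> * P)"
  proof (intro mult_mono arr ennreal_leI)
   have "q i n * 1 \<le> q i n * (2 * p)" using p q0 by (intro mult_left_mono) auto
   then show "q i n \<le> 2 * (q i n * p)" by simp
  qed auto
  also have "\<dots> = 2 * (ennreal (q i n * p) * B + ennreal (q i n * p * \<bar>m\<bar>) * P)"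
  proof -
   have "ennreal (2 * (q i n * p)) = 2 * ennreal (q i n * p)" using p q0 by (subst ennreal_mult) auto
   moreover have "ennreal (q i n * p * \<bar>m\<bar>) = ennreal (q i n * p) * ennreal \<bar>m\<bar>" using p q0 by (intro ennreal_mult) auto
   ultimately show ?thesis by (simp only: distrib_left mult.assoc)
  qed
  also have "\<dots> \<le> 2 * (ennreal (5 * exp 1) * jumpout i n v + (ennreal (C * \<bar>t n\<bar>) + ennreal (16 * exp 1) * jumpout i n v))"
   by (intro mult_left_mono add_mono J1 J3) auto
  also have "\<dots> = G n"
  proof -
   have "ennreal (42 * exp 1) = ennreal 2 * (ennreal (5 * exp 1) + ennreal (16 * exp 1))"
    by (subst ennreal_plus[symmetric], simp, simp, subst ennreal_mult[symmetric]) auto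
   moreover have "ennreal (2 * (C * \<bar>t n\<bar>)) = 2 * ennreal (C * \<bar>t n\<bar>)"
    by (subst ennreal_mult') auto
   ultimately show ?thesis unfolding G_def by (simp add: distrib_left distrib_right mult.assoc add_ac)
  qed
  finally show ?thesis .
 qed
 have freq: "\<exists>\<^sub>F n in sequentially. lam i n \<le> mu i n"
 proof (rule ccontr)
  assume "\<not> ?thesis"
  then have "\<forall>\<^sub>F n in sequentially. norm (1 / lam i n) \<le> 2 * (1 / theta i n)"
   unfolding not_frequently
  proof eventually_elim
   case (elim n)
   then show ?case using lam_pos[of i n] theta_pos[of i n] by (simp add: field_simps)
  qed
  then have "summable (\<lambda>n. 1 / lam i n)"
   using summable_mult[OF True] by (rule summable_comparison_test_ev)
  with nonexp show False by simp
 qed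
 have ev1: "\<forall>\<^sub>F n in sequentially. 1 / theta i n \<le> v"
  using order_tendstoD(2)[OF summable_LIMSEQ_zero[OF True] v] by eventually_elim simp
 have ev2: "\<forall>\<^sub>F n in sequentially. G n < e"
  by (rule order_tendstoD(2)[OF G0 e])
 have "\<forall>\<^sub>F n in sequentially. lam i n \<le> mu i n \<longrightarrow> ennreal (q i n) * arrival i n v < e"
  using ev1 ev2 by eventually_elim (use bound in \<open>blast intro: le_less_trans\<close>)
 with freq show ?thesis by (rule frequently_mp[rotated])
next
 case False
 define d where "d n = min (1 / theta i n) v" for n
 have d0: "0 < d n" for n using v theta_pos[of i n] by (simp add: d_def)
 show ?thesis
 proof (rule ccontr)
  assume "\<not> ?thesis"
  then have "\<forall>\<^sub>F n in sequentially. e \<le> ennreal (q i n) * arrival i n v"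
   unfolding not_frequently by eventually_elim simp
  then obtain N where N: "\<And>n. N \<le> n \<Longrightarrow> e \<le> ennreal (q i n) * arrival i n v"
   by (auto simp: eventually_sequentially)
  have "e * (\<Sum>n. ennreal (d (n + N))) = (\<Sum>n. e * ennreal (d (n + N)))"
   by simp
  also have "\<dots> \<le> (\<Sum>n. ennreal (q i (n + N) * d (n + N)) * arrival i (n + N) v)"
  proof (intro suminf_le summableI)
   fix n
   show "e * ennreal (d (n + N)) \<le> ennreal (q i (n + N) * d (n + N)) * arrival i (n + N) v"
    using mult_right_mono[OF N[of "n + N"], of "ennreal (d (n + N))"] q_pos[of i "n + N"] d0[of "n + N"]
    by (simp add: ennreal_mult mult_ac)
  qed
  also have "\<dots> \<le> (\<Sum>n. ennreal (q i n * d n) * arrival i n v)"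
   using suminf_offset[of "\<lambda>n. ennreal (q i n * d n) * arrival i n v" N] by (simp add: add.commute)
  also have "\<dots> < \<infinity>"
   using arrival_sum_finite[OF v, of i] unfolding d_def .
  finally have "(\<Sum>n. ennreal (d (n + N))) < \<infinity>"
   using e by (auto simp: ennreal_mult_less_top)
  then have "summable (\<lambda>n. d (n + N))"
   by (intro summable_suminf_not_top) (auto simp: less_imp_le[OF d0])
  then have sd: "summable d" by (simp add: summable_iff_shift)
  have "\<forall>\<^sub>F n in sequentially. d n < v"
   by (rule order_tendstoD(2)[OF summable_LIMSEQ_zero[OF sd] v])
  then have "\<forall>\<^sub>F n in sequentially. norm (1 / theta i n) \<le> d n"
   by eventually_elim (use theta_pos in \<open>auto simp: d_def min_def less_imp_le split: if_splits\<close>)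
  then have "summable (\<lambda>n. 1 / theta i n)"
   using sd by (rule summable_comparison_test_ev)
  with False show False by simp
 qed
qed

text \<open>
 The remainder: the mean displacement gained after the \<open>n\<close>-th shock of the phase, on the event
 that this shock precedes \<open>u\<close>.
\<close>

definition R :: "nat \<Rightarrow> nat \<Rightarrow> real \<Rightarrow> real" where
 "R i n u = q i n * (\<integral>z. indicator {..u} (fst z) * a i n (u - fst z) \<partial>nu i n)"

lemma measurable_R [measurable]: "R i n \<in> borel_measurable borel"
 unfolding R_def[abs_def] by measurable

lemma reach_finite:
 assumes "0 \<le> u"
 shows "(\<integral>\<^sup>+z. indicator {..u} (fst z) * Vabs i n (snd z) (u - fst z) \<partial>nu i n) < \<infinity>"
proof -
 have "reach (\<lambda>y. ennreal \<bar>y\<bar>) i n u \<le> Vabs i 0 0 u"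
  by (subst V_decomposition[OF _ assms, where N = n]) (auto simp: add_increasing)
 also have "\<dots> < \<infinity>" by (rule V_abs_finite[OF assms])
 finally show ?thesis
  using q_pos[of i n] by (auto simp: reach_def ennreal_mult_less_top)
qed

lemma R_integrable:
 assumes u: "0 \<le> u" shows "integrable (nu i n) (\<lambda>z. indicator {..u} (fst z) * a i n (u - fst z))"
proof (rule integrableI_bounded)
 have "(\<integral>\<^sup>+z. ennreal (norm (indicator {..u} (fst z) * a i n (u - fst z))) \<partial>nu i n)
   \<le> (\<integral>\<^sup>+z. indicator {..u} (fst z) * Vabs i n (snd z) (u - fst z) + ennreal \<bar>snd z\<bar> \<partial>nu i n)"
 proof (rule nn_integral_mono)
  fix z :: "real \<times> real"
  show "ennreal (norm (indicator {..u} (fst z) * a i n (u - fst z))) \<le> indicator {..u} (fst z) * Vabs i n (snd z) (u - fst z) + ennreal \<bar>snd z\<bar>"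
  proof (cases "fst z \<le> u")
   case True
   have "ennreal \<bar>a i n (u - fst z)\<bar> \<le> ennreal \<bar>snd z + a i n (u - fst z)\<bar> + ennreal \<bar>snd z\<bar>"
    using ennreal_abs_triangle[of "snd z + a i n (u - fst z)" "- snd z"] by simp
   also have "\<dots> \<le> Vabs i n (snd z) (u - fst z) + ennreal \<bar>snd z\<bar>"
    using True by (intro add_right_mono V_mean(4)) auto
   finally show ?thesis using True by simp
  qed simp
 qed
 also have "\<dots> < \<infinity>"
  using reach_finite[OF u, of i n] nu_abs_finite[of i n] by (subst nn_integral_add) auto
 finally show "(\<integral>\<^sup>+z. ennreal (norm (indicator {..u} (fst z) * a i n (u - fst z))) \<partial>nu i n) < \<infinity>" .
qed measurable

lemma R_0: "0 \<le> u \<Longrightarrow> R i 0 u = a i 0 u"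
 by (simp add: R_def q_def integral_return space_pair_measure)

text \<open>
 The later gain is the final displacement minus the displacement at the shock.
\<close>

lemma R_bound:
 assumes u: "0 \<le> u"
 shows "ennreal \<bar>R i n u\<bar> \<le> reach (\<lambda>y. ennreal \<bar>y\<bar>) i n u + ennreal (q i n) * arrival i n u"
proof -
 have "ennreal \<bar>R i n u\<bar> = ennreal (q i n) * ennreal (norm (\<integral>z. indicator {..u} (fst z) * a i n (u - fst z) \<partial>nu i n))"
  using q_pos[of i n] by (simp add: R_def abs_mult ennreal_mult)
 also have "\<dots> \<le> ennreal (q i n) * (\<integral>\<^sup>+z. ennreal (norm (indicator {..u} (fst z) * a i n (u - fst z))) \<partial>nu i n)"
  by (intro mult_left_mono integral_norm_bound_ennreal R_integrable u) auto
 also have "\<dots> \<le> ennreal (q i n) * (\<integral>\<^sup>+z. indicator {..u} (fst z) * Vabs i n (snd z) (u - fst z) + indicator {..u} (fst z) * ennreal \<bar>snd z\<bar> \<partial>nu i n)"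
 proof (intro mult_left_mono nn_integral_mono)
  fix z :: "real \<times> real"
  show "ennreal (norm (indicator {..u} (fst z) * a i n (u - fst z))) \<le> indicator {..u} (fst z) * Vabs i n (snd z) (u - fst z) + indicator {..u} (fst z) * ennreal \<bar>snd z\<bar>"
  proof (cases "fst z \<le> u")
   case True
   have "ennreal \<bar>a i n (u - fst z)\<bar> \<le> ennreal \<bar>snd z + a i n (u - fst z)\<bar> + ennreal \<bar>snd z\<bar>"
    using ennreal_abs_triangle[of "snd z + a i n (u - fst z)" "- snd z"] by simp
   also have "\<dots> \<le> Vabs i n (snd z) (u - fst z) + ennreal \<bar>snd z\<bar>"
    using True by (intro add_right_mono V_mean(4)) auto
   finally show ?thesis using True by simp
  qed simp
 qed simp
 also have "\<dots> = reach (\<lambda>y. ennreal \<bar>y\<bar>) i n u + ennreal (q i n) * arrival i n u"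
  unfolding reach_def arrival_def by (subst nn_integral_add) (auto simp: distrib_left)
 finally show ?thesis .
qed

lemma nrm_R_bound:
 assumes v: "0 < v"
 shows "nrm v (R i n) \<le> (\<integral>\<^sup>+u. indicator {0..<v} u * reach (\<lambda>y. ennreal \<bar>y\<bar>) i n u \<partial>lborel)
  + ennreal v * (ennreal (q i n) * arrival i n v)"
proof -
 have "nrm v (R i n) \<le> (\<integral>\<^sup>+u. indicator {0..<v} u * (reach (\<lambda>y. ennreal \<bar>y\<bar>) i n u + ennreal (q i n) * arrival i n v) \<partial>lborel)"
 proof (rule nrm_le)
  fix u assume u: "0 \<le> u" "u < v"
  have "arrival i n u \<le> arrival i n v"
   unfolding arrival_def using u by (intro nn_integral_mono) (auto simp: indicator_def)
  then show "ennreal \<bar>R i n u\<bar> \<le> reach (\<lambda>y. ennreal \<bar>y\<bar>) i n u + ennreal (q i n) * arrival i n v"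
   using R_bound[OF u(1), of i n] by (meson add_left_mono mult_left_mono order_trans zero_le)
 qed
 also have "\<dots> = (\<integral>\<^sup>+u. indicator {0..<v} u * reach (\<lambda>y. ennreal \<bar>y\<bar>) i n u \<partial>lborel) + (\<integral>\<^sup>+u. (ennreal (q i n) * arrival i n v) * indicator {0..<v} u \<partial>lborel)"
  unfolding distrib_left mult.commute[of "indicator {0..<v} _" "ennreal (q i n) * arrival i n v"]
  by (rule nn_integral_add) measurable
 also have "(\<integral>\<^sup>+u. (ennreal (q i n) * arrival i n v) * indicator {0..<v} u \<partial>lborel) = ennreal v * (ennreal (q i n) * arrival i n v)"
  using v by (subst nn_integral_cmult_indicator) (auto simp: mult.commute)
 finally show ?thesis .
qed

lemma reach_norm_tendsto_0:
 assumes v: "0 \<le> v"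
 shows "(\<lambda>n. \<integral>\<^sup>+u. indicator {0..<v} u * reach (\<lambda>y. ennreal \<bar>y\<bar>) i n u \<partial>lborel) \<longlonglongrightarrow> 0"
proof -
 define b where "b j = (\<integral>\<^sup>+u. indicator {0..<v} u * U j (\<lambda>y. ennreal \<bar>y\<bar>) i 0 0 u \<partial>lborel)" for j
 have sum_b: "(\<Sum>j. b (n + j)) = (\<integral>\<^sup>+u. indicator {0..<v} u * (\<Sum>j. U (n + j) (\<lambda>y. ennreal \<bar>y\<bar>) i 0 0 u) \<partial>lborel)" for n
  unfolding b_def ennreal_suminf_cmult[symmetric] by (rule nn_integral_suminf[symmetric]) measurable
 have "(\<Sum>j. b j) < \<infinity>"
  using sum_b[of 0] Vabs_locally_integrable[OF v, of i 0] by (simp add: V_def)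
 then have lim: "(\<lambda>n. \<Sum>j. b (n + j)) \<longlonglongrightarrow> 0" by (rule ennreal_tail_tendsto_0)
 have le: "(\<integral>\<^sup>+u. indicator {0..<v} u * reach (\<lambda>y. ennreal \<bar>y\<bar>) i n u \<partial>lborel) \<le> (\<Sum>j. b (n + j))" for n
  unfolding sum_b by (intro nn_integral_mono) (auto simp: indicator_def intro!: reach_le_tail)
 show ?thesis
  by (rule tendsto_sandwich[OF _ _ tendsto_const lim]) (simp, intro always_eventually allI le)
qed

text \<open>
 The first-step equation with \<open>g = 0\<close>, integrated over the arrival at the \<open>n\<close>-th
 shock: its shock part is the next remainder.
\<close>

lemma R_step:
 assumes g0: "g i n = 0" and u: "0 \<le> u"
 shows "ennreal \<bar>R i n u - R i (Suc n) u\<bar> \<le> drive (\<lambda>t. ennreal \<bar>a (Suc i) 0 t\<bar>) i n u"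
proof -
 define k where "k b t w = indicator {0<..t} w * (exp (- (theta i n * w)) * b (t - w))" for b :: "real \<Rightarrow> real" and t w :: real
 have k_int: "integrable lborel (k b t)" if b: "integrable lborel (\<lambda>v. indicator {0..<t} v * b v)" and [measurable]: "b \<in> borel_measurable borel" for b t
 proof (rule Bochner_Integration.integrable_bound)
  show "integrable lborel (\<lambda>w. indicator {0<..t} w * b (t - w))"
   using b by (simp add: integral_reflect(1))
  show "k b t \<in> borel_measurable lborel" unfolding k_def by measurable
  show "AE w in lborel. norm (k b t w) \<le> norm (indicator {0<..t} w * b (t - w))"
  proof (intro AE_I2)
   fix w
   have "0 < w \<Longrightarrow> exp (- (theta i n * w)) \<le> 1" using theta_pos[of i n] by simp
   then show "norm (k b t w) \<le> norm (indicator {0<..t} w * b (t - w))"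
    unfolding k_def by (auto simp: indicator_def abs_mult intro!: mult_left_le_one_le)
  qed
 qed
 define A where "A v = lam i n * a i (Suc n) v" for v
 define F where "F v = mu i n * a (Suc i) 0 v" for v
 have [measurable]: "A \<in> borel_measurable borel" "F \<in> borel_measurable borel"
  unfolding A_def[abs_def] F_def[abs_def] by measurable
 have A_int: "integrable lborel (k A t)" and F_int: "integrable lborel (k F t)" if "0 \<le> t" for t
 proof -
  have "integrable lborel (\<lambda>v. lam i n * (indicator {0..<t} v * a i (Suc n) v))" "integrable lborel (\<lambda>v. mu i n * (indicator {0..<t} v * a (Suc i) 0 v))"
   using a_locally_integrable[OF that] by (intro integrable_mult_right; blast)+
  then show "integrable lborel (k A t)" "integrable lborel (k F t)"
   by (auto intro!: k_int simp: A_def F_def mult.left_commute)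
 qed
 have a_eq: "a i n t = (\<integral>w. k A t w \<partial>lborel) + (\<integral>w. k F t w \<partial>lborel)" if t: "0 \<le> t" for t
 proof -
  have "(\<lambda>w. indicator {0<..t} w * (exp (- (theta i n * w)) * (lam i n * a i (Suc n) (t - w) + mu i n * a (Suc i) 0 (t - w))))
    = (\<lambda>w. k A t w + k F t w)"
   by (auto simp: k_def A_def F_def fun_eq_iff distrib_left)
  then show ?thesis
   using mean_first_step(2)[OF t, of i n] g0 A_int[OF t] F_int[OF t] by simp
 qed
 define p m where "p v = ennreal (a i (Suc n) v)" and "m v = ennreal (- a i (Suc n) v)" for v
 have [measurable]: "p \<in> borel_measurable borel" "m \<in> borel_measurable borel" unfolding p_def m_def by measurable
 define W where "W f z = (\<integral>\<^sup>+w. indicator {0<..u - fst z} w * ennreal (exp (- (theta i n * w))) * (ennreal (lam i n) * f (u - fst z - w)) \<partial>lborel)"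
  for f and z :: "real \<times> real"
 have [measurable]: "W f \<in> borel_measurable (borel \<Otimes>\<^sub>M borel)" if [measurable]: "f \<in> borel_measurable borel" for f
  unfolding W_def[abs_def] by measurable
 have transport: "ennreal (q i n) * (\<integral>\<^sup>+z. indicator {..u} (fst z) * W f z \<partial>nu i n) = ennreal (q i (Suc n)) * (\<integral>\<^sup>+z. indicator {..u} (fst z) * f (u - fst z) \<partial>nu i (Suc n))"
  if [measurable]: "f \<in> borel_measurable borel" for f
  using shock_transport[of "\<lambda>z. f (u - fst z)" i n u] unfolding W_def by (simp add: Dr.emeasure_space_1 diff_diff_eq)
 have fin: "(\<integral>\<^sup>+z. indicator {..u} (fst z) * f (u - fst z) \<partial>nu i (Suc n)) < \<infinity>"
  if [measurable]: "f \<in> borel_measurable borel" and f: "\<And>v. f v \<le> ennreal \<bar>a i (Suc n) v\<bar>" for f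
 proof -
  have "(\<integral>\<^sup>+z. indicator {..u} (fst z) * f (u - fst z) \<partial>nu i (Suc n)) \<le> (\<integral>\<^sup>+z. ennreal (norm (indicator {..u} (fst z) * a i (Suc n) (u - fst z))) \<partial>nu i (Suc n))"
   by (intro nn_integral_mono) (auto simp: indicator_def f)
  also have "\<dots> < \<infinity>" using R_integrable[OF u, of i "Suc n"] by (simp add: integrable_iff_bounded)
  finally show ?thesis .
 qed
 have pf: "p v \<le> ennreal \<bar>a i (Suc n) v\<bar>" "m v \<le> ennreal \<bar>a i (Suc n) v\<bar>" for v
  unfolding p_def m_def by (auto intro: ennreal_leI)
 have finW: "(\<integral>\<^sup>+z. indicator {..u} (fst z) * W f z \<partial>nu i n) < \<infinity>"
  if "f \<in> borel_measurable borel" "\<And>v. f v \<le> ennreal \<bar>a i (Suc n) v\<bar>" for f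
 proof -
  have "ennreal (q i n) * (\<integral>\<^sup>+z. indicator {..u} (fst z) * W f z \<partial>nu i n) < \<infinity>"
   unfolding transport[OF that(1)] using fin[OF that] by (simp add: ennreal_mult_less_top)
  then show ?thesis using q_pos[of i n] by (auto simp: ennreal_mult_less_top)
 qed
 have Wz: "enn2real (indicator {..u} (fst z) * W p z) - enn2real (indicator {..u} (fst z) * W m z) = indicator {..u} (fst z) * (\<integral>w. k A (u - fst z) w \<partial>lborel)" for z
 proof (cases "fst z \<le> u")
  case True
  then have t: "0 \<le> u - fst z" by simp
  have Wfin: "W f z < \<infinity>" if f: "\<And>v. f v \<le> ennreal \<bar>a i (Suc n) v\<bar>" for f
  proof -
   have "W f z \<le> (\<integral>\<^sup>+w. ennreal (norm (k A (u - fst z) w)) \<partial>lborel)"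
    unfolding W_def
   proof (rule nn_integral_mono)
    fix w
    have "ennreal (lam i n) * f (u - fst z - w) \<le> ennreal (lam i n * \<bar>a i (Suc n) (u - fst z - w)\<bar>)"
     using lam_pos[of i n] f[of "u - fst z - w"] by (simp add: ennreal_mult mult_left_mono)
    then show "indicator {0<..u - fst z} w * ennreal (exp (- (theta i n * w))) * (ennreal (lam i n) * f (u - fst z - w)) \<le> ennreal (norm (k A (u - fst z) w))"
     using lam_pos[of i n] unfolding k_def A_def
     by (cases "w \<in> {0<..u - fst z}") (auto simp: abs_mult ennreal_mult mult_left_mono)
   qed
   also have "\<dots> < \<infinity>" using A_int[OF t] by (simp add: integrable_iff_bounded)
   finally show ?thesis .
  qed
  have "enn2real (W p z) - enn2real (W m z) = (\<integral>w. k A (u - fst z) w \<partial>lborel)"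
   using Wfin[of p] Wfin[of m] pf unfolding W_def
  proof (subst enn2real_nn_integral_diff(2))
   have "enn2real (p x) - enn2real (m x) = a i (Suc n) x" for x
    unfolding p_def m_def by (cases "0 \<le> a i (Suc n) x") (auto simp: ennreal_neg)
   then have "enn2real (indicator {0<..t} w * ennreal (exp (- (theta i n * w))) * (ennreal (lam i n) * p (t - w))) -
     enn2real (indicator {0<..t} w * ennreal (exp (- (theta i n * w))) * (ennreal (lam i n) * m (t - w))) = k A t w" for t w
    using lam_pos[of i n] unfolding k_def A_def
    by (cases "w \<in> {0<..t}") (simp_all add: enn2real_mult right_diff_distrib[symmetric] mult.assoc)
   then show "(\<integral>w. enn2real (indicator {0<..u - fst z} w * ennreal (exp (- (theta i n * w))) * (ennreal (lam i n) * p (u - fst z - w))) -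
     enn2real (indicator {0<..u - fst z} w * ennreal (exp (- (theta i n * w))) * (ennreal (lam i n) * m (u - fst z - w))) \<partial>lborel)
     = (\<integral>w. k A (u - fst z) w \<partial>lborel)" by simp
  qed auto
  then show ?thesis using True by simp
 qed simp
 have mp: "p \<in> borel_measurable borel" and mm: "m \<in> borel_measurable borel" by measurable
 note D = enn2real_nn_integral_diff[OF _ _ finW[OF mp pf(1)] finW[OF mm pf(2)], unfolded Wz]
 have D1: "integrable (nu i n) (\<lambda>z. indicator {..u} (fst z) * (\<integral>w. k A (u - fst z) w \<partial>lborel))"
  by (rule D(1)) measurable
 have D2: "enn2real (\<integral>\<^sup>+z. indicator {..u} (fst z) * W p z \<partial>nu i n) - enn2real (\<integral>\<^sup>+z. indicator {..u} (fst z) * W m z \<partial>nu i n)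
   = (\<integral>z. indicator {..u} (fst z) * (\<integral>w. k A (u - fst z) w \<partial>lborel) \<partial>nu i n)"
  by (rule D(2)) measurable
 have RS: "R i (Suc n) u = q i n * (\<integral>z. indicator {..u} (fst z) * (\<integral>w. k A (u - fst z) w \<partial>lborel) \<partial>nu i n)"
 proof -
  have e: "ennreal (indicator {..u} x * y) = indicator {..u} x * ennreal y" "ennreal (- (indicator {..u} x * y)) = indicator {..u} x * ennreal (- y)" for x y :: real
   by (auto simp: indicator_def)
  have "(\<integral>z. indicator {..u} (fst z) * a i (Suc n) (u - fst z) \<partial>nu i (Suc n)) =
    enn2real (\<integral>\<^sup>+z. indicator {..u} (fst z) * p (u - fst z) \<partial>nu i (Suc n)) - enn2real (\<integral>\<^sup>+z. indicator {..u} (fst z) * m (u - fst z) \<partial>nu i (Suc n))"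
   using real_lebesgue_integral_def[OF R_integrable[OF u, of i "Suc n"]] unfolding e p_def m_def .
  then have "R i (Suc n) u = enn2real (ennreal (q i (Suc n)) * (\<integral>\<^sup>+z. indicator {..u} (fst z) * p (u - fst z) \<partial>nu i (Suc n)))
    - enn2real (ennreal (q i (Suc n)) * (\<integral>\<^sup>+z. indicator {..u} (fst z) * m (u - fst z) \<partial>nu i (Suc n)))"
   using q_pos[of i "Suc n"] by (simp add: R_def enn2real_mult right_diff_distrib)
  also have "\<dots> = q i n * (enn2real (\<integral>\<^sup>+z. indicator {..u} (fst z) * W p z \<partial>nu i n) - enn2real (\<integral>\<^sup>+z. indicator {..u} (fst z) * W m z \<partial>nu i n))"
   unfolding transport[OF mp, symmetric] transport[OF mm, symmetric]
   using q_pos[of i n] by (simp add: enn2real_mult right_diff_distrib)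
  finally show ?thesis unfolding D2 .
 qed
 have "R i n u - R i (Suc n) u = q i n * (\<integral>z. indicator {..u} (fst z) * a i n (u - fst z) - indicator {..u} (fst z) * (\<integral>w. k A (u - fst z) w \<partial>lborel) \<partial>nu i n)"
  unfolding RS unfolding R_def Bochner_Integration.integral_diff[OF R_integrable[OF u] D1] by (simp add: right_diff_distrib)
 then have "ennreal \<bar>R i n u - R i (Suc n) u\<bar> = ennreal (q i n) * ennreal (norm (\<integral>z. indicator {..u} (fst z) * a i n (u - fst z) - indicator {..u} (fst z) * (\<integral>w. k A (u - fst z) w \<partial>lborel) \<partial>nu i n))"
  using q_pos[of i n] by (simp add: abs_mult ennreal_mult)
 also have "\<dots> \<le> ennreal (q i n) * (\<integral>\<^sup>+z. ennreal (norm (indicator {..u} (fst z) * a i n (u - fst z) - indicator {..u} (fst z) * (\<integral>w. k A (u - fst z) w \<partial>lborel))) \<partial>nu i n)"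
  by (intro mult_left_mono integral_norm_bound_ennreal Bochner_Integration.integrable_diff R_integrable u D1) auto
 also have "\<dots> \<le> drive (\<lambda>t. ennreal \<bar>a (Suc i) 0 t\<bar>) i n u"
  unfolding drive_def
 proof (intro mult_left_mono nn_integral_mono)
  fix z :: "real \<times> real"
  show "ennreal (norm (indicator {..u} (fst z) * a i n (u - fst z) - indicator {..u} (fst z) * (\<integral>w. k A (u - fst z) w \<partial>lborel)))
   \<le> indicator {..u} (fst z) * (\<integral>\<^sup>+w. indicator {0<..u - fst z} w * ennreal (exp (- (theta i n * w))) * (ennreal (mu i n) * ennreal \<bar>a (Suc i) 0 (u - fst z - w)\<bar>) \<partial>lborel)"
  proof (cases "fst z \<le> u")
   case True
   then have t: "0 \<le> u - fst z" by simp
   have "ennreal (norm (\<integral>w. k F (u - fst z) w \<partial>lborel)) \<le> (\<integral>\<^sup>+w. ennreal (norm (k F (u - fst z) w)) \<partial>lborel)"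
    by (rule integral_norm_bound_ennreal[OF F_int[OF t]])
   also have "\<dots> = (\<integral>\<^sup>+w. indicator {0<..u - fst z} w * ennreal (exp (- (theta i n * w))) * (ennreal (mu i n) * ennreal \<bar>a (Suc i) 0 (u - fst z - w)\<bar>) \<partial>lborel)"
    using mu_pos[of i n] by (intro nn_integral_cong) (auto simp: k_def F_def indicator_def abs_mult ennreal_mult)
   finally show ?thesis using True a_eq[OF t] by simp
  qed simp
 qed simp
 finally show ?thesis .
qed

text \<open>
 Summing \<open>R_step\<close> from \<open>0\<close> to an index at which the remainder is small.
\<close>

lemma nrm_a_contraction:
 assumes g0: "\<And>n. g i n = 0"
  and nonexp: "\<not> summable (\<lambda>n. 1 / lam i n)" and inj: "inj (theta i)"
  and lim: "(\<lambda>n. (c i n + mu i n * mean (DR i n)) * Lam (lam i) n * kappa (theta i) n 0) \<longlonglongrightarrow> 0"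
  and v: "0 < v"
 shows "nrm v (a i 0) \<le> ennreal (theta i 0 / (1 + theta i 0)) * nrm v (a (Suc i) 0)"
proof -
 define F where "F = nrm v (a (Suc i) 0)"
 have step: "nrm v (R i n) \<le> nrm v (R i (Suc n)) + ennreal (beta i n) * F" for n
 proof -
  have "nrm v (R i n) \<le> nrm v (R i (Suc n)) + nrm v (\<lambda>u. R i n u - R i (Suc n) u)"
   by (rule nrm_triangle) auto
  also have "nrm v (\<lambda>u. R i n u - R i (Suc n) u) \<le> (\<integral>\<^sup>+u. indicator {0..<v} u * (ennreal (exp (- u)) * drive (\<lambda>t. ennreal \<bar>a (Suc i) 0 t\<bar>) i n u) \<partial>lborel)"
   unfolding nrm_def using R_step[OF g0]
   by (intro nn_integral_mono) (auto simp: indicator_def ennreal_mult intro!: mult_left_mono)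
  also have "\<dots> \<le> ennreal (beta i n) * F"
   unfolding F_def by (rule drive_nrm) measurable
  finally show ?thesis by (simp add: add_left_mono)
 qed
 have iter: "nrm v (a i 0) \<le> nrm v (R i n) + ennreal (\<Sum>k<n. beta i k) * F" for n
 proof (induction n)
  case 0
  have "nrm v (a i 0) = nrm v (R i 0)"
   unfolding nrm_def by (intro nn_integral_cong) (auto simp: indicator_def R_0)
  then show ?case by simp
 next
  case (Suc n)
  have "ennreal (\<Sum>k<Suc n. beta i k) = ennreal (\<Sum>k<n. beta i k) + ennreal (beta i n)"
   by (simp add: ennreal_plus sum_nonneg beta_nonneg)
  then show ?case
   using order_trans[OF Suc add_right_mono[OF step[of n]]] by (simp add: distrib_right add_ac)
 qed
 have le: "nrm v (a i 0) \<le> ennreal (theta i 0 / (1 + theta i 0)) * F + ennreal e" if e: "0 < e" for e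
 proof -
  have "\<exists>\<^sub>F n in sequentially. ennreal (q i n) * arrival i n v < ennreal (e / (2 * v))"
   using e v by (intro arrival_frequently_small[OF nonexp inj lim v]) auto
  moreover have "\<forall>\<^sub>F n in sequentially. (\<integral>\<^sup>+u. indicator {0..<v} u * reach (\<lambda>y. ennreal \<bar>y\<bar>) i n u \<partial>lborel) < ennreal (e / 2)"
   using e v by (intro order_tendstoD(2)[OF reach_norm_tendsto_0]) auto
  ultimately have "\<exists>\<^sub>F n in sequentially. ennreal (q i n) * arrival i n v < ennreal (e / (2 * v)) \<and> (\<integral>\<^sup>+u. indicator {0..<v} u * reach (\<lambda>y. ennreal \<bar>y\<bar>) i n u \<partial>lborel) < ennreal (e / 2)"
   by (rule frequently_eventually_frequently)
  then obtain n where n: "ennreal (q i n) * arrival i n v < ennreal (e / (2 * v))" "(\<integral>\<^sup>+u. indicator {0..<v} u * reach (\<lambda>y. ennreal \<bar>y\<bar>) i n u \<partial>lborel) < ennreal (e / 2)"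
   using frequently_ex by blast
  have "nrm v (R i n) \<le> ennreal (e / 2) + ennreal v * ennreal (e / (2 * v))"
   by (rule order_trans[OF nrm_R_bound[OF v] add_mono[OF less_imp_le[OF n(2)] mult_left_mono[OF less_imp_le[OF n(1)]]]]) simp
  also have "ennreal v * ennreal (e / (2 * v)) = ennreal (e / 2)"
   using e v by (subst ennreal_mult[symmetric]) auto
  also have "ennreal (e / 2) + ennreal (e / 2) = ennreal e"
   using e by (subst ennreal_plus[symmetric]) auto
  finally have Re: "nrm v (R i n) \<le> ennreal e" .
  have "ennreal (\<Sum>k<n. beta i k) * F \<le> ennreal (theta i 0 / (1 + theta i 0)) * F"
   by (intro mult_right_mono ennreal_leI sum_beta) auto
  from order_trans[OF iter[of n] add_mono[OF Re this]] show ?thesis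
   by (simp only: add.commute)
 qed
 show ?thesis unfolding F_def[symmetric]
  by (rule ennreal_le_epsilon) (rule le)
qed

lemma nrm_a_finite: "0 \<le> v \<Longrightarrow> nrm v (a i n) < \<infinity>"
 by (rule le_less_trans[OF nrm_le Vabs_locally_integrable]) (auto intro: abs_a_le_Vabs)

lemma a_periodic: "a (Suc (Suc i)) n = a i n"
 unfolding a_def[abs_def] V_periodic ..

text \<open>
 Two successive contractions lead back to the same state, by periodicity, with a factor below 1.
\<close>

theorem balance_imp_means_zero:
 assumes g0: "\<And>i n. g i n = 0"
  and nonexp: "\<And>i. \<not> summable (\<lambda>n. 1 / lam i n)" and inj: "\<And>i. inj (theta i)"
  and lim: "\<And>i. (\<lambda>n. (c i n + mu i n * mean (DR i n)) * Lam (lam i) n * kappa (theta i) n 0) \<longlonglongrightarrow> 0"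
  and u: "0 \<le> u"
 shows "a i n u = 0"
proof -
 have zero: "nrm v (a i 0) = 0" if v: "0 < v" for v i
 proof -
  define r where "r i = theta i 0 / (1 + theta i 0)" for i
  have r: "0 \<le> r i" "r i < 1" for i using theta_pos[of i 0] by (auto simp: r_def)
  have contr: "nrm v (a i 0) \<le> ennreal (r i) * nrm v (a (Suc i) 0)" for i
   unfolding r_def by (rule nrm_a_contraction[OF g0 nonexp inj lim v])
  obtain x where x: "nrm v (a i 0) = ennreal x" "0 \<le> x"
   using nrm_a_finite[of v i 0] v by (cases "nrm v (a i 0)") auto
  have "nrm v (a i 0) \<le> ennreal (r i) * (ennreal (r (Suc i)) * nrm v (a i 0))"
   using order_trans[OF contr[of i] mult_left_mono[OF contr[of "Suc i"]]] by (simp add: a_periodic)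
  then have "x \<le> r i * r (Suc i) * x"
   unfolding x using x(2) r by (simp add: ennreal_mult[symmetric] mult.assoc)
  moreover have "r i * r (Suc i) < 1" using r[of i] r[of "Suc i"] mult_strict_mono[of "r i" 1 "r (Suc i)" 1] by simp
  ultimately have "\<not> 0 < x"
   using mult_strict_right_mono[of "r i * r (Suc i)" 1 x] by auto
  then have "x = 0" using x(2) by simp
  then show ?thesis using x by simp
 qed
 have AE0: "AE u in lborel. 0 \<le> u \<longrightarrow> a i 0 u = 0" for i
 proof -
  have "AE u in lborel. indicator {0..<real (Suc N)} u * ennreal (exp (- u) * \<bar>a i 0 u\<bar>) = 0" for N
  proof -
   have "nrm (real (Suc N)) (a i 0) = 0" by (rule zero) simp
   then show ?thesis unfolding nrm_def by (subst (asm) nn_integral_0_iff_AE) auto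
  qed
  then have "AE u in lborel. \<forall>N. indicator {0..<real (Suc N)} u * ennreal (exp (- u) * \<bar>a i 0 u\<bar>) = 0"
   by (subst AE_all_countable) blast
  then show ?thesis
  proof eventually_elim
   case (elim u)
   obtain N :: nat where "u < real N" using reals_Archimedean2 by blast
   then have "u < real (Suc N)" by simp
   with elim[rule_format, of N] show ?case by (auto simp: indicator_def ennreal_eq_0_iff mult_le_0_iff split: if_splits)
  qed
 qed
 show ?thesis by (rule means_propagate[OF g0 AE0 AE0 u])
qed

end

section \<open>Deterministic facts about counting processes\<close>

lemma Max_infinite_nat: "infinite A \<Longrightarrow> Max A = (the None :: nat)"
 by (simp add: Max.infinite)

lemma Max_empty_nat: "Max {} = (the None :: nat)"
 by (simp add: Max.eq_fold')

text \<open>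
 \<open>Max\<close> of an empty or an infinite set of numbers is one fixed number, so these cases form a
 measurable set on which the function is constant.
\<close>

lemma measurable_Max_nat:
 assumes [measurable]: "\<And>n::nat. Measurable.pred M (Q n)"
 shows "(\<lambda>x. Max {n. Q n x}) \<in> measurable M (count_space UNIV)"
proof (rule measurable_count_space_eq2_countable[THEN iffD2], intro conjI ballI)
 fix k :: nat
 have eq: "(Max {n. Q n x} = k) \<longleftrightarrow>
   (if (\<exists>n. Q n x) \<and> (\<exists>b. \<forall>n. Q n x \<longrightarrow> n \<le> b) then Q k x \<and> (\<forall>n. Q n x \<longrightarrow> n \<le> k) else the None = k)" for x
 proof (cases "(\<exists>n. Q n x) \<and> (\<exists>b. \<forall>n. Q n x \<longrightarrow> n \<le> b)")
  case True
  then have "finite {n. Q n x}" "{n. Q n x} \<noteq> {}"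
   by (auto simp: finite_nat_set_iff_bounded_le)
  then show ?thesis using True by (auto simp: Max_eq_iff)
 next
  case False
  then have "{n. Q n x} = {} \<or> infinite {n. Q n x}"
   by (auto simp: finite_nat_set_iff_bounded_le)
  then have "Max {n. Q n x} = the None"
   using Max_infinite_nat Max_empty_nat by metis
  then show ?thesis unfolding if_not_P[OF False] by (simp only:)
 qed
 have "(\<lambda>x. Max {n. Q n x}) -` {k} \<inter> space M = {x \<in> space M.
   (if (\<exists>n. Q n x) \<and> (\<exists>b. \<forall>n. Q n x \<longrightarrow> n \<le> b) then Q k x \<and> (\<forall>n. Q n x \<longrightarrow> n \<le> k) else the None = k)}"
  by (simp only: eq[symmetric]) auto
 also have "\<dots> \<in> sets M" by measurable
 finally show "(\<lambda>x. Max {n. Q n x}) -` {k} \<inter> space M \<in> sets M" .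
qed auto

text \<open>
 Holding times of a path on which the shocks are separated and do not accumulate, so that the maximum in the
 count is attained.
\<close>

definition proper :: "(nat \<Rightarrow> real) \<Rightarrow> bool" where
 "proper h \<longleftrightarrow> (\<forall>k. 0 < h k) \<and> (\<forall>t. \<exists>n. t < sum h {..<n})"

lemma proper_mono: "proper h \<Longrightarrow> m \<le> n \<Longrightarrow> sum h {..<m} \<le> sum h {..<n}"
 by (intro sum_mono2) (auto simp: proper_def less_imp_le)

lemma proper_nonneg: "proper h \<Longrightarrow> 0 \<le> sum h {..<n}"
 by (intro sum_nonneg) (auto simp: proper_def less_imp_le)

lemma proper_le_iff: "proper h \<Longrightarrow> sum h {..<m} \<le> sum h {..<n} \<longleftrightarrow> m \<le> n"
proof -
 assume p: "proper h"
 have "strict_mono (\<lambda>n. sum h {..<n})"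
  using p by (intro strict_monoI_Suc) (simp add: proper_def)
 from strict_mono_less_eq[OF this, of m n] show ?thesis .
qed

lemma proper_count:
 assumes p: "proper h" and t: "0 \<le> t"
 shows "n \<le> Max {n. sum h {..<n} \<le> t} \<longleftrightarrow> sum h {..<n} \<le> t"
proof -
 obtain N where N: "t < sum h {..<N}" using p by (auto simp: proper_def)
 have "{n. sum h {..<n} \<le> t} \<subseteq> {..N}"
 proof
  fix n assume "n \<in> {n. sum h {..<n} \<le> t}"
  then have "sum h {..<n} \<le> sum h {..<N}" using N by auto
  then show "n \<in> {..N}" using p by (simp add: proper_le_iff)
 qed
 then have fin: "finite {n. sum h {..<n} \<le> t}" by (rule finite_subset) simp
 have ne: "{n. sum h {..<n} \<le> t} \<noteq> {}" using t by (auto intro: exI[of _ 0])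
 show ?thesis
  using Max_ge_iff[OF fin ne, of n] proper_mono[OF p] by (auto intro: order_trans)
qed

lemma proper_count_eq:
 assumes p: "proper h" and t: "0 \<le> t"
 shows "Max {n. sum h {..<n} \<le> t} = n \<longleftrightarrow> sum h {..<n} \<le> t \<and> t < sum h {..<Suc n}"
 using proper_count[OF assms, of n] proper_count[OF assms, of "Suc n"]
 by (metis Suc_n_not_le_n le_antisym not_less not_less_eq_eq)

lemma proper_interval:
 assumes p: "proper h" and t: "0 \<le> t"
 obtains n where "sum h {..<n} \<le> t" "t < sum h {..<Suc n}"
 using proper_count_eq[OF assms, of "Max {n. sum h {..<n} \<le> t}"] by auto

lemma drift_formula:
 assumes p: "proper h" and u: "0 \<le> u" "u \<le> h n"
 shows "(LBINT s:{0..sum h {..<n} + u}. b (Max {k. sum h {..<k} \<le> s})) = (\<Sum>k<n. b k * h k) + b n * u"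
proof -
 define S where "S n = sum h {..<n}" for n
 have S0: "0 \<le> S n" for n unfolding S_def by (rule proper_nonneg[OF p])
 have Suc: "S (Suc n) = S n + h n" for n by (simp add: S_def)
 have hp: "0 < h k" for k using p by (simp add: proper_def)
 have mono: "m \<le> n \<Longrightarrow> S m \<le> S n" for m n unfolding S_def by (rule proper_mono[OF p])
 have "AE s in lborel. indicator {0..S n + u} s *\<^sub>R b (Max {k. S k \<le> s}) =
   (\<Sum>k<n. b k * indicator {S k..<S (Suc k)} s) + b n * indicator {S n..S n + u} s"
  using AE_lborel_singleton[of "S n + u"]
 proof eventually_elim
  case (elim s)
  show ?case
  proof (cases "0 \<le> s \<and> s < S n + u")
   case True
   then obtain j where j: "S j \<le> s" "s < S (Suc j)"
    using proper_interval[OF p, of s] unfolding S_def by blast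
   have M: "Max {k. S k \<le> s} = j"
    using proper_count_eq[OF p, of s j] j True unfolding S_def by simp
   have ind: "indicator {S k..<S (Suc k)} s = (if k = j then 1 else 0 :: real)" for k
   proof (cases "k = j")
    case False
    then consider "Suc k \<le> j" | "Suc j \<le> k" by linarith
    then show ?thesis using mono[of "Suc k" j] mono[of "Suc j" k] j by cases (auto simp: indicator_def)
   qed (use j in auto)
   have "j \<le> n"
   proof (rule ccontr)
    assume "\<not> j \<le> n"
    then have "S (Suc n) \<le> S j" by (intro mono) simp
    then show False using j True u Suc[of n] by simp
   qed
   then consider "j < n" | "j = n" by linarith
   then show ?thesis
   proof cases
    case 1
    then have "S (Suc j) \<le> S n" by (intro mono) simp
    then show ?thesis using 1 M True j by (simp add: ind if_distrib[of "\<lambda>x. _ * x"] cong: if_cong)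
   next
    case 2
    then show ?thesis using M True j by (simp add: ind if_distrib[of "\<lambda>x. _ * x"] cong: if_cong)
   qed
  next
   case False
   have "indicator {S k..<S (Suc k)} s = (0::real)" if "k < n" for k
    using False S0[of k] mono[of "Suc k" n] that u by (auto simp: indicator_def)
   then have "(\<Sum>k<n. b k * indicator {S k..<S (Suc k)} s) = 0" by (intro sum.neutral) auto
   then show ?thesis using False elim S0[of n] by (auto simp: indicator_def)
  qed
 qed
 moreover have [measurable]: "(\<lambda>s. b (Max {k. S k \<le> s})) \<in> borel_measurable borel"
  by (rule measurable_compose[OF measurable_Max_nat]) auto
 ultimately have "(\<integral>s. indicator {0..S n + u} s *\<^sub>R b (Max {k. S k \<le> s}) \<partial>lborel) =
   (\<integral>s. (\<Sum>k<n. b k * indicator {S k..<S (Suc k)} s) + b n * indicator {S n..S n + u} s \<partial>lborel)"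
  by (intro integral_cong_AE; (measurable | assumption))
 also have "\<dots> = (\<Sum>k<n. b k * h k) + b n * u"
 proof -
  have I: "integrable lborel (\<lambda>s. b k * indicator {S k..<S (Suc k)} s)" "(\<integral>s. b k * indicator {S k..<S (Suc k)} s \<partial>lborel) = b k * h k" for k
   using hp[of k] by (simp_all add: Suc)
  have J: "integrable lborel (\<lambda>s. b n * indicator {S n..S n + u} s)" "(\<integral>s. b n * indicator {S n..S n + u} s \<partial>lborel) = b n * u"
   using u by simp_all
  show ?thesis
   unfolding Bochner_Integration.integral_add[OF Bochner_Integration.integrable_sum[OF I(1)] J(1)]
    Bochner_Integration.integral_sum[OF I(1)] I(2) J(2) ..
 qed
 finally show ?thesis unfolding set_lebesgue_integral_def S_def .
qed

lemma shock_count_eq_Max: "shock_count H m t z = Max {n. sum (\<lambda>k. H m k z) {..<n} \<le> t}"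
 by (simp add: shock_count_def)

lemma phase_drift_formula:
 assumes "proper (\<lambda>k. H m k z)" "0 \<le> u" "u \<le> H m n z"
 shows "phase_drift i c H m ((\<Sum>k<n. H m k z) + u) z = (\<Sum>k<n. c (eps i m) k * H m k z) + c (eps i m) n * u"
 using drift_formula[OF assms, of "c (eps i m)"] by (simp add: phase_drift_def shock_count_eq_Max)

section \<open>Measurability of the functionals of the paths\<close>

lemma measurable_shock_count:
 assumes [measurable]: "\<And>k. H m k \<in> borel_measurable M" "f \<in> borel_measurable M"
 shows "(\<lambda>z. shock_count H m (f z) z) \<in> measurable M (count_space UNIV)"
 unfolding shock_count_def by (rule measurable_Max_nat) measurable

lemma measurable_switch_time:
 assumes [measurable]: "\<And>k. 1 \<le> k \<Longrightarrow> k \<le> m \<Longrightarrow> T k \<in> borel_measurable M"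
 shows "switch_time T m \<in> borel_measurable M"
 unfolding switch_time_def[abs_def] by (rule borel_measurable_sum) auto

lemma measurable_switch_count:
 assumes T: "\<And>k. 1 \<le> k \<Longrightarrow> T k \<in> borel_measurable M"
 shows "switch_count T t \<in> measurable M (count_space UNIV)"
proof -
 have [measurable]: "switch_time T m \<in> borel_measurable M" for m
  by (rule measurable_switch_time) (use T in auto)
 show ?thesis unfolding switch_count_def[abs_def] by (rule measurable_Max_nat) measurable
qed

lemma measurable_elapsed:
 assumes T: "\<And>k. 1 \<le> k \<Longrightarrow> T k \<in> borel_measurable M"
 shows "elapsed T t \<in> borel_measurable M"
proof -
 have [measurable]: "switch_time T m \<in> borel_measurable M" for m
  by (rule measurable_switch_time) (use T in auto)
 have "(\<lambda>z. switch_time T (switch_count T t z) z) \<in> borel_measurable M"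
  by (rule measurable_compose_countable[OF _ measurable_switch_count[OF T]]) auto
 then show ?thesis unfolding elapsed_def[abs_def] by measurable
qed

lemma measurable_phase_drift:
 assumes H [measurable]: "\<And>k. H m k \<in> borel_measurable M" and [measurable]: "f \<in> borel_measurable M"
 shows "(\<lambda>z. phase_drift i c H m (f z) z) \<in> borel_measurable M"
proof -
 have N: "(\<lambda>p. c (eps i m) (shock_count H m (snd p) (fst p))) \<in> borel_measurable (M \<Otimes>\<^sub>M lborel)"
 proof -
  have "(\<lambda>p. shock_count H m (snd p) (fst p)) \<in> measurable (M \<Otimes>\<^sub>M lborel) (count_space UNIV)"
   unfolding shock_count_def by (rule measurable_Max_nat) measurable
  from measurable_compose[OF this, of "c (eps i m)" borel] show ?thesis by simp
 qed
 have "(\<lambda>p. indicator {0..f (fst p)} (snd p) :: real) \<in> borel_measurable (M \<Otimes>\<^sub>M lborel)"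
  unfolding indicator_def atLeastAtMost_iff by measurable
 with N have "(\<lambda>p. indicator {0..f (fst p)} (snd p) *\<^sub>R c (eps i m) (shock_count H m (snd p) (fst p))) \<in> borel_measurable (M \<Otimes>\<^sub>M lborel)"
  by (rule borel_measurable_scaleR[rotated])
 then show ?thesis
  unfolding phase_drift_def set_lebesgue_integral_def
  by (intro lborel.borel_measurable_lebesgue_integral) (simp add: split_beta')
qed

lemma measurable_phase_jumps:
 assumes H: "\<And>k. H m k \<in> borel_measurable M" and r: "\<And>k. r m k \<in> borel_measurable M" and f: "f \<in> borel_measurable M"
 shows "(\<lambda>z. phase_jumps H r m (f z) z) \<in> borel_measurable M"
 unfolding phase_jumps_def
 by (rule measurable_compose_countable[OF _ measurable_shock_count[where H = H and m = m, OF H f]]) (use r in measurable)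

locale measurable_input =
 fixes M :: "'a measure" and H r R :: "nat \<Rightarrow> nat \<Rightarrow> 'a \<Rightarrow> real" and T :: "nat \<Rightarrow> 'a \<Rightarrow> ennreal"
 assumes H [measurable]: "\<And>m k. H m k \<in> borel_measurable M"
  and T [measurable]: "\<And>m. T (Suc m) \<in> borel_measurable M"
  and r [measurable]: "\<And>m k. r m k \<in> borel_measurable M"
  and R [measurable]: "\<And>m k. R m k \<in> borel_measurable M"
begin

lemma T1 [measurable]: "1 \<le> k \<Longrightarrow> T k \<in> borel_measurable M"
 using T[of "k - 1"] by simp

lemma process_measurable: "process i c H T r R t \<in> borel_measurable M"
proof -
 have sc: "switch_count T t \<in> measurable M (count_space UNIV)" by (rule measurable_switch_count) (rule T1)
 have el: "elapsed T t \<in> borel_measurable M" by (rule measurable_elapsed) (rule T1)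
 have d: "(\<lambda>z. phase_drift i c H m (elapsed T t z) z) \<in> borel_measurable M"
  and j: "(\<lambda>z. phase_jumps H r m (elapsed T t z) z) \<in> borel_measurable M" for m
  using measurable_phase_drift[of H m M, OF H el] measurable_phase_jumps[of H m M r, OF H r el] by auto
 have e: "(\<lambda>z. enn2real (T (Suc m) z)) \<in> borel_measurable M" for m by measurable
 have d': "(\<lambda>z. phase_drift i c H m (enn2real (T (Suc m) z)) z) \<in> borel_measurable M"
  and j': "(\<lambda>z. phase_jumps H r m (enn2real (T (Suc m) z)) z) \<in> borel_measurable M" for m
  using measurable_phase_drift[of H m M, OF H e] measurable_phase_jumps[of H m M r, OF H r e] by auto
 have R': "(\<lambda>z. R m (shock_count H m (enn2real (T (Suc m) z)) z) z) \<in> borel_measurable M" for m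
  by (rule measurable_compose_countable[OF _ measurable_shock_count[where H = H, OF H e]]) (rule R)
 have sum: "(\<lambda>z. \<Sum>m=1..n. f m z) \<in> borel_measurable M" if "\<And>m. f (Suc m) \<in> borel_measurable M" for f :: "nat \<Rightarrow> 'a \<Rightarrow> real" and n
 proof (rule borel_measurable_sum)
  fix m assume "m \<in> {1..n}"
  then show "f m \<in> borel_measurable M" using that[of "m - 1"] by simp
 qed
 define A where "A n z = (\<Sum>m=1..n. phase_drift i c H (m - 1) (enn2real (T m z)) z)" for n z
 define B where "B n z = (\<Sum>m=1..n. R (m - 1) (shock_count H (m - 1) (enn2real (T m z)) z) z + phase_jumps H r (m - 1) (enn2real (T m z)) z)" for n z
 define C where "C m z = phase_drift i c H m (elapsed T t z) z" for m z
 define D where "D m z = phase_jumps H r m (elapsed T t z) z" for m z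
 have "A n \<in> borel_measurable M" for n unfolding A_def by (rule sum) (simp add: d')
 moreover have "B n \<in> borel_measurable M" for n unfolding B_def by (rule sum) (use R' j' in auto)
 moreover have "C m \<in> borel_measurable M" "D m \<in> borel_measurable M" for m unfolding C_def D_def by (rule d, rule j)
 ultimately have "(\<lambda>z. (A (switch_count T t z) z + C (switch_count T t z) z) + (B (switch_count T t z) z + D (switch_count T t z) z)) \<in> borel_measurable M"
  by (intro borel_measurable_add measurable_compose_countable[where f = A, OF _ sc] measurable_compose_countable[where f = B, OF _ sc]
    measurable_compose_countable[where f = C, OF _ sc] measurable_compose_countable[where f = D, OF _ sc])
 then show ?thesis
  unfolding process_def[abs_def] linear_part_def jump_part_def A_def B_def C_def D_def .
qed

lemma observation_measurable: "observation i c H T r R t \<in> borel_measurable M"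
proof -
 have sc: "switch_count T t \<in> measurable M (count_space UNIV)" by (rule measurable_switch_count) (rule T1)
 have el: "elapsed T t \<in> borel_measurable M" by (rule measurable_elapsed) (rule T1)
 have "(\<lambda>z. shock_count H (switch_count T t z) (elapsed T t z) z) \<in> measurable M (count_space UNIV)"
  by (rule measurable_compose_countable[OF measurable_shock_count[where H = H, OF H el] sc])
 moreover have "state i T t \<in> measurable M (count_space UNIV)"
  unfolding state_def[abs_def] by (rule measurable_compose[OF sc]) (rule measurable_count_space)
 moreover have "f \<in> borel_measurable M" if "f \<in> measurable M (count_space UNIV)" for f :: "'a \<Rightarrow> nat"
  using measurable_compose[OF that, of "\<lambda>x. x" borel] by simp
 ultimately show ?thesis
  unfolding observation_def[abs_def] using process_measurable[of i c t] sc
  by (intro borel_measurable_Pair) simp_all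
qed

end

lemma process_cong:
 assumes "\<And>m k. H m k z = H' m k z"
 shows "process i c H T r R t z = process i c H' T r R t z" "shock_count H m u z = shock_count H' m u z"
 using assms
 by (simp_all add: process_def linear_part_def jump_part_def phase_drift_def phase_jumps_def shock_count_def)

section \<open>Exponential tails\<close>

lemma nn_integral_Ex_exp:
 assumes b: "0 < b" and a: "0 \<le> a"
 shows "(\<integral>\<^sup>+w. ennreal (exp (- (a * w))) \<partial>Ex b) = ennreal (b / (a + b))"
proof -
 have "(\<integral>\<^sup>+w. ennreal (exp (- (a * w))) \<partial>Ex b) = (\<integral>\<^sup>+w. indicator {0<..} w * ennreal (exp (- ((a + b) * w))) * ennreal b \<partial>lborel)"
 proof -
  have e: "exp (- ((a + b) * w)) = exp (- (b * w)) * exp (- (a * w))" for w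
   unfolding exp_add[symmetric] by (simp add: distrib_right)
  show ?thesis
   unfolding e using b by (subst nn_integral_Ex) (auto intro!: nn_integral_cong simp: ennreal_mult mult_ac)
 qed
 also have "\<dots> = ennreal (1 / (a + b)) * ennreal b"
  by (rule nn_integral_exp_tail_mult) (use a b in simp)
 also have "\<dots> = ennreal (b / (a + b))"
  using a b by (subst ennreal_mult[symmetric]) auto
 finally show ?thesis .
qed

lemma emeasure_Ex_tail:
 assumes b: "0 < b" and a: "0 \<le> a" and w: "0 \<le> w"
 shows "(\<integral>\<^sup>+x. indicator {w<..} x * ennreal (exp (- (a * x))) \<partial>Ex b) = ennreal (b / (a + b) * exp (- ((a + b) * w)))"
proof -
 have "(\<integral>\<^sup>+x. indicator {w<..} x * ennreal (exp (- (a * x))) \<partial>Ex b)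
   = (\<integral>\<^sup>+x. indicator {0<..} x * ennreal (b * exp (- (b * x))) * (indicator {w<..} x * ennreal (exp (- (a * x)))) \<partial>lborel)"
  by (rule nn_integral_Ex) measurable
 also have "\<dots> = (\<integral>\<^sup>+x. indicator {0<..} (w + x) * ennreal (b * exp (- (b * (w + x)))) * (indicator {w<..} (w + x) * ennreal (exp (- (a * (w + x))))) \<partial>lborel)"
  by (rule nn_integral_shift) measurable
 also have "\<dots> = (\<integral>\<^sup>+x. indicator {0<..} x * ennreal (exp (- ((a + b) * x))) * ennreal (b * exp (- ((a + b) * w))) \<partial>lborel)"
 proof (rule nn_integral_cong)
  fix x :: real
  have "b * exp (- (b * (w + x))) * exp (- (a * (w + x))) = exp (- ((a + b) * x)) * (b * exp (- ((a + b) * w)))"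
   by (simp add: exp_add[symmetric] algebra_simps)
  then have "ennreal (b * exp (- (b * (w + x)))) * ennreal (exp (- (a * (w + x)))) = ennreal (exp (- ((a + b) * x))) * ennreal (b * exp (- ((a + b) * w)))"
   using b by (simp add: ennreal_mult[symmetric])
  then show "indicator {0<..} (w + x) * ennreal (b * exp (- (b * (w + x)))) * (indicator {w<..} (w + x) * ennreal (exp (- (a * (w + x)))))
    = indicator {0<..} x * ennreal (exp (- ((a + b) * x))) * ennreal (b * exp (- ((a + b) * w)))"
   using w by (cases "0 < x") (auto simp: mult_ac)
 qed
 also have "\<dots> = ennreal (1 / (a + b)) * ennreal (b * exp (- ((a + b) * w)))"
  by (rule nn_integral_exp_tail_mult) (use a b in simp)
 also have "\<dots> = ennreal (b / (a + b) * exp (- ((a + b) * w)))"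
  using a b by (subst ennreal_mult[symmetric]) auto
 finally show ?thesis .
qed

section \<open>Two disintegration lemmas\<close>

lemma (in prob_space) nn_integral_indep:
 assumes F: "space F = space M" "sets F \<subseteq> events" and Y [measurable]: "Y \<in> M \<rightarrow>\<^sub>M N"
  and indep: "\<And>A B. A \<in> sets F \<Longrightarrow> B \<in> sets N \<Longrightarrow> prob (A \<inter> (Y -` B \<inter> space M)) = prob A * prob (Y -` B \<inter> space M)"
  and \<Phi>: "\<Phi> \<in> borel_measurable (F \<Otimes>\<^sub>M N)"
 shows "(\<integral>\<^sup>+z. \<Phi> (z, Y z) \<partial>M) = (\<integral>\<^sup>+z. (\<integral>\<^sup>+y. \<Phi> (z, y) \<partial>distr M N Y) \<partial>M)"
proof -
 have id: "(\<lambda>z. z) \<in> M \<rightarrow>\<^sub>M F"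
  using F by (auto simp: measurable_def)
 have pair: "(\<lambda>z. (z, Y z)) \<in> M \<rightarrow>\<^sub>M F \<Otimes>\<^sub>M N"
  using id Y by (rule measurable_Pair)
 interpret Fp: prob_space "distr M F (\<lambda>z. z)" by (rule prob_space_distr[OF id])
 interpret Np: prob_space "distr M N Y" by (rule prob_space_distr[OF Y])
 have eq: "distr M F (\<lambda>z. z) \<Otimes>\<^sub>M distr M N Y = distr M (F \<Otimes>\<^sub>M N) (\<lambda>z. (z, Y z))"
 proof (rule pair_measure_eqI)
  fix A B assume A: "A \<in> sets (distr M F (\<lambda>z. z))" and B: "B \<in> sets (distr M N Y)"
  have "A \<subseteq> space M" using A F sets.sets_into_space[of A F] by auto
  then have "(\<lambda>z. (z, Y z)) -` (A \<times> B) \<inter> space M = A \<inter> (Y -` B \<inter> space M)" "(\<lambda>z. z) -` A \<inter> space M = A"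
   by auto
  then show "emeasure (distr M F (\<lambda>z. z)) A * emeasure (distr M N Y) B = emeasure (distr M (F \<Otimes>\<^sub>M N) (\<lambda>z. (z, Y z))) (A \<times> B)"
   using A B indep[of A B]
   by (simp add: emeasure_distr[OF id] emeasure_distr[OF Y] emeasure_distr[OF pair] emeasure_eq_measure ennreal_mult[symmetric])
 qed (auto intro: Fp.sigma_finite_measure_axioms Np.sigma_finite_measure_axioms cong: sets_pair_measure_cong)
 have \<Phi>': "\<Phi> \<in> borel_measurable (distr M F (\<lambda>z. z) \<Otimes>\<^sub>M distr M N Y)"
  using \<Phi> by (simp cong: measurable_cong_sets sets_pair_measure_cong)
 have "(\<integral>\<^sup>+z. \<Phi> (z, Y z) \<partial>M) = (\<integral>\<^sup>+p. \<Phi> p \<partial>distr M (F \<Otimes>\<^sub>M N) (\<lambda>z. (z, Y z)))"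
  using \<Phi> by (subst nn_integral_distr[OF pair]) auto
 also have "\<dots> = (\<integral>\<^sup>+z. (\<integral>\<^sup>+y. \<Phi> (z, y) \<partial>distr M N Y) \<partial>distr M F (\<lambda>z. z))"
  unfolding eq[symmetric] by (rule Np.nn_integral_fst[OF \<Phi>', symmetric])
 also have "\<dots> = (\<integral>\<^sup>+z. (\<integral>\<^sup>+y. \<Phi> (z, y) \<partial>distr M N Y) \<partial>M)"
  using Np.borel_measurable_nn_integral_fst[OF \<Phi>'] by (subst nn_integral_distr[OF id]) (auto cong: measurable_cong_sets)
 finally show ?thesis .
qed

text \<open>
 The assumed identity concerns a past event together with a half-line for the random variable; such products
 generate the product sigma-algebra.
\<close>

lemma (in prob_space) nn_integral_disintegrate:
 fixes W :: "'a \<Rightarrow> real"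
 assumes F: "space F = space M" "sets F \<subseteq> events"
  and X [measurable]: "X \<in> events" and Y [measurable]: "Y \<in> events" and W [measurable]: "W \<in> borel_measurable M"
  and K: "sets K = sets borel" "finite_measure K"
  and eq: "\<And>A w. A \<in> sets F \<Longrightarrow> emeasure M (A \<inter> X \<inter> {z \<in> space M. w < W z}) = emeasure M (A \<inter> Y) * emeasure K {w<..}"
  and \<Phi>: "\<Phi> \<in> borel_measurable (F \<Otimes>\<^sub>M borel)"
 shows "(\<integral>\<^sup>+z. indicator X z * \<Phi> (z, W z) \<partial>M) = (\<integral>\<^sup>+z. indicator Y z * (\<integral>\<^sup>+w. \<Phi> (z, w) \<partial>K) \<partial>M)"
proof -
 interpret K: finite_measure K by fact
 have id: "(\<lambda>z. z) \<in> M \<rightarrow>\<^sub>M F"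
  using F by (auto simp: measurable_def)
 have pair: "(\<lambda>z. (z, W z)) \<in> M \<rightarrow>\<^sub>M F \<Otimes>\<^sub>M borel"
  using id W by (rule measurable_Pair)
 define MX where "MX = density M (indicator X)"
 define MY where "MY = density M (indicator Y)"
 have idX: "(\<lambda>z. z) \<in> MX \<rightarrow>\<^sub>M F" "(\<lambda>z. z) \<in> MY \<rightarrow>\<^sub>M F" and WX: "W \<in> MX \<rightarrow>\<^sub>M borel" and pairX: "(\<lambda>z. (z, W z)) \<in> MX \<rightarrow>\<^sub>M F \<Otimes>\<^sub>M borel"
  using id W pair by (simp_all add: MX_def MY_def)
 have emX: "emeasure MX A = emeasure M (A \<inter> X)" "emeasure MY A = emeasure M (A \<inter> Y)" if "A \<in> events" for A
  using that by (simp_all add: MX_def MY_def emeasure_restricted Int_commute)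
 have half: "emeasure M (A \<inter> X \<inter> (W -` B \<inter> space M)) = emeasure M (A \<inter> Y) * emeasure K B" if A: "A \<in> sets F" and B: "B \<in> sets borel" for A B
 proof -
  have [measurable]: "A \<in> events" using A F by auto
  define D where "D = density M (indicator (A \<inter> X))"
  define E where "E = density K (\<lambda>_. emeasure M (A \<inter> Y))"
  have WD: "W \<in> D \<rightarrow>\<^sub>M borel" by (simp add: D_def)
  have emD: "emeasure (distr D borel W) C = emeasure M (A \<inter> X \<inter> (W -` C \<inter> space M))" if "C \<in> sets borel" for C
  proof -
   have "W -` C \<inter> space M \<in> events" using that by measurable
   then show ?thesis
    using that by (simp add: emeasure_distr[OF WD]) (simp add: D_def emeasure_restricted sets.Int)
  qed
  have emE: "emeasure E C = emeasure M (A \<inter> Y) * emeasure K C" if "C \<in> sets borel" for C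
   using that K by (simp add: E_def emeasure_density nn_integral_cmult)
  have "distr D borel W = E"
  proof (rule measure_eqI_lessThan)
   fix x :: real
   have "emeasure (distr D borel W) {x<..} = emeasure M (A \<inter> X \<inter> {z \<in> space M. x < W z})"
    by (subst emD) (auto intro!: arg_cong[where f = "emeasure M"])
   also have "\<dots> = emeasure E {x<..}" using eq[OF A] by (simp add: emE)
   finally show "emeasure (distr D borel W) {x<..} = emeasure E {x<..}" .
   show "emeasure (distr D borel W) {x<..} < \<infinity>"
    by (subst emD) (auto simp: emeasure_eq_measure)
  qed (simp_all add: E_def K)
  then show ?thesis using emD[OF B] emE[OF B] by simp
 qed
 interpret Fp: finite_measure "distr MY F (\<lambda>z. z)"
 proof
  have "(\<lambda>z. z) -` space F \<inter> space MY = space M" using F by (simp add: MY_def)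
  then have "emeasure (distr MY F (\<lambda>z. z)) (space (distr MY F (\<lambda>z. z))) = emeasure MY (space M)"
   by (simp add: emeasure_distr[OF idX(2) sets.top])
  also have "\<dots> = emeasure M (space M \<inter> Y)" by (rule emX(2)) simp
  finally show "emeasure (distr MY F (\<lambda>z. z)) (space (distr MY F (\<lambda>z. z))) \<noteq> \<infinity>"
   by (simp add: emeasure_eq_measure)
 qed
 have eq2: "distr MY F (\<lambda>z. z) \<Otimes>\<^sub>M K = distr MX (F \<Otimes>\<^sub>M borel) (\<lambda>z. (z, W z))"
 proof (rule pair_measure_eqI)
  fix A B assume A: "A \<in> sets (distr MY F (\<lambda>z. z))" and B: "B \<in> sets K"
  have AM: "A \<in> events" and sub: "A \<subseteq> space M" using A F sets.sets_into_space[of A F] by auto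
  have "emeasure (distr MX (F \<Otimes>\<^sub>M borel) (\<lambda>z. (z, W z))) (A \<times> B) = emeasure MX (A \<inter> (W -` B \<inter> space M))"
  proof -
   have "(\<lambda>z. (z, W z)) -` (A \<times> B) \<inter> space MX = A \<inter> (W -` B \<inter> space M)"
    using sub by (auto simp: MX_def)
   then show ?thesis using A B K by (simp add: emeasure_distr[OF pairX])
  qed
  also have "\<dots> = emeasure M (A \<inter> X \<inter> (W -` B \<inter> space M))"
  proof -
   have "A \<inter> (W -` B \<inter> space M) \<in> events" using AM B K by (auto intro!: sets.Int measurable_sets[OF W])
   then show ?thesis by (simp add: emX Int_ac)
  qed
  also have "\<dots> = emeasure M (A \<inter> Y) * emeasure K B"
   using half[of A B] A B K by simp
  also have "emeasure M (A \<inter> Y) = emeasure (distr MY F (\<lambda>z. z)) A"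
  proof -
   have "(\<lambda>z. z) -` A \<inter> space MY = A" using sub by (auto simp: MY_def)
   then show ?thesis using A AM by (simp add: emeasure_distr[OF idX(2)] emX)
  qed
  finally show "emeasure (distr MY F (\<lambda>z. z)) A * emeasure K B = emeasure (distr MX (F \<Otimes>\<^sub>M borel) (\<lambda>z. (z, W z))) (A \<times> B)" by simp
 qed (auto intro: Fp.sigma_finite_measure_axioms K.sigma_finite_measure_axioms simp: K cong: sets_pair_measure_cong)
 have \<Phi>': "\<Phi> \<in> borel_measurable (distr MY F (\<lambda>z. z) \<Otimes>\<^sub>M K)"
  using \<Phi> K by (simp cong: measurable_cong_sets sets_pair_measure_cong)
 have \<Phi>W: "(\<lambda>z. \<Phi> (z, W z)) \<in> borel_measurable M"
  using measurable_compose[OF pair \<Phi>] .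
 have in_m: "(\<lambda>z. \<integral>\<^sup>+w. \<Phi> (z, w) \<partial>K) \<in> borel_measurable F"
  using K.borel_measurable_nn_integral_fst[OF \<Phi>'] by (simp cong: measurable_cong_sets)
 have "(\<integral>\<^sup>+z. indicator X z * \<Phi> (z, W z) \<partial>M) = (\<integral>\<^sup>+z. \<Phi> (z, W z) \<partial>MX)"
  unfolding MX_def using \<Phi>W by (subst nn_integral_density) auto
 also have "\<dots> = (\<integral>\<^sup>+p. \<Phi> p \<partial>distr MX (F \<Otimes>\<^sub>M borel) (\<lambda>z. (z, W z)))"
  using \<Phi> by (subst nn_integral_distr[OF pairX]) auto
 also have "\<dots> = (\<integral>\<^sup>+z. (\<integral>\<^sup>+w. \<Phi> (z, w) \<partial>K) \<partial>distr MY F (\<lambda>z. z))"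
  unfolding eq2[symmetric] by (rule K.nn_integral_fst[OF \<Phi>', symmetric])
 also have "\<dots> = (\<integral>\<^sup>+z. (\<integral>\<^sup>+w. \<Phi> (z, w) \<partial>K) \<partial>MY)"
  using in_m by (subst nn_integral_distr[OF idX(2)]) auto
 also have "\<dots> = (\<integral>\<^sup>+z. indicator Y z * (\<integral>\<^sup>+w. \<Phi> (z, w) \<partial>K) \<partial>M)"
  unfolding MY_def using measurable_compose[OF id in_m] by (subst nn_integral_density) auto
 finally show ?thesis .
qed

section \<open>Generated sigma-algebras\<close>

lemma space_gen_sigma [simp]: "space (gen_sigma \<Omega> Y I) = \<Omega>"
 unfolding gen_sigma_def by (rule space_measure_of) auto

lemma sets_gen_sigma: "sets (gen_sigma \<Omega> Y I) = sigma_sets \<Omega> (\<Union>s\<in>I. {Y s -` A \<inter> \<Omega> | A. A \<in> sets borel})"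
 unfolding gen_sigma_def by (rule sets_measure_of) auto

lemma measurable_gen_sigma: "s \<in> I \<Longrightarrow> Y s \<in> borel_measurable (gen_sigma \<Omega> Y I)"
 by (rule measurableI) (auto simp: sets_gen_sigma)

lemma gen_sigma_least:
 assumes "\<And>s. s \<in> I \<Longrightarrow> Y s \<in> borel_measurable M" and "space M = \<Omega>"
 shows "sets (gen_sigma \<Omega> Y I) \<subseteq> sets M"
 unfolding sets_gen_sigma assms(2)[symmetric]
 by (rule sets.sigma_sets_subset) (use assms in \<open>auto intro: measurable_sets\<close>)

lemma measurable_sub:
 assumes "f \<in> F \<rightarrow>\<^sub>M N" "space F = space M" "sets F \<subseteq> sets M"
 shows "f \<in> M \<rightarrow>\<^sub>M N"
 using assms by (auto simp: measurable_def)

section \<open>The driving processes\<close>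

context switching_model
begin

abbreviation l :: "nat \<Rightarrow> nat \<Rightarrow> real" where "l m n \<equiv> lam (eps i m) n"
abbreviation b :: "nat \<Rightarrow> nat \<Rightarrow> real" where "b m n \<equiv> mu (eps i m) n"

lemma eps_cases: "eps j m \<in> {0, 1}"
 by (auto simp: eps_def)

lemma l_pos: "0 < l m n" and b_pos: "0 < b m n"
 using lam_pos[OF eps_cases] mu_pos[OF eps_cases] by auto

lemma H_rv [measurable]: "H m n \<in> borel_measurable P"
 using distributed_measurable[OF H_exponential[of m n]] by simp

sublocale input: measurable_input P H r R T
 by unfold_locales (use H_rv T_measurable r_measurable R_measurable in auto)

lemma nn_integral_H:
 assumes [measurable]: "f \<in> borel_measurable borel"
 shows "(\<integral>\<^sup>+z. f (H m n z) \<partial>P) = (\<integral>\<^sup>+w. f w \<partial>Ex (l m n))"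
 using distributed_nn_integral[OF H_exponential[of m n], of f] nn_integral_Ex_erlang[OF assms, of "l m n"] by simp

lemma AE_H_pos: "AE z in P. 0 < H m n z"
proof -
 have "\<P>(z in P. 0 < H m n z) = 1"
  using exponential_distributedD_gt[OF H_exponential[of m n] order_refl l_pos] by simp
 then show ?thesis by (subst (asm) prob_Collect_eq_1) auto
qed

text \<open>
 The Laplace transform of the \<open>n\<close>-th partial sum is the product of \<open>l / (1 + l)\<close>,
 which tends to 0 because \<open>1 / l\<close> is not summable.
\<close>

lemma AE_H_unbounded: "AE z in P. \<forall>t. \<exists>n. t < (\<Sum>k<n. H m k z)"
proof -
 have lapl: "(\<integral>\<^sup>+z. ennreal (exp (- (\<Sum>k<n. H m k z))) \<partial>P) = ennreal (\<Prod>k<n. l m k / (1 + l m k))" for n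
 proof -
  have ind: "indep_vars (\<lambda>_. borel) (\<lambda>k z. ennreal (exp (- H m k z))) {..<n}"
   using indep_vars_compose2[OF indep_vars_subset[OF H_indep[of m], of "{..<n}"], of "\<lambda>_ x. ennreal (exp (- x))" "\<lambda>_. borel"] by simp
  have "(\<integral>\<^sup>+z. ennreal (exp (- (\<Sum>k<n. H m k z))) \<partial>P) = (\<integral>\<^sup>+z. (\<Prod>k<n. ennreal (exp (- H m k z))) \<partial>P)"
   by (simp add: sum_negf[symmetric] exp_sum prod_ennreal)
  also have "\<dots> = (\<Prod>k<n. \<integral>\<^sup>+z. ennreal (exp (- H m k z)) \<partial>P)"
   by (rule indep_vars_nn_integral[OF _ ind]) auto
  also have "\<dots> = (\<Prod>k<n. ennreal (l m k / (1 + l m k)))"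
  proof (rule prod.cong[OF refl])
   fix k
   show "(\<integral>\<^sup>+z. ennreal (exp (- H m k z)) \<partial>P) = ennreal (l m k / (1 + l m k))"
    using nn_integral_H[of "\<lambda>x. ennreal (exp (- x))" m k] nn_integral_Ex_exp[OF l_pos[of m k], of 1] by simp
  qed
  also have "\<dots> = ennreal (\<Prod>k<n. l m k / (1 + l m k))"
   using l_pos by (intro prod_ennreal) (auto intro!: divide_nonneg_nonneg simp: less_imp_le add_nonneg_nonneg)
  finally show ?thesis .
 qed
 have small: "\<exists>n. (\<Prod>k<n. l m k / (1 + l m k)) < e" if e: "0 < e" for e
 proof (rule ccontr)
  assume no: "\<not> ?thesis"
  have pos: "0 < 1 + l m k" for k using l_pos[of m k] by simp
  have "(\<Sum>k<n. 1 / (1 + l m k)) \<le> - ln e" for n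
  proof -
   have "e \<le> (\<Prod>k<n. l m k / (1 + l m k))" using no by (auto simp: not_less)
   also have "\<dots> \<le> (\<Prod>k<n. exp (- (1 / (1 + l m k))))"
   proof (rule prod_mono, intro conjI)
    fix k
    show "0 \<le> l m k / (1 + l m k)" using l_pos[of m k] pos[of k] by (simp add: less_imp_le)
    have "l m k / (1 + l m k) = 1 + - (1 / (1 + l m k))" using pos[of k] by (simp add: field_simps)
    also have "\<dots> \<le> exp (- (1 / (1 + l m k)))" by (rule exp_ge_add_one_self)
    finally show "l m k / (1 + l m k) \<le> exp (- (1 / (1 + l m k)))" .
   qed
   also have "\<dots> = exp (- (\<Sum>k<n. 1 / (1 + l m k)))" by (simp add: exp_sum sum_negf[symmetric])
   finally have "ln e \<le> ln (exp (- (\<Sum>k<n. 1 / (1 + l m k))))"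
    using e by (subst ln_le_cancel_iff) auto
   then show ?thesis by simp
  qed
  then have sm: "summable (\<lambda>k. 1 / (1 + l m k))"
   by (intro summableI_nonneg_bounded[where x = "- ln e"]) (use pos in \<open>auto simp: less_imp_le\<close>)
  have "\<forall>\<^sub>F k in sequentially. 1 / (1 + l m k) < 1 / 2"
   using order_tendstoD(2)[OF summable_LIMSEQ_zero[OF sm], of "1/2"] by simp
  then have "\<forall>\<^sub>F k in sequentially. norm (1 / l m k) \<le> 2 * (1 / (1 + l m k))"
  proof eventually_elim
   case (elim k)
   then show ?case using l_pos[of m k] pos[of k] by (simp add: field_simps)
  qed
  then have "summable (\<lambda>k. 1 / l m k)"
   using summable_mult[OF sm] by (rule summable_comparison_test_ev)
  with lam_non_explosive[OF eps_cases[of i m]] show False by simp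
 qed
 have "AE z in P. \<exists>n. real t < (\<Sum>k<n. H m k z)" for t :: nat
 proof -
  define Z where "Z = {z \<in> space P. \<forall>n. (\<Sum>k<n. H m k z) \<le> real t}"
  have [measurable]: "Z \<in> sets P" unfolding Z_def by measurable
  have le: "prob Z \<le> exp (real t) * (\<Prod>k<n. l m k / (1 + l m k))" for n
  proof -
   have nn: "0 \<le> (\<Prod>k<n. l m k / (1 + l m k))"
    using l_pos by (auto intro!: prod_nonneg divide_nonneg_nonneg simp: less_imp_le add_nonneg_nonneg)
   have "ennreal (exp (- real t)) * emeasure P Z = (\<integral>\<^sup>+z. ennreal (exp (- real t)) * indicator Z z \<partial>P)"
    by (subst nn_integral_cmult_indicator) auto
   also have "\<dots> \<le> (\<integral>\<^sup>+z. ennreal (exp (- (\<Sum>k<n. H m k z))) \<partial>P)"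
    by (intro nn_integral_mono) (auto simp: Z_def indicator_def intro!: ennreal_leI)
   also have "\<dots> = ennreal (\<Prod>k<n. l m k / (1 + l m k))" by (rule lapl)
   finally have "exp (- real t) * prob Z \<le> (\<Prod>k<n. l m k / (1 + l m k))"
    using nn by (simp add: emeasure_eq_measure ennreal_mult[symmetric])
   from mult_left_mono[OF this, of "exp (real t)"] show ?thesis
    by (simp add: mult.assoc[symmetric] exp_add[symmetric])
  qed
  have "prob Z \<le> 0"
  proof (rule field_le_epsilon)
   fix e :: real assume "0 < e"
   then obtain n where "(\<Prod>k<n. l m k / (1 + l m k)) < e / exp (real t)"
    using small[of "e / exp (real t)"] by auto
   then have "exp (real t) * (\<Prod>k<n. l m k / (1 + l m k)) < e" by (simp add: field_simps)
   with le[of n] show "prob Z \<le> 0 + e" by simp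
  qed
  then have "emeasure P Z = 0" by (simp add: emeasure_eq_measure measure_le_0_iff)
  then have "AE z in P. z \<notin> Z" by (intro AE_not_in) (auto simp: null_sets_def)
  with AE_space show ?thesis by eventually_elim (auto simp: Z_def not_le)
 qed
 then have "AE z in P. \<forall>t::nat. \<exists>n. real t < (\<Sum>k<n. H m k z)" by (simp add: AE_all_countable)
 then show ?thesis
 proof eventually_elim
  case (elim z)
  show ?case
  proof
   fix t :: real
   obtain N :: nat where "t < real N" using reals_Archimedean2 by blast
   with elim[rule_format, of N] show "\<exists>n. t < (\<Sum>k<n. H m k z)" by (auto intro: less_trans)
  qed
 qed
qed

lemma AE_proper_all: "AE z in P. \<forall>m. proper (\<lambda>k. H m k z)"
proof -
 have "AE z in P. \<forall>m. (\<forall>k. 0 < H m k z) \<and> (\<forall>t. \<exists>n. t < (\<Sum>k<n. H m k z))"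
  using AE_H_pos AE_H_unbounded by (simp add: AE_all_countable AE_conj_iff)
 then show ?thesis by (simp add: proper_def)
qed

text \<open>
 The conditional law of the switching gap is prescribed given the counts only. The holding times are functions
 of the counts almost surely, but need not be measurable with respect to them.
\<close>

definition sN :: "nat \<Rightarrow> 'a measure" where
 "sN m = gen_sigma (space P) (shock_count H m) {0..}"

lemma shock_count_rv: "shock_count H m t \<in> borel_measurable P"
 using measurable_compose[OF measurable_shock_count[where H = H and m = m, OF H_rv measurable_const, of t], of "\<lambda>x. x" borel] by simp

lemma space_sN [simp]: "space (sN m) = space P" by (simp add: sN_def)

lemma sets_sN: "sets (sN m) \<subseteq> sets P"
 unfolding sN_def by (rule gen_sigma_least) (auto intro: shock_count_rv)

lemma sN_shock [measurable]: "0 \<le> t \<Longrightarrow> shock_count H m t \<in> borel_measurable (sN m)"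
 unfolding sN_def by (rule measurable_gen_sigma) simp

text \<open>
 The time of the \<open>n\<close>-th shock, recovered from the counts at rational times.
\<close>

definition hit :: "nat \<Rightarrow> nat \<Rightarrow> 'a \<Rightarrow> real" where
 "hit m n z = enn2real (INF q\<in>\<rat> \<inter> {0..}. if shock_count H m q z < n then \<top> else ennreal q)"

text \<open>
 A version of the holding time that is a function of the counts.
\<close>

definition Hh :: "nat \<Rightarrow> nat \<Rightarrow> 'a \<Rightarrow> real" where
 "Hh m k z = hit m (Suc k) z - hit m k z"

lemma hit_measurable [measurable]: "hit m n \<in> borel_measurable (sN m)"
proof -
 have "(\<lambda>z. if shock_count H m q z < n then \<top> else ennreal q) \<in> borel_measurable (sN m)" if "q \<in> \<rat> \<inter> {0..}" for q
 proof -
  have [measurable]: "shock_count H m q \<in> borel_measurable (sN m)" using that by (intro sN_shock) auto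
  show ?thesis by measurable
 qed
 moreover have "countable (\<rat> \<inter> {0::real..})" by (rule countable_Int1) (rule countable_rat)
 ultimately have "(\<lambda>z. INF q\<in>\<rat> \<inter> {0..}. if shock_count H m q z < n then \<top> else ennreal q) \<in> borel_measurable (sN m)"
  by (intro borel_measurable_INF)
 then show ?thesis unfolding hit_def[abs_def] by measurable
qed

lemma Hh_sN [measurable]: "Hh m k \<in> borel_measurable (sN m)"
 unfolding Hh_def[abs_def] by measurable

lemma Hh_rv [measurable]: "Hh m k \<in> borel_measurable P"
 by (rule measurable_sub[OF Hh_sN]) (use sets_sN in auto)

lemma hit_eq:
 assumes p: "proper (\<lambda>k. H m k z)" shows "hit m n z = (\<Sum>k<n. H m k z)"
proof -
 define S where "S = (\<Sum>k<n. H m k z)"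
 have S0: "0 \<le> S" unfolding S_def by (rule proper_nonneg[OF p])
 have cnt: "shock_count H m q z < n \<longleftrightarrow> q < S" if "0 \<le> q" for q
  using proper_count[OF p that, of n] unfolding S_def shock_count_eq_Max by (auto simp: not_le[symmetric])
 have "(INF q\<in>\<rat> \<inter> {0..}. if shock_count H m q z < n then \<top> else ennreal q) = ennreal S"
 proof (rule antisym)
  show "ennreal S \<le> (INF q\<in>\<rat> \<inter> {0..}. if shock_count H m q z < n then \<top> else ennreal q)"
   by (rule INF_greatest) (auto simp: cnt not_less intro: ennreal_leI)
  show "(INF q\<in>\<rat> \<inter> {0..}. if shock_count H m q z < n then \<top> else ennreal q) \<le> ennreal S"
  proof (rule ennreal_le_epsilon)
   fix e :: real assume "0 < e"
   then obtain q where q: "q \<in> \<rat>" "S < q" "q < S + e" using Rats_dense_in_real[of S "S + e"] by auto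
   have "(INF q\<in>\<rat> \<inter> {0..}. if shock_count H m q z < n then \<top> else ennreal q) \<le> (if shock_count H m q z < n then \<top> else ennreal q)"
    by (rule INF_lower) (use q S0 in auto)
   also have "\<dots> = ennreal q" using cnt[of q] q S0 by auto
   also have "\<dots> \<le> ennreal (S + e)" using q by (intro ennreal_leI) auto
   also have "\<dots> = ennreal S + ennreal e" using S0 \<open>0 < e\<close> by simp
   finally show "(INF q\<in>\<rat> \<inter> {0..}. if shock_count H m q z < n then \<top> else ennreal q) \<le> ennreal S + ennreal e" .
  qed
 qed
 then show ?thesis unfolding hit_def using S0 by (simp add: S_def)
qed

lemma Hh_eq: "proper (\<lambda>k. H m k z) \<Longrightarrow> Hh m n z = H m n z"
 by (simp add: Hh_def hit_eq)

lemma AE_Hh: "AE z in P. \<forall>m n. Hh m n z = H m n z"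
 using AE_proper_all by eventually_elim (auto intro: Hh_eq)

lemma Hh_events_indep:
 assumes B: "B \<in> sets (gen_sigma (space P) (Hh m) {..<n})" and C: "C \<in> sets borel"
 shows "prob (B \<inter> (Hh m n -` C \<inter> space P)) = prob B * prob (Hh m n -` C \<inter> space P)"
proof -
 define E where "E k = {Hh m k -` A \<inter> space P | A. A \<in> sets (borel :: real measure)}" for k
 have ind: "indep_sets E UNIV"
 proof (rule indep_setsI)
  show "E k \<subseteq> events" for k unfolding E_def by (auto intro: measurable_sets)
  fix X J assume J: "J \<noteq> {}" "finite (J::nat set)" and X: "\<forall>j\<in>J. X j \<in> E j"
  then have "\<forall>j\<in>J. \<exists>A. A \<in> sets (borel::real measure) \<and> X j = Hh m j -` A \<inter> space P" by (auto simp: E_def)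
  then obtain A where A: "\<And>j. j \<in> J \<Longrightarrow> A j \<in> sets (borel::real measure)" "\<And>j. j \<in> J \<Longrightarrow> X j = Hh m j -` A j \<inter> space P" by metis
  have ev: "X j \<in> events" "H m j -` A j \<inter> space P \<in> events" if "j \<in> J" for j
   using A(1)[OF that] A(2)[OF that] by (auto intro: measurable_sets)
  have cong: "AE z in P. (z \<in> X j) = (z \<in> H m j -` A j \<inter> space P)" if "j \<in> J" for j
   using AE_Hh by eventually_elim (auto simp: A(2)[OF that])
  have "prob (\<Inter>j\<in>J. X j) = prob (\<Inter>j\<in>J. H m j -` A j \<inter> space P)"
  proof (rule finite_measure_eq_AE)
   have "AE z in P. \<forall>j\<in>J. (z \<in> X j) = (z \<in> H m j -` A j \<inter> space P)"
    using cong J(2) by (simp add: AE_finite_all)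
   then show "AE z in P. (z \<in> (\<Inter>j\<in>J. X j)) = (z \<in> (\<Inter>j\<in>J. H m j -` A j \<inter> space P))"
    by eventually_elim auto
   show "(\<Inter>j\<in>J. X j) \<in> events" "(\<Inter>j\<in>J. H m j -` A j \<inter> space P) \<in> events"
    by (rule sets.finite_INT; use J ev in blast)+
  qed
  also have "\<dots> = (\<Prod>j\<in>J. prob (H m j -` A j \<inter> space P))"
  proof -
   have ind': "indep_sets (\<lambda>k. {H m k -` A \<inter> space P | A. A \<in> sets (borel :: real measure)}) UNIV"
    using H_indep[of m] by (simp add: indep_vars_def2)
   have "\<forall>j\<in>J. H m j -` A j \<inter> space P \<in> {H m j -` A \<inter> space P | A. A \<in> sets (borel :: real measure)}"
    using A(1) by blast
   then show ?thesis by (rule indep_setsD[OF ind' subset_UNIV J(1) J(2)])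
  qed
  also have "\<dots> = (\<Prod>j\<in>J. prob (X j))"
   by (intro prod.cong refl finite_measure_eq_AE[symmetric] cong ev)
  finally show "prob (\<Inter>j\<in>J. X j) = (\<Prod>j\<in>J. prob (X j))" .
 qed
 define I where "I j = (if j then {..<n} else {n})" for j
 have st: "Int_stable (E k)" for k
 proof (rule Int_stableI)
  fix a c assume "a \<in> E k" "c \<in> E k"
  then obtain A A' where "A \<in> sets borel" "A' \<in> sets borel" "a = Hh m k -` A \<inter> space P" "c = Hh m k -` A' \<inter> space P"
   by (auto simp: E_def)
  then show "a \<inter> c \<in> E k" unfolding E_def by (intro CollectI exI[of _ "A \<inter> A'"]) auto
 qed
 have "indep_sets (\<lambda>j. sigma_sets (space P) (\<Union>k\<in>I j. E k)) UNIV"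
 proof (rule indep_sets_collect_sigma)
  show "indep_sets E (\<Union>j\<in>UNIV. I j)" by (rule indep_sets_mono_index[OF _ ind]) simp
  show "disjoint_family_on I UNIV" by (auto simp: disjoint_family_on_def I_def)
 qed (rule st)
 from indep_setsD[OF this, of UNIV "\<lambda>j. if j then B else Hh m n -` C \<inter> space P"]
 have "prob (\<Inter>j. if j then B else Hh m n -` C \<inter> space P) = (\<Prod>j\<in>UNIV. prob (if j then B else Hh m n -` C \<inter> space P))"
  using B C by (simp add: I_def sets_gen_sigma E_def UNIV_bool) (auto intro!: sigma_sets.Basic)
 then show ?thesis by (simp add: UNIV_bool Int_commute mult.commute)
qed

section \<open>The law of a switching gap given its driving process\<close>

abbreviation hazard :: "nat \<Rightarrow> real \<Rightarrow> 'a \<Rightarrow> real" where "hazard m t z \<equiv> phase_drift i mu H m t z"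

lemma gap_law_fixed:
 assumes D: "D \<in> sets (sN m)" and t: "0 \<le> t"
 shows "emeasure P (D \<inter> {z \<in> space P. ennreal t < T (Suc m) z}) = (\<integral>\<^sup>+z. indicator D z * ennreal (exp (- hazard m t z)) \<partial>P)"
proof -
 have [measurable]: "T (Suc m) \<in> borel_measurable P" by (rule T_measurable)
 have DP [measurable]: "D \<in> sets P" using D sets_sN by auto
 interpret S: finite_measure_subalgebra P "sN m"
  by unfold_locales (auto simp: subalgebra_def sets_sN[THEN subsetD])
 interpret S: sigma_finite_subalgebra P "sN m"
  by (rule finite_measure_subalgebra_is_sigma_finite) unfold_locales
 define X where "X = {z \<in> space P. ennreal t < T (Suc m) z}"
 have [measurable]: "X \<in> sets P" unfolding X_def by measurable
 have Am [measurable]: "hazard m t \<in> borel_measurable P"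
  by (rule measurable_phase_drift) auto
 have ce: "AE z in P. real_cond_exp P (sN m) (indicator X) z = exp (- hazard m t z)"
  using T_conditional_law[OF t, of m] unfolding sN_def X_def phase_drift_def .
 have int: "integrable P (indicator X :: 'a \<Rightarrow> real)"
  by (rule integrable_real_indicator) (simp_all add: emeasure_eq_measure)
 have "(\<integral>z\<in>D. indicator X z \<partial>P) = (\<integral>z\<in>D. real_cond_exp P (sN m) (indicator X) z \<partial>P)"
  by (rule S.real_cond_exp_intA[OF int D])
 also have "\<dots> = (\<integral>z. indicator D z * exp (- hazard m t z) \<partial>P)"
  unfolding set_lebesgue_integral_def using ce by (intro integral_cong_AE) (auto elim: eventually_mono)
 also have "(\<integral>z\<in>D. indicator X z \<partial>P) = prob (D \<inter> X)"
  unfolding set_lebesgue_integral_def by (simp add: indicator_inter_arith[symmetric])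
 finally have eq: "prob (D \<inter> X) = (\<integral>z. indicator D z * exp (- hazard m t z) \<partial>P)" .
 have cint: "integrable P (\<lambda>z. indicator D z * exp (- hazard m t z))"
 proof -
  have "integrable P (\<lambda>z. indicator D z * real_cond_exp P (sN m) (indicator X) z)"
   using integrable_mult_indicator[OF DP S.real_cond_exp_int(1)[OF int]] by simp
  then show ?thesis using ce by (subst integrable_cong_AE[symmetric]) (auto elim: eventually_mono)
 qed
 have "ennreal (prob (D \<inter> X)) = (\<integral>\<^sup>+z. ennreal (indicator D z * exp (- hazard m t z)) \<partial>P)"
  unfolding eq using cint by (intro nn_integral_eq_integral[symmetric]) auto
 then show ?thesis
  unfolding X_def[symmetric] emeasure_eq_measure by (simp add: ennreal_mult'' ennreal_indicator)
qed

lemma hazard_formula: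
 assumes "proper (\<lambda>k. H m k z)" "0 \<le> v" "v \<le> H m n z"
 shows "hazard m ((\<Sum>k<n. H m k z) + v) z = (\<Sum>k<n. b m k * H m k z) + b m n * v"
 by (rule phase_drift_formula[where H = H and m = m and z = z, OF assms])

lemma hazard_nonneg:
 assumes "proper (\<lambda>k. H m k z)" "0 \<le> t" shows "0 \<le> hazard m t z"
proof -
 obtain n where n: "(\<Sum>k<n. H m k z) \<le> t" "t < (\<Sum>k<Suc n. H m k z)"
  using proper_interval[OF assms] by blast
 have "hazard m ((\<Sum>k<n. H m k z) + (t - (\<Sum>k<n. H m k z))) z = (\<Sum>k<n. b m k * H m k z) + b m n * (t - (\<Sum>k<n. H m k z))"
  using n by (intro hazard_formula[OF assms(1)]) auto
 moreover have "0 \<le> (\<Sum>k<n. b m k * H m k z)"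
  using b_pos assms(1) by (intro sum_nonneg mult_nonneg_nonneg) (auto simp: proper_def less_imp_le)
 ultimately show ?thesis using n b_pos[of m n] by simp
qed

lemma hazard_right_continuous:
 assumes p: "proper (\<lambda>k. H m k z)" and t: "0 \<le> t" and lim: "x \<longlonglongrightarrow> t" and x: "\<And>k::nat. t < x k"
 shows "(\<lambda>k. hazard m (x k) z) \<longlonglongrightarrow> hazard m t z"
proof -
 define S where "S n = (\<Sum>k<n. H m k z)" for n
 obtain n where n: "S n \<le> t" "t < S (Suc n)"
  using proper_interval[OF p t] unfolding S_def by blast
 have form: "hazard m y z = (\<Sum>k<n. b m k * H m k z) + b m n * (y - S n)" if "S n \<le> y" "y \<le> S (Suc n)" for y
  using hazard_formula[OF p, of "y - S n" n] that by (simp add: S_def)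
 have "\<forall>\<^sub>F k in sequentially. x k < S (Suc n)" by (rule order_tendstoD(2)[OF lim n(2)])
 then have "\<forall>\<^sub>F k in sequentially. (\<Sum>k<n. b m k * H m k z) + b m n * (x k - S n) = hazard m (x k) z"
  by eventually_elim (use x n in \<open>intro form[symmetric], auto intro: less_imp_le order_trans\<close>)
 moreover have "(\<lambda>k. (\<Sum>k<n. b m k * H m k z) + b m n * (x k - S n)) \<longlonglongrightarrow> (\<Sum>k<n. b m k * H m k z) + b m n * (t - S n)"
  by (intro tendsto_intros lim)
 ultimately show ?thesis
  using form[of t] n by (auto dest: Lim_transform_eventually[rotated])
qed

text \<open>
 For a random time that takes countably many values this is \<open>gap_law_fixed\<close> on each of its level
 sets. A general time is approached strictly from above by dyadic times, which are measurable with respect to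
 the counts as well, and both sides converge because the hazard is continuous from the right.
\<close>

lemma gap_law_random:
 assumes D: "D \<in> sets (sN m)" and \<tau>: "\<tau> \<in> borel_measurable (sN m)" and \<tau>0: "\<And>z. z \<in> space P \<Longrightarrow> 0 \<le> \<tau> z"
 shows "emeasure P (D \<inter> {z \<in> space P. ennreal (\<tau> z) < T (Suc m) z}) = (\<integral>\<^sup>+z. indicator D z * ennreal (exp (- hazard m (\<tau> z) z)) \<partial>P)"
proof -
 have [measurable]: "T (Suc m) \<in> borel_measurable P" by (rule T_measurable)
 have DP [measurable]: "D \<in> sets P" using D sets_sN by auto
 have \<tau>P [measurable]: "\<tau> \<in> borel_measurable P" by (rule measurable_sub[OF \<tau>]) (use sets_sN in auto)
 have Am: "(\<lambda>z. hazard m (f z) z) \<in> borel_measurable P" if "f \<in> borel_measurable P" for f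
  by (rule measurable_phase_drift) (use that in auto)
 define j where "j k z = nat \<lfloor>2 ^ k * \<tau> z\<rfloor>" for k :: nat and z
 define x where "x k z = (real (j k z) + 1) / 2 ^ k" for k :: nat and z
 have jm: "{z \<in> space P. j k z = n} \<in> sets (sN m)" for k n
 proof -
  have "j k \<in> measurable (sN m) (count_space UNIV)" unfolding j_def using \<tau> by measurable
  from measurable_sets[OF this, of "{n}"] show ?thesis by (simp add: vimage_def Int_def conj_commute)
 qed
 have jr: "real (j k z) = of_int \<lfloor>2 ^ k * \<tau> z\<rfloor>" if "z \<in> space P" for k z
  using \<tau>0[OF that] by (simp add: j_def)
 have gt: "\<tau> z < x k z" and le: "x k z \<le> \<tau> z + 1 / 2 ^ k" if "z \<in> space P" for k z
 proof -
  have "2 ^ k * \<tau> z < real (j k z) + 1" "real (j k z) \<le> 2 ^ k * \<tau> z"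
   unfolding jr[OF that] by linarith+
  then show "\<tau> z < x k z" "x k z \<le> \<tau> z + 1 / 2 ^ k" by (auto simp: x_def field_simps)
 qed
 have lim: "(\<lambda>k. x k z) \<longlonglongrightarrow> \<tau> z" if "z \<in> space P" for z
 proof (rule tendsto_sandwich[OF _ _ tendsto_const])
  show "\<forall>\<^sub>F k in sequentially. \<tau> z \<le> x k z" by (intro always_eventually allI less_imp_le gt that)
  show "\<forall>\<^sub>F k in sequentially. x k z \<le> \<tau> z + 1 / 2 ^ k" by (intro always_eventually allI le that)
  have "(\<lambda>k. (1 / 2 :: real) ^ k) \<longlonglongrightarrow> 0" by (rule LIMSEQ_realpow_zero) auto
  then have "(\<lambda>k. \<tau> z + (1 / 2) ^ k) \<longlonglongrightarrow> \<tau> z + 0" by (intro tendsto_add tendsto_const)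
  then show "(\<lambda>k. \<tau> z + 1 / 2 ^ k) \<longlonglongrightarrow> \<tau> z" by (simp add: power_one_over)
 qed
 have xm [measurable]: "x k \<in> borel_measurable P" for k unfolding x_def j_def by measurable
 have step: "emeasure P (D \<inter> {z \<in> space P. ennreal (x k z) < T (Suc m) z}) = (\<integral>\<^sup>+z. indicator D z * ennreal (exp (- hazard m (x k z) z)) \<partial>P)" for k
 proof -
  define E where "E n = D \<inter> {z \<in> space P. j k z = n}" for n
  have E: "E n \<in> sets (sN m)" for n unfolding E_def using D jm by (rule sets.Int)
  have EP [measurable]: "E n \<in> sets P" for n using E sets_sN by auto
  define t where "t n = (real n + 1) / 2 ^ k" for n
  have t0: "0 \<le> t n" for n by (simp add: t_def)
  have xt: "z \<in> E n \<Longrightarrow> x k z = t n" for z n by (simp add: E_def x_def t_def)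
  have D_un: "indicator D z = (\<Sum>n. indicator (E n) z :: ennreal)" if "z \<in> space P" for z
  proof -
   have "disjoint_family E" by (auto simp: disjoint_family_on_def E_def)
   then have "(\<Sum>n. indicator (E n) z :: ennreal) = indicator (\<Union>n. E n) z" by (rule suminf_indicator)
   moreover have "(\<Union>n. E n) = D \<inter> space P" using sets.sets_into_space[OF DP] by (auto simp: E_def)
   ultimately show ?thesis using that by (simp add: indicator_def)
  qed
  have "emeasure P (D \<inter> {z \<in> space P. ennreal (x k z) < T (Suc m) z}) = (\<Sum>n. emeasure P (E n \<inter> {z \<in> space P. ennreal (x k z) < T (Suc m) z}))"
  proof -
   have "(\<Sum>n. emeasure P (E n \<inter> {z \<in> space P. ennreal (x k z) < T (Suc m) z})) = emeasure P (\<Union>n. E n \<inter> {z \<in> space P. ennreal (x k z) < T (Suc m) z})"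
   proof (rule suminf_emeasure)
    have "{z \<in> space P. ennreal (x k z) < T (Suc m) z} \<in> sets P" by measurable
    then show "range (\<lambda>n. E n \<inter> {z \<in> space P. ennreal (x k z) < T (Suc m) z}) \<subseteq> events"
     by (auto intro: sets.Int[OF EP])
   qed (auto simp: disjoint_family_on_def E_def)
   moreover have "(\<Union>n. E n \<inter> {z \<in> space P. ennreal (x k z) < T (Suc m) z}) = D \<inter> {z \<in> space P. ennreal (x k z) < T (Suc m) z}"
    using sets.sets_into_space[OF DP] by (auto simp: E_def)
   ultimately show ?thesis by simp
  qed
  also have "\<dots> = (\<Sum>n. emeasure P (E n \<inter> {z \<in> space P. ennreal (t n) < T (Suc m) z}))"
   by (intro suminf_cong arg_cong[where f = "emeasure P"]) (auto simp: xt)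
  also have "\<dots> = (\<Sum>n. \<integral>\<^sup>+z. indicator (E n) z * ennreal (exp (- hazard m (t n) z)) \<partial>P)"
   by (intro suminf_cong gap_law_fixed E t0)
  also have "\<dots> = (\<Sum>n. \<integral>\<^sup>+z. indicator (E n) z * ennreal (exp (- hazard m (x k z) z)) \<partial>P)"
   by (intro suminf_cong nn_integral_cong) (auto simp: indicator_def xt)
  also have "\<dots> = (\<integral>\<^sup>+z. (\<Sum>n. indicator (E n) z * ennreal (exp (- hazard m (x k z) z))) \<partial>P)"
   using Am[OF xm] by (intro nn_integral_suminf[symmetric]) measurable
  also have "\<dots> = (\<integral>\<^sup>+z. indicator D z * ennreal (exp (- hazard m (x k z) z)) \<partial>P)"
   by (intro nn_integral_cong) (simp add: D_un)
  finally show ?thesis .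
 qed
 have "(\<lambda>k. \<integral>\<^sup>+z. indicator (D \<inter> {z \<in> space P. ennreal (x k z) < T (Suc m) z}) z \<partial>P) \<longlonglongrightarrow> (\<integral>\<^sup>+z. indicator (D \<inter> {z \<in> space P. ennreal (\<tau> z) < T (Suc m) z}) z \<partial>P)"
 proof (rule nn_integral_dominated_convergence[where w = "\<lambda>_. 1"])
  show "AE z in P. (\<lambda>k. indicator (D \<inter> {z \<in> space P. ennreal (x k z) < T (Suc m) z}) z :: ennreal) \<longlonglongrightarrow> indicator (D \<inter> {z \<in> space P. ennreal (\<tau> z) < T (Suc m) z}) z"
  proof (rule AE_I2)
   fix z assume z: "z \<in> space P"
   show "(\<lambda>k. indicator (D \<inter> {z \<in> space P. ennreal (x k z) < T (Suc m) z}) z :: ennreal) \<longlonglongrightarrow> indicator (D \<inter> {z \<in> space P. ennreal (\<tau> z) < T (Suc m) z}) z"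
   proof (cases "ennreal (\<tau> z) < T (Suc m) z")
    case True
    have "(\<lambda>k. ennreal (x k z)) \<longlonglongrightarrow> ennreal (\<tau> z)" by (intro tendsto_intros lim z)
    from order_tendstoD(2)[OF this True]
    have "\<forall>\<^sub>F k in sequentially. indicator (D \<inter> {z \<in> space P. ennreal (x k z) < T (Suc m) z}) z = (indicator (D \<inter> {z \<in> space P. ennreal (\<tau> z) < T (Suc m) z}) z :: ennreal)"
     by eventually_elim (use True in \<open>auto simp: indicator_def\<close>)
    then show ?thesis by (rule tendsto_eventually)
   next
    case False
    have "\<not> ennreal (x k z) < T (Suc m) z" for k
     using False ennreal_leI[OF less_imp_le[OF gt[OF z, of k]]] by (auto simp: not_less intro: order_trans)
    then show ?thesis using False by simp
   qed
  qed
 qed (auto simp: emeasure_space_1 indicator_def)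
 moreover have "(\<lambda>k. \<integral>\<^sup>+z. indicator D z * ennreal (exp (- hazard m (x k z) z)) \<partial>P) \<longlonglongrightarrow> (\<integral>\<^sup>+z. indicator D z * ennreal (exp (- hazard m (\<tau> z) z)) \<partial>P)"
 proof (rule nn_integral_dominated_convergence[where w = "\<lambda>_. 1"])
  show "AE z in P. (\<lambda>k. indicator D z * ennreal (exp (- hazard m (x k z) z))) \<longlonglongrightarrow> indicator D z * ennreal (exp (- hazard m (\<tau> z) z))"
   using AE_proper_all AE_space
  proof eventually_elim
   case (elim z)
   have "(\<lambda>k. hazard m (x k z) z) \<longlonglongrightarrow> hazard m (\<tau> z) z"
    by (rule hazard_right_continuous) (use elim \<tau>0 lim gt in auto)
   then have "(\<lambda>k. ennreal (exp (- hazard m (x k z) z))) \<longlonglongrightarrow> ennreal (exp (- hazard m (\<tau> z) z))" by (intro tendsto_intros)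
   then show ?case by (cases "z \<in> D") auto
  qed
  show "AE z in P. indicator D z * ennreal (exp (- hazard m (x k z) z)) \<le> 1" for k
   using AE_proper_all AE_space
  proof eventually_elim
   case (elim z)
   have "0 \<le> x k z" using gt[OF elim(2), of k] \<tau>0[OF elim(2)] by simp
   then have "0 \<le> hazard m (x k z) z" using elim by (intro hazard_nonneg) auto
   then have "ennreal (exp (- hazard m (x k z) z)) \<le> ennreal 1" by (intro ennreal_leI) simp
   then show ?case by (auto simp: indicator_def)
  qed
  show "(\<integral>\<^sup>+z. 1 \<partial>P) < \<infinity>" by (simp add: emeasure_space_1)
 qed (use Am[OF xm] Am[OF \<tau>P] in measurable)
 ultimately show ?thesis
  using step by (simp add: LIMSEQ_unique)
qed

end

section \<open>Shocks and switchings of one phase\<close>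

text \<open>
 Both sides are finite measures in the set, so the identity extends from a generator stable under
 intersections.
\<close>

lemma (in prob_space) emeasure_generator_extend:
 assumes E: "Int_stable E" "E \<subseteq> events" "space M \<in> E"
  and X [measurable]: "X \<in> events" and Y [measurable]: "Y \<in> events" and k: "k < \<infinity>"
  and eq: "\<And>A. A \<in> E \<Longrightarrow> emeasure M (A \<inter> X) = emeasure M (A \<inter> Y) * k"
  and A: "A \<in> sigma_sets (space M) E"
 shows "emeasure M (A \<inter> X) = emeasure M (A \<inter> Y) * k"
proof -
 have sub: "E \<subseteq> Pow (space M)" using E(2) sets.sets_into_space by auto
 have ev: "A \<in> events" if "A \<in> sigma_sets (space M) E" for A
  using that sets.sigma_sets_subset[OF E(2)] by auto
 show ?thesis
  using E(1) sub A
 proof (induction rule: sigma_sets_induct_disjoint)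
  case (basic A) then show ?case by (rule eq)
 next
  case empty show ?case by simp
 next
  case (compl A)
  have [measurable]: "A \<in> events" by (rule ev) fact
  have c: "emeasure M ((space M - A) \<inter> Z) + emeasure M (A \<inter> Z) = emeasure M (space M \<inter> Z)" if [measurable]: "Z \<in> events" for Z
  proof -
   have "emeasure M ((space M - A) \<inter> Z) + emeasure M (A \<inter> Z) = emeasure M (((space M - A) \<inter> Z) \<union> (A \<inter> Z))"
    by (rule plus_emeasure) auto
   also have "((space M - A) \<inter> Z) \<union> (A \<inter> Z) = space M \<inter> Z" using sets.sets_into_space[OF that] by auto
   finally show ?thesis .
  qed
  have "emeasure M ((space M - A) \<inter> X) + emeasure M (A \<inter> X) = (emeasure M ((space M - A) \<inter> Y) + emeasure M (A \<inter> Y)) * k"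
   unfolding c[OF X] c[OF Y] by (rule eq[OF E(3)])
  then have "emeasure M ((space M - A) \<inter> X) + emeasure M (A \<inter> X) = emeasure M ((space M - A) \<inter> Y) * k + emeasure M (A \<inter> X)"
   by (simp add: distrib_right compl)
  then show ?case by (simp add: ennreal_add_left_cancel add.commute[of _ "emeasure M (A \<inter> X)"] emeasure_eq_measure)
 next
  case (union A)
  have [measurable]: "A n \<in> events" for n using union by (intro ev) auto
  have u: "emeasure M ((\<Union>n. A n) \<inter> Z) = (\<Sum>n. emeasure M (A n \<inter> Z))" if [measurable]: "Z \<in> events" for Z
  proof -
   have "(\<Sum>n. emeasure M (A n \<inter> Z)) = emeasure M (\<Union>n. A n \<inter> Z)"
    by (rule suminf_emeasure) (use union in \<open>auto simp: disjoint_family_on_def\<close>)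
   then show ?thesis by (simp add: Int_UN_distrib2)
  qed
  show ?case unfolding u[OF X] u[OF Y] by (simp add: union ennreal_suminf_multc)
 qed
qed

context switching_model
begin

abbreviation th :: "nat \<Rightarrow> nat \<Rightarrow> real" where "th m n \<equiv> l m n + b m n"

definition Sh :: "nat \<Rightarrow> nat \<Rightarrow> 'a \<Rightarrow> real" where
 "Sh m n z = (\<Sum>k<n. Hh m k z)"

lemma Sh_Suc: "Sh m (Suc n) z = Sh m n z + Hh m n z" by (simp add: Sh_def)

lemma Sh_sN [measurable]: "Sh m n \<in> borel_measurable (sN m)"
 unfolding Sh_def[abs_def] by measurable

lemma Sh_rv [measurable]: "Sh m n \<in> borel_measurable P"
 unfolding Sh_def[abs_def] by measurable

lemma T_rv [measurable]: "T (Suc m) \<in> borel_measurable P" by (rule T_measurable)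

definition surv :: "nat \<Rightarrow> nat \<Rightarrow> 'a \<Rightarrow> real" where
 "surv m n z = exp (- (\<Sum>k<n. b m k * Hh m k z))"

lemma surv_rv [measurable]: "surv m n \<in> borel_measurable P"
 unfolding surv_def[abs_def] by measurable

text \<open>
 The accumulated switching rate up to a time between the \<open>n\<close>-th and the next shock splits into
 the part \<open>surv\<close> before the \<open>n\<close>-th shock and a linear part.
\<close>

lemma gap_law:
 assumes D: "D \<in> sets (sN m)" and v: "v \<in> borel_measurable (sN m)"
  and v0: "AE z in P. z \<in> D \<longrightarrow> 0 \<le> v z \<and> v z \<le> Hh m n z"
 shows "emeasure P (D \<inter> {z \<in> space P. ennreal (Sh m n z + v z) < T (Suc m) z})
  = (\<integral>\<^sup>+z. indicator D z * (ennreal (surv m n z) * ennreal (exp (- (b m n * v z)))) \<partial>P)"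
proof -
 have e: "ennreal (max 0 x) = ennreal x" for x by (cases "0 \<le> x") (auto simp: max_def ennreal_neg)
 have "(\<lambda>z. max 0 (Sh m n z + v z)) \<in> borel_measurable (sN m)" using v by measurable
 from gap_law_random[OF D this]
 have "emeasure P (D \<inter> {z \<in> space P. ennreal (Sh m n z + v z) < T (Suc m) z})
   = (\<integral>\<^sup>+z. indicator D z * ennreal (exp (- hazard m (max 0 (Sh m n z + v z)) z)) \<partial>P)"
  by (simp add: e)
 also have "\<dots> = (\<integral>\<^sup>+z. indicator D z * (ennreal (surv m n z) * ennreal (exp (- (b m n * v z)))) \<partial>P)"
 proof (rule nn_integral_cong_AE)
  show "AE z in P. indicator D z * ennreal (exp (- hazard m (max 0 (Sh m n z + v z)) z)) = indicator D z * (ennreal (surv m n z) * ennreal (exp (- (b m n * v z))))"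
   using v0 AE_Hh AE_proper_all
  proof eventually_elim
   case (elim z)
   show ?case
   proof (cases "z \<in> D")
    case True
    then have v: "0 \<le> v z" "v z \<le> H m n z" using elim by auto
    have p: "proper (\<lambda>k. H m k z)" using elim by simp
    have S: "Sh m n z = (\<Sum>k<n. H m k z)" using elim by (simp add: Sh_def)
    have "0 \<le> Sh m n z" unfolding S by (rule proper_nonneg[OF p])
    then have "hazard m (max 0 (Sh m n z + v z)) z = (\<Sum>k<n. b m k * Hh m k z) + b m n * v z"
     using hazard_formula[OF p v] v elim by (simp add: S)
    then show ?thesis by (simp add: surv_def ennreal_mult[symmetric] exp_add[symmetric])
   qed simp
  qed
 qed
 finally show ?thesis .
qed

definition Hs :: "nat \<Rightarrow> nat \<Rightarrow> 'a measure" where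
 "Hs m n = gen_sigma (space P) (Hh m) {..<n}"

lemma space_Hs [simp]: "space (Hs m n) = space P" by (simp add: Hs_def)

lemma sets_Hs: "sets (Hs m n) \<subseteq> sets (sN m)"
 unfolding Hs_def by (rule gen_sigma_least) auto

lemma Hh_Hs: "k < n \<Longrightarrow> Hh m k \<in> borel_measurable (Hs m n)"
 unfolding Hs_def by (rule measurable_gen_sigma) simp

lemma surv_Hs: "surv m n \<in> borel_measurable (Hs m n)"
 unfolding surv_def[abs_def] by (intro measurable_compose[OF _ borel_measurable_exp] borel_measurable_uminus borel_measurable_sum borel_measurable_times borel_measurable_const Hh_Hs) auto

text \<open>
 The next holding time is independent of the first \<open>n\<close> holding times, and all factors but the
 last depend on these only.
\<close>

lemma Hs_product:
 assumes B: "B \<in> sets (Hs m n)" and f [measurable]: "f \<in> borel_measurable borel"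
 shows "(\<integral>\<^sup>+z. indicator B z * (ennreal (surv m n z) * f (Hh m n z)) \<partial>P)
  = (\<integral>\<^sup>+z. indicator B z * ennreal (surv m n z) \<partial>P) * (\<integral>\<^sup>+w. f w \<partial>Ex (l m n))"
proof -
 have BP [measurable]: "B \<in> sets P" using B sets_Hs sets_sN by blast
 have sub: "sets (Hs m n) \<subseteq> events" using sets_Hs sets_sN by blast
 note surv_Hs[measurable] B[measurable]
 have e1: "(\<integral>\<^sup>+z. indicator B z * (ennreal (surv m n z) * f (Hh m n z)) \<partial>P)
   = (\<integral>\<^sup>+z. (\<integral>\<^sup>+y. indicator B z * (ennreal (surv m n z) * f y) \<partial>distr P borel (Hh m n)) \<partial>P)"
  using nn_integral_indep[of "Hs m n" "Hh m n" borel "\<lambda>p. indicator B (fst p) * (ennreal (surv m n (fst p)) * f (snd p))"]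
   Hh_events_indep[of _ m n] sub by (simp add: Hs_def[symmetric])
 have e2: "(\<integral>\<^sup>+y. indicator B z * (ennreal (surv m n z) * f y) \<partial>distr P borel (Hh m n)) = indicator B z * ennreal (surv m n z) * (\<integral>\<^sup>+w. f w \<partial>Ex (l m n))" for z
 proof -
  have "AE z in P. f (Hh m n z) = f (H m n z)"
   using AE_Hh by eventually_elim simp
  then have "(\<integral>\<^sup>+z. f (Hh m n z) \<partial>P) = (\<integral>\<^sup>+z. f (H m n z) \<partial>P)"
   by (rule nn_integral_cong_AE)
  moreover have "(\<integral>\<^sup>+y. f y \<partial>distr P borel (Hh m n)) = (\<integral>\<^sup>+z. f (Hh m n z) \<partial>P)"
   by (rule nn_integral_distr) measurable
  ultimately have d: "(\<integral>\<^sup>+y. f y \<partial>distr P borel (Hh m n)) = (\<integral>\<^sup>+w. f w \<partial>Ex (l m n))"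
   using nn_integral_H[OF f, of m n] by simp
  have "(\<integral>\<^sup>+y. indicator B z * ennreal (surv m n z) * f y \<partial>distr P borel (Hh m n)) = indicator B z * ennreal (surv m n z) * (\<integral>\<^sup>+y. f y \<partial>distr P borel (Hh m n))"
   by (rule nn_integral_cmult) measurable
  then show ?thesis unfolding d by (simp only: mult.assoc)
 qed
 have e3: "(\<integral>\<^sup>+z. indicator B z * ennreal (surv m n z) * (\<integral>\<^sup>+w. f w \<partial>Ex (l m n)) \<partial>P) = (\<integral>\<^sup>+z. indicator B z * ennreal (surv m n z) \<partial>P) * (\<integral>\<^sup>+w. f w \<partial>Ex (l m n))"
  by (rule nn_integral_multc) measurable
 show ?thesis unfolding e1 e2 e3 ..
qed

definition alive :: "nat \<Rightarrow> nat \<Rightarrow> 'a set" where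
 "alive m n = {z \<in> space P. ennreal (Sh m n z) < T (Suc m) z}"

lemma alive_sets [measurable]: "alive m n \<in> sets P"
 unfolding alive_def by measurable

lemma alive_0: "AE z in P. z \<in> alive m 0"
 using T_pos[of m] AE_space by eventually_elim (simp add: alive_def Sh_def)

lemma emeasure_alive:
 assumes B: "B \<in> sets (Hs m n)"
 shows "emeasure P (B \<inter> alive m n) = (\<integral>\<^sup>+z. indicator B z * ennreal (surv m n z) \<partial>P)"
proof -
 have "AE z in P. z \<in> B \<longrightarrow> 0 \<le> (0::real) \<and> 0 \<le> Hh m n z"
  using AE_Hh AE_proper_all by eventually_elim (auto simp: proper_def less_imp_le)
 from gap_law[of B m "\<lambda>_. 0" n, OF _ _ this] show ?thesis using B sets_Hs by (auto simp: alive_def)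
qed

lemma shock_tail:
 assumes B: "B \<in> sets (Hs m n)"
 shows "emeasure P (B \<inter> (alive m (Suc n) \<inter> {z \<in> space P. w < Hh m n z}))
  = emeasure P (B \<inter> alive m n) * (\<integral>\<^sup>+x. indicator {w<..} x * ennreal (exp (- (b m n * x))) \<partial>Ex (l m n))"
proof -
 define D where "D = B \<inter> {z \<in> space P. w < Hh m n z}"
 have D: "D \<in> sets (sN m)"
 proof -
  have "{z \<in> space (sN m). w < Hh m n z} \<in> sets (sN m)" by measurable
  then show ?thesis unfolding D_def using B sets_Hs by auto
 qed
 have "AE z in P. z \<in> D \<longrightarrow> 0 \<le> Hh m n z \<and> Hh m n z \<le> Hh m n z"
  using AE_Hh AE_proper_all by eventually_elim (auto simp: proper_def less_imp_le)
 from gap_law[OF D _ this] have "emeasure P (D \<inter> alive m (Suc n)) = (\<integral>\<^sup>+z. indicator D z * (ennreal (surv m n z) * ennreal (exp (- (b m n * Hh m n z)))) \<partial>P)"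
  by (simp add: alive_def Sh_Suc)
 also have "\<dots> = (\<integral>\<^sup>+z. indicator B z * (ennreal (surv m n z) * (indicator {w<..} (Hh m n z) * ennreal (exp (- (b m n * Hh m n z))))) \<partial>P)"
  by (intro nn_integral_cong) (auto simp: D_def indicator_def)
 also have "\<dots> = emeasure P (B \<inter> alive m n) * (\<integral>\<^sup>+x. indicator {w<..} x * ennreal (exp (- (b m n * x))) \<partial>Ex (l m n))"
  unfolding emeasure_alive[OF B] by (rule Hs_product[OF B, of "\<lambda>x. indicator {w<..} x * ennreal (exp (- (b m n * x)))"]) measurable
 finally show ?thesis by (simp add: D_def Int_ac)
qed

lemma stay_tail:
 assumes B: "B \<in> sets (Hs m n)" and w: "0 \<le> w"
 shows "emeasure P (B \<inter> {z \<in> space P. w < Hh m n z \<and> ennreal (Sh m n z + w) < T (Suc m) z})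
  = emeasure P (B \<inter> alive m n) * ennreal (exp (- (th m n * w)))"
proof -
 define D where "D = B \<inter> {z \<in> space P. w < Hh m n z}"
 have D: "D \<in> sets (sN m)"
 proof -
  have "{z \<in> space (sN m). w < Hh m n z} \<in> sets (sN m)" by measurable
  then show ?thesis unfolding D_def using B sets_Hs by auto
 qed
 have "AE z in P. z \<in> D \<longrightarrow> 0 \<le> w \<and> w \<le> Hh m n z" using w by (auto simp: D_def)
 from gap_law[OF D _ this] have "emeasure P (D \<inter> {z \<in> space P. ennreal (Sh m n z + w) < T (Suc m) z}) = (\<integral>\<^sup>+z. indicator D z * (ennreal (surv m n z) * ennreal (exp (- (b m n * w)))) \<partial>P)"
  by simp
 also have "\<dots> = (\<integral>\<^sup>+z. indicator B z * (ennreal (surv m n z) * (indicator {w<..} (Hh m n z) * ennreal (exp (- (b m n * w))))) \<partial>P)"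
  by (intro nn_integral_cong) (auto simp: D_def indicator_def)
 also have "\<dots> = emeasure P (B \<inter> alive m n) * (\<integral>\<^sup>+x. indicator {w<..} x * ennreal (exp (- (b m n * w))) \<partial>Ex (l m n))"
  unfolding emeasure_alive[OF B] by (rule Hs_product[OF B, of "\<lambda>x. indicator {w<..} x * ennreal (exp (- (b m n * w)))"]) measurable
 also have "(\<integral>\<^sup>+x. indicator {w<..} x * ennreal (exp (- (b m n * w))) \<partial>Ex (l m n)) = ennreal (exp (- (th m n * w)))"
 proof -
  have "(\<integral>\<^sup>+x. indicator {w<..} x * ennreal (exp (- (b m n * w))) \<partial>Ex (l m n)) = (\<integral>\<^sup>+x. indicator {w<..} x \<partial>Ex (l m n)) * ennreal (exp (- (b m n * w)))"
   by (rule nn_integral_multc) measurable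
  moreover have "(\<integral>\<^sup>+x. indicator {w<..} x \<partial>Ex (l m n)) = ennreal (exp (- (l m n * w)))"
   using emeasure_Ex_tail[OF l_pos[of m n], of 0 w] w l_pos[of m n] by simp
  ultimately show ?thesis by (simp add: ennreal_mult[symmetric] exp_add[symmetric] distrib_right)
 qed
 finally show ?thesis by (simp add: D_def Int_def conj_ac)
qed

text \<open>
 Survival past the next shock and survival until shortly before it have nearly the same probability.
\<close>

lemma AE_no_tie: "AE z in P. T (Suc m) z \<noteq> ennreal (Sh m (Suc n) z)"
proof -
 define Z where "Z = {z \<in> space P. T (Suc m) z = ennreal (Sh m (Suc n) z)}"
 have [measurable]: "Z \<in> sets P" unfolding Z_def by measurable
 have "emeasure P Z \<le> 0"
 proof (rule ennreal_le_epsilon)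
  fix e :: real assume e: "0 < e"
  define d where "d = e / b m n"
  have d: "0 < d" "b m n * d = e" using e b_pos[of m n] by (auto simp: d_def)
  define v where "v z = max 0 (Hh m n z - d)" for z
  have [measurable]: "v \<in> borel_measurable (sN m)" unfolding v_def[abs_def] by measurable
  have vP [measurable]: "v \<in> borel_measurable P" unfolding v_def[abs_def] by measurable
  have top: "space P \<in> sets (sN m)" using sets.top[of "sN m"] by simp
  have "AE z in P. z \<in> space P \<longrightarrow> 0 \<le> v z \<and> v z \<le> Hh m n z"
   using AE_Hh AE_proper_all by eventually_elim (use d in \<open>auto simp: proper_def less_imp_le v_def\<close>)
  from gap_law[OF top _ this]
  have 1: "emeasure P {z \<in> space P. ennreal (Sh m n z + v z) < T (Suc m) z} = (\<integral>\<^sup>+z. ennreal (surv m n z) * ennreal (exp (- (b m n * v z))) \<partial>P)"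
   by (simp add: Int_absorb1 Collect_restrict cong: nn_integral_cong_simp)
  have "AE z in P. z \<in> space P \<longrightarrow> 0 \<le> Hh m n z \<and> Hh m n z \<le> Hh m n z"
   using AE_Hh AE_proper_all by eventually_elim (auto simp: proper_def less_imp_le)
  from gap_law[OF top _ this]
  have 2: "emeasure P (alive m (Suc n)) = (\<integral>\<^sup>+z. ennreal (surv m n z) * ennreal (exp (- (b m n * Hh m n z))) \<partial>P)"
   by (simp add: Int_absorb1 Collect_restrict alive_def Sh_Suc cong: nn_integral_cong_simp)
  have "emeasure P Z + emeasure P (alive m (Suc n)) = emeasure P (Z \<union> alive m (Suc n))"
   by (rule plus_emeasure) (auto simp: Z_def alive_def)
  also have "\<dots> \<le> emeasure P {z \<in> space P. ennreal (Sh m n z + v z) < T (Suc m) z}"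
  proof (rule emeasure_mono_AE)
   show "AE z in P. z \<in> Z \<union> alive m (Suc n) \<longrightarrow> z \<in> {z \<in> space P. ennreal (Sh m n z + v z) < T (Suc m) z}"
    using AE_Hh AE_proper_all
   proof eventually_elim
    case (elim z)
    have p: "proper (\<lambda>k. H m k z)" using elim by simp
    have "0 \<le> Sh m n z" using elim proper_nonneg[OF p, of n] by (simp add: Sh_def)
    moreover have "0 < Hh m n z" using p elim by (simp add: proper_def)
    ultimately have "ennreal (Sh m n z + v z) < ennreal (Sh m (Suc n) z)"
     using d by (intro ennreal_lessI) (auto simp: Sh_Suc v_def)
    then show ?case by (auto simp: Z_def alive_def intro: less_trans)
   qed
  qed measurable
  also have "\<dots> \<le> (\<integral>\<^sup>+z. ennreal (surv m n z) * ennreal (exp (- (b m n * Hh m n z))) + ennreal e \<partial>P)"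
   unfolding 1
  proof (rule nn_integral_mono_AE)
   show "AE z in P. ennreal (surv m n z) * ennreal (exp (- (b m n * v z))) \<le> ennreal (surv m n z) * ennreal (exp (- (b m n * Hh m n z))) + ennreal e"
    using AE_Hh AE_proper_all
   proof eventually_elim
    case (elim z)
    have p: "proper (\<lambda>k. H m k z)" using elim by simp
    have Hp: "0 < Hh m k z" for k using p elim by (simp add: proper_def)
    have s1: "surv m n z \<le> 1"
     unfolding surv_def using b_pos Hp by (simp add: sum_nonneg less_imp_le)
    have "exp (- (b m n * v z)) - exp (- (b m n * Hh m n z)) \<le> e"
    proof -
     have vd: "b m n * Hh m n z - b m n * v z \<le> e"
      unfolding d(2)[symmetric] right_diff_distrib[symmetric] using b_pos[of m n] by (intro mult_left_mono) (auto simp: v_def)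
     have v1: "exp (- (b m n * v z)) \<le> 1" using b_pos[of m n] by (simp add: v_def)
     have "1 + (b m n * v z - b m n * Hh m n z) \<le> exp (b m n * v z - b m n * Hh m n z)" by (rule exp_ge_add_one_self)
     then have ge: "1 - exp (b m n * v z - b m n * Hh m n z) \<le> e" using vd by linarith
     have "exp (- (b m n * v z)) - exp (- (b m n * Hh m n z)) = exp (- (b m n * v z)) * (1 - exp (b m n * v z - b m n * Hh m n z))"
      by (simp add: right_diff_distrib exp_add[symmetric])
     also have "\<dots> \<le> exp (- (b m n * v z)) * e" by (intro mult_left_mono ge) simp
     also have "\<dots> \<le> 1 * e" using v1 e by (intro mult_right_mono) auto
     finally show ?thesis by simp
    qed
    then have "surv m n z * (exp (- (b m n * v z)) - exp (- (b m n * Hh m n z))) \<le> 1 * e"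
    proof -
     assume E: "exp (- (b m n * v z)) - exp (- (b m n * Hh m n z)) \<le> e"
     have "surv m n z * (exp (- (b m n * v z)) - exp (- (b m n * Hh m n z))) \<le> surv m n z * e"
      by (rule mult_left_mono[OF E]) (simp add: surv_def)
     also have "\<dots> \<le> 1 * e" using s1 e by (intro mult_right_mono) auto
     finally show ?thesis .
    qed
    then have "surv m n z * exp (- (b m n * v z)) \<le> surv m n z * exp (- (b m n * Hh m n z)) + e"
     by (simp add: right_diff_distrib)
    then show ?case
     using e by (simp add: ennreal_mult[symmetric] ennreal_plus[symmetric] ennreal_leI surv_def del: ennreal_plus)
   qed
  qed
  also have "\<dots> = emeasure P (alive m (Suc n)) + ennreal e"
   unfolding 2 by (subst nn_integral_add) (auto simp: emeasure_space_1)
  finally have "emeasure P (alive m (Suc n)) + emeasure P Z \<le> emeasure P (alive m (Suc n)) + ennreal e" by (simp add: add.commute)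
  then show "emeasure P Z \<le> 0 + ennreal e" by (simp add: emeasure_eq_measure ennreal_add_left_cancel_le)
 qed
 then have "AE z in P. z \<notin> Z" by (intro AE_not_in) (auto simp: null_sets_def)
 with AE_space show ?thesis by eventually_elim (auto simp: Z_def)
qed

definition switchset :: "nat \<Rightarrow> nat \<Rightarrow> 'a set" where
 "switchset m n = {z \<in> space P. ennreal (Sh m n z) < T (Suc m) z \<and> T (Suc m) z < ennreal (Sh m (Suc n) z)}"

definition age :: "nat \<Rightarrow> nat \<Rightarrow> 'a \<Rightarrow> real" where
 "age m n z = enn2real (T (Suc m) z) - Sh m n z"

lemma switchset_sets [measurable]: "switchset m n \<in> sets P"
 unfolding switchset_def by measurable

lemma age_rv [measurable]: "age m n \<in> borel_measurable P"
 unfolding age_def[abs_def] by measurable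

text \<open>
 Being still in the cell for longer than \<open>w\<close> leads either to a shock or to a switching later than
 \<open>w\<close>; the first probability and the total are known.
\<close>

lemma switch_tail:
 assumes B: "B \<in> sets (Hs m n)" and w: "0 \<le> w"
 shows "emeasure P (B \<inter> (switchset m n \<inter> {z \<in> space P. w < age m n z}))
  = emeasure P (B \<inter> alive m n) * ennreal (b m n / th m n * exp (- (th m n * w)))"
proof -
 have BP [measurable]: "B \<in> sets P" using B sets_Hs sets_sN by blast
 define Q1 where "Q1 = B \<inter> {z \<in> space P. w < Hh m n z \<and> ennreal (Sh m n z + w) < T (Suc m) z}"
 define Q2 where "Q2 = B \<inter> (alive m (Suc n) \<inter> {z \<in> space P. w < Hh m n z})"
 define Q3 where "Q3 = B \<inter> (switchset m n \<inter> {z \<in> space P. w < age m n z})"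
 have [measurable]: "Q1 \<in> sets P" "Q2 \<in> sets P" "Q3 \<in> sets P" unfolding Q1_def Q2_def Q3_def by measurable
 have pos: "0 < th m n" using l_pos[of m n] b_pos[of m n] by simp
 have "emeasure P Q1 = emeasure P (Q3 \<union> Q2)"
 proof (rule emeasure_eq_AE)
  show "AE z in P. (z \<in> Q1) = (z \<in> Q3 \<union> Q2)"
   using AE_Hh AE_proper_all AE_no_tie[of m n] AE_space
  proof eventually_elim
   case (elim z)
   have p: "proper (\<lambda>k. H m k z)" using elim by simp
   have S0: "0 \<le> Sh m n z" using elim proper_nonneg[OF p, of n] by (simp add: Sh_def)
   have Hp: "0 < Hh m n z" using p elim by (simp add: proper_def)
   show ?case
   proof (cases "T (Suc m) z")
    case (real t)
    have less: "ennreal x < T (Suc m) z \<longleftrightarrow> x < t" if "0 \<le> x" for x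
     unfolding real(2) by (rule ennreal_less_iff[OF that])
    have gr: "T (Suc m) z < ennreal x \<longleftrightarrow> t < x" for x
     unfolding real(2) by (rule ennreal_less_iff[OF real(1)])
    have nt: "t \<noteq> Sh m n z + Hh m n z"
     using elim(3) unfolding real(2) Sh_Suc by auto
    have "z \<in> Q1 \<longleftrightarrow> z \<in> B \<and> w < Hh m n z \<and> Sh m n z + w < t"
     using elim(4) less[of "Sh m n z + w"] S0 w by (simp add: Q1_def del: ennreal_plus)
    moreover have "z \<in> Q2 \<longleftrightarrow> z \<in> B \<and> Sh m n z + Hh m n z < t \<and> w < Hh m n z"
     using elim(4) less[of "Sh m n z + Hh m n z"] S0 Hp by (simp add: Q2_def alive_def Sh_Suc del: ennreal_plus)
    moreover have "z \<in> Q3 \<longleftrightarrow> z \<in> B \<and> Sh m n z < t \<and> t < Sh m n z + Hh m n z \<and> w < t - Sh m n z"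
     using elim(4) less[of "Sh m n z"] gr[of "Sh m n z + Hh m n z"] S0 Hp real
     by (simp add: Q3_def switchset_def age_def Sh_Suc del: ennreal_plus)
    ultimately show ?thesis using nt S0 w by auto
   next
    case top
    then show ?thesis using S0 Hp w elim by (auto simp: Q1_def Q2_def Q3_def alive_def switchset_def)
   qed
  qed
 qed measurable
 also have "\<dots> = emeasure P Q3 + emeasure P Q2"
  by (rule plus_emeasure[symmetric]) (auto simp: Q2_def Q3_def alive_def switchset_def)
 finally have eq: "emeasure P (B \<inter> alive m n) * ennreal (exp (- (th m n * w))) = emeasure P Q3 + emeasure P (B \<inter> alive m n) * ennreal (l m n / th m n * exp (- (th m n * w)))"
  using stay_tail[OF B w] shock_tail[OF B, of w] emeasure_Ex_tail[OF l_pos[of m n] less_imp_le[OF b_pos[of m n]] w]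
  by (simp add: Q1_def Q2_def add.commute)
 have "ennreal (exp (- (th m n * w))) = ennreal (b m n / th m n * exp (- (th m n * w))) + ennreal (l m n / th m n * exp (- (th m n * w)))"
 proof -
  have "b m n / th m n * exp (- (th m n * w)) + l m n / th m n * exp (- (th m n * w)) = exp (- (th m n * w))"
   using pos by (simp add: distrib_right[symmetric] add_divide_distrib[symmetric] add.commute)
  then show ?thesis
   using l_pos[of m n] b_pos[of m n] pos by (subst ennreal_plus[symmetric]) auto
 qed
 then have "emeasure P (B \<inter> alive m n) * ennreal (b m n / th m n * exp (- (th m n * w))) + emeasure P (B \<inter> alive m n) * ennreal (l m n / th m n * exp (- (th m n * w)))
   = emeasure P Q3 + emeasure P (B \<inter> alive m n) * ennreal (l m n / th m n * exp (- (th m n * w)))"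
  using eq by (simp add: distrib_left)
 moreover have "emeasure P (B \<inter> alive m n) * ennreal (l m n / th m n * exp (- (th m n * w))) \<noteq> \<top>"
  by (simp add: emeasure_eq_measure ennreal_mult_eq_top_iff)
 ultimately show ?thesis unfolding Q3_def[symmetric]
  by (simp add: ennreal_add_left_cancel add.commute[of _ "emeasure P (B \<inter> alive m n) * ennreal (l m n / th m n * exp (- (th m n * w)))"])
qed

end

context switching_model
begin

section \<open>Information available on arrival\<close>

text \<open>
 The sources that are completely revealed on arrival in the cell \<open>(m, n)\<close>. The current driving
 process is revealed only up to its \<open>n\<close>-th shock and enters separately in \<open>G\<close>.
\<close>

definition past :: "nat \<Rightarrow> nat \<Rightarrow> source set" where
 "past m n = Driver ` {..<m} \<union> {Small_Jump k j | k j. k < m \<or> k = m \<and> j < n} \<union> {Big_Jump k j | k j. k < m}"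

abbreviation SE :: "source \<Rightarrow> 'a set set" where "SE \<equiv> source_events (space P) H T r R"

definition Src :: "source set \<Rightarrow> 'a measure" where
 "Src S = sigma (space P) (\<Union>s\<in>S. SE s)"

lemma SE_sub: "SE s \<subseteq> sets P"
 using sources_indep by (auto simp: indep_sets_def)

lemma SE_stable: "Int_stable (SE s)"
 by (cases s) (simp_all only: source_events.simps sets.Int_stable)

lemma SE_pow: "(\<Union>s\<in>S. SE s) \<subseteq> Pow (space P)"
 using SE_sub sets.sets_into_space by blast

lemma space_Src [simp]: "space (Src S) = space P"
 unfolding Src_def by (rule space_measure_of[OF SE_pow])

lemma sets_Src: "sets (Src S) = sigma_sets (space P) (\<Union>s\<in>S. SE s)"
 unfolding Src_def by (rule sets_measure_of[OF SE_pow])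

lemma sets_Src_sub: "sets (Src S) \<subseteq> sets P"
 unfolding sets_Src using SE_sub by (intro sets.sigma_sets_subset) auto

lemma Src_mono: "S \<subseteq> S' \<Longrightarrow> sets (Src S) \<subseteq> sets (Src S')"
 unfolding sets_Src by (rule sigma_sets_mono') auto

lemma SE_Src: "s \<in> S \<Longrightarrow> SE s \<subseteq> sets (Src S)"
 unfolding sets_Src by (auto intro: sigma_sets.Basic)

lemma Src_indep:
 assumes dis: "S \<inter> S' = {}" and A: "A \<in> sets (Src S)" and B: "B \<in> sets (Src S')"
 shows "prob (A \<inter> B) = prob A * prob B"
proof -
 define I where "I j = (if j then S else S')" for j
 have "indep_sets (\<lambda>j. sigma_sets (space P) (\<Union>s\<in>I j. SE s)) UNIV"
 proof (rule indep_sets_collect_sigma)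
  show "indep_sets SE (\<Union>j\<in>UNIV. I j)" by (rule indep_sets_mono_index[OF _ sources_indep]) simp
  show "disjoint_family_on I UNIV" using dis by (auto simp: disjoint_family_on_def I_def)
 qed (rule SE_stable)
 from indep_setsD[OF this, of UNIV "\<lambda>j. if j then A else B"]
 have "prob (\<Inter>j. if j then A else B) = (\<Prod>j\<in>UNIV. prob (if j then A else B))"
  using A B by (simp add: I_def sets_Src UNIV_bool)
 then show ?thesis by (simp add: UNIV_bool Int_commute mult.commute)
qed

lemma r_Src: "Small_Jump m n \<in> S \<Longrightarrow> r m n \<in> borel_measurable (Src S)"
proof (rule measurableI)
 fix A :: "real set" assume "Small_Jump m n \<in> S" "A \<in> sets borel"
 then have "r m n -` A \<inter> space P \<in> SE (Small_Jump m n)" by (simp add: in_vimage_algebra)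
 with SE_Src[OF \<open>Small_Jump m n \<in> S\<close>] show "r m n -` A \<inter> space (Src S) \<in> sets (Src S)" by auto
qed simp

lemma R_Src: "Big_Jump m n \<in> S \<Longrightarrow> R m n \<in> borel_measurable (Src S)"
proof (rule measurableI)
 fix A :: "real set" assume "Big_Jump m n \<in> S" "A \<in> sets borel"
 then have "R m n -` A \<inter> space P \<in> SE (Big_Jump m n)" by (simp add: in_vimage_algebra)
 with SE_Src[OF \<open>Big_Jump m n \<in> S\<close>] show "R m n -` A \<inter> space (Src S) \<in> sets (Src S)" by auto
qed simp

lemma driver_Src:
 assumes "Driver m \<in> S"
 shows "sets (sN m) \<subseteq> sets (Src S)" and "T (Suc m) \<in> borel_measurable (Src S)"
proof -
 define D where "D = gen_sigma (space P) (\<lambda>t z. (shock_count H m t z, T (Suc m) z)) {0..}"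
 have sub: "sets D \<subseteq> sets (Src S)" using SE_Src[OF assms] by (simp add: D_def)
 have pair: "(\<lambda>z. (shock_count H m t z, T (Suc m) z)) \<in> borel_measurable D" if "0 \<le> t" for t
  unfolding D_def by (rule measurable_gen_sigma[of t "{0..}" "\<lambda>t z. (shock_count H m t z, T (Suc m) z)"]) (use that in simp)
 have f: "fst \<in> borel_measurable (borel :: (nat \<times> ennreal) measure)" and s: "snd \<in> borel_measurable (borel :: (nat \<times> ennreal) measure)"
  by (intro borel_measurable_continuous_onI continuous_intros)+
 have "shock_count H m t \<in> borel_measurable D" if "0 \<le> t" for t
  using measurable_compose[OF pair[OF that] f] by simp
 then have "sets (sN m) \<subseteq> sets D"
  unfolding sN_def by (intro gen_sigma_least) (auto simp: D_def)
 then show "sets (sN m) \<subseteq> sets (Src S)" using sub by auto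
 have "T (Suc m) \<in> borel_measurable D"
  using measurable_compose[OF pair[of 0] s] by simp
 then show "T (Suc m) \<in> borel_measurable (Src S)"
  by (rule measurable_sub) (use sub in \<open>auto simp: D_def\<close>)
qed

lemma Hh_Src: "Driver m \<in> S \<Longrightarrow> Hh m k \<in> borel_measurable (Src S)"
 using Hh_sN by (rule measurable_sub) (use driver_Src(1) in auto)

definition Gen :: "nat \<Rightarrow> nat \<Rightarrow> 'a set set" where
 "Gen m n = {B1 \<inter> B2 | B1 B2. B1 \<in> sets (Src (past m n)) \<and> B2 \<in> sets (Hs m n)}"

definition G :: "nat \<Rightarrow> nat \<Rightarrow> 'a measure" where
 "G m n = sigma (space P) (Gen m n)"

lemma sets_Hs_P: "sets (Hs m n) \<subseteq> sets P"
 using sets_Hs sets_sN by blast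

lemma Gen_sub: "Gen m n \<subseteq> sets P"
 using sets_Src_sub sets_Hs_P by (force simp: Gen_def)

lemma space_G [simp]: "space (G m n) = space P"
 unfolding G_def by (rule space_measure_of) (use Gen_sub sets.sets_into_space in blast)

lemma sets_G: "sets (G m n) = sigma_sets (space P) (Gen m n)"
 unfolding G_def by (rule sets_measure_of) (use Gen_sub sets.sets_into_space in blast)

lemma Gen_stable: "Int_stable (Gen m n)"
proof (rule Int_stableI)
 fix a c assume "a \<in> Gen m n" "c \<in> Gen m n"
 then obtain B1 B2 C1 C2 where *: "B1 \<in> sets (Src (past m n))" "B2 \<in> sets (Hs m n)" "C1 \<in> sets (Src (past m n))" "C2 \<in> sets (Hs m n)" "a = B1 \<inter> B2" "c = C1 \<inter> C2"
  by (auto simp: Gen_def)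
 then have "a \<inter> c = (B1 \<inter> C1) \<inter> (B2 \<inter> C2)" by auto
 then show "a \<inter> c \<in> Gen m n" using * by (auto simp: Gen_def)
qed

lemma G_sub: "sets (G m n) \<subseteq> sets P"
 unfolding sets_G using Gen_sub by (rule sets.sigma_sets_subset)

lemma Src_G: "sets (Src (past m n)) \<subseteq> sets (G m n)"
proof
 fix B assume B: "B \<in> sets (Src (past m n))"
 have "B = B \<inter> space P" using B sets_Src_sub sets.sets_into_space by blast
 then have "B \<in> Gen m n" using B sets.top[of "Hs m n"] unfolding Gen_def by auto
 then show "B \<in> sets (G m n)" unfolding sets_G by (rule sigma_sets.Basic)
qed

lemma Hs_G: "sets (Hs m n) \<subseteq> sets (G m n)"
proof
 fix B assume B: "B \<in> sets (Hs m n)"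
 have "B = space P \<inter> B" using B sets_Hs_P sets.sets_into_space by blast
 then have "B \<in> Gen m n" using B sets.top[of "Src (past m n)"] unfolding Gen_def by auto
 then show "B \<in> sets (G m n)" unfolding sets_G by (rule sigma_sets.Basic)
qed

lemma G_least:
 assumes "space M = space P" "sets (Src (past m n)) \<subseteq> sets M" "\<And>k. k < n \<Longrightarrow> Hh m k \<in> borel_measurable M"
 shows "sets (G m n) \<subseteq> sets M"
proof -
 have "sets (Hs m n) \<subseteq> sets M" unfolding Hs_def by (rule gen_sigma_least) (use assms in auto)
 then have "Gen m n \<subseteq> sets M" using assms(2) by (force simp: Gen_def)
 then show ?thesis unfolding sets_G assms(1)[symmetric] by (rule sets.sigma_sets_subset)
qed

lemma G_Src: "sets (G m n) \<subseteq> sets (Src (insert (Driver m) (past m n)))"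
proof (rule G_least)
 show "sets (Src (past m n)) \<subseteq> sets (Src (insert (Driver m) (past m n)))" by (rule Src_mono) auto
qed (auto intro: Hh_Src)

lemma Hh_G: "k < n \<Longrightarrow> Hh m k \<in> borel_measurable (G m n)"
 by (rule measurable_sub[OF Hh_Hs]) (use Hs_G in auto)

lemma Hh_G_old: "m' < m \<Longrightarrow> Hh m' k \<in> borel_measurable (G m n)"
 by (rule measurable_sub[OF Hh_Src[of m' "past m n"]]) (use Src_G in \<open>auto simp: past_def\<close>)

lemma T_G: "m' < m \<Longrightarrow> T (Suc m') \<in> borel_measurable (G m n)"
 by (rule measurable_sub[OF driver_Src(2)[of m' "past m n"]]) (use Src_G in \<open>auto simp: past_def\<close>)

lemma r_G: "m' < m \<or> m' = m \<and> k < n \<Longrightarrow> r m' k \<in> borel_measurable (G m n)"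
 by (rule measurable_sub[OF r_Src[of m' k "past m n"]]) (use Src_G in \<open>auto simp: past_def\<close>)

lemma R_G: "m' < m \<Longrightarrow> R m' k \<in> borel_measurable (G m n)"
 by (rule measurable_sub[OF R_Src[of m' k "past m n"]]) (use Src_G in \<open>auto simp: past_def\<close>)

lemma G_shock: "sets (G m n) \<subseteq> sets (G m (Suc n))"
proof (rule G_least)
 have "sets (Src (past m n)) \<subseteq> sets (Src (past m (Suc n)))" by (rule Src_mono) (auto simp: past_def)
 then show "sets (Src (past m n)) \<subseteq> sets (G m (Suc n))" using Src_G by blast
qed (auto intro: Hh_G)

lemma G_switch: "sets (G m n) \<subseteq> sets (G (Suc m) 0)"
proof (rule G_least)
 have "sets (Src (past m n)) \<subseteq> sets (Src (past (Suc m) 0))" by (rule Src_mono) (auto simp: past_def)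
 then show "sets (Src (past m n)) \<subseteq> sets (G (Suc m) 0)" using Src_G by blast
qed (auto intro: Hh_G_old)

lemma jump_independent:
 assumes \<Phi>: "\<Phi> \<in> borel_measurable (Src S \<Otimes>\<^sub>M borel)"
 shows "Small_Jump m n \<notin> S \<Longrightarrow> (\<integral>\<^sup>+z. \<Phi> (z, r m n z) \<partial>P) = (\<integral>\<^sup>+z. (\<integral>\<^sup>+y. \<Phi> (z, y) \<partial>Dr (eps i m) n) \<partial>P)"
  and "Big_Jump m n \<notin> S \<Longrightarrow> (\<integral>\<^sup>+z. \<Phi> (z, R m n z) \<partial>P) = (\<integral>\<^sup>+z. (\<integral>\<^sup>+y. \<Phi> (z, y) \<partial>DR (eps i m) n) \<partial>P)"
proof -
 show "(\<integral>\<^sup>+z. \<Phi> (z, r m n z) \<partial>P) = (\<integral>\<^sup>+z. (\<integral>\<^sup>+y. \<Phi> (z, y) \<partial>Dr (eps i m) n) \<partial>P)" if "Small_Jump m n \<notin> S"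
 proof -
  have "(\<integral>\<^sup>+z. \<Phi> (z, r m n z) \<partial>P) = (\<integral>\<^sup>+z. (\<integral>\<^sup>+y. \<Phi> (z, y) \<partial>distr P borel (r m n)) \<partial>P)"
  proof (rule nn_integral_indep[OF _ sets_Src_sub r_measurable _ \<Phi>])
   fix A B assume "A \<in> sets (Src S)" "B \<in> sets (borel :: real measure)"
   then show "prob (A \<inter> (r m n -` B \<inter> space P)) = prob A * prob (r m n -` B \<inter> space P)"
    using measurable_sets[OF r_Src[of m n "{Small_Jump m n}"], of B] that
    by (intro Src_indep[of S "{Small_Jump m n}"]) auto
  qed simp
  then show ?thesis by (simp only: r_law)
 qed
 show "(\<integral>\<^sup>+z. \<Phi> (z, R m n z) \<partial>P) = (\<integral>\<^sup>+z. (\<integral>\<^sup>+y. \<Phi> (z, y) \<partial>DR (eps i m) n) \<partial>P)" if "Big_Jump m n \<notin> S"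
 proof -
  have "(\<integral>\<^sup>+z. \<Phi> (z, R m n z) \<partial>P) = (\<integral>\<^sup>+z. (\<integral>\<^sup>+y. \<Phi> (z, y) \<partial>distr P borel (R m n)) \<partial>P)"
  proof (rule nn_integral_indep[OF _ sets_Src_sub R_measurable _ \<Phi>])
   fix A B assume "A \<in> sets (Src S)" "B \<in> sets (borel :: real measure)"
   then show "prob (A \<inter> (R m n -` B \<inter> space P)) = prob A * prob (R m n -` B \<inter> space P)"
    using measurable_sets[OF R_Src[of m n "{Big_Jump m n}"], of B] that
    by (intro Src_indep[of S "{Big_Jump m n}"]) auto
  qed simp
  then show ?thesis by (simp only: R_law)
 qed
qed

section \<open>The next event\<close>

text \<open>
 The revealed sources are independent of the current driving process and its gap.
\<close>

lemma extend_to_past: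
 assumes X: "X \<in> sets (Src {Driver m})" and k: "k < \<infinity>"
  and eq: "\<And>B. B \<in> sets (Hs m n) \<Longrightarrow> emeasure P (B \<inter> X) = emeasure P (B \<inter> alive m n) * k"
  and A: "A \<in> sets (G m n)"
 shows "emeasure P (A \<inter> X) = emeasure P (A \<inter> alive m n) * k"
proof (rule emeasure_generator_extend[OF Gen_stable Gen_sub _ _ alive_sets k _ A[unfolded sets_G]])
 show "space P \<in> Gen m n"
  using sets.top[of "Src (past m n)"] sets.top[of "Hs m n"] unfolding Gen_def by fastforce
 show XP: "X \<in> sets P" using X sets_Src_sub by auto
 fix A assume "A \<in> Gen m n"
 then obtain B1 B2 where B: "B1 \<in> sets (Src (past m n))" "B2 \<in> sets (Hs m n)" "A = B1 \<inter> B2" by (auto simp: Gen_def)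
 have Hd: "sets (Hs m n) \<subseteq> sets (Src {Driver m})" using sets_Hs driver_Src(1)[of m "{Driver m}"] by blast
 have alive_d: "alive m n \<in> sets (Src {Driver m})"
 proof -
  have [measurable]: "T (Suc m) \<in> borel_measurable (Src {Driver m})" "Sh m n \<in> borel_measurable (Src {Driver m})"
   using driver_Src(2)[of m "{Driver m}"] Hh_Src[of m "{Driver m}"] unfolding Sh_def[abs_def] by (auto intro!: borel_measurable_sum)
  have "{z \<in> space (Src {Driver m}). ennreal (Sh m n z) < T (Suc m) z} \<in> sets (Src {Driver m})" by measurable
  then show ?thesis by (simp add: alive_def)
 qed
 have split: "emeasure P (B1 \<inter> (B2 \<inter> Z)) = emeasure P B1 * emeasure P (B2 \<inter> Z)" if "Z \<in> sets (Src {Driver m})" for Z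
 proof -
  have "prob (B1 \<inter> (B2 \<inter> Z)) = prob B1 * prob (B2 \<inter> Z)"
   using B that Hd by (intro Src_indep[of "past m n" "{Driver m}"]) (auto simp: past_def)
  then show ?thesis by (simp add: emeasure_eq_measure ennreal_mult)
 qed
 show "emeasure P (A \<inter> X) = emeasure P (A \<inter> alive m n) * k"
  unfolding B(3) Int_assoc split[OF X] split[OF alive_d] eq[OF B(2)] by (simp add: mult.assoc)
qed

text \<open>
 The law of the time of an event of rate \<open>a\<close> that competes with others, at total rate
 \<open>t\<close>; its mass is \<open>a / t\<close>.
\<close>

definition rateK :: "real \<Rightarrow> real \<Rightarrow> real measure" where
 "rateK a t = density lborel (\<lambda>w. indicator {0<..} w * ennreal (a * exp (- (t * w))))"

lemma sets_rateK [simp, measurable_cong]: "sets (rateK a t) = sets borel"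
 by (simp add: rateK_def)

lemma nn_integral_rateK:
 assumes [measurable]: "f \<in> borel_measurable borel"
 shows "(\<integral>\<^sup>+w. f w \<partial>rateK a t) = (\<integral>\<^sup>+w. indicator {0<..} w * ennreal (a * exp (- (t * w))) * f w \<partial>lborel)"
 unfolding rateK_def by (rule nn_integral_density) measurable

lemma emeasure_rateK: "emeasure (rateK a t) {w<..} = (\<integral>\<^sup>+x. indicator {0<..} x * ennreal (a * exp (- (t * x))) * indicator {w<..} x \<partial>lborel)"
 using nn_integral_rateK[of "indicator {w<..}" a t] by simp

lemma emeasure_rateK_tail:
 assumes "0 < a" "a < t"
 shows "emeasure (rateK a t) {w<..} = (\<integral>\<^sup>+x. indicator {w<..} x * ennreal (exp (- ((t - a) * x))) \<partial>Ex a)"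
proof -
 have "a * exp (- (t * x)) = a * exp (- (a * x)) * exp (- ((t - a) * x))" for x
  by (simp add: mult.assoc exp_add[symmetric] left_diff_distrib)
 then show ?thesis
  using assms unfolding emeasure_rateK
  by (subst nn_integral_Ex) (auto intro!: nn_integral_cong simp: ennreal_mult mult_ac)
qed

lemma finite_rateK:
 assumes "0 < a" "a < t" shows "finite_measure (rateK a t)"
proof
 have "(\<integral>\<^sup>+w. 1 \<partial>rateK a t) = (\<integral>\<^sup>+w. indicator {0<..} w * ennreal (exp (- (t * w))) * ennreal a \<partial>lborel)"
  using assms by (subst nn_integral_rateK) (auto intro!: nn_integral_cong simp: ennreal_mult mult_ac)
 also have "\<dots> = ennreal (1 / t) * ennreal a" using assms by (intro nn_integral_exp_tail_mult) auto
 finally show "emeasure (rateK a t) (space (rateK a t)) \<noteq> \<infinity>" using assms by (simp add: ennreal_mult[symmetric])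
qed

text \<open>
 Given the past on arrival in a cell that is still alive, the waiting time and the jump of the next shock have
 the product law of the kernel.
\<close>

lemma shock_law:
 assumes \<Phi>: "(\<lambda>p. \<Phi> (fst p) (fst (snd p)) (snd (snd p))) \<in> borel_measurable (G m n \<Otimes>\<^sub>M (borel \<Otimes>\<^sub>M borel))"
 shows "(\<integral>\<^sup>+z. indicator (alive m (Suc n)) z * \<Phi> z (Hh m n z) (r m n z) \<partial>P)
  = (\<integral>\<^sup>+z. indicator (alive m n) z * (\<integral>\<^sup>+w. (\<integral>\<^sup>+y. \<Phi> z w y \<partial>Dr (eps i m) n) \<partial>rateK (l m n) (th m n)) \<partial>P)"
proof -
 let ?S = "insert (Driver m) (past m n)"
 interpret D: prob_space "Dr (eps i m) n" unfolding r_law[symmetric] by (rule prob_space_distr) (rule r_measurable)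
 have setsD [measurable_cong]: "sets (Dr (eps i m) n) = sets borel" unfolding r_law[symmetric] by simp
 have idm: "(\<lambda>z. z) \<in> Src ?S \<rightarrow>\<^sub>M G m n" using G_Src[of m n] by (auto simp: measurable_def)
 have [measurable]: "T (Suc m) \<in> borel_measurable (Src ?S)" "Hh m n \<in> borel_measurable (Src ?S)" "Sh m (Suc n) \<in> borel_measurable (Src ?S)"
  using driver_Src(2)[of m ?S] Hh_Src[of m ?S] unfolding Sh_def[abs_def] by (auto intro!: borel_measurable_sum)
 have alS [measurable]: "alive m (Suc n) \<in> sets (Src ?S)"
 proof -
  have "{z \<in> space (Src ?S). ennreal (Sh m (Suc n) z) < T (Suc m) z} \<in> sets (Src ?S)" by measurable
  then show ?thesis by (simp add: alive_def)
 qed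
 have m1: "(\<lambda>p. \<Phi> (fst p) (Hh m n (fst p)) (snd p)) \<in> borel_measurable (Src ?S \<Otimes>\<^sub>M borel)"
 proof -
  have "(\<lambda>p. (fst p, (Hh m n (fst p), snd p))) \<in> Src ?S \<Otimes>\<^sub>M borel \<rightarrow>\<^sub>M G m n \<Otimes>\<^sub>M (borel \<Otimes>\<^sub>M borel)"
   by (intro measurable_Pair measurable_compose[OF measurable_fst idm]) measurable
  from measurable_compose[OF this \<Phi>] show ?thesis by simp
 qed
 have m2: "(\<lambda>p. \<integral>\<^sup>+y. \<Phi> (fst p) (snd p) y \<partial>Dr (eps i m) n) \<in> borel_measurable (G m n \<Otimes>\<^sub>M borel)"
 proof -
  have "(\<lambda>p. (fst (fst p), (snd (fst p), snd p))) \<in> (G m n \<Otimes>\<^sub>M borel) \<Otimes>\<^sub>M Dr (eps i m) n \<rightarrow>\<^sub>M G m n \<Otimes>\<^sub>M (borel \<Otimes>\<^sub>M borel)"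
   by measurable
  from D.borel_measurable_nn_integral_fst[OF measurable_compose[OF this \<Phi>]] show ?thesis by simp
 qed
 have "(\<integral>\<^sup>+z. indicator (alive m (Suc n)) z * \<Phi> z (Hh m n z) (r m n z) \<partial>P)
   = (\<integral>\<^sup>+z. (\<integral>\<^sup>+y. indicator (alive m (Suc n)) z * \<Phi> z (Hh m n z) y \<partial>Dr (eps i m) n) \<partial>P)"
 proof -
  have "(\<lambda>p. indicator (alive m (Suc n)) (fst p) * \<Phi> (fst p) (Hh m n (fst p)) (snd p)) \<in> borel_measurable (Src ?S \<Otimes>\<^sub>M borel)"
   using m1 by measurable
  moreover have "Small_Jump m n \<notin> ?S" by (auto simp: past_def)
  ultimately show ?thesis
   using jump_independent(1)[of "\<lambda>p. indicator (alive m (Suc n)) (fst p) * \<Phi> (fst p) (Hh m n (fst p)) (snd p)" ?S m n] by simp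
 qed
 also have "\<dots> = (\<integral>\<^sup>+z. indicator (alive m (Suc n)) z * (\<integral>\<^sup>+y. \<Phi> z (Hh m n z) y \<partial>Dr (eps i m) n) \<partial>P)"
 proof (intro nn_integral_cong)
  fix z show "(\<integral>\<^sup>+y. indicator (alive m (Suc n)) z * \<Phi> z (Hh m n z) y \<partial>Dr (eps i m) n) = indicator (alive m (Suc n)) z * (\<integral>\<^sup>+y. \<Phi> z (Hh m n z) y \<partial>Dr (eps i m) n)"
   by (cases "z \<in> alive m (Suc n)") auto
 qed
 also have "\<dots> = (\<integral>\<^sup>+z. indicator (alive m n) z * (\<integral>\<^sup>+w. (\<integral>\<^sup>+y. \<Phi> z w y \<partial>Dr (eps i m) n) \<partial>rateK (l m n) (th m n)) \<partial>P)"
 proof -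
  have "emeasure P (A \<inter> alive m (Suc n) \<inter> {z \<in> space P. w < Hh m n z}) = emeasure P (A \<inter> alive m n) * emeasure (rateK (l m n) (th m n)) {w<..}"
   if A: "A \<in> sets (G m n)" for A w
  proof -
   have X: "alive m (Suc n) \<inter> {z \<in> space P. w < Hh m n z} \<in> sets (Src {Driver m})"
   proof -
    have [measurable]: "T (Suc m) \<in> borel_measurable (Src {Driver m})" "Hh m n \<in> borel_measurable (Src {Driver m})" "Sh m (Suc n) \<in> borel_measurable (Src {Driver m})"
     using driver_Src(2)[of m "{Driver m}"] Hh_Src[of m "{Driver m}"] unfolding Sh_def[abs_def] by (auto intro!: borel_measurable_sum)
    have "{z \<in> space (Src {Driver m}). ennreal (Sh m (Suc n) z) < T (Suc m) z} \<inter> {z \<in> space (Src {Driver m}). w < Hh m n z} \<in> sets (Src {Driver m})" by measurable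
    then show ?thesis by (simp add: alive_def)
   qed
   have K: "emeasure (rateK (l m n) (th m n)) {w<..} = (\<integral>\<^sup>+x. indicator {w<..} x * ennreal (exp (- (b m n * x))) \<partial>Ex (l m n))"
    using emeasure_rateK_tail[of "l m n" "th m n" w] l_pos[of m n] b_pos[of m n] by simp
   interpret K: finite_measure "rateK (l m n) (th m n)" using l_pos b_pos by (intro finite_rateK) auto
   have "emeasure P (A \<inter> (alive m (Suc n) \<inter> {z \<in> space P. w < Hh m n z})) = emeasure P (A \<inter> alive m n) * emeasure (rateK (l m n) (th m n)) {w<..}"
    using K.emeasure_finite[of "{w<..}"]
    by (intro extend_to_past[OF X _ _ A]) (auto simp: K shock_tail less_top)
   then show ?thesis by (simp only: Int_assoc)
  qed
  moreover have "finite_measure (rateK (l m n) (th m n))" using l_pos b_pos by (intro finite_rateK) auto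
  ultimately show ?thesis
   using nn_integral_disintegrate[of "G m n" "alive m (Suc n)" "alive m n" "Hh m n" "rateK (l m n) (th m n)" "\<lambda>p. \<integral>\<^sup>+y. \<Phi> (fst p) (snd p) y \<partial>Dr (eps i m) n"] m2 G_sub[of m n]
   by simp
 qed
 finally show ?thesis .
qed

lemma switch_law:
 assumes \<Phi>: "(\<lambda>p. \<Phi> (fst p) (fst (snd p)) (snd (snd p))) \<in> borel_measurable (G m n \<Otimes>\<^sub>M (borel \<Otimes>\<^sub>M borel))"
 shows "(\<integral>\<^sup>+z. indicator (switchset m n) z * \<Phi> z (age m n z) (R m n z) \<partial>P)
  = (\<integral>\<^sup>+z. indicator (alive m n) z * (\<integral>\<^sup>+w. (\<integral>\<^sup>+y. \<Phi> z w y \<partial>DR (eps i m) n) \<partial>rateK (b m n) (th m n)) \<partial>P)"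
proof -
 let ?S = "insert (Driver m) (past m n)"
 interpret D: prob_space "DR (eps i m) n" unfolding R_law[symmetric] by (rule prob_space_distr) (rule R_measurable)
 have setsD [measurable_cong]: "sets (DR (eps i m) n) = sets borel" unfolding R_law[symmetric] by simp
 have idm: "(\<lambda>z. z) \<in> Src ?S \<rightarrow>\<^sub>M G m n" using G_Src[of m n] by (auto simp: measurable_def)
 have TS: "T (Suc m) \<in> borel_measurable (Src S)" "Sh m k \<in> borel_measurable (Src S)" if "Driver m \<in> S" for S k
  using driver_Src(2)[OF that] Hh_Src[OF that] unfolding Sh_def[abs_def] by (auto intro!: borel_measurable_sum)
 have age_S: "age m n \<in> borel_measurable (Src S)" if "Driver m \<in> S" for S
  unfolding age_def[abs_def] using TS[OF that] by measurable
 have sw_S: "switchset m n \<in> sets (Src S)" if "Driver m \<in> S" for S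
 proof -
  note TS[OF that, measurable]
  have "{z \<in> space (Src S). ennreal (Sh m n z) < T (Suc m) z \<and> T (Suc m) z < ennreal (Sh m (Suc n) z)} \<in> sets (Src S)" by measurable
  then show ?thesis by (simp add: switchset_def)
 qed
 have [measurable]: "age m n \<in> borel_measurable (Src ?S)" "switchset m n \<in> sets (Src ?S)" by (auto intro: age_S sw_S)
 have m1: "(\<lambda>p. \<Phi> (fst p) (age m n (fst p)) (snd p)) \<in> borel_measurable (Src ?S \<Otimes>\<^sub>M borel)"
 proof -
  have "(\<lambda>p. (fst p, (age m n (fst p), snd p))) \<in> Src ?S \<Otimes>\<^sub>M borel \<rightarrow>\<^sub>M G m n \<Otimes>\<^sub>M (borel \<Otimes>\<^sub>M borel)"
   by (intro measurable_Pair measurable_compose[OF measurable_fst idm]) measurable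
  from measurable_compose[OF this \<Phi>] show ?thesis by simp
 qed
 have m2: "(\<lambda>p. \<integral>\<^sup>+y. \<Phi> (fst p) (snd p) y \<partial>DR (eps i m) n) \<in> borel_measurable (G m n \<Otimes>\<^sub>M borel)"
 proof -
  have "(\<lambda>p. (fst (fst p), (snd (fst p), snd p))) \<in> (G m n \<Otimes>\<^sub>M borel) \<Otimes>\<^sub>M DR (eps i m) n \<rightarrow>\<^sub>M G m n \<Otimes>\<^sub>M (borel \<Otimes>\<^sub>M borel)"
   by measurable
  from D.borel_measurable_nn_integral_fst[OF measurable_compose[OF this \<Phi>]] show ?thesis by simp
 qed
 have "(\<integral>\<^sup>+z. indicator (switchset m n) z * \<Phi> z (age m n z) (R m n z) \<partial>P)
   = (\<integral>\<^sup>+z. (\<integral>\<^sup>+y. indicator (switchset m n) z * \<Phi> z (age m n z) y \<partial>DR (eps i m) n) \<partial>P)"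
 proof -
  have "(\<lambda>p. indicator (switchset m n) (fst p) * \<Phi> (fst p) (age m n (fst p)) (snd p)) \<in> borel_measurable (Src ?S \<Otimes>\<^sub>M borel)"
   using m1 by measurable
  moreover have "Big_Jump m n \<notin> ?S" by (auto simp: past_def)
  ultimately show ?thesis
   using jump_independent(2)[of "\<lambda>p. indicator (switchset m n) (fst p) * \<Phi> (fst p) (age m n (fst p)) (snd p)" ?S m n] by simp
 qed
 also have "\<dots> = (\<integral>\<^sup>+z. indicator (switchset m n) z * (\<integral>\<^sup>+y. \<Phi> z (age m n z) y \<partial>DR (eps i m) n) \<partial>P)"
 proof (intro nn_integral_cong)
  fix z show "(\<integral>\<^sup>+y. indicator (switchset m n) z * \<Phi> z (age m n z) y \<partial>DR (eps i m) n) = indicator (switchset m n) z * (\<integral>\<^sup>+y. \<Phi> z (age m n z) y \<partial>DR (eps i m) n)"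
   by (cases "z \<in> switchset m n") auto
 qed
 also have "\<dots> = (\<integral>\<^sup>+z. indicator (alive m n) z * (\<integral>\<^sup>+w. (\<integral>\<^sup>+y. \<Phi> z w y \<partial>DR (eps i m) n) \<partial>rateK (b m n) (th m n)) \<partial>P)"
 proof -
  have age_pos: "AE z in P. z \<in> switchset m n \<longrightarrow> 0 < age m n z"
   using AE_Hh AE_proper_all
  proof eventually_elim
   case (elim z)
   have p: "proper (\<lambda>k. H m k z)" using elim by simp
   have S0: "0 \<le> Sh m n z" using elim proper_nonneg[OF p, of n] by (simp add: Sh_def)
   then show ?case
    by (cases "T (Suc m) z") (auto simp: switchset_def age_def ennreal_less_iff)
  qed
  have "emeasure P (A \<inter> switchset m n \<inter> {z \<in> space P. w < age m n z}) = emeasure P (A \<inter> alive m n) * emeasure (rateK (b m n) (th m n)) {w<..}"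
   if A: "A \<in> sets (G m n)" for A w
  proof -
   have AP [measurable]: "A \<in> sets P" using A G_sub by auto
   interpret K: finite_measure "rateK (b m n) (th m n)" using l_pos b_pos by (intro finite_rateK) auto
   have pos: "emeasure P (A \<inter> (switchset m n \<inter> {z \<in> space P. w < age m n z})) = emeasure P (A \<inter> alive m n) * emeasure (rateK (b m n) (th m n)) {w<..}"
    if w: "0 \<le> w" for w
   proof (intro extend_to_past[OF _ _ _ A])
    show "switchset m n \<inter> {z \<in> space P. w < age m n z} \<in> sets (Src {Driver m})"
    proof -
     have [measurable]: "age m n \<in> borel_measurable (Src {Driver m})" by (rule age_S) simp
     have "{z \<in> space (Src {Driver m}). w < age m n z} \<in> sets (Src {Driver m})" by measurable
     then show ?thesis using sw_S[of "{Driver m}"] by auto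
    qed
    show "emeasure (rateK (b m n) (th m n)) {w<..} < \<infinity>" using K.emeasure_finite[of "{w<..}"] by (simp add: less_top[symmetric])
    fix B assume B: "B \<in> sets (Hs m n)"
    have "emeasure (rateK (b m n) (th m n)) {w<..} = ennreal (b m n / th m n * exp (- (th m n * w)))"
     using emeasure_rateK_tail[of "b m n" "th m n" w] emeasure_Ex_tail[OF b_pos[of m n] less_imp_le[OF l_pos[of m n]] w] l_pos[of m n] b_pos[of m n] by simp
    then show "emeasure P (B \<inter> (switchset m n \<inter> {z \<in> space P. w < age m n z})) = emeasure P (B \<inter> alive m n) * emeasure (rateK (b m n) (th m n)) {w<..}"
     using switch_tail[OF B w] by simp
   qed
   show ?thesis
   proof (cases "0 \<le> w")
    case True then show ?thesis using pos by (simp only: Int_assoc)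
   next
    case False
    have "emeasure P (A \<inter> switchset m n \<inter> {z \<in> space P. w < age m n z}) = emeasure P (A \<inter> (switchset m n \<inter> {z \<in> space P. 0 < age m n z}))"
     by (rule emeasure_eq_AE) (use age_pos False in \<open>auto elim: eventually_mono\<close>)
    also have "\<dots> = emeasure P (A \<inter> alive m n) * emeasure (rateK (b m n) (th m n)) {0<..}" by (rule pos) simp
    also have "emeasure (rateK (b m n) (th m n)) {0<..} = emeasure (rateK (b m n) (th m n)) {w<..}"
     unfolding emeasure_rateK using False by (intro nn_integral_cong) (auto simp: indicator_def)
    finally show ?thesis .
   qed
  qed
  moreover have "finite_measure (rateK (b m n) (th m n))" using l_pos b_pos by (intro finite_rateK) auto
  ultimately show ?thesis
   using nn_integral_disintegrate[of "G m n" "switchset m n" "alive m n" "age m n" "rateK (b m n) (th m n)" "\<lambda>p. \<integral>\<^sup>+y. \<Phi> (fst p) (snd p) y \<partial>DR (eps i m) n"] m2 G_sub[of m n]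
   by simp
 qed
 finally show ?thesis .
qed

section \<open>The switchings do not accumulate\<close>

text \<open>
 The phase may spend more than one unit of time in its first cell, whose total rate takes only two values; so
 each gap exceeds 1 with a probability bounded below, and the gaps are independent.
\<close>

lemma AE_gap_large: "AE z in P. \<forall>m. \<exists>k\<ge>m. 1 < T (Suc k) z"
proof -
 define M where "M = max (lam 0 0 + mu 0 0) (lam 1 0 + mu 1 0)"
 have thM: "th m 0 \<le> M" for m using eps_cases[of i m] by (auto simp: M_def)
 have thp: "0 < th m 0" for m using l_pos[of m 0] b_pos[of m 0] by simp
 define F where "F k = {z \<in> space P. T (Suc k) z \<le> 1}" for k
 have F [measurable]: "F k \<in> sets P" for k unfolding F_def by measurable
 have small: "prob (F k) \<le> 1 - exp (- M)" for k
 proof -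
  have "ennreal (exp (- th k 0)) = emeasure P (space P \<inter> {z \<in> space P. 1 < Hh k 0 z \<and> ennreal (Sh k 0 z + 1) < T (Suc k) z})"
  proof -
   have "emeasure P (space P \<inter> alive k 0) = emeasure P (space P)"
    using alive_0[of k] by (intro emeasure_eq_AE) (auto elim: eventually_mono)
   then show ?thesis using stay_tail[of "space P" k 0 1] sets.top[of "Hs k 0"] by (simp add: emeasure_space_1)
  qed
  also have "\<dots> \<le> emeasure P (space P - F k)"
   by (rule emeasure_mono) (auto simp: F_def Sh_def not_le)
  finally have "exp (- th k 0) \<le> prob (space P - F k)" by (simp add: emeasure_eq_measure)
  then have "prob (F k) \<le> 1 - exp (- th k 0)" by (simp add: prob_compl)
  moreover have "exp (- M) \<le> exp (- th k 0)" using thM[of k] by simp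
  ultimately show ?thesis by linarith
 qed
 have M0: "0 \<le> 1 - exp (- M)" "1 - exp (- M) < 1" using thp[of 0] thM[of 0] by auto
 have "AE z in P. z \<notin> (\<Inter>k\<in>{m..}. F k)" for m
 proof -
  have le: "prob (\<Inter>k\<in>{m..}. F k) \<le> (1 - exp (- M)) ^ K" if "0 < K" for K
  proof -
   have FE: "F k \<in> SE (Driver k)" for k
   proof -
    have "T (Suc k) \<in> borel_measurable (Src {Driver k})" by (rule driver_Src(2)) simp
    then have "{z \<in> space (Src {Driver k}). T (Suc k) z \<le> 1} \<in> sets (Src {Driver k})" by measurable
    moreover have "sets (Src {Driver k}) = SE (Driver k)"
    proof -
     have "sigma_sets (space P) (SE (Driver k)) = SE (Driver k)"
      using sets.sigma_sets_eq[of "gen_sigma (space P) (\<lambda>t z. (shock_count H k t z, T (Suc k) z)) {0..}"] by simp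
     then show ?thesis by (simp only: sets_Src UN_insert UN_empty Un_empty_right)
    qed
    ultimately show ?thesis by (simp add: F_def)
   qed
   have "prob (\<Inter>s\<in>Driver ` {m..<m + K}. F (case s of Driver k \<Rightarrow> k)) = (\<Prod>s\<in>Driver ` {m..<m + K}. prob (F (case s of Driver k \<Rightarrow> k)))"
    by (rule indep_setsD[OF sources_indep]) (use that FE in auto)
   then have "prob (\<Inter>k\<in>{m..<m + K}. F k) = (\<Prod>k\<in>{m..<m + K}. prob (F k))"
    by (simp add: prod.reindex inj_on_def)
   also have "\<dots> \<le> (\<Prod>k\<in>{m..<m + K}. 1 - exp (- M))" by (intro prod_mono) (use small in auto)
   also have "\<dots> = (1 - exp (- M)) ^ K" by simp
   finally have "prob (\<Inter>k\<in>{m..<m + K}. F k) \<le> (1 - exp (- M)) ^ K" .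
   moreover have "prob (\<Inter>k\<in>{m..}. F k) \<le> prob (\<Inter>k\<in>{m..<m + K}. F k)"
    using that by (intro finite_measure_mono) (auto intro!: sets.finite_INT)
   ultimately show ?thesis by linarith
  qed
  have "(\<lambda>K. (1 - exp (- M)) ^ K) \<longlonglongrightarrow> 0" using M0 by (rule LIMSEQ_realpow_zero)
  then have "prob (\<Inter>k\<in>{m..}. F k) \<le> 0"
   by (rule LIMSEQ_le_const) (use le in \<open>auto intro!: exI[of _ 1]\<close>)
  moreover have ev: "(\<Inter>k\<in>{m..}. F k) \<in> sets P" by (rule sets.countable_INT') auto
  ultimately have "(\<Inter>k\<in>{m..}. F k) \<in> null_sets P" by (simp add: null_sets_def emeasure_eq_measure measure_le_0_iff)
  then show ?thesis by (rule AE_not_in)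
 qed
 then have "AE z in P. \<forall>m. z \<notin> (\<Inter>k\<in>{m..}. F k)" by (simp add: AE_all_countable)
 with AE_space show ?thesis
 proof eventually_elim
  case (elim z)
  show ?case
  proof
   fix m
   from elim obtain k where "k \<ge> m" "z \<notin> F k" by fastforce
   then show "\<exists>k\<ge>m. 1 < T (Suc k) z" using elim(1) by (auto simp: F_def not_le)
  qed
 qed
qed

lemma AE_switch_time_unbounded: "AE z in P. \<forall>t. \<exists>m. ennreal t < switch_time T m z"
 using AE_gap_large
proof eventually_elim
 case (elim z)
 have mono: "switch_time T m z \<le> switch_time T k z" if "m \<le> k" for m k
  unfolding switch_time_def using that by (intro sum_mono2) auto
 have "\<exists>m. of_nat N \<le> switch_time T m z" for N :: nat
 proof (induction N)
  case (Suc N)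
  then obtain m where m: "of_nat N \<le> switch_time T m z" by blast
  obtain k where k: "m \<le> k" "1 < T (Suc k) z" using elim by blast
  have "of_nat N + 1 \<le> switch_time T k z + T (Suc k) z"
   using m mono[OF k(1)] k(2) by (intro add_mono) auto
  also have "\<dots> = switch_time T (Suc k) z" by (simp add: switch_time_def)
  finally show ?case by (auto simp: add.commute)
 qed simp
 show ?case
 proof
  fix t :: real
  obtain N :: nat where "t < real N" using reals_Archimedean2 by blast
  then have "ennreal t < ennreal (real (Suc N))" by (intro ennreal_lessI) auto
  then have "ennreal t < of_nat (Suc N)" by (simp only: ennreal_of_nat_eq_real_of_nat)
  then show "\<exists>m. ennreal t < switch_time T m z"
   using \<open>\<And>N. \<exists>m. of_nat N \<le> switch_time T m z\<close>[of "Suc N"] by (auto intro: less_le_trans)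
 qed
qed

end

section \<open>The position of the process\<close>

text \<open>
 The tendencies do not affect the law of the input, but they are needed to speak of the position.
\<close>

locale switching_process = switching_model +
 fixes c :: "nat \<Rightarrow> nat \<Rightarrow> real"
begin

sublocale K: switching_kernel "\<lambda>j. lam (j mod 2)" "\<lambda>j. mu (j mod 2)" "\<lambda>j. c (j mod 2)"
 "\<lambda>j. Dr (j mod 2)" "\<lambda>j. DR (j mod 2)"
proof (rule switching_kernel.intro)
 fix j n :: nat
 have e: "j mod 2 \<in> {0, 1}" by auto
 have m: "eps i (i + j) = j mod 2" by (simp add: eps_def mod_simps) presburger
 show "0 < lam (j mod 2) n" "0 < mu (j mod 2) n" using lam_pos[OF e] mu_pos[OF e] by auto
 show "prob_space (Dr (j mod 2) n)" "sets (Dr (j mod 2) n) = sets borel"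
  using r_law[of "i + j" n] prob_space_distr[OF r_measurable[of "i + j" n]] unfolding m by (auto dest: sym)
 show "prob_space (DR (j mod 2) n)" "sets (DR (j mod 2) n) = sets borel"
  using R_law[of "i + j" n] prob_space_distr[OF R_measurable[of "i + j" n]] unfolding m by (auto dest: sym)
 show "integrable (Dr (j mod 2) n) (\<lambda>x. x)" "integrable (DR (j mod 2) n) (\<lambda>x. x)"
  using r_mean_finite[OF e] R_mean_finite[OF e] by auto
qed simp_all

abbreviation X :: "real \<Rightarrow> 'a \<Rightarrow> real" where "X \<equiv> process i c H T r R"
abbreviation d :: "nat \<Rightarrow> nat \<Rightarrow> real" where "d m n \<equiv> c (eps i m) n"

text \<open>
 The paths on which every statement about the position holds literally.
\<close>

definition good :: "'a \<Rightarrow> bool" where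
 "good z \<longleftrightarrow> z \<in> space P \<and> (\<forall>m n. Hh m n z = H m n z) \<and> (\<forall>m. proper (\<lambda>k. Hh m k z)) \<and> (\<forall>m. 0 < T (Suc m) z)
  \<and> (\<forall>m n. T (Suc m) z \<noteq> ennreal (Sh m (Suc n) z)) \<and> (\<forall>t. \<exists>m. ennreal t < switch_time T m z)"

lemma goodD:
 assumes "good z"
 shows "z \<in> space P" "Hh m n z = H m n z" "proper (\<lambda>k. Hh m k z)" "0 < T (Suc m) z"
  "T (Suc m) z \<noteq> ennreal (Sh m (Suc n) z)" "\<exists>m. ennreal t < switch_time T m z"
 using assms unfolding good_def by blast+

lemma AE_good: "AE z in P. good z"
proof -
 have 1: "AE z in P. \<forall>m. 0 < T (Suc m) z" using T_pos by (simp add: AE_all_countable)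
 have 2: "AE z in P. \<forall>m n. T (Suc m) z \<noteq> ennreal (Sh m (Suc n) z)" using AE_no_tie by (simp add: AE_all_countable)
 show ?thesis using AE_space AE_Hh AE_proper_all 1 2 AE_switch_time_unbounded
  by eventually_elim (auto simp: good_def)
qed

definition clock :: "nat \<Rightarrow> 'a \<Rightarrow> real" where "clock m z = enn2real (switch_time T m z)"

definition arr :: "nat \<Rightarrow> nat \<Rightarrow> 'a \<Rightarrow> real" where "arr m n z = clock m z + Sh m n z"

text \<open>
 The position just after the \<open>m\<close>-th switching, and in \<open>pos\<close> just after the
 \<open>n\<close>-th shock of the phase that follows. Written with \<open>Hh\<close> they are functions of the
 past on arrival.
\<close>

definition base :: "nat \<Rightarrow> 'a \<Rightarrow> real" where
 "base m z = (\<Sum>k<m. phase_drift i c Hh k (enn2real (T (Suc k) z)) z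
   + (R k (shock_count Hh k (enn2real (T (Suc k) z)) z) z + phase_jumps Hh r k (enn2real (T (Suc k) z)) z))"

definition pos :: "nat \<Rightarrow> nat \<Rightarrow> 'a \<Rightarrow> real" where
 "pos m n z = base m z + (\<Sum>k<n. d m k * Hh m k z + r m k z)"

text \<open>
 The path is in the cell \<open>(m, n)\<close> at time \<open>t\<close>, expressed by its arrival time and the
 survival of the phase. This form separates what is known on arrival from the next event.
\<close>

definition inside :: "nat \<Rightarrow> nat \<Rightarrow> real \<Rightarrow> 'a \<Rightarrow> bool" where
 "inside m n t z \<longleftrightarrow> switch_time T m z < \<top> \<and> arr m n z \<le> t \<and> t < arr m (Suc n) z \<and> ennreal (t - clock m z) < T (Suc m) z"

lemma Sh_0 [simp]: "Sh m 0 z = 0" by (simp add: Sh_def)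

lemma arr_Suc: "arr m (Suc n) z = arr m n z + Hh m n z"
 by (simp add: arr_def Sh_Suc)

lemma pos_Suc: "pos m (Suc n) z = pos m n z + d m n * Hh m n z + r m n z"
 by (simp add: pos_def)

lemma clock_nonneg: "0 \<le> clock m z" by (simp add: clock_def)

lemma Sh_nonneg: "good z \<Longrightarrow> 0 \<le> Sh m n z"
 unfolding Sh_def by (rule proper_nonneg[OF goodD(3)])

lemma Hh_pos: "good z \<Longrightarrow> 0 < Hh m n z"
 using goodD(3) by (auto simp: proper_def)

lemma phase_values:
 assumes g: "good z" and x: "Sh m n z \<le> x" "x < Sh m (Suc n) z"
 shows "shock_count Hh m x z = n"
  and "phase_drift i c Hh m x z = (\<Sum>k<n. d m k * Hh m k z) + d m n * (x - Sh m n z)"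
  and "phase_jumps Hh r m x z = (\<Sum>k<n. r m k z)"
proof -
 have p: "proper (\<lambda>k. Hh m k z)" by (rule goodD(3)[OF g])
 show c: "shock_count Hh m x z = n"
  using proper_count_eq[OF p, of x n] x Sh_nonneg[OF g, of m n] unfolding shock_count_eq_Max Sh_def by simp
 show "phase_drift i c Hh m x z = (\<Sum>k<n. d m k * Hh m k z) + d m n * (x - Sh m n z)"
  using phase_drift_formula[of Hh m z "x - Sh m n z" n i c, OF p] x by (simp add: Sh_Suc Sh_def[symmetric])
 show "phase_jumps Hh r m x z = (\<Sum>k<n. r m k z)"
  unfolding phase_jumps_def c
  by (subst sum.atLeast_Suc_atMost_Suc_shift[of _ 0 "n - 1"] | simp add: sum.atLeast1_atMost_eq)+
qed

lemma switch_time_Suc: "switch_time T (Suc m) z = switch_time T m z + T (Suc m) z"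
 by (simp add: switch_time_def)

lemma switch_time_mono: "m \<le> k \<Longrightarrow> switch_time T m z \<le> switch_time T k z"
 unfolding switch_time_def by (intro sum_mono2) auto

lemma clock_le: "switch_time T m z < \<top> \<Longrightarrow> 0 \<le> t \<Longrightarrow> switch_time T m z \<le> ennreal t \<longleftrightarrow> clock m z \<le> t"
 unfolding clock_def by (cases "switch_time T m z") auto

lemma clock_Suc:
 assumes "switch_time T m z < \<top>" "T (Suc m) z < \<top>"
 shows "clock (Suc m) z = clock m z + enn2real (T (Suc m) z)" "switch_time T (Suc m) z < \<top>"
 using assms unfolding clock_def switch_time_Suc by (auto simp: enn2real_plus)

lemma less_switch_time_Suc:
 assumes "switch_time T m z < \<top>" "clock m z \<le> t"
 shows "ennreal t < switch_time T (Suc m) z \<longleftrightarrow> ennreal (t - clock m z) < T (Suc m) z"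
proof -
 obtain x where x: "switch_time T m z = ennreal x" "0 \<le> x" using assms by (cases "switch_time T m z") auto
 have "clock m z = x" using x by (simp add: clock_def)
 then show ?thesis
  using assms x unfolding switch_time_Suc
  by (cases "T (Suc m) z") (auto simp: ennreal_less_iff ennreal_plus[symmetric] simp del: ennreal_plus)
qed

lemma inside_iff:
 assumes g: "good z" and t: "0 \<le> t"
 shows "inside m n t z \<longleftrightarrow> switch_count T t z = m \<and> shock_count Hh m (elapsed T t z) z = n"
proof -
 obtain K where K: "ennreal t < switch_time T K z" using goodD(6)[OF g] by blast
 have fin: "finite {m. switch_time T m z \<le> ennreal t}"
 proof (rule finite_subset)
  show "{m. switch_time T m z \<le> ennreal t} \<subseteq> {..K}"
  proof
   fix m assume m: "m \<in> {m. switch_time T m z \<le> ennreal t}"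
   show "m \<in> {..K}"
   proof (rule ccontr)
    assume "m \<notin> {..K}"
    then have "switch_time T K z \<le> switch_time T m z" by (intro switch_time_mono) auto
    then have "switch_time T K z \<le> ennreal t" using m by auto
    then show False using K by simp
   qed
  qed
 qed simp
 have ne: "{m. switch_time T m z \<le> ennreal t} \<noteq> {}"
  using t by (auto intro!: exI[of _ 0] simp: switch_time_def)
 have cnt: "switch_count T t z = m \<longleftrightarrow> switch_time T m z \<le> ennreal t \<and> ennreal t < switch_time T (Suc m) z"
 proof
  assume e: "switch_count T t z = m"
  have "switch_time T m z \<le> ennreal t" using Max_in[OF fin ne] e by (simp add: switch_count_def)
  moreover have "\<not> switch_time T (Suc m) z \<le> ennreal t"
  proof
   assume "switch_time T (Suc m) z \<le> ennreal t"
   then have "Suc m \<le> switch_count T t z" unfolding switch_count_def by (intro Max_ge fin) simp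
   then show False using e by simp
  qed
  ultimately show "switch_time T m z \<le> ennreal t \<and> ennreal t < switch_time T (Suc m) z" by (simp add: not_le)
 next
  assume a: "switch_time T m z \<le> ennreal t \<and> ennreal t < switch_time T (Suc m) z"
  show "switch_count T t z = m"
   unfolding switch_count_def
  proof (rule Max_eqI[OF fin])
   fix k assume k: "k \<in> {m. switch_time T m z \<le> ennreal t}"
   show "k \<le> m"
   proof (rule ccontr)
    assume "\<not> k \<le> m"
    then have "switch_time T (Suc m) z \<le> switch_time T k z" by (intro switch_time_mono) auto
    also have "\<dots> \<le> ennreal t" using k by simp
    finally have "switch_time T (Suc m) z \<le> ennreal t" .
    with a leD show False by blast
   qed
  qed (use a in simp)
 qed
 have p: "proper (\<lambda>k. Hh m k z)" by (rule goodD(3)[OF g])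
 have fin': "switch_time T m z < \<top>" if "switch_time T m z \<le> ennreal t" using that by (simp add: le_less_trans)
 have sc: "shock_count Hh m x z = n \<longleftrightarrow> Sh m n z \<le> x \<and> x < Sh m (Suc n) z" if "0 \<le> x" for x
  using proper_count_eq[OF p that, of n] unfolding shock_count_eq_Max Sh_def .
 show ?thesis
 proof (cases "switch_count T t z = m")
  case True
  then have a: "switch_time T m z \<le> ennreal t" "ennreal t < switch_time T (Suc m) z" using cnt by auto
  have e: "elapsed T t z = t - clock m z" using True by (simp add: elapsed_def clock_def)
  have ct: "clock m z \<le> t" using clock_le[OF fin'[OF a(1)] t] a by simp
  show ?thesis
   using True sc[of "t - clock m z"] ct fin'[OF a(1)] a(2) less_switch_time_Suc[OF fin'[OF a(1)] ct]
   unfolding inside_def e arr_def by auto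
 next
  case False
  have "\<not> inside m n t z"
  proof
   assume ins: "inside m n t z"
   then have f: "switch_time T m z < \<top>" and ct: "clock m z \<le> t"
    using Sh_nonneg[OF g, of m n] by (auto simp: inside_def arr_def)
   then have "switch_count T t z = m"
    using ins clock_le[OF f t] less_switch_time_Suc[OF f ct] unfolding cnt by (auto simp: inside_def)
   with False show False by simp
  qed
  with False show ?thesis by simp
 qed
qed

lemma process_inside:
 assumes g: "good z" and t: "0 \<le> t" and ins: "inside m n t z"
 shows "X t z = pos m n z + d m n * (t - arr m n z)"
proof -
 have m: "switch_count T t z = m" using ins inside_iff[OF g t] by simp
 have e: "elapsed T t z = t - clock m z" using m by (simp add: elapsed_def clock_def)
 have x: "Sh m n z \<le> t - clock m z" "t - clock m z < Sh m (Suc n) z" using ins by (auto simp: inside_def arr_def)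
 have "X t z = process i c Hh T r R t z"
  by (rule process_cong) (rule goodD(2)[OF g, symmetric])
 also have "\<dots> = base m z + (phase_drift i c Hh m (t - clock m z) z + phase_jumps Hh r m (t - clock m z) z)"
  unfolding process_def linear_part_def jump_part_def m e base_def
  by (simp add: sum.atLeast1_atMost_eq sum.distrib)
 also have "\<dots> = pos m n z + d m n * (t - arr m n z)"
  unfolding phase_values[OF g x] pos_def by (simp add: arr_def sum.distrib)
 finally show ?thesis .
qed

text \<open>
 A sojourn is ended by exactly one of the two possible events, because no shock coincides with a switching.
\<close>

lemma stay_or_go:
 assumes g: "good z" and v: "0 \<le> v"
 shows "v < Hh m n z \<and> ennreal (Sh m n z + v) < T (Suc m) z \<longleftrightarrow>
  z \<in> alive m (Suc n) \<and> v < Hh m n z \<or> z \<in> switchset m n \<and> v < age m n z"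
proof -
 have S0: "0 \<le> Sh m n z" "0 \<le> Sh m (Suc n) z" using Sh_nonneg[OF g] by auto
 have sp: "z \<in> space P" using g by (simp add: good_def)
 have H: "0 < Hh m n z" by (rule Hh_pos[OF g])
 have nt: "T (Suc m) z \<noteq> ennreal (Sh m (Suc n) z)" by (rule goodD(5)[OF g])
 show ?thesis
 proof (cases "T (Suc m) z")
  case (real x)
  have le: "ennreal y < T (Suc m) z \<longleftrightarrow> y < x" if "0 \<le> y" for y
   unfolding real(2) by (rule ennreal_less_iff[OF that])
  have gr: "T (Suc m) z < ennreal y \<longleftrightarrow> x < y" for y
   unfolding real(2) by (rule ennreal_less_iff[OF real(1)])
  have "x \<noteq> Sh m (Suc n) z" using nt real by auto
  moreover have "z \<in> alive m (Suc n) \<longleftrightarrow> Sh m (Suc n) z < x" using le[OF S0(2)] sp by (simp add: alive_def)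
  moreover have "z \<in> switchset m n \<longleftrightarrow> Sh m n z < x \<and> x < Sh m (Suc n) z" using le[OF S0(1)] gr sp by (simp add: switchset_def)
  moreover have "age m n z = x - Sh m n z" using real by (simp add: age_def)
  moreover have "ennreal (Sh m n z + v) < T (Suc m) z \<longleftrightarrow> Sh m n z + v < x" using S0 v by (intro le) simp
  ultimately show ?thesis using S0 v H Sh_Suc[of m n z] by auto
 next
  case top
  then show ?thesis using sp v H by (auto simp: alive_def switchset_def)
 qed
qed

lemma alive_switch_disjoint: "z \<in> alive m (Suc n) \<Longrightarrow> z \<in> switchset m n \<Longrightarrow> False"
 by (auto simp: alive_def switchset_def)

lemma inside_alive:
 assumes g: "good z"
 shows "inside m n t z \<longleftrightarrow> switch_time T m z < \<top> \<and> arr m n z \<le> t \<and>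
  t - arr m n z < Hh m n z \<and> ennreal (Sh m n z + (t - arr m n z)) < T (Suc m) z"
proof -
 have eq: "Sh m n z + (t - arr m n z) = t - clock m z" by (simp add: arr_def)
 show ?thesis unfolding inside_def arr_Suc eq by auto
qed

lemma inside_arrival:
 assumes g: "good z"
 shows "inside m n (arr m n z) z \<longleftrightarrow> switch_time T m z < \<top> \<and> z \<in> alive m n"
 using goodD(1)[OF g] Hh_pos[OF g, of m n] unfolding inside_alive[OF g] by (auto simp: alive_def)

lemma after_switch:
 assumes g: "good z" and f: "switch_time T m z < \<top>" and s: "z \<in> switchset m n"
 shows "clock (Suc m) z = arr m n z + age m n z" and "inside (Suc m) 0 (clock (Suc m) z) z"
  and "pos (Suc m) 0 z = pos m n z + d m n * age m n z + R m n z" and "0 < age m n z"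
proof -
 have T: "T (Suc m) z < \<top>" using s by (auto simp: switchset_def intro: less_trans)
 then obtain x where x: "T (Suc m) z = ennreal x" "0 \<le> x" by (cases "T (Suc m) z") auto
 have xS: "Sh m n z < x" "x < Sh m (Suc n) z"
  using s x Sh_nonneg[OF g] by (auto simp: switchset_def ennreal_less_iff)
 show "clock (Suc m) z = arr m n z + age m n z"
  unfolding clock_Suc[OF f T] by (simp add: arr_def age_def)
 show "0 < age m n z" using xS x by (simp add: age_def)
 have "z \<in> alive (Suc m) 0" using goodD(1,4)[OF g] by (simp add: alive_def)
 then show "inside (Suc m) 0 (clock (Suc m) z) z"
  using inside_arrival[OF g, of "Suc m" 0] clock_Suc[OF f T] by (simp add: arr_def)
 show "pos (Suc m) 0 z = pos m n z + d m n * age m n z + R m n z"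
  using phase_values[OF g, of m n x] xS x
  by (simp add: pos_def base_def age_def sum.distrib)
qed

lemma next_event:
 assumes g: "good z" and ins: "inside m n s z" and st: "s \<le> t"
 shows "\<not> inside m n t z \<longleftrightarrow> z \<in> alive m (Suc n) \<and> arr m (Suc n) z \<le> t \<or> z \<in> switchset m n \<and> clock (Suc m) z \<le> t"
proof -
 have f: "switch_time T m z < \<top>" and a: "arr m n z \<le> s" using ins by (auto simp: inside_def)
 have 1: "z \<in> alive m (Suc n) \<or> z \<in> switchset m n"
  using ins stay_or_go[OF g, of "s - arr m n z" m n] a unfolding inside_alive[OF g] by auto
 have 2: "inside m n t z \<longleftrightarrow> z \<in> alive m (Suc n) \<and> t < arr m (Suc n) z \<or> z \<in> switchset m n \<and> t < clock (Suc m) z"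
  using f a st stay_or_go[OF g, of "t - arr m n z" m n] after_switch(1)[OF g f, of n]
  unfolding inside_alive[OF g] arr_Suc by auto
 show ?thesis using 1 2 alive_switch_disjoint[of z m n] by (auto simp: not_le not_less)
qed

text \<open>
 The indicator of exactly \<open>j\<close> further events up to time \<open>t\<close> after the arrival in the
 cell \<open>(m, n)\<close>, in the recursive form that matches the recursion of the kernel.
\<close>

primrec cnt :: "real \<Rightarrow> nat \<Rightarrow> nat \<Rightarrow> nat \<Rightarrow> 'a \<Rightarrow> ennreal" where
 "cnt t 0 m n z = (if inside m n t z then 1 else 0)"
| "cnt t (Suc j) m n z = (if z \<in> alive m (Suc n) \<and> arr m (Suc n) z \<le> t then cnt t j m (Suc n) z else 0)
   + (if z \<in> switchset m n \<and> clock (Suc m) z \<le> t then cnt t j (Suc m) 0 z else 0)"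

text \<open>
 After a time in a cell only finitely many events can precede \<open>t\<close>: each one increases the number
 of the phase or the number of shocks, and both are bounded on a good path.
\<close>

lemma cnt_total:
 assumes g: "good z" and "inside m n s z" and "s \<le> t"
 shows "(\<Sum>j. cnt t j m n z) = 1"
proof -
 have "\<exists>M. t < clock M z \<or> switch_time T M z = \<top>"
 proof -
  obtain M where "ennreal t < switch_time T M z" using goodD(6)[OF g] by blast
  then show ?thesis unfolding clock_def by (cases "switch_time T M z") (auto simp: ennreal_less_iff intro!: exI[of _ M] dest: ennreal_lessI[rotated] elim: contrapos_np)
 qed
 then obtain M where M: "t < clock M z \<or> switch_time T M z = \<top>" by blast
 have "\<exists>k. \<forall>m. t < Sh m (k m) z"
  unfolding Sh_def by (rule choice) (use goodD(3)[OF g] in \<open>auto simp: proper_def\<close>)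
 then obtain k where k: "\<And>m. t < Sh m (k m) z" by blast
 have reach: "m < M \<and> n < k m" if "inside m n s z" "s \<le> t" for m n s
 proof -
  have f: "switch_time T m z < \<top>" and a: "arr m n z \<le> t" using that by (auto simp: inside_def)
  have "m < M"
  proof (rule ccontr)
   assume "\<not> m < M"
   then have le: "switch_time T M z \<le> switch_time T m z" by (intro switch_time_mono) simp
   then have "switch_time T M z < \<top>" using f by (rule le_less_trans)
   moreover have "clock M z \<le> clock m z" unfolding clock_def using le f by (intro enn2real_mono) auto
   ultimately show False using M a Sh_nonneg[OF g, of m n] by (auto simp: arr_def)
  qed
  moreover have "n < k m"
  proof (rule ccontr)
   assume "\<not> n < k m"
   then have "Sh m (k m) z \<le> Sh m n z"
    unfolding Sh_def using goodD(3)[OF g] \<open>\<not> n < k m\<close> by (intro proper_mono) auto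
   then show False using k[of m] a clock_nonneg[of m z] by (auto simp: arr_def)
  qed
  ultimately show ?thesis ..
 qed
 have "\<forall>m n s. p = (M - m, k m - n) \<longrightarrow> inside m n s z \<longrightarrow> s \<le> t \<longrightarrow> (\<Sum>j. cnt t j m n z) = 1" for p
 proof (induction p rule: wf_induct_rule[OF wf_lex_prod[OF wf_less_than wf_less_than]])
  case (1 p)
  show ?case
  proof (intro allI impI)
   fix m n s assume p: "p = (M - m, k m - n)" and ins: "inside m n s z" and st: "s \<le> t"
   have f: "switch_time T m z < \<top>" using ins by (simp add: inside_def)
   have r: "m < M" "n < k m" using reach[OF ins st] by auto
   have sum: "(\<Sum>j. cnt t j m n z) = cnt t 0 m n z + (\<Sum>j. cnt t (Suc j) m n z)"
    using suminf_offset[of "\<lambda>j. cnt t j m n z" 1] by simp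
   consider "inside m n t z" | "z \<in> alive m (Suc n)" "arr m (Suc n) z \<le> t" | "z \<in> switchset m n" "clock (Suc m) z \<le> t"
    using next_event[OF g ins st] by blast
   then show "(\<Sum>j. cnt t j m n z) = 1"
   proof cases
    case 1
    then show ?thesis using next_event[OF g ins st] unfolding sum by (simp add: if_not_P)
   next
    case 2
    have "\<not> inside m n t z" using 2 next_event[OF g ins st] by blast
    moreover have "z \<notin> switchset m n" using 2 alive_switch_disjoint by blast
    moreover have "(\<Sum>j. cnt t j m (Suc n) z) = 1"
     using 1[rule_format, of "(M - m, k m - Suc n)" m "Suc n" "arr m (Suc n) z"] p r inside_arrival[OF g, of m "Suc n"] f 2 by auto
    ultimately show ?thesis using 2 unfolding sum by simp
   next
    case 3
    have "\<not> inside m n t z" using 3 next_event[OF g ins st] by blast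
    moreover have "z \<notin> alive m (Suc n)" using 3 alive_switch_disjoint by blast
    moreover have "(\<Sum>j. cnt t j (Suc m) 0 z) = 1"
     using 1[rule_format, of "(M - Suc m, k (Suc m) - 0)" "Suc m" 0 "clock (Suc m) z"] p r diff_less_mono2[of m "Suc m" M] after_switch(2)[OF g f 3(1)] 3 by auto
    ultimately show ?thesis using 3 unfolding sum by simp
   qed
  qed
 qed
 then show ?thesis using assms by blast
qed

end

context switching_process
begin

section \<open>The law of the path after an arrival\<close>

lemma switch_time_G [measurable]: "switch_time T m \<in> borel_measurable (G m n)"
proof (rule measurable_switch_time)
 fix k assume "1 \<le> k" "k \<le> m"
 then show "T k \<in> borel_measurable (G m n)" using T_G[of "k - 1" m n] by simp
qed

lemma clock_G [measurable]: "clock m \<in> borel_measurable (G m n)"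
 unfolding clock_def[abs_def] by measurable

lemma Sh_G [measurable]: "Sh m n \<in> borel_measurable (G m n)"
 unfolding Sh_def[abs_def] by (intro borel_measurable_sum Hh_G) simp

lemma arr_G [measurable]: "arr m n \<in> borel_measurable (G m n)"
 unfolding arr_def[abs_def] by measurable

lemma base_G [measurable]: "base m \<in> borel_measurable (G m n)"
 unfolding base_def[abs_def]
proof (rule borel_measurable_sum)
 fix k assume "k \<in> {..<m}"
 then have k: "k < m" by simp
 have e: "(\<lambda>z. enn2real (T (Suc k) z)) \<in> borel_measurable (G m n)" using T_G[OF k] by measurable
 have h: "Hh k j \<in> borel_measurable (G m n)" "r k j \<in> borel_measurable (G m n)" "R k j \<in> borel_measurable (G m n)" for j
  using k by (auto intro: Hh_G_old r_G R_G)
 have "(\<lambda>z. R k (shock_count Hh k (enn2real (T (Suc k) z)) z) z) \<in> borel_measurable (G m n)"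
  by (rule measurable_compose_countable[OF _ measurable_shock_count[where H = Hh and m = k, OF h(1) e]]) (rule h)
 then show "(\<lambda>z. phase_drift i c Hh k (enn2real (T (Suc k) z)) z
   + (R k (shock_count Hh k (enn2real (T (Suc k) z)) z) z + phase_jumps Hh r k (enn2real (T (Suc k) z)) z)) \<in> borel_measurable (G m n)"
  using measurable_phase_drift[of Hh k, OF h(1) e] measurable_phase_jumps[of Hh k _ r, OF h(1) h(2) e]
  by (intro borel_measurable_add) auto
qed

lemma pos_G [measurable]: "pos m n \<in> borel_measurable (G m n)"
proof -
 have "(\<lambda>z. \<Sum>k<n. d m k * Hh m k z + r m k z) \<in> borel_measurable (G m n)"
  by (intro borel_measurable_sum borel_measurable_add borel_measurable_times borel_measurable_const Hh_G r_G) auto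
 then show ?thesis unfolding pos_def[abs_def] by measurable
qed

lemma G_P: "f \<in> borel_measurable (G m n) \<Longrightarrow> f \<in> borel_measurable P"
 by (rule measurable_sub[of f "G m n" borel P]) (simp_all add: G_sub)

lemma P_measurable [measurable]:
 "switch_time T m \<in> borel_measurable P" "clock m \<in> borel_measurable P" "arr m n \<in> borel_measurable P" "pos m n \<in> borel_measurable P"
 by (rule G_P[OF switch_time_G[of _ 0]], rule G_P[OF clock_G[of _ 0]], rule G_P[OF arr_G], rule G_P[OF pos_G])

lemma inside_measurable [measurable]:
 assumes [measurable]: "f \<in> borel_measurable P"
 shows "Measurable.pred P (\<lambda>z. inside m n (f z) z)"
 unfolding inside_def by measurable

lemma cnt_measurable [measurable]: "cnt t j m n \<in> borel_measurable P"
proof (induction j arbitrary: m n)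
 case (Suc j)
 have [measurable]: "cnt t j m (Suc n) \<in> borel_measurable P" "cnt t j (Suc m) 0 \<in> borel_measurable P" by (rule Suc)+
 show ?case unfolding cnt.simps[abs_def] by measurable
qed (simp add: cnt.simps[abs_def])

lemma X_measurable [measurable]: "X t \<in> borel_measurable P"
 by (rule input.process_measurable)

lemma prob_Dr: "prob_space (Dr (eps i m) n)" and prob_DR: "prob_space (DR (eps i m) n)"
 using K.Dr_prob[of "i + m" n] K.DR_prob[of "i + m" n] by (simp_all add: eps_def)

lemma sets_Dr_eps [measurable_cong]: "sets (Dr (eps i m) n) = sets borel" and sets_DR_eps [measurable_cong]: "sets (DR (eps i m) n) = sets borel"
 using K.sets_Dr[of "i + m" n] K.sets_DR[of "i + m" n] by (simp_all add: eps_def)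

text \<open>
 The survival of the cell up to a time known on arrival, as the sum of the laws of the two events that can end
 the cell later.
\<close>

lemma stay_law:
 assumes F [measurable]: "F \<in> borel_measurable (G m n)" and v [measurable]: "v \<in> borel_measurable (G m n)"
  and nn: "\<And>z. F z \<noteq> 0 \<Longrightarrow> 0 \<le> v z"
 shows "(\<integral>\<^sup>+z. F z * (if v z < Hh m n z \<and> ennreal (Sh m n z + v z) < T (Suc m) z then 1 else 0) \<partial>P)
  = (\<integral>\<^sup>+z. F z * (indicator (alive m n) z * ennreal (exp (- (th m n * v z)))) \<partial>P)"
proof -
 interpret D: prob_space "Dr (eps i m) n" by (rule prob_Dr)
 interpret E: prob_space "DR (eps i m) n" by (rule prob_DR)
 have [measurable]: "F \<in> borel_measurable P" "v \<in> borel_measurable P" by (rule G_P[OF F], rule G_P[OF v])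
 define \<Phi> where "\<Phi> z w y = F z * (if v z < w then 1 else 0)" for z w and y :: real
 have \<Phi>m: "(\<lambda>p. \<Phi> (fst p) (fst (snd p)) (snd (snd p))) \<in> borel_measurable (G m n \<Otimes>\<^sub>M (borel \<Otimes>\<^sub>M borel))"
  unfolding \<Phi>_def by measurable
 have pos: "0 < l m n" "0 < b m n" "0 < th m n" using l_pos[of m n] b_pos[of m n] by auto
 have inner: "(\<integral>\<^sup>+w. F z * (if v z < w then 1 else 0) \<partial>rateK a (th m n)) = F z * emeasure (rateK a (th m n)) {v z<..}" for z a
 proof -
  have "(\<integral>\<^sup>+w. F z * (if v z < w then 1 else 0) \<partial>rateK a (th m n)) = (\<integral>\<^sup>+w. F z * indicator {v z<..} w \<partial>rateK a (th m n))"
   by (intro nn_integral_cong) (auto simp: indicator_def)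
  also have "\<dots> = F z * emeasure (rateK a (th m n)) {v z<..}" by (rule nn_integral_cmult_indicator) simp
  finally show ?thesis .
 qed
 have tail: "emeasure (rateK (l m n) (th m n)) {x<..} + emeasure (rateK (b m n) (th m n)) {x<..} = ennreal (exp (- (th m n * x)))" if x: "0 \<le> x" for x
 proof -
  have 1: "emeasure (rateK (l m n) (th m n)) {x<..} = ennreal (l m n / th m n * exp (- (th m n * x)))"
   using emeasure_rateK_tail[of "l m n" "th m n" x] emeasure_Ex_tail[OF pos(1) less_imp_le[OF pos(2)] x] pos by (simp add: add.commute)
  have 2: "emeasure (rateK (b m n) (th m n)) {x<..} = ennreal (b m n / th m n * exp (- (th m n * x)))"
   using emeasure_rateK_tail[of "b m n" "th m n" x] emeasure_Ex_tail[OF pos(2) less_imp_le[OF pos(1)] x] pos by (simp add: add.commute)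
  have "l m n / th m n * exp (- (th m n * x)) + b m n / th m n * exp (- (th m n * x)) = exp (- (th m n * x))"
   using pos by (simp add: distrib_right[symmetric] add_divide_distrib[symmetric])
  then show ?thesis unfolding 1 2 using pos by (subst ennreal_plus[symmetric]) auto
 qed
 have "(\<integral>\<^sup>+z. F z * (if v z < Hh m n z \<and> ennreal (Sh m n z + v z) < T (Suc m) z then 1 else 0) \<partial>P)
   = (\<integral>\<^sup>+z. indicator (alive m (Suc n)) z * \<Phi> z (Hh m n z) (r m n z) + indicator (switchset m n) z * \<Phi> z (age m n z) (R m n z) \<partial>P)"
 proof (rule nn_integral_cong_AE)
  show "AE z in P. F z * (if v z < Hh m n z \<and> ennreal (Sh m n z + v z) < T (Suc m) z then 1 else 0)
    = indicator (alive m (Suc n)) z * \<Phi> z (Hh m n z) (r m n z) + indicator (switchset m n) z * \<Phi> z (age m n z) (R m n z)"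
   using AE_good
  proof eventually_elim
   case (elim z)
   show ?case
   proof (cases "F z = 0")
    case False
    from stay_or_go[OF elim nn[OF this], of m n] alive_switch_disjoint[of z m n]
    show ?thesis by (auto simp: \<Phi>_def indicator_def)
   qed (simp add: \<Phi>_def)
  qed
 qed
 also have "\<dots> = (\<integral>\<^sup>+z. indicator (alive m (Suc n)) z * \<Phi> z (Hh m n z) (r m n z) \<partial>P) + (\<integral>\<^sup>+z. indicator (switchset m n) z * \<Phi> z (age m n z) (R m n z) \<partial>P)"
  unfolding \<Phi>_def by (rule nn_integral_add) measurable
 also have "\<dots> = (\<integral>\<^sup>+z. indicator (alive m n) z * (F z * emeasure (rateK (l m n) (th m n)) {v z<..}) \<partial>P)
   + (\<integral>\<^sup>+z. indicator (alive m n) z * (F z * emeasure (rateK (b m n) (th m n)) {v z<..}) \<partial>P)"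
  unfolding shock_law[OF \<Phi>m] switch_law[OF \<Phi>m] unfolding \<Phi>_def inner[symmetric]
  by (simp add: D.emeasure_space_1 E.emeasure_space_1)
 also have "\<dots> = (\<integral>\<^sup>+z. indicator (alive m n) z * (F z * emeasure (rateK (l m n) (th m n)) {v z<..})
   + indicator (alive m n) z * (F z * emeasure (rateK (b m n) (th m n)) {v z<..}) \<partial>P)"
 proof (rule nn_integral_add[symmetric])
  have [measurable]: "(\<lambda>w. emeasure (rateK a (th m n)) {w<..}) \<in> borel_measurable borel" for a
   unfolding emeasure_rateK indicator_def greaterThan_iff by measurable
  show "(\<lambda>z. indicator (alive m n) z * (F z * emeasure (rateK (l m n) (th m n)) {v z<..})) \<in> borel_measurable P"
   "(\<lambda>z. indicator (alive m n) z * (F z * emeasure (rateK (b m n) (th m n)) {v z<..})) \<in> borel_measurable P"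
   by measurable
 qed
 also have "\<dots> = (\<integral>\<^sup>+z. F z * (indicator (alive m n) z * ennreal (exp (- (th m n * v z)))) \<partial>P)"
 proof (intro nn_integral_cong)
  fix z
  show "indicator (alive m n) z * (F z * emeasure (rateK (l m n) (th m n)) {v z<..})
   + indicator (alive m n) z * (F z * emeasure (rateK (b m n) (th m n)) {v z<..}) = F z * (indicator (alive m n) z * ennreal (exp (- (th m n * v z))))"
  proof (cases "F z = 0")
   case False
   show ?thesis unfolding tail[OF nn[OF False], symmetric] by (simp only: distrib_left mult_ac)
  qed simp
 qed
 finally show ?thesis .
qed

text \<open>
 The kernel forgets the time \<open>v\<close> already spent in the cell, up to the survival factor.
\<close>

lemma U_restart:
 assumes [measurable]: "\<phi> \<in> borel_measurable borel" and v: "0 \<le> v"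
 shows "(\<integral>\<^sup>+w. (\<integral>\<^sup>+y. (if v < w \<and> w \<le> v + u then K.U j \<phi> (i + m) (Suc n) (x + d m n * (w - v) + y) (v + u - w) else 0) \<partial>Dr (eps i m) n) \<partial>rateK (l m n) (th m n))
   + (\<integral>\<^sup>+w. (\<integral>\<^sup>+y. (if v < w \<and> w \<le> v + u then K.U j \<phi> (Suc (i + m)) 0 (x + d m n * (w - v) + y) (v + u - w) else 0) \<partial>DR (eps i m) n) \<partial>rateK (b m n) (th m n))
   = ennreal (exp (- (th m n * v))) * K.U (Suc j) \<phi> (i + m) n x u"
proof -
 interpret D: prob_space "Dr (eps i m) n" by (rule prob_Dr)
 interpret E: prob_space "DR (eps i m) n" by (rule prob_DR)
 define f where "f w = (\<integral>\<^sup>+y. K.U j \<phi> (i + m) (Suc n) (x + d m n * w + y) (u - w) \<partial>Dr (eps i m) n)" for w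
 define h where "h w = (\<integral>\<^sup>+y. K.U j \<phi> (Suc (i + m)) 0 (x + d m n * w + y) (u - w) \<partial>DR (eps i m) n)" for w
 have fm [measurable]: "f \<in> borel_measurable borel" unfolding f_def[abs_def] by measurable
 have hm [measurable]: "h \<in> borel_measurable borel" unfolding h_def[abs_def] by measurable
 have shift: "v + u - w = u - (w - v)" for w by simp
 have 1: "(\<integral>\<^sup>+y. (if v < w \<and> w \<le> v + u then K.U j \<phi> (i + m) (Suc n) (x + d m n * (w - v) + y) (v + u - w) else 0) \<partial>Dr (eps i m) n) = indicator {v<..v + u} w * f (w - v)" for w
  unfolding f_def shift by (cases "v < w \<and> w \<le> v + u") auto
 have 2: "(\<integral>\<^sup>+y. (if v < w \<and> w \<le> v + u then K.U j \<phi> (Suc (i + m)) 0 (x + d m n * (w - v) + y) (v + u - w) else 0) \<partial>DR (eps i m) n) = indicator {v<..v + u} w * h (w - v)" for w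
  unfolding h_def shift by (cases "v < w \<and> w \<le> v + u") auto
 have "(\<integral>\<^sup>+w. indicator {v<..v + u} w * f (w - v) \<partial>rateK (l m n) (th m n)) + (\<integral>\<^sup>+w. indicator {v<..v + u} w * h (w - v) \<partial>rateK (b m n) (th m n))
   = (\<integral>\<^sup>+w. indicator {0<..} w * ennreal (l m n * exp (- (th m n * w))) * (indicator {v<..v + u} w * f (w - v))
     + indicator {0<..} w * ennreal (b m n * exp (- (th m n * w))) * (indicator {v<..v + u} w * h (w - v)) \<partial>lborel)"
  by (subst (1 2) nn_integral_rateK) (measurable, rule nn_integral_add[symmetric], measurable)
 also have "\<dots> = (\<integral>\<^sup>+w. indicator {0<..} (v + w) * ennreal (l m n * exp (- (th m n * (v + w)))) * (indicator {v<..v + u} (v + w) * f (v + w - v))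
     + indicator {0<..} (v + w) * ennreal (b m n * exp (- (th m n * (v + w)))) * (indicator {v<..v + u} (v + w) * h (v + w - v)) \<partial>lborel)"
  by (rule nn_integral_shift) measurable
 also have "\<dots> = (\<integral>\<^sup>+w. ennreal (exp (- (th m n * v))) * (indicator {0<..u} w * ennreal (exp (- (th m n * w))) * (ennreal (l m n) * f w + ennreal (b m n) * h w)) \<partial>lborel)"
 proof (intro nn_integral_cong)
  fix w
  have e: "ennreal (a * exp (- (th m n * (v + w)))) = ennreal (exp (- (th m n * v))) * (ennreal (exp (- (th m n * w))) * ennreal a)" if "0 < a" for a
   using that by (simp add: ennreal_mult[symmetric] exp_add[symmetric] algebra_simps)
  have e': "ennreal (l m n * exp (- (th m n * (v + w)))) = ennreal (exp (- (th m n * v))) * (ennreal (exp (- (th m n * w))) * ennreal (l m n))"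
   "ennreal (b m n * exp (- (th m n * (v + w)))) = ennreal (exp (- (th m n * v))) * (ennreal (exp (- (th m n * w))) * ennreal (b m n))"
   by (rule e[OF l_pos], rule e[OF b_pos])
  show "indicator {0<..} (v + w) * ennreal (l m n * exp (- (th m n * (v + w)))) * (indicator {v<..v + u} (v + w) * f (v + w - v))
     + indicator {0<..} (v + w) * ennreal (b m n * exp (- (th m n * (v + w)))) * (indicator {v<..v + u} (v + w) * h (v + w - v))
    = ennreal (exp (- (th m n * v))) * (indicator {0<..u} w * ennreal (exp (- (th m n * w))) * (ennreal (l m n) * f w + ennreal (b m n) * h w))"
  proof (cases "0 < w \<and> w \<le> u")
   case True
   then have "indicator {0<..} (v + w) = (1::ennreal)" "indicator {v<..v + u} (v + w) = (1::ennreal)" "indicator {0<..u} w = (1::ennreal)" using v by auto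
   moreover have "v + w - v = w" by simp
   ultimately show ?thesis unfolding e' by (simp only: mult_1_left mult_1_right distrib_left mult_ac)
  next
   case False
   then have "indicator {v<..v + u} (v + w) = (0::ennreal)" "indicator {0<..u} w = (0::ennreal)" using v by auto
   then show ?thesis by simp
  qed
 qed
 also have "\<dots> = ennreal (exp (- (th m n * v))) * (\<integral>\<^sup>+w. indicator {0<..u} w * ennreal (exp (- (th m n * w))) * (ennreal (l m n) * f w + ennreal (b m n) * h w) \<partial>lborel)"
  by (rule nn_integral_cmult) measurable
 also have "(\<integral>\<^sup>+w. indicator {0<..u} w * ennreal (exp (- (th m n * w))) * (ennreal (l m n) * f w + ennreal (b m n) * h w) \<partial>lborel) = K.U (Suc j) \<phi> (i + m) n x u"
  unfolding f_def h_def K.U.simps by (simp add: eps_def)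
 finally show ?thesis unfolding 1 2 .
qed

end

section \<open>The Markov property\<close>

context switching_process
begin

text \<open>
 \<open>gate\<close> restricts to paths in the cell at time \<open>s\<close>; \<open>win\<close> is the part
 of this restriction that is known on arrival in the cell when \<open>s\<close> is.
\<close>

definition gate :: "nat \<Rightarrow> nat \<Rightarrow> real \<Rightarrow> real \<Rightarrow> 'a \<Rightarrow> ennreal" where
 "gate m n s t z = (if inside m n s z \<and> s \<le> t then 1 else 0)"

definition win :: "nat \<Rightarrow> nat \<Rightarrow> real \<Rightarrow> real \<Rightarrow> 'a \<Rightarrow> ennreal" where
 "win m n s t z = (if switch_time T m z < \<top> \<and> arr m n z \<le> s \<and> s \<le> t then 1 else 0)"

lemma gate_measurable [measurable]:
 assumes [measurable]: "f \<in> borel_measurable P"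
 shows "(\<lambda>z. gate m n (f z) t z) \<in> borel_measurable P"
 unfolding gate_def by measurable

lemma win_measurable [measurable]:
 assumes [measurable]: "f \<in> borel_measurable (G m n)"
 shows "(\<lambda>z. win m n (f z) t z) \<in> borel_measurable (G m n)"
 unfolding win_def by measurable

lemma G_S: "f \<in> borel_measurable (G m n) \<Longrightarrow> f \<in> borel_measurable (G m (Suc n))"
 by (rule measurable_sub[of f "G m n"]) (simp_all add: G_shock)

lemma G_W: "f \<in> borel_measurable (G m n) \<Longrightarrow> f \<in> borel_measurable (G (Suc m) 0)"
 by (rule measurable_sub[of f "G m n"]) (simp_all add: G_switch)

lemma gate_eq:
 assumes g: "good z"
 shows "gate m n s t z = win m n s t z * (if s - arr m n z < Hh m n z \<and> ennreal (Sh m n z + (s - arr m n z)) < T (Suc m) z then 1 else 0)"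
 unfolding gate_def win_def inside_alive[OF g] by auto

lemma gate_stay:
 assumes s [measurable]: "s \<in> borel_measurable (G m n)" and Y [measurable]: "Y \<in> borel_measurable (G m n)"
 shows "(\<integral>\<^sup>+z. gate m n (s z) t z * Y z \<partial>P)
  = (\<integral>\<^sup>+z. win m n (s z) t z * Y z * (indicator (alive m n) z * ennreal (exp (- (th m n * (s z - arr m n z))))) \<partial>P)"
proof -
 have "(\<integral>\<^sup>+z. gate m n (s z) t z * Y z \<partial>P) = (\<integral>\<^sup>+z. win m n (s z) t z * Y z *
   (if s z - arr m n z < Hh m n z \<and> ennreal (Sh m n z + (s z - arr m n z)) < T (Suc m) z then 1 else 0) \<partial>P)"
  by (rule nn_integral_cong_AE) (use AE_good in eventually_elim, simp add: gate_eq)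
 also have "\<dots> = (\<integral>\<^sup>+z. win m n (s z) t z * Y z * (indicator (alive m n) z * ennreal (exp (- (th m n * (s z - arr m n z))))) \<partial>P)"
  by (rule stay_law) (measurable, auto simp: win_def split: if_splits)
 finally show ?thesis .
qed

lemma U_0: "K.U 0 \<phi> (i + m) n x u = ennreal (exp (- (th m n * u))) * \<phi> (x + d m n * u)"
 by (simp add: eps_def)

text \<open>
 The strong form with a random time \<open>s\<close> is what the induction on the number \<open>j\<close> of
 events needs: it is applied again at the arrival in the next cell, where \<open>F\<close> collects the
 information about the event that led there. \<open>Z\<close> allows the position at time \<open>s\<close> to
 be subtracted later.
\<close>

lemma restart_law:
 assumes \<phi> [measurable]: "\<phi> \<in> borel_measurable borel" and t: "0 \<le> t"
 shows "F \<in> borel_measurable (G m n) \<Longrightarrow> s \<in> borel_measurable (G m n) \<Longrightarrow> Z \<in> borel_measurable (G m n) \<Longrightarrow>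
  (\<integral>\<^sup>+z. F z * (gate m n (s z) t z * (cnt t j m n z * \<phi> (Z z + X t z))) \<partial>P)
  = (\<integral>\<^sup>+z. gate m n (s z) t z * (F z * K.U j \<phi> (i + m) n (Z z + pos m n z + d m n * (s z - arr m n z)) (t - s z)) \<partial>P)"
proof (induction j arbitrary: m n F s Z)
 case 0
 note [measurable] = 0
 have "(\<integral>\<^sup>+z. F z * (gate m n (s z) t z * (cnt t 0 m n z * \<phi> (Z z + X t z))) \<partial>P)
  = (\<integral>\<^sup>+z. win m n (s z) t z * (F z * \<phi> (Z z + pos m n z + d m n * (t - arr m n z))) *
    (if t - arr m n z < Hh m n z \<and> ennreal (Sh m n z + (t - arr m n z)) < T (Suc m) z then 1 else 0) \<partial>P)"
 proof (rule nn_integral_cong_AE)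
  show "AE z in P. F z * (gate m n (s z) t z * (cnt t 0 m n z * \<phi> (Z z + X t z)))
   = win m n (s z) t z * (F z * \<phi> (Z z + pos m n z + d m n * (t - arr m n z))) *
    (if t - arr m n z < Hh m n z \<and> ennreal (Sh m n z + (t - arr m n z)) < T (Suc m) z then 1 else 0)"
   using AE_good
  proof eventually_elim
   case (elim z)
   show ?case
   proof (cases "switch_time T m z < \<top> \<and> arr m n z \<le> s z \<and> s z \<le> t")
    case True
    then have "win m n (s z) t z = 1" by (simp add: win_def)
    show ?thesis
    proof (cases "t - arr m n z < Hh m n z \<and> ennreal (Sh m n z + (t - arr m n z)) < T (Suc m) z")
     case in_t: True
     have ins: "inside m n t z" using True in_t by (simp add: inside_alive[OF elim])
     have "ennreal (Sh m n z + (s z - arr m n z)) \<le> ennreal (Sh m n z + (t - arr m n z))"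
      using True by (intro ennreal_leI) simp
     then have "ennreal (Sh m n z + (s z - arr m n z)) < T (Suc m) z" using in_t by (auto intro: le_less_trans)
     then have "inside m n (s z) z" using True in_t by (simp add: inside_alive[OF elim])
     then show ?thesis using True in_t ins process_inside[OF elim t ins] by (simp add: gate_def win_def add.assoc)
    next
     case False
     then have "\<not> inside m n t z" by (simp add: inside_alive[OF elim])
     with False show ?thesis by auto
    qed
   next
    case False
    then have "\<not> (inside m n (s z) z \<and> s z \<le> t)" by (auto simp: inside_def)
    with False show ?thesis by (auto simp: gate_def win_def)
   qed
  qed
 qed
 also have "\<dots> = (\<integral>\<^sup>+z. win m n (s z) t z * (F z * \<phi> (Z z + pos m n z + d m n * (t - arr m n z))) * (indicator (alive m n) z * ennreal (exp (- (th m n * (t - arr m n z))))) \<partial>P)"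
  by (rule stay_law) (measurable, auto simp: win_def split: if_splits)
 also have "\<dots> = (\<integral>\<^sup>+z. win m n (s z) t z * (F z * K.U 0 \<phi> (i + m) n (Z z + pos m n z + d m n * (s z - arr m n z)) (t - s z)) * (indicator (alive m n) z * ennreal (exp (- (th m n * (s z - arr m n z))))) \<partial>P)"
 proof (intro nn_integral_cong)
  fix z
  have p: "Z z + pos m n z + d m n * (s z - arr m n z) + d m n * (t - s z) = Z z + pos m n z + d m n * (t - arr m n z)"
   by (simp add: algebra_simps)
  have "ennreal (exp (- (th m n * (t - arr m n z)))) = ennreal (exp (- (th m n * (t - s z)))) * ennreal (exp (- (th m n * (s z - arr m n z))))"
   by (simp add: ennreal_mult[symmetric] exp_add[symmetric] algebra_simps)
  then show "win m n (s z) t z * (F z * \<phi> (Z z + pos m n z + d m n * (t - arr m n z))) * (indicator (alive m n) z * ennreal (exp (- (th m n * (t - arr m n z)))))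
   = win m n (s z) t z * (F z * K.U 0 \<phi> (i + m) n (Z z + pos m n z + d m n * (s z - arr m n z)) (t - s z)) * (indicator (alive m n) z * ennreal (exp (- (th m n * (s z - arr m n z)))))"
   unfolding U_0 p by (simp only: mult_ac)
 qed
 also have "\<dots> = (\<integral>\<^sup>+z. gate m n (s z) t z * (F z * K.U 0 \<phi> (i + m) n (Z z + pos m n z + d m n * (s z - arr m n z)) (t - s z)) \<partial>P)"
  by (rule gate_stay[symmetric]; measurable)
 finally show ?case .
next
 case (Suc j)
 note Fm [measurable] = Suc.prems(1) and sm [measurable] = Suc.prems(2) and Zm [measurable] = Suc.prems(3)
 note [measurable] = G_P[OF Fm] G_P[OF sm] G_P[OF Zm]
 interpret D: prob_space "Dr (eps i m) n" by (rule prob_Dr)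
 interpret E: prob_space "DR (eps i m) n" by (rule prob_DR)
 have pos: "0 < l m n" "0 < b m n" "0 < th m n" using l_pos[of m n] b_pos[of m n] by auto
 interpret Kl: finite_measure "rateK (l m n) (th m n)" using pos by (intro finite_rateK) auto
 interpret Kb: finite_measure "rateK (b m n) (th m n)" using pos by (intro finite_rateK) auto
 define v where "v z = s z - arr m n z" for z
 define C where "C z = win m n (s z) t z * F z" for z
 define x where "x z = Z z + pos m n z + d m n * v z" for z
 have vm [measurable]: "v \<in> borel_measurable (G m n)" unfolding v_def[abs_def] by measurable
 have Cm [measurable]: "C \<in> borel_measurable (G m n)" unfolding C_def[abs_def] by measurable
 have xm [measurable]: "x \<in> borel_measurable (G m n)" unfolding x_def[abs_def] by measurable
 note [measurable] = G_P[OF vm] G_P[OF Cm] G_P[OF xm]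
 define \<Phi> where "\<Phi> z w y = C z * (if v z < w \<and> w \<le> v z + (t - s z) then K.U j \<phi> (i + m) (Suc n) (x z + d m n * (w - v z) + y) (v z + (t - s z) - w) else 0)" for z w y
 define \<Psi> where "\<Psi> z w y = C z * (if v z < w \<and> w \<le> v z + (t - s z) then K.U j \<phi> (Suc (i + m)) 0 (x z + d m n * (w - v z) + y) (v z + (t - s z) - w) else 0)" for z w y
 have \<Phi>m: "(\<lambda>p. \<Phi> (fst p) (fst (snd p)) (snd (snd p))) \<in> borel_measurable (G m n \<Otimes>\<^sub>M (borel \<Otimes>\<^sub>M borel))"
  unfolding \<Phi>_def by measurable
 have \<Psi>m: "(\<lambda>p. \<Psi> (fst p) (fst (snd p)) (snd (snd p))) \<in> borel_measurable (G m n \<Otimes>\<^sub>M (borel \<Otimes>\<^sub>M borel))"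
  unfolding \<Psi>_def by measurable
 define f where "f z = (if z \<in> alive m (Suc n) \<and> arr m (Suc n) z \<le> t then cnt t j m (Suc n) z else 0)" for z
 define h where "h z = (if z \<in> switchset m n \<and> clock (Suc m) z \<le> t then cnt t j (Suc m) 0 z else 0)" for z
 have [measurable]: "f \<in> borel_measurable P" "h \<in> borel_measurable P" unfolding f_def[abs_def] h_def[abs_def] by measurable
 have shock: "(\<integral>\<^sup>+z. F z * (gate m n (s z) t z * (f z * \<phi> (Z z + X t z))) \<partial>P)
  = (\<integral>\<^sup>+z. indicator (alive m n) z * (\<integral>\<^sup>+w. (\<integral>\<^sup>+y. \<Phi> z w y \<partial>Dr (eps i m) n) \<partial>rateK (l m n) (th m n)) \<partial>P)"
 proof -
  define F1 where "F1 z = C z * (if v z < Hh m n z then 1 else 0)" for z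
  have [measurable]: "Hh m n \<in> borel_measurable (G m (Suc n))" by (rule Hh_G) simp
  note [measurable] = G_S[OF vm] G_S[OF Cm]
  have F1m: "F1 \<in> borel_measurable (G m (Suc n))" unfolding F1_def[abs_def] by measurable
  have "(\<integral>\<^sup>+z. F z * (gate m n (s z) t z * (f z * \<phi> (Z z + X t z))) \<partial>P)
   = (\<integral>\<^sup>+z. F1 z * (gate m (Suc n) (arr m (Suc n) z) t z * (cnt t j m (Suc n) z * \<phi> (Z z + X t z))) \<partial>P)"
  proof (rule nn_integral_cong_AE)
   show "AE z in P. F z * (gate m n (s z) t z * (f z * \<phi> (Z z + X t z))) = F1 z * (gate m (Suc n) (arr m (Suc n) z) t z * (cnt t j m (Suc n) z * \<phi> (Z z + X t z)))"
    using AE_good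
   proof eventually_elim
    case (elim z)
    have "gate m n (s z) t z * f z = win m n (s z) t z * (if v z < Hh m n z then 1 else 0) * (gate m (Suc n) (arr m (Suc n) z) t z * cnt t j m (Suc n) z)"
    proof (cases "win m n (s z) t z = 0")
     case True
     then show ?thesis by (simp add: gate_eq[OF elim])
    next
     case False
     then have w: "switch_time T m z < \<top>" "0 \<le> v z" "win m n (s z) t z = 1" by (auto simp: win_def v_def split: if_splits)
     show ?thesis
     proof (cases "z \<in> alive m (Suc n)")
      case True
      have "gate m n (s z) t z = (if v z < Hh m n z then 1 else 0)"
       using stay_or_go[OF elim w(2), of m n] True alive_switch_disjoint[OF True] w(3) unfolding gate_eq[OF elim] v_def by auto
      then show ?thesis using True w inside_arrival[OF elim, of m "Suc n"] by (simp add: f_def gate_def)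
     next
      case False
      then show ?thesis using inside_arrival[OF elim, of m "Suc n"] by (simp add: f_def gate_def)
     qed
    qed
    then have "F z * ((gate m n (s z) t z * f z) * \<phi> (Z z + X t z)) = F1 z * (gate m (Suc n) (arr m (Suc n) z) t z * (cnt t j m (Suc n) z * \<phi> (Z z + X t z)))"
     unfolding F1_def C_def by (simp only: mult_ac)
    then show ?case by (simp only: mult.assoc)
   qed
  qed
  also have "\<dots> = (\<integral>\<^sup>+z. gate m (Suc n) (arr m (Suc n) z) t z * (F1 z * K.U j \<phi> (i + m) (Suc n) (Z z + pos m (Suc n) z + d m (Suc n) * (arr m (Suc n) z - arr m (Suc n) z)) (t - arr m (Suc n) z)) \<partial>P)"
   by (rule Suc.IH[OF F1m arr_G G_S[OF Zm]])
  also have "\<dots> = (\<integral>\<^sup>+z. indicator (alive m (Suc n)) z * \<Phi> z (Hh m n z) (r m n z) \<partial>P)"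
  proof (rule nn_integral_cong_AE)
   show "AE z in P. gate m (Suc n) (arr m (Suc n) z) t z * (F1 z * K.U j \<phi> (i + m) (Suc n) (Z z + pos m (Suc n) z + d m (Suc n) * (arr m (Suc n) z - arr m (Suc n) z)) (t - arr m (Suc n) z))
    = indicator (alive m (Suc n)) z * \<Phi> z (Hh m n z) (r m n z)"
    using AE_good
   proof eventually_elim
    case (elim z)
    have 1: "Z z + pos m (Suc n) z + d m (Suc n) * (arr m (Suc n) z - arr m (Suc n) z) = x z + d m n * (Hh m n z - v z) + r m n z"
     by (simp add: x_def pos_Suc algebra_simps)
    have 2: "t - arr m (Suc n) z = v z + (t - s z) - Hh m n z" by (simp add: v_def arr_Suc)
    have 3: "arr m (Suc n) z \<le> t \<longleftrightarrow> Hh m n z \<le> v z + (t - s z)" by (auto simp: v_def arr_Suc)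
    have 4: "C z = 0 \<or> switch_time T m z < \<top>" by (simp add: C_def win_def)
    show ?case
     unfolding 1 2 \<Phi>_def F1_def gate_def inside_arrival[OF elim] 3 using 4
     by (auto simp: indicator_def)
   qed
  qed
  also have "\<dots> = (\<integral>\<^sup>+z. indicator (alive m n) z * (\<integral>\<^sup>+w. (\<integral>\<^sup>+y. \<Phi> z w y \<partial>Dr (eps i m) n) \<partial>rateK (l m n) (th m n)) \<partial>P)"
   by (rule shock_law[OF \<Phi>m])
  finally show ?thesis .
 qed
 have switch: "(\<integral>\<^sup>+z. F z * (gate m n (s z) t z * (h z * \<phi> (Z z + X t z))) \<partial>P)
  = (\<integral>\<^sup>+z. indicator (alive m n) z * (\<integral>\<^sup>+w. (\<integral>\<^sup>+y. \<Psi> z w y \<partial>DR (eps i m) n) \<partial>rateK (b m n) (th m n)) \<partial>P)"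
 proof -
  define F2 where "F2 z = C z * (if v z < age m n z \<and> ennreal (Sh m n z) < T (Suc m) z \<and> T (Suc m) z < ennreal (Sh m (Suc n) z) then 1 else 0)" for z
  have [measurable]: "T (Suc m) \<in> borel_measurable (G (Suc m) 0)" by (rule T_G) simp
  have [measurable]: "Sh m k \<in> borel_measurable (G (Suc m) 0)" for k
   unfolding Sh_def[abs_def] by (intro borel_measurable_sum Hh_G_old) simp
  have [measurable]: "age m n \<in> borel_measurable (G (Suc m) 0)" unfolding age_def[abs_def] by measurable
  note [measurable] = G_W[OF vm] G_W[OF Cm]
  have F2m: "F2 \<in> borel_measurable (G (Suc m) 0)" unfolding F2_def[abs_def] by measurable
  have sw: "good z \<Longrightarrow> (ennreal (Sh m n z) < T (Suc m) z \<and> T (Suc m) z < ennreal (Sh m (Suc n) z)) \<longleftrightarrow> z \<in> switchset m n" for z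
   using goodD(1) by (auto simp: switchset_def)
  have "(\<integral>\<^sup>+z. F z * (gate m n (s z) t z * (h z * \<phi> (Z z + X t z))) \<partial>P)
   = (\<integral>\<^sup>+z. F2 z * (gate (Suc m) 0 (clock (Suc m) z) t z * (cnt t j (Suc m) 0 z * \<phi> (Z z + X t z))) \<partial>P)"
  proof (rule nn_integral_cong_AE)
   show "AE z in P. F z * (gate m n (s z) t z * (h z * \<phi> (Z z + X t z))) = F2 z * (gate (Suc m) 0 (clock (Suc m) z) t z * (cnt t j (Suc m) 0 z * \<phi> (Z z + X t z)))"
    using AE_good
   proof eventually_elim
    case (elim z)
    have "gate m n (s z) t z * h z = win m n (s z) t z * (if v z < age m n z \<and> z \<in> switchset m n then 1 else 0) * (gate (Suc m) 0 (clock (Suc m) z) t z * cnt t j (Suc m) 0 z)"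
    proof (cases "win m n (s z) t z = 0")
     case True
     then show ?thesis by (simp add: gate_eq[OF elim])
    next
     case False
     then have w: "switch_time T m z < \<top>" "0 \<le> v z" "win m n (s z) t z = 1" by (auto simp: win_def v_def split: if_splits)
     show ?thesis
     proof (cases "z \<in> switchset m n")
      case True
      have "gate m n (s z) t z = (if v z < age m n z then 1 else 0)"
       using stay_or_go[OF elim w(2), of m n] True alive_switch_disjoint[OF _ True] w(3) unfolding gate_eq[OF elim] v_def by auto
      then show ?thesis using True w after_switch(2)[OF elim w(1) True] by (simp add: h_def gate_def)
     next
      case False
      then show ?thesis by (simp add: h_def)
     qed
    qed
    then have "F z * ((gate m n (s z) t z * h z) * \<phi> (Z z + X t z)) = F2 z * (gate (Suc m) 0 (clock (Suc m) z) t z * (cnt t j (Suc m) 0 z * \<phi> (Z z + X t z)))"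
     unfolding F2_def C_def sw[OF elim] by (simp only: mult_ac)
    then show ?case by (simp only: mult.assoc)
   qed
  qed
  also have "\<dots> = (\<integral>\<^sup>+z. gate (Suc m) 0 (clock (Suc m) z) t z * (F2 z * K.U j \<phi> (i + Suc m) 0 (Z z + pos (Suc m) 0 z + d (Suc m) 0 * (clock (Suc m) z - arr (Suc m) 0 z)) (t - clock (Suc m) z)) \<partial>P)"
   by (rule Suc.IH[OF F2m clock_G G_W[OF Zm]])
  also have "\<dots> = (\<integral>\<^sup>+z. indicator (switchset m n) z * \<Psi> z (age m n z) (R m n z) \<partial>P)"
  proof (rule nn_integral_cong_AE)
   show "AE z in P. gate (Suc m) 0 (clock (Suc m) z) t z * (F2 z * K.U j \<phi> (i + Suc m) 0 (Z z + pos (Suc m) 0 z + d (Suc m) 0 * (clock (Suc m) z - arr (Suc m) 0 z)) (t - clock (Suc m) z))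
    = indicator (switchset m n) z * \<Psi> z (age m n z) (R m n z)"
    using AE_good
   proof eventually_elim
    case (elim z)
    show ?case
    proof (cases "C z = 0 \<or> z \<notin> switchset m n")
     case True
     then show ?thesis by (auto simp: \<Psi>_def F2_def sw[OF elim])
    next
     case False
     then have s: "z \<in> switchset m n" and f: "switch_time T m z < \<top>" by (auto simp: C_def win_def split: if_splits)
     note a = after_switch[OF elim f s]
     have 1: "Z z + pos (Suc m) 0 z + d (Suc m) 0 * (clock (Suc m) z - arr (Suc m) 0 z) = x z + d m n * (age m n z - v z) + R m n z"
      by (simp add: x_def a(3) arr_def[of "Suc m" 0] algebra_simps)
     have 2: "t - clock (Suc m) z = v z + (t - s z) - age m n z" by (simp add: v_def a(1))
     have 3: "clock (Suc m) z \<le> t \<longleftrightarrow> age m n z \<le> v z + (t - s z)" by (auto simp: v_def a(1))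
     show ?thesis
      unfolding 1 2 \<Psi>_def F2_def gate_def 3 sw[OF elim] using a(2) s by (auto simp: indicator_def)
    qed
   qed
  qed
  also have "\<dots> = (\<integral>\<^sup>+z. indicator (alive m n) z * (\<integral>\<^sup>+w. (\<integral>\<^sup>+y. \<Psi> z w y \<partial>DR (eps i m) n) \<partial>rateK (b m n) (th m n)) \<partial>P)"
   by (rule switch_law[OF \<Psi>m])
  finally show ?thesis .
 qed
 have "(\<integral>\<^sup>+z. F z * (gate m n (s z) t z * (cnt t (Suc j) m n z * \<phi> (Z z + X t z))) \<partial>P)
  = (\<integral>\<^sup>+z. F z * (gate m n (s z) t z * (f z * \<phi> (Z z + X t z))) + F z * (gate m n (s z) t z * (h z * \<phi> (Z z + X t z))) \<partial>P)"
  unfolding cnt.simps f_def[symmetric] h_def[symmetric] by (intro nn_integral_cong) (simp only: distrib_left distrib_right)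
 also have "\<dots> = (\<integral>\<^sup>+z. F z * (gate m n (s z) t z * (f z * \<phi> (Z z + X t z))) \<partial>P) + (\<integral>\<^sup>+z. F z * (gate m n (s z) t z * (h z * \<phi> (Z z + X t z))) \<partial>P)"
  by (rule nn_integral_add) measurable
 also have "\<dots> = (\<integral>\<^sup>+z. indicator (alive m n) z * (\<integral>\<^sup>+w. (\<integral>\<^sup>+y. \<Phi> z w y \<partial>Dr (eps i m) n) \<partial>rateK (l m n) (th m n))
   + indicator (alive m n) z * (\<integral>\<^sup>+w. (\<integral>\<^sup>+y. \<Psi> z w y \<partial>DR (eps i m) n) \<partial>rateK (b m n) (th m n)) \<partial>P)"
  unfolding shock switch
  by (rule nn_integral_add[symmetric]) (unfold \<Phi>_def \<Psi>_def, measurable)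
 also have "\<dots> = (\<integral>\<^sup>+z. win m n (s z) t z * (F z * K.U (Suc j) \<phi> (i + m) n (x z) (t - s z)) * (indicator (alive m n) z * ennreal (exp (- (th m n * v z)))) \<partial>P)"
 proof (intro nn_integral_cong)
  fix z
  define \<Phi>' where "\<Phi>' w = (\<integral>\<^sup>+y. (if v z < w \<and> w \<le> v z + (t - s z) then K.U j \<phi> (i + m) (Suc n) (x z + d m n * (w - v z) + y) (v z + (t - s z) - w) else 0) \<partial>Dr (eps i m) n)" for w
  define \<Psi>' where "\<Psi>' w = (\<integral>\<^sup>+y. (if v z < w \<and> w \<le> v z + (t - s z) then K.U j \<phi> (Suc (i + m)) 0 (x z + d m n * (w - v z) + y) (v z + (t - s z) - w) else 0) \<partial>DR (eps i m) n)" for w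
  have m: "\<Phi>' \<in> borel_measurable (rateK a tt)" "\<Psi>' \<in> borel_measurable (rateK a tt)" for a tt
   unfolding \<Phi>'_def[abs_def] \<Psi>'_def[abs_def] by measurable
  have 1: "(\<integral>\<^sup>+w. (\<integral>\<^sup>+y. \<Phi> z w y \<partial>Dr (eps i m) n) \<partial>rateK (l m n) (th m n)) = C z * (\<integral>\<^sup>+w. \<Phi>' w \<partial>rateK (l m n) (th m n))"
  proof -
   have "(\<integral>\<^sup>+y. \<Phi> z w y \<partial>Dr (eps i m) n) = C z * \<Phi>' w" for w
    unfolding \<Phi>_def \<Phi>'_def by (rule nn_integral_cmult) measurable
   then show ?thesis using nn_integral_cmult[OF m(1), where c = "C z"] by simp
  qed
  have 2: "(\<integral>\<^sup>+w. (\<integral>\<^sup>+y. \<Psi> z w y \<partial>DR (eps i m) n) \<partial>rateK (b m n) (th m n)) = C z * (\<integral>\<^sup>+w. \<Psi>' w \<partial>rateK (b m n) (th m n))"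
  proof -
   have "(\<integral>\<^sup>+y. \<Psi> z w y \<partial>DR (eps i m) n) = C z * \<Psi>' w" for w
    unfolding \<Psi>_def \<Psi>'_def by (rule nn_integral_cmult) measurable
   then show ?thesis using nn_integral_cmult[OF m(2), where c = "C z"] by simp
  qed
  show "indicator (alive m n) z * (\<integral>\<^sup>+w. (\<integral>\<^sup>+y. \<Phi> z w y \<partial>Dr (eps i m) n) \<partial>rateK (l m n) (th m n))
   + indicator (alive m n) z * (\<integral>\<^sup>+w. (\<integral>\<^sup>+y. \<Psi> z w y \<partial>DR (eps i m) n) \<partial>rateK (b m n) (th m n))
   = win m n (s z) t z * (F z * K.U (Suc j) \<phi> (i + m) n (x z) (t - s z)) * (indicator (alive m n) z * ennreal (exp (- (th m n * v z))))"
  proof (cases "C z = 0")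
   case True
   then have "win m n (s z) t z * F z = 0" by (simp only: C_def)
   then show ?thesis unfolding 1 2 True by (simp only: mult.assoc[symmetric] mult_zero_left mult_zero_right add_0)
  next
   case False
   then have v0: "0 \<le> v z" by (auto simp: C_def win_def v_def split: if_splits)
   have "(\<integral>\<^sup>+w. \<Phi>' w \<partial>rateK (l m n) (th m n)) + (\<integral>\<^sup>+w. \<Psi>' w \<partial>rateK (b m n) (th m n)) = ennreal (exp (- (th m n * v z))) * K.U (Suc j) \<phi> (i + m) n (x z) (t - s z)"
    unfolding \<Phi>'_def \<Psi>'_def by (rule U_restart[OF \<phi> v0])
   then have "indicator (alive m n) z * (C z * ((\<integral>\<^sup>+w. \<Phi>' w \<partial>rateK (l m n) (th m n)) + (\<integral>\<^sup>+w. \<Psi>' w \<partial>rateK (b m n) (th m n))))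
    = indicator (alive m n) z * (C z * (ennreal (exp (- (th m n * v z))) * K.U (Suc j) \<phi> (i + m) n (x z) (t - s z)))" by (simp only:)
   then show ?thesis unfolding 1 2 distrib_left C_def by (simp only: mult_ac)
  qed
 qed
 also have "\<dots> = (\<integral>\<^sup>+z. gate m n (s z) t z * (F z * K.U (Suc j) \<phi> (i + m) n (x z) (t - s z)) \<partial>P)"
  unfolding v_def by (rule gate_stay[symmetric]; measurable)
 finally show ?case unfolding x_def v_def .
qed

text \<open>
 The sum of \<open>restart_law\<close> over the number of events, with \<open>Z\<close> the negative of the
 position at time \<open>s\<close>, which is known on arrival in the cell.
\<close>

lemma increment_law:
 assumes \<phi> [measurable]: "\<phi> \<in> borel_measurable borel" and s: "0 \<le> s" "s \<le> t" and B: "B \<in> sets (G m n)"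
 shows "(\<integral>\<^sup>+z. indicator (B \<inter> {z \<in> space P. inside m n s z}) z * \<phi> (X t z - X s z) \<partial>P)
  = emeasure P (B \<inter> {z \<in> space P. inside m n s z}) * K.V \<phi> (i + m) n 0 (t - s)"
proof -
 define F :: "'a \<Rightarrow> ennreal" where "F = indicator B"
 define Z where "Z z = - (pos m n z + d m n * (s - arr m n z))" for z
 have BP [measurable]: "B \<in> sets P" using B G_sub by auto
 have Fm: "F \<in> borel_measurable (G m n)" unfolding F_def using B by measurable
 have Zm: "Z \<in> borel_measurable (G m n)" unfolding Z_def[abs_def] by measurable
 note [measurable] = G_P[OF Fm] G_P[OF Zm]
 have "(\<integral>\<^sup>+z. indicator (B \<inter> {z \<in> space P. inside m n s z}) z * \<phi> (X t z - X s z) \<partial>P)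
  = (\<integral>\<^sup>+z. (\<Sum>j. F z * (gate m n s t z * (cnt t j m n z * \<phi> (Z z + X t z)))) \<partial>P)"
 proof (rule nn_integral_cong_AE)
  show "AE z in P. indicator (B \<inter> {z \<in> space P. inside m n s z}) z * \<phi> (X t z - X s z)
   = (\<Sum>j. F z * (gate m n s t z * (cnt t j m n z * \<phi> (Z z + X t z))))"
   using AE_good
  proof eventually_elim
   case (elim z)
   have sum: "(\<Sum>j. F z * (gate m n s t z * (cnt t j m n z * \<phi> (Z z + X t z)))) = F z * (gate m n s t z * ((\<Sum>j. cnt t j m n z) * \<phi> (Z z + X t z)))"
    by simp
   show ?case
   proof (cases "inside m n s z")
    case True
    have "Z z + X t z = X t z - X s z" using process_inside[OF elim s(1) True] by (simp add: Z_def)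
    then show ?thesis using True goodD(1)[OF elim] s unfolding sum cnt_total[OF elim True s(2)]
     by (simp add: F_def gate_def indicator_def)
   next
    case False
    then show ?thesis unfolding sum by (simp add: gate_def)
   qed
  qed
 qed
 also have "\<dots> = (\<Sum>j. \<integral>\<^sup>+z. F z * (gate m n s t z * (cnt t j m n z * \<phi> (Z z + X t z))) \<partial>P)"
  by (rule nn_integral_suminf) measurable
 also have "\<dots> = (\<Sum>j. \<integral>\<^sup>+z. gate m n s t z * (F z * K.U j \<phi> (i + m) n 0 (t - s)) \<partial>P)"
 proof (rule suminf_cong)
  fix j
  have 0: "Z z + pos m n z + d m n * (s - arr m n z) = 0" for z by (simp add: Z_def)
  have "0 \<le> t" using s by simp
  from restart_law[OF \<phi> this Fm _ Zm, of "\<lambda>_. s" j]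
  show "(\<integral>\<^sup>+z. F z * (gate m n s t z * (cnt t j m n z * \<phi> (Z z + X t z))) \<partial>P) = (\<integral>\<^sup>+z. gate m n s t z * (F z * K.U j \<phi> (i + m) n 0 (t - s)) \<partial>P)"
   unfolding 0 by simp
 qed
 also have "\<dots> = (\<Sum>j. emeasure P (B \<inter> {z \<in> space P. inside m n s z}) * K.U j \<phi> (i + m) n 0 (t - s))"
 proof (rule suminf_cong)
  fix j
  have "(\<integral>\<^sup>+z. gate m n s t z * (F z * K.U j \<phi> (i + m) n 0 (t - s)) \<partial>P)
   = (\<integral>\<^sup>+z. K.U j \<phi> (i + m) n 0 (t - s) * indicator (B \<inter> {z \<in> space P. inside m n s z}) z \<partial>P)"
   by (intro nn_integral_cong) (use s in \<open>auto simp: F_def gate_def indicator_def\<close>)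
  then show "(\<integral>\<^sup>+z. gate m n s t z * (F z * K.U j \<phi> (i + m) n 0 (t - s)) \<partial>P) = emeasure P (B \<inter> {z \<in> space P. inside m n s z}) * K.U j \<phi> (i + m) n 0 (t - s)"
   by (subst (asm) nn_integral_cmult_indicator) (auto simp: mult.commute)
 qed
 also have "\<dots> = emeasure P (B \<inter> {z \<in> space P. inside m n s z}) * K.V \<phi> (i + m) n 0 (t - s)"
  unfolding K.V_def by simp
 finally show ?thesis .
qed

end

context switching_process
begin

section \<open>The observed history\<close>

abbreviation hist :: "real \<Rightarrow> 'a measure" where "hist \<equiv> history (space P) i c H T r R"

abbreviation cell :: "nat \<Rightarrow> nat \<Rightarrow> real \<Rightarrow> 'a set" where "cell m n s \<equiv> {z \<in> space P. inside m n s z}"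

text \<open>
 Up to time \<open>s\<close> a path in the cell \<open>(m, n)\<close> has used only the revealed input. The
 replacements make every later event happen after \<open>s\<close>: a holding time \<open>s + 1\<close> and an
 infinite gap.
\<close>

lemma observation_truncated:
 assumes g: "good z" and ins: "inside m n s z" and u: "0 \<le> u" "u \<le> s"
 shows "observation i c (\<lambda>k j z. if k < m \<or> k = m \<and> j < n then Hh k j z else s + 1) (\<lambda>k z. if k \<le> m then T k z else \<top>)
   (\<lambda>k j z. if k < m \<or> k = m \<and> j < n then r k j z else 0) (\<lambda>k j z. if k < m then R k j z else 0) u z
  = observation i c H T r R u z"
  (is "observation i c ?H ?T ?r ?R u z = _")
proof -
 have s0: "0 \<le> s" using u by simp
 have f: "switch_time T m z < \<top>" and cm: "clock m z \<le> s" and sm: "s < arr m (Suc n) z" and Tm: "ennreal (s - clock m z) < T (Suc m) z"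
  using ins Sh_nonneg[OF g, of m n] by (auto simp: inside_def arr_def)
 have later: "ennreal s < switch_time T k z" if "m < k" for k
 proof -
  have "ennreal s < switch_time T (Suc m) z" using less_switch_time_Suc[OF f cm] Tm by simp
  also have "\<dots> \<le> switch_time T k z" using that by (intro switch_time_mono) simp
  finally show ?thesis .
 qed
 have st: "switch_time ?T k z = switch_time T k z" if "k \<le> m" for k
  unfolding switch_time_def using that by (intro sum.cong) auto
 have st': "switch_time ?T k z = \<top>" if "m < k" for k
 proof -
  have "?T k z \<le> (\<Sum>j=1..k. ?T j z)" by (rule member_le_sum) (use that in auto)
  then show ?thesis using that unfolding switch_time_def by (simp add: top_unique)
 qed
 have "{k. switch_time ?T k z \<le> ennreal u} = {k. switch_time T k z \<le> ennreal u}"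
 proof (intro Collect_cong)
  fix k
  show "switch_time ?T k z \<le> ennreal u \<longleftrightarrow> switch_time T k z \<le> ennreal u"
  proof (cases "k \<le> m")
   case False
   have "ennreal u \<le> ennreal s" using u by (intro ennreal_leI)
   then have "\<not> switch_time T k z \<le> ennreal u" using later[of k] False by (auto simp: not_le intro: le_less_trans)
   then show ?thesis using st'[of k] False by (simp add: top_unique)
  qed (simp add: st)
 qed
 then have M': "switch_count ?T u z = switch_count T u z" by (simp only: switch_count_def)
 define M where "M = switch_count T u z"
 have insM: "inside M (shock_count Hh M (elapsed T u z) z) u z" using inside_iff[OF g u(1)] by (simp add: M_def)
 have cM: "clock M z \<le> u" and fM: "switch_time T M z < \<top>"
  using insM Sh_nonneg[OF g, of M "shock_count Hh M (elapsed T u z) z"] by (auto simp: inside_def arr_def)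
 have Mm: "M \<le> m"
 proof (rule ccontr)
  assume "\<not> M \<le> m"
  then have "ennreal s < switch_time T M z" by (intro later) simp
  moreover have "switch_time T M z \<le> ennreal u" using clock_le[OF fM u(1)] cM by simp
  moreover have "ennreal u \<le> ennreal s" using u by (intro ennreal_leI)
  ultimately show False by (meson leD order_trans)
 qed
 have el: "elapsed ?T u z = u - clock M z" "elapsed T u z = u - clock M z"
  using st[OF Mm] by (simp_all add: elapsed_def M' M_def[symmetric] clock_def)
 \<comment> \<open>The functionals of a phase agree up to the observed duration of the phase.\<close>
 have eqs: "shock_count ?H p x z = shock_count H p x z" "phase_jumps ?H ?r p x z = phase_jumps H r p x z"
  if "p < m \<or> p = m \<and> 0 \<le> x \<and> x \<le> s - clock m z" for p x
 proof -
  have "shock_count ?H p x z = shock_count H p x z \<and> (p = m \<longrightarrow> shock_count H p x z \<le> n)"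
  proof (cases "p = m")
   case True
   with that have x: "0 \<le> x" "x \<le> s - clock m z" by auto
   have Hsum: "(\<Sum>k<j. H m k z) = Sh m j z" for j using goodD(2)[OF g] by (simp add: Sh_def)
   have big: "x < Sh m j z" if "n < j" for j
   proof -
    have "Sh m (Suc n) z \<le> Sh m j z" unfolding Sh_def using that by (intro proper_mono[OF goodD(3)[OF g]]) simp
    then show ?thesis using x sm by (simp add: arr_def)
   qed
   have "{j. (\<Sum>k<j. ?H m k z) \<le> x} = {j. (\<Sum>k<j. H m k z) \<le> x}"
   proof (intro Collect_cong)
    fix j
    show "(\<Sum>k<j. ?H m k z) \<le> x \<longleftrightarrow> (\<Sum>k<j. H m k z) \<le> x"
    proof (cases "j \<le> n")
     case True
     then have "(\<Sum>k<j. ?H m k z) = Sh m j z" unfolding Sh_def by (intro sum.cong) auto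
     then show ?thesis unfolding Hsum by simp
    next
     case False
     have "s + 1 = ?H m n z" by simp
     also have "\<dots> \<le> (\<Sum>k<j. ?H m k z)"
      by (rule member_le_sum) (use False Hh_pos[OF g] s0 in \<open>auto simp: less_imp_le\<close>)
     finally have "\<not> (\<Sum>k<j. ?H m k z) \<le> x" using x clock_nonneg[of m z] by linarith
     then show ?thesis unfolding Hsum using big[of j] False by simp
    qed
   qed
   then have 1: "shock_count ?H m x z = shock_count H m x z" by (simp only: shock_count_def)
   have "shock_count H m x z = shock_count Hh m x z" unfolding shock_count_def using goodD(2)[OF g] by simp
   moreover have "\<not> Suc n \<le> shock_count Hh m x z"
    unfolding shock_count_eq_Max using proper_count[OF goodD(3)[OF g] x(1), of "Suc n" m] big[of "Suc n"]
    by (simp add: Sh_def)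
   ultimately show ?thesis using 1 True by simp
  next
   case False
   then have "p < m" using that by auto
   then show ?thesis using goodD(2)[OF g] False by (simp add: shock_count_def)
  qed
  then show "shock_count ?H p x z = shock_count H p x z" "phase_jumps ?H ?r p x z = phase_jumps H r p x z"
   using that unfolding phase_jumps_def by (auto intro!: sum.cong)
 qed
 have drift: "phase_drift i c ?H p x z = phase_drift i c H p x z" if "p < m \<or> p = m \<and> x \<le> s - clock m z" for p x
  unfolding phase_drift_def
  by (rule set_lebesgue_integral_cong) (use that in \<open>auto intro!: arg_cong[where f = "c (eps i p)"] eqs(1)\<close>)
 have lastM: "M < m \<or> M = m \<and> 0 \<le> u - clock M z \<and> u - clock M z \<le> s - clock m z" using Mm cM u by auto
 have "linear_part i c ?H ?T u z = linear_part i c H T u z"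
  unfolding linear_part_def M' M_def[symmetric] el
  by (intro arg_cong2[where f = "(+)"] sum.cong) (use Mm lastM in \<open>auto intro!: drift\<close>)
 moreover have "jump_part ?H ?T ?r ?R u z = jump_part H T r R u z"
  unfolding jump_part_def M' M_def[symmetric] el
 proof (intro arg_cong2[where f = "(+)"] sum.cong refl)
  fix k assume k: "k \<in> {1..M}"
  then have km: "k - 1 < m" "k \<le> m" using Mm by auto
  show "?R (k - 1) (shock_count ?H (k - 1) (enn2real (?T k z)) z) z = R (k - 1) (shock_count H (k - 1) (enn2real (T k z)) z) z"
   using km eqs(1)[of "k - 1" "enn2real (T k z)"] by simp
  show "phase_jumps ?H ?r (k - 1) (enn2real (?T k z)) z = phase_jumps H r (k - 1) (enn2real (T k z)) z"
   using km eqs(2)[of "k - 1" "enn2real (T k z)"] by simp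
 next
  show "phase_jumps ?H ?r M (u - clock M z) z = phase_jumps H r M (u - clock M z) z"
   by (rule eqs(2)[OF lastM])
 qed
 ultimately show ?thesis
  unfolding observation_def process_def state_def M' M_def[symmetric] el eqs(1)[OF lastM] by simp
qed

text \<open>
 Within a cell, an observed event is an event of the past on arrival; this holds for single observations by
 truncation and passes to the generated sigma-algebra.
\<close>

lemma history_trace:
 assumes \<Gamma>: "\<Gamma> \<in> sets (hist s)"
 shows "\<exists>B\<in>sets (G m n). \<forall>z. good z \<longrightarrow> inside m n s z \<longrightarrow> (z \<in> \<Gamma> \<longleftrightarrow> z \<in> B)"
proof -
 let ?H = "\<lambda>k j z. if k < m \<or> k = m \<and> j < n then Hh k j z else s + 1"
 let ?T = "\<lambda>k z. if k \<le> m then T k z else \<top>"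
 let ?r = "\<lambda>k j z. if k < m \<or> k = m \<and> j < n then r k j z else 0"
 let ?R = "\<lambda>k j z. if k < m then R k j z else 0"
 interpret trunc: measurable_input "G m n" ?H ?r ?R ?T
 proof
  show "?H k j \<in> borel_measurable (G m n)" for k j 
   by (cases "k < m \<or> k = m \<and> j < n") (auto intro: Hh_G Hh_G_old)
  show "?T (Suc k) \<in> borel_measurable (G m n)" for k 
   by (cases "Suc k \<le> m") (auto intro: T_G)
  show "?r k j \<in> borel_measurable (G m n)" for k j 
   by (cases "k < m \<or> k = m \<and> j < n") (auto intro: r_G)
  show "?R k j \<in> borel_measurable (G m n)" for k j 
   by (cases "k < m") (auto intro: R_G)
 qed
 have "\<Gamma> \<in> sigma_sets (space P) (\<Union>u\<in>{0..s}. {observation i c H T r R u -` A \<inter> space P | A. A \<in> sets borel})"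
  using \<Gamma> by (simp only: history_def sets_gen_sigma)
 then show ?thesis
 proof induction
  case (Basic a)
  then obtain u A where u: "0 \<le> u" "u \<le> s" and A: "A \<in> sets borel" and a: "a = observation i c H T r R u -` A \<inter> space P" by auto
  have B: "observation i c ?H ?T ?r ?R u -` A \<inter> space (G m n) \<in> sets (G m n)"
   by (rule measurable_sets[OF trunc.observation_measurable A])
  show ?case
   by (rule bexI[OF _ B]) (use observation_truncated[OF _ _ u] in \<open>simp add: a\<close>)
 next
  case Empty
  show ?case by (rule bexI[of _ "{}"]) auto
 next
  case (Compl a)
  then obtain B where B: "B \<in> sets (G m n)" "\<And>z. good z \<Longrightarrow> inside m n s z \<Longrightarrow> z \<in> a \<longleftrightarrow> z \<in> B" by blast
  show ?case
   by (rule bexI[OF _ sets.compl_sets[OF B(1)]]) (use B goodD(1) in auto)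
 next
  case (Union a)
  then have "\<forall>k. \<exists>B. B \<in> sets (G m n) \<and> (\<forall>z. good z \<longrightarrow> inside m n s z \<longrightarrow> (z \<in> a k \<longleftrightarrow> z \<in> B))" by blast
  then obtain B where B: "\<And>k. B k \<in> sets (G m n)" "\<And>k z. good z \<Longrightarrow> inside m n s z \<Longrightarrow> z \<in> a k \<longleftrightarrow> z \<in> B k" by metis
  show ?case
   by (rule bexI[of _ "\<Union>k. B k"]) (use B in auto)
 qed
qed

lemma hist_subalgebra: "subalgebra P (hist t)"
proof -
 have "sets (hist t) \<subseteq> sets P"
  unfolding history_def by (rule gen_sigma_least) (auto intro: input.observation_measurable)
 then show ?thesis by (simp add: subalgebra_def history_def space_gen_sigma)
qed

lemma hist_observation: "0 \<le> u \<Longrightarrow> u \<le> t \<Longrightarrow> observation i c H T r R u \<in> borel_measurable (hist t)"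
 unfolding history_def by (rule measurable_gen_sigma) simp

lemma hist_mono: "s \<le> t \<Longrightarrow> sets (hist s) \<subseteq> sets (hist t)"
proof -
 assume "s \<le> t"
 then have "sets (gen_sigma (space P) (observation i c H T r R) {0..s}) \<subseteq> sets (hist t)"
  by (intro gen_sigma_least hist_observation) (auto simp: history_def space_gen_sigma)
 then show ?thesis by (simp add: history_def)
qed

lemma hist_X: "0 \<le> t \<Longrightarrow> X t \<in> borel_measurable (hist t)"
proof -
 assume t: "0 \<le> t"
 have f: "fst \<in> borel_measurable (borel :: (real \<times> nat \<times> nat \<times> nat) measure)"
  by (intro borel_measurable_continuous_onI continuous_intros)
 show ?thesis using measurable_compose[OF hist_observation[OF t order_refl] f] by (simp add: observation_def)
qed

text \<open>
 The observation contains the numbers of the phase and of its shocks. On the remaining null set they need not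
 agree with \<open>inside\<close>.
\<close>

lemma cell_observed:
 assumes "0 \<le> s"
 shows "\<exists>E\<in>sets (hist s). \<forall>z. good z \<longrightarrow> (z \<in> E \<longleftrightarrow> inside m n s z)"
proof -
 have f: "(\<lambda>p. snd (snd p)) \<in> borel_measurable (borel :: (real \<times> nat \<times> nat \<times> nat) measure)"
  by (intro borel_measurable_continuous_onI continuous_intros)
 have "(\<lambda>z. snd (snd (observation i c H T r R s z))) \<in> borel_measurable (hist s)"
  by (rule measurable_compose[OF hist_observation[OF assms order_refl] f])
 then have "(\<lambda>z. snd (snd (observation i c H T r R s z))) -` {(m, n)} \<inter> space (hist s) \<in> sets (hist s)"
  by (rule measurable_sets) simp
 moreover have "z \<in> (\<lambda>z. snd (snd (observation i c H T r R s z))) -` {(m, n)} \<inter> space (hist s) \<longleftrightarrow> inside m n s z" if g: "good z" for z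
 proof -
  have "shock_count H k x z = shock_count Hh k x z" for k x using goodD(2)[OF g] by (simp add: shock_count_def)
  then show ?thesis using inside_iff[OF g assms, of m n] goodD(1)[OF g] by (auto simp: observation_def history_def space_gen_sigma)
 qed
 ultimately show ?thesis by blast
qed

lemma increment_law_history:
 assumes \<phi> [measurable]: "\<phi> \<in> borel_measurable borel" and s: "0 \<le> s" "s \<le> t" and \<Gamma>: "\<Gamma> \<in> sets (hist s)"
 shows "(\<integral>\<^sup>+z. indicator (\<Gamma> \<inter> cell m n s) z * \<phi> (X t z - X s z) \<partial>P) = emeasure P (\<Gamma> \<inter> cell m n s) * K.V \<phi> (i + m) n 0 (t - s)"
proof -
 obtain B where B: "B \<in> sets (G m n)" "\<And>z. good z \<Longrightarrow> inside m n s z \<Longrightarrow> z \<in> \<Gamma> \<longleftrightarrow> z \<in> B"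
  using history_trace[OF \<Gamma>] by blast
 have [measurable]: "\<Gamma> \<in> sets P" "B \<in> sets P" using \<Gamma> hist_subalgebra[of s] B(1) G_sub by (auto simp: subalgebra_def)
 have "(\<integral>\<^sup>+z. indicator (\<Gamma> \<inter> cell m n s) z * \<phi> (X t z - X s z) \<partial>P) = (\<integral>\<^sup>+z. indicator (B \<inter> cell m n s) z * \<phi> (X t z - X s z) \<partial>P)"
  by (rule nn_integral_cong_AE, use AE_good in eventually_elim) (use B(2) in \<open>auto simp: indicator_def\<close>)
 moreover have "emeasure P (\<Gamma> \<inter> cell m n s) = emeasure P (B \<inter> cell m n s)"
  by (rule emeasure_eq_AE, use AE_good in eventually_elim) (use B(2) in auto)
 ultimately show ?thesis using increment_law[OF \<phi> s B(1)] by simp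
qed

lemma cells_partition: "0 \<le> s \<Longrightarrow> AE z in P. (\<Sum>m. \<Sum>n. indicator (cell m n s) z) = (1 :: ennreal)"
 using AE_good
proof eventually_elim
 case (elim z)
 define M where "M = switch_count T s z"
 define N where "N = shock_count Hh M (elapsed T s z) z"
 have iff: "indicator (cell m n s) z = (if m = M then if n = N then 1 else 0 else 0 :: ennreal)" for m n
  using inside_iff[OF elim(2) elim(1), of m n] goodD(1)[OF elim(2)] by (auto simp: indicator_def M_def N_def)
 have "(\<Sum>n. indicator (cell m n s) z) = (if m = M then 1 else 0 :: ennreal)" for m
  using sums_unique[OF sums_single[of N "\<lambda>_. 1::ennreal"]] unfolding iff by simp
 then show ?case using sums_unique[OF sums_single[of M "\<lambda>_. 1::ennreal"]] by simp
qed

text \<open>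
 An event of the history is split along the cells; on each part the positive and the negative part of the
 increment have the same integral.
\<close>

lemma centred_imp_martingale:
 assumes int: "\<And>t. 0 \<le> t \<Longrightarrow> integrable P (X t)"
  and centred: "\<And>m n u. 0 \<le> u \<Longrightarrow> K.V (\<lambda>y. ennreal y) (i + m) n 0 u = K.V (\<lambda>y. ennreal (- y)) (i + m) n 0 u"
 shows "martingale P hist X"
 unfolding martingale_def
proof (intro conjI allI impI)
 fix s t :: real assume s: "0 \<le> s" and st: "s \<le> t"
 interpret F: finite_measure_subalgebra P "hist s" by unfold_locales (rule hist_subalgebra)
 have t: "0 \<le> t" using s st by simp
 have zero: "(\<integral>z. indicator A z * (X t z - X s z) \<partial>P) = 0" if A: "A \<in> sets (hist s)" for A
 proof -
  have AP [measurable]: "A \<in> sets P" using A hist_subalgebra[of s] by (auto simp: subalgebra_def)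
  have sum: "(\<integral>\<^sup>+z. indicator A z * \<phi> (X t z - X s z) \<partial>P) = (\<Sum>m. \<Sum>n. emeasure P (A \<inter> cell m n s) * K.V \<phi> (i + m) n 0 (t - s))"
   if \<phi> [measurable]: "\<phi> \<in> borel_measurable borel" for \<phi>
  proof -
   have "(\<integral>\<^sup>+z. indicator A z * \<phi> (X t z - X s z) \<partial>P) = (\<integral>\<^sup>+z. (\<Sum>m. \<Sum>n. indicator (A \<inter> cell m n s) z * \<phi> (X t z - X s z)) \<partial>P)"
   proof (rule nn_integral_cong_AE, use cells_partition[OF s] in eventually_elim)
    fix z assume 1: "(\<Sum>m. \<Sum>n. indicator (cell m n s) z) = (1 :: ennreal)"
    have "indicator (A \<inter> cell m n s) z * \<phi> (X t z - X s z) = indicator (cell m n s) z * (indicator A z * \<phi> (X t z - X s z))" for m n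
     by (auto simp: indicator_def)
    then show "indicator A z * \<phi> (X t z - X s z) = (\<Sum>m. \<Sum>n. indicator (A \<inter> cell m n s) z * \<phi> (X t z - X s z))"
     using 1 by simp
   qed
   also have "\<dots> = (\<Sum>m. \<Sum>n. \<integral>\<^sup>+z. indicator (A \<inter> cell m n s) z * \<phi> (X t z - X s z) \<partial>P)"
    by (subst nn_integral_suminf, measurable, subst nn_integral_suminf, measurable)
   finally show ?thesis unfolding increment_law_history[OF \<phi> s st A] .
  qed
  have i: "integrable P (\<lambda>z. indicator A z * (X t z - X s z))"
   using integrable_mult_indicator[OF AP, of "\<lambda>z. X t z - X s z"] int[OF t] int[OF s] by simp
  have "ennreal (indicator A z * x) = indicator A z * ennreal x" "ennreal (- (indicator A z * x)) = indicator A z * ennreal (- x)" for z x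
   by (auto simp: indicator_def)
  then have "(\<integral>\<^sup>+z. ennreal (indicator A z * (X t z - X s z)) \<partial>P) = (\<integral>\<^sup>+z. ennreal (- (indicator A z * (X t z - X s z))) \<partial>P)"
   using sum[of "\<lambda>y. ennreal y"] sum[of "\<lambda>y. ennreal (- y)"] centred[of "t - s"] st by simp
  then show ?thesis unfolding real_lebesgue_integral_def[OF i] by simp
 qed
 show "AE z in P. real_cond_exp P (hist s) (X t) z = X s z"
 proof (rule F.real_cond_exp_charact)
  fix A assume A: "A \<in> sets (hist s)"
  then have AP [measurable]: "A \<in> sets P" using hist_subalgebra[of s] by (auto simp: subalgebra_def)
  have "(\<integral>z. indicator A z * (X t z - X s z) \<partial>P) = (\<integral>z. indicator A z * X t z \<partial>P) - (\<integral>z. indicator A z * X s z \<partial>P)"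
   unfolding right_diff_distrib using integrable_mult_indicator[OF AP int[OF t]] integrable_mult_indicator[OF AP int[OF s]]
   by (intro Bochner_Integration.integral_diff) auto
  then show "(\<integral>z\<in>A. X t z \<partial>P) = (\<integral>z\<in>A. X s z \<partial>P)"
   using zero[OF A] by (simp add: set_lebesgue_integral_def)
 qed (use int s t hist_X in auto)
qed (use hist_subalgebra hist_mono hist_X int in auto)

section \<open>The kernel as the law of an increment\<close>

lemma emeasure_rateK_initial: "0 < a \<Longrightarrow> 0 < x \<Longrightarrow> 0 < emeasure (rateK a tt) {..x}"
proof -
 assume a: "0 < a" "0 < x"
 have "0 < ennreal (a * exp (- (\<bar>tt\<bar> * x))) * ennreal x" using a by (simp add: ennreal_zero_less_mult_iff)
 also have "\<dots> = (\<integral>\<^sup>+w. ennreal (a * exp (- (\<bar>tt\<bar> * x))) * indicator {0<..x} w \<partial>lborel)"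
  using a by (subst nn_integral_cmult_indicator) auto
 also have "\<dots> \<le> (\<integral>\<^sup>+w. indicator {0<..} w * ennreal (a * exp (- (tt * w))) * indicator {..x} w \<partial>lborel)"
 proof (intro nn_integral_mono)
  fix w :: real
  show "ennreal (a * exp (- (\<bar>tt\<bar> * x))) * indicator {0<..x} w \<le> indicator {0<..} w * ennreal (a * exp (- (tt * w))) * indicator {..x} w"
  proof (cases "0 < w \<and> w \<le> x")
   case True
   have "tt * w \<le> \<bar>tt\<bar> * x" using True by (intro mult_mono) auto
   then have "a * exp (- (\<bar>tt\<bar> * x)) \<le> a * exp (- (tt * w))" using a by (intro mult_left_mono) auto
   then show ?thesis using True by (simp add: ennreal_leI)
  qed auto
 qed
 also have "\<dots> = emeasure (rateK a tt) {..x}" using nn_integral_rateK[of "indicator {..x}" a tt] by simp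
 finally show ?thesis .
qed

text \<open>
 Each further shock may come within any given time with positive probability, before a switching.
\<close>

lemma alive_early: "0 < x \<Longrightarrow> 0 < emeasure P (alive m n \<inter> {z \<in> space P. Sh m n z \<le> x})"
proof (induction n arbitrary: x)
 case 0
 have "emeasure P (alive m 0 \<inter> {z \<in> space P. Sh m 0 z \<le> x}) = emeasure P (space P)"
  by (rule emeasure_eq_AE, use alive_0[of m] AE_space in eventually_elim) (use 0 in auto)
 then show ?case by (simp add: emeasure_space_1)
next
 case (Suc n)
 interpret D: prob_space "Dr (eps i m) n" by (rule prob_Dr)
 have x2: "0 < x / 2" using Suc.prems by simp
 define \<Phi> where "\<Phi> z w y = (if Sh m n z \<le> x / 2 \<and> w \<le> x / 2 then 1 else 0 :: ennreal)" for z w and y :: real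
 have \<Phi>m: "(\<lambda>p. \<Phi> (fst p) (fst (snd p)) (snd (snd p))) \<in> borel_measurable (G m n \<Otimes>\<^sub>M (borel \<Otimes>\<^sub>M borel))"
  unfolding \<Phi>_def by measurable
 have "0 < emeasure P (alive m n \<inter> {z \<in> space P. Sh m n z \<le> x / 2}) * emeasure (rateK (l m n) (th m n)) {..x / 2}"
  using Suc.IH[OF x2] emeasure_rateK_initial[OF l_pos x2] by (simp add: ennreal_zero_less_mult_iff)
 also have "\<dots> = (\<integral>\<^sup>+z. emeasure (rateK (l m n) (th m n)) {..x / 2} * indicator (alive m n \<inter> {z \<in> space P. Sh m n z \<le> x / 2}) z \<partial>P)"
  by (subst nn_integral_cmult_indicator) (auto simp: mult.commute)
 also have "\<dots> = (\<integral>\<^sup>+z. indicator (alive m n) z * (\<integral>\<^sup>+w. (\<integral>\<^sup>+y. \<Phi> z w y \<partial>Dr (eps i m) n) \<partial>rateK (l m n) (th m n)) \<partial>P)"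
 proof (intro nn_integral_cong)
  fix z assume sp: "z \<in> space P"
  have "(\<integral>\<^sup>+w. (\<integral>\<^sup>+y. \<Phi> z w y \<partial>Dr (eps i m) n) \<partial>rateK (l m n) (th m n)) = (\<integral>\<^sup>+w. (if Sh m n z \<le> x / 2 then 1 else 0) * indicator {..x / 2} w \<partial>rateK (l m n) (th m n))"
   unfolding \<Phi>_def by (intro nn_integral_cong) (auto simp: D.emeasure_space_1 indicator_def)
  also have "\<dots> = (if Sh m n z \<le> x / 2 then 1 else 0) * emeasure (rateK (l m n) (th m n)) {..x / 2}"
   by (rule nn_integral_cmult_indicator) simp
  finally show "emeasure (rateK (l m n) (th m n)) {..x / 2} * indicator (alive m n \<inter> {z \<in> space P. Sh m n z \<le> x / 2}) z
   = indicator (alive m n) z * (\<integral>\<^sup>+w. (\<integral>\<^sup>+y. \<Phi> z w y \<partial>Dr (eps i m) n) \<partial>rateK (l m n) (th m n))"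
   using sp by (auto simp: indicator_def)
 qed
 also have "\<dots> = (\<integral>\<^sup>+z. indicator (alive m (Suc n)) z * \<Phi> z (Hh m n z) (r m n z) \<partial>P)"
  by (rule shock_law[OF \<Phi>m, symmetric])
 also have "\<dots> \<le> (\<integral>\<^sup>+z. indicator (alive m (Suc n) \<inter> {z \<in> space P. Sh m (Suc n) z \<le> x}) z \<partial>P)"
  by (intro nn_integral_mono) (auto simp: \<Phi>_def indicator_def Sh_Suc)
 also have "\<dots> = emeasure P (alive m (Suc n) \<inter> {z \<in> space P. Sh m (Suc n) z \<le> x})"
  by (rule nn_integral_indicator) measurable
 finally show ?case .
qed

lemma clock_0 [simp]: "clock 0 z = 0" "switch_time T 0 z = 0"
 by (simp_all add: clock_def switch_time_def)

lemma cell_positive: "0 < emeasure P (cell 0 n 1)"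
proof -
 define F where "F z = (if Sh 0 n z \<le> 1 then 1 else 0 :: ennreal)" for z
 have Fm [measurable]: "F \<in> borel_measurable (G 0 n)" unfolding F_def by measurable
 define v where "v z = 1 - Sh 0 n z" for z
 have vm [measurable]: "v \<in> borel_measurable (G 0 n)" unfolding v_def by measurable
 have "0 < ennreal (exp (- th 0 n)) * emeasure P (alive 0 n \<inter> {z \<in> space P. Sh 0 n z \<le> 1})"
  using alive_early[of 1 0 n] by (simp add: ennreal_zero_less_mult_iff)
 also have "\<dots> = (\<integral>\<^sup>+z. ennreal (exp (- th 0 n)) * indicator (alive 0 n \<inter> {z \<in> space P. Sh 0 n z \<le> 1}) z \<partial>P)"
  by (rule nn_integral_cmult_indicator[symmetric]) measurable
 also have "\<dots> \<le> (\<integral>\<^sup>+z. F z * (indicator (alive 0 n) z * ennreal (exp (- (th 0 n * v z)))) \<partial>P)"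
 proof (rule nn_integral_mono_AE, use AE_good in eventually_elim)
  fix z assume g: "good z"
  have "v z \<le> 1" using Sh_nonneg[OF g] by (simp add: v_def)
  then have "th 0 n * v z \<le> th 0 n" using l_pos[of 0 n] b_pos[of 0 n] by (intro mult_left_le) auto
  then have "ennreal (exp (- th 0 n)) \<le> ennreal (exp (- (th 0 n * v z)))" by (intro ennreal_leI) simp
  then show "ennreal (exp (- th 0 n)) * indicator (alive 0 n \<inter> {z \<in> space P. Sh 0 n z \<le> 1}) z \<le> F z * (indicator (alive 0 n) z * ennreal (exp (- (th 0 n * v z))))"
   by (auto simp: F_def indicator_def)
 qed
 also have "\<dots> = (\<integral>\<^sup>+z. F z * (if v z < Hh 0 n z \<and> ennreal (Sh 0 n z + v z) < T (Suc 0) z then 1 else 0) \<partial>P)"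
  by (rule stay_law[symmetric]) (auto simp: F_def v_def split: if_splits)
 also have "\<dots> = (\<integral>\<^sup>+z. indicator (cell 0 n 1) z \<partial>P)"
 proof (rule nn_integral_cong_AE, use AE_good in eventually_elim)
  fix z assume g: "good z"
  show "F z * (if v z < Hh 0 n z \<and> ennreal (Sh 0 n z + v z) < T (Suc 0) z then 1 else 0) = indicator (cell 0 n 1) z"
   using goodD(1)[OF g] inside_alive[OF g, of 0 n 1] by (auto simp: F_def v_def indicator_def arr_def)
 qed
 also have "\<dots> = emeasure P (cell 0 n 1)" by (rule nn_integral_indicator) measurable
 finally show ?thesis .
qed

text \<open>
 Time 1 is an arbitrary positive time; at time 0 only the cell \<open>(0, 0)\<close> is occupied.
\<close>

definition increment_distribution :: "nat \<Rightarrow> real \<Rightarrow> real measure" where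
 "increment_distribution n u = distr (uniform_measure P (cell 0 n 1)) borel (\<lambda>z. X (1 + u) z - X 1 z)"

lemma increment_distribution:
 assumes u: "0 \<le> u"
 shows "prob_space (increment_distribution n u)" "sets (increment_distribution n u) = sets borel"
  and "\<phi> \<in> borel_measurable borel \<Longrightarrow> (\<integral>\<^sup>+y. \<phi> y \<partial>increment_distribution n u) = K.V \<phi> i n 0 u"
proof -
 have ne: "emeasure P (cell 0 n 1) \<noteq> 0" "emeasure P (cell 0 n 1) \<noteq> \<top>" using cell_positive[of n] by (auto simp: emeasure_eq_measure)
 interpret U: prob_space "uniform_measure P (cell 0 n 1)" using ne by (intro prob_space_uniform_measure) auto
 have m: "(\<lambda>z. X (1 + u) z - X 1 z) \<in> borel_measurable (uniform_measure P (cell 0 n 1))" by measurable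
 show "prob_space (increment_distribution n u)" unfolding increment_distribution_def by (rule U.prob_space_distr[OF m])
 show "sets (increment_distribution n u) = sets borel" by (simp add: increment_distribution_def)
 assume \<phi> [measurable]: "\<phi> \<in> borel_measurable borel"
 have "(\<integral>\<^sup>+y. \<phi> y \<partial>increment_distribution n u) = (\<integral>\<^sup>+z. \<phi> (X (1 + u) z - X 1 z) \<partial>uniform_measure P (cell 0 n 1))"
  unfolding increment_distribution_def by (subst nn_integral_distr[OF m]) auto
 also have "\<dots> = (\<integral>\<^sup>+z. \<phi> (X (1 + u) z - X 1 z) * indicator (cell 0 n 1) z \<partial>P) / emeasure P (cell 0 n 1)"
  by (rule nn_integral_uniform_measure) measurable
 also have "(\<integral>\<^sup>+z. \<phi> (X (1 + u) z - X 1 z) * indicator (cell 0 n 1) z \<partial>P) = K.V \<phi> i n 0 u * emeasure P (cell 0 n 1)"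
  using increment_law[OF \<phi>, of 1 "1 + u" "space P" 0 n] u sets.top[of "G 0 n"] by (simp add: mult.commute Int_absorb1 Collect_restrict)
 also have "K.V \<phi> i n 0 u * emeasure P (cell 0 n 1) / emeasure P (cell 0 n 1) = K.V \<phi> i n 0 u"
  by (rule mult_divide_eq_ennreal) (use ne in auto)
 finally show "(\<integral>\<^sup>+y. \<phi> y \<partial>increment_distribution n u) = K.V \<phi> i n 0 u" .
qed

lemma V_abs_integrable:
 assumes int: "\<And>t. 0 \<le> t \<Longrightarrow> integrable P (X t)" and u: "0 \<le> u"
 shows "K.V (\<lambda>y. ennreal \<bar>y\<bar>) i n 0 u < \<infinity>"
proof -
 have "emeasure P (cell 0 n 1) * K.V (\<lambda>y. ennreal \<bar>y\<bar>) i n 0 u = (\<integral>\<^sup>+z. indicator (space P \<inter> cell 0 n 1) z * ennreal \<bar>X (1 + u) z - X 1 z\<bar> \<partial>P)"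
  using increment_law[of "\<lambda>y. ennreal \<bar>y\<bar>" 1 "1 + u" "space P" 0 n] u sets.top[of "G 0 n"] by (simp add: Int_absorb1 Collect_restrict)
 also have "\<dots> \<le> (\<integral>\<^sup>+z. ennreal (norm (X (1 + u) z - X 1 z)) \<partial>P)"
  by (intro nn_integral_mono) (auto simp: indicator_def)
 also have "\<dots> < \<infinity>" using Bochner_Integration.integrable_diff[OF int[of "1 + u"] int[of 1]] u by (simp add: integrable_iff_bounded)
 finally show ?thesis using cell_positive[of n] by (auto simp: ennreal_mult_less_top less_top)
qed

text \<open>
 The martingale property is tested with the observable event that the path is in the cell at time 1.
\<close>

lemma martingale_imp_mean_zero:
 assumes mart: "martingale P hist X" and u: "0 \<le> u"
 shows "(\<integral>y. y \<partial>increment_distribution n u) = 0"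
proof -
 interpret F: finite_measure_subalgebra P "hist 1" by unfold_locales (rule hist_subalgebra)
 have int: "integrable P (X t)" if "0 \<le> t" for t using mart that by (simp add: martingale_def)
 obtain E where E: "E \<in> sets (hist 1)" "\<And>z. good z \<Longrightarrow> z \<in> E \<longleftrightarrow> inside 0 n 1 z" using cell_observed[of 1 0 n] by auto
 have EP [measurable]: "E \<in> sets P" using E(1) hist_subalgebra[of 1] by (auto simp: subalgebra_def)
 have ae: "AE z in P. real_cond_exp P (hist 1) (X (1 + u)) z = X 1 z" using mart u by (simp add: martingale_def)
 have "(\<integral>z\<in>E. X (1 + u) z \<partial>P) = (\<integral>z\<in>E. real_cond_exp P (hist 1) (X (1 + u)) z \<partial>P)"
  by (rule F.real_cond_exp_intA[OF _ E(1)]) (use int u in simp)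
 also have "\<dots> = (\<integral>z\<in>E. X 1 z \<partial>P)"
  unfolding set_lebesgue_integral_def
 proof (rule integral_cong_AE)
  show "(\<lambda>z. indicator E z *\<^sub>R real_cond_exp P (hist 1) (X (1 + u)) z) \<in> borel_measurable P"
   by (intro borel_measurable_scaleR borel_measurable_indicator EP borel_measurable_cond_exp2)
  show "(\<lambda>z. indicator E z *\<^sub>R X 1 z) \<in> borel_measurable P" by measurable
  show "AE z in P. indicator E z *\<^sub>R real_cond_exp P (hist 1) (X (1 + u)) z = indicator E z *\<^sub>R X 1 z"
   using ae by eventually_elim simp
 qed
 finally have "(\<integral>z. indicator E z * X (1 + u) z \<partial>P) = (\<integral>z. indicator E z * X 1 z \<partial>P)" by (simp add: set_lebesgue_integral_def)
 then have 0: "(\<integral>z. indicator E z * (X (1 + u) z - X 1 z) \<partial>P) = 0"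
  unfolding right_diff_distrib using integrable_mult_indicator[OF EP int[of "1 + u"]] integrable_mult_indicator[OF EP int[of 1]] u
  by (subst Bochner_Integration.integral_diff) auto
 have "(\<integral>y. y \<partial>increment_distribution n u) = (\<integral>z. X (1 + u) z - X 1 z \<partial>uniform_measure P (cell 0 n 1))"
  unfolding increment_distribution_def by (rule integral_distr) measurable
 also have "\<dots> = (\<integral>z. (indicator (cell 0 n 1) z / measure P (cell 0 n 1)) *\<^sub>R (X (1 + u) z - X 1 z) \<partial>P)"
 proof -
  have p: "0 < measure P (cell 0 n 1)" using cell_positive[of n] by (simp add: emeasure_eq_measure)
  have "uniform_measure P (cell 0 n 1) = density P (\<lambda>z. ennreal (indicator (cell 0 n 1) z / measure P (cell 0 n 1)))"
   unfolding uniform_measure_def using p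
   by (intro arg_cong[where f = "density P"] ext) (auto simp: indicator_def emeasure_eq_measure divide_ennreal ennreal_1[symmetric] simp del: ennreal_1)
  then show ?thesis using p by (simp only:) (rule integral_density, auto)
 qed
 also have "\<dots> = (\<integral>z. (1 / measure P (cell 0 n 1)) * (indicator E z * (X (1 + u) z - X 1 z)) \<partial>P)"
  by (rule integral_cong_AE, measurable, use AE_good in eventually_elim) (use E(2) goodD(1) in \<open>auto simp: indicator_def\<close>)
 also have "\<dots> = 0" by (subst integral_mult_right_zero) (simp add: 0)
 finally show ?thesis .
qed

lemma kernel:
 "switching_kernel (\<lambda>j. lam (j mod 2)) (\<lambda>j. mu (j mod 2)) (\<lambda>j. c (j mod 2)) (\<lambda>j. Dr (j mod 2)) (\<lambda>j. DR (j mod 2))"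
 by (rule K.switching_kernel_axioms)

end

section \<open>The martingale criterion\<close>

theorem theorem4p2:
  fixes P :: "nat \<Rightarrow> 'a measure"
    and lam mu c :: "nat \<Rightarrow> nat \<Rightarrow> real"
    and Dr DR :: "nat \<Rightarrow> nat \<Rightarrow> real measure"
    and H r R :: "nat \<Rightarrow> nat \<Rightarrow> 'a \<Rightarrow> real"
    and T :: "nat \<Rightarrow> 'a \<Rightarrow> ennreal"
  assumes model: "\<And>i. i \<in> {0, 1} \<Longrightarrow> switching_model (P i) i lam mu Dr DR H T r R"
    and expectations: "\<And>i t. i \<in> {0, 1} \<Longrightarrow> 0 \<le> t \<Longrightarrow> integrable (P i) (process i c H T r R t)"
    and series_rho: "\<And>i k. i \<in> {0, 1} \<Longrightarrow>
      summable (\<lambda>j. rho (Dr i) (k + j) * Lam (lam i) (k + j)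
                    * kappa (\<lambda>n. lam i n + mu i n) (k + j) k)"
    and series_drift: "\<And>i k. i \<in> {0, 1} \<Longrightarrow>
      summable (\<lambda>j. (c i (k + j) + mu i (k + j) * mean (DR i (k + j))) * Lam (lam i) (k + j)
                    * kappa (\<lambda>n. lam i n + mu i n) (k + j) k)"
  shows "(\<forall>i\<in>{0, 1}. martingale (P i) (history (space (P i)) i c H T r R) (process i c H T r R))
    \<longleftrightarrow> (\<forall>i\<in>{0, 1}. \<forall>n. c i n + lam i n * mean (Dr i n) + mu i n * mean (DR i n) = 0)"
proof -
 have par: "j mod 2 \<in> {0, 1}" for j :: nat by auto
 have proc: "switching_process (P (j mod 2)) (j mod 2) lam mu Dr DR H T r R" for j
  using model[OF par[of j]] by (simp add: switching_process_def)
 interpret K: switching_kernel "\<lambda>j. lam (j mod 2)" "\<lambda>j. mu (j mod 2)" "\<lambda>j. c (j mod 2)" "\<lambda>j. Dr (j mod 2)" "\<lambda>j. DR (j mod 2)"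
  using switching_process.kernel[OF proc] .
 have V_mod: "K.V \<phi> j n x u = K.V \<phi> (j mod 2) n x u" for \<phi> j n x u 
 proof (induction j rule: nat_less_induct)
  case (1 j)
  show ?case
  proof (cases "j < 2")
   case False
   then have j: "j = Suc (Suc (j - 2))" by simp
   have "K.V \<phi> j n x u = K.V \<phi> (j - 2) n x u" by (subst j) (rule K.V_periodic)
   moreover have "(j - 2) mod 2 = j mod 2" using False by presburger
   ultimately show ?thesis using 1[rule_format, of "j - 2"] False by simp
  qed simp
 qed
 define Q where "Q j n u = switching_process.increment_distribution (P (j mod 2)) (j mod 2) H T r R c n (max 0 u)" for j n u
 have int: "integrable (P (j mod 2)) (process (j mod 2) c H T r R t)" if "0 \<le> t" for j t
  by (rule expectations[OF par that])
 interpret I: integrable_kernel "\<lambda>j. lam (j mod 2)" "\<lambda>j. mu (j mod 2)" "\<lambda>j. c (j mod 2)" "\<lambda>j. Dr (j mod 2)" "\<lambda>j. DR (j mod 2)" Q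
 proof (intro integrable_kernel.intro integrable_kernel_axioms.intro K.switching_kernel_axioms)
  fix j n :: nat and u :: real and \<phi> :: "real \<Rightarrow> ennreal"
  show "sets (Q j n u) = sets borel"
   unfolding Q_def by (rule switching_process.increment_distribution(2)[OF proc]) simp
  assume u: "0 \<le> u"
  show "prob_space (Q j n u)"
   unfolding Q_def by (rule switching_process.increment_distribution(1)[OF proc]) simp
  show "K.V (\<lambda>y. ennreal \<bar>y\<bar>) j n 0 u < \<infinity>"
   unfolding V_mod[of _ j] by (rule switching_process.V_abs_integrable[OF proc int u])
  assume "\<phi> \<in> borel_measurable borel"
  then show "(\<integral>\<^sup>+y. \<phi> y \<partial>Q j n u) = K.V \<phi> j n 0 u"
   unfolding Q_def V_mod[of _ j] using switching_process.increment_distribution(3)[OF proc u, where \<phi> = \<phi> and n = n and c = c] u by (simp add: max_def)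
 qed
 show ?thesis
 proof
  assume mart: "\<forall>i\<in>{0, 1}. martingale (P i) (history (space (P i)) i c H T r R) (process i c H T r R)"
  have "I.a j n u = 0" if u: "0 \<le> u" for j n u
  proof -
   have "martingale (P (j mod 2)) (history (space (P (j mod 2))) (j mod 2) c H T r R) (process (j mod 2) c H T r R)"
    by (rule bspec[OF mart par])
   from switching_process.martingale_imp_mean_zero[OF proc this u, where n = n]
   show ?thesis using u unfolding I.a_eq[OF u] Q_def by (simp add: max_def)
  qed
  then have "I.g j n = 0" for j n by (rule I.means_zero_imp_balance)
  then have "c (j mod 2) n + lam (j mod 2) n * mean (Dr (j mod 2) n) + mu (j mod 2) n * mean (DR (j mod 2) n) = 0" for j n
   by (simp add: I.g_def)
  from this[of 0] this[of 1] show "\<forall>i\<in>{0, 1}. \<forall>n. c i n + lam i n * mean (Dr i n) + mu i n * mean (DR i n) = 0" by simp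
 next
  assume bal: "\<forall>i\<in>{0, 1}. \<forall>n. c i n + lam i n * mean (Dr i n) + mu i n * mean (DR i n) = 0"
  have g: "I.g j n = 0" for j n using bspec[OF bal par[of j]] unfolding I.g_def by (rule spec)
  have nonexp: "\<not> summable (\<lambda>n. 1 / lam (j mod 2) n)" for j
   using switching_parameters.lam_non_explosive[OF switching_model.axioms(2)[OF model[OF par]] par] .
  have inj: "inj (\<lambda>n. lam (j mod 2) n + mu (j mod 2) n)" for j
   using switching_parameters.rates_distinct[OF switching_model.axioms(2)[OF model[OF par]] par] .
  have lim: "(\<lambda>n. (c (j mod 2) n + mu (j mod 2) n * mean (DR (j mod 2) n)) * Lam (lam (j mod 2)) n * kappa (\<lambda>n. lam (j mod 2) n + mu (j mod 2) n) n 0) \<longlonglongrightarrow> 0" for j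
   using summable_LIMSEQ_zero[OF series_drift[OF par[of j], of 0]] by simp
  have a: "I.a j n u = 0" if "0 \<le> u" for j n u
   by (rule I.balance_imp_means_zero[OF g nonexp inj lim that])
  have centred: "K.V (\<lambda>y. ennreal y) j n 0 u = K.V (\<lambda>y. ennreal (- y)) j n 0 u" if u: "0 \<le> u" for j n u
  proof -
   have "K.V (\<lambda>y. ennreal (b * y)) j n 0 u < \<infinity>" if "b \<in> {1, -1}" for b
   proof -
    have "K.V (\<lambda>y. ennreal (b * y)) j n 0 u = (\<integral>\<^sup>+y. ennreal (b * y) \<partial>Q j n u)" by (rule I.Q_law[OF u, symmetric]) measurable
    also have "\<dots> \<le> (\<integral>\<^sup>+y. ennreal \<bar>y\<bar> \<partial>Q j n u)" using that by (intro nn_integral_mono ennreal_leI) auto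
    also have "\<dots> = K.V (\<lambda>y. ennreal \<bar>y\<bar>) j n 0 u" by (rule I.Q_law[OF u]) measurable
    also have "\<dots> < \<infinity>" by (rule I.V_abs_finite[OF u])
    finally show ?thesis .
   qed
   from this[of 1] this[of "-1"]
   have fin: "K.V (\<lambda>y. ennreal y) j n 0 u < \<top>" "K.V (\<lambda>y. ennreal (- y)) j n 0 u < \<top>" by simp_all
   have "enn2real (K.V (\<lambda>y. ennreal y) j n 0 u) = enn2real (K.V (\<lambda>y. ennreal (- y)) j n 0 u)"
    using a[OF u, of j n] unfolding I.a_def by simp
   then have "ennreal (enn2real (K.V (\<lambda>y. ennreal y) j n 0 u)) = ennreal (enn2real (K.V (\<lambda>y. ennreal (- y)) j n 0 u))" by (rule arg_cong)
   then show ?thesis by (simp only: ennreal_enn2real[OF fin(1)] ennreal_enn2real[OF fin(2)])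
  qed
  show "\<forall>i\<in>{0, 1}. martingale (P i) (history (space (P i)) i c H T r R) (process i c H T r R)"
  proof
   fix i :: nat assume i: "i \<in> {0, 1}"
   then have "i mod 2 = i" by auto
   with switching_process.centred_imp_martingale[OF proc[of i] int[of _ i], OF _ centred]
   show "martingale (P i) (history (space (P i)) i c H T r R) (process i c H T r R)" by simp
  qed
 qed
qed

end
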